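(* Consider the two-dimensional NLS equation $iw_t=w_{xx}\pm w_{zz}+\zeta f(|w|^2)w$ and let $\mathcal L(k)=\mathcal L\pm k^2\mathcal L^{(2)}$ be the Fourier transform in $z$ (dual variable $k$) of its linearization about a one-dimensional ($z$-independent) periodic traveling wave that satisfies the genericity conditions, with $T$-periodic boundary conditions in $y$. For small $k$, a normal form for the four bands of continuous spectrum emerging from the origin in the spectral plane is as follows: the eigenvalues $\lambda$ of $\mathcal L(k)$ near the origin are given by $$\det\left(\lambda^2\begin{pmatrix}a_2&b_2\\ b_2&d_2\end{pmatrix}\pm k^2\begin{pmatrix}a_0'&b_0'\\ b_0'&d_0'\end{pmatrix}\right)+O(5)=0,$$ where $O(5)$ denotes terms $\lambda^jk^l$ with $j,l\ge0$ and $j+l\ge5$, the sign $\pm$ is the one in the equation, $$a_2=\mathbf v_1\mathbf u_1=-\tfrac{\sigma}{2}(\gamma M_E+\rho M_\kappa+\sigma M_\omega),\quad b_2=\mathbf v_1\mathbf u_3=\mathbf v_3\mathbf u_1=-\tfrac{\sigma\rho T}{2}=-\tfrac{\sigma}{2}(\tau M_E+\nu M_\kappa),\quad d_2=\mathbf v_3\mathbf u_3=-\tfrac{\sigma}{2}\left(\nu T+\tfrac{\sigma M}{2}\right),$$ and $$a_0'=-\mathbf v_1\mathcal L^{(2)}\mathbf u_0=-\sigma^2M,\quad b_0'=-\mathbf v_1\mathcal L^{(2)}\mathbf u_2=-\sigma^2\kappa T,\quad d_0'=-\mathbf v_3\mathcal L^{(2)}\mathbf u_2=-\sigma^2(2ET-\omega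 M-\zeta U),$$ with $U=\int_0^TF(A^2)\,dy$. Moreover, for small $k$ and to leading order, the eigenvalues of the linearized hyperbolic 2D NLS operator (sign $-$) under transverse perturbation are $i$ times the eigenvalues of the linearized elliptic 2D NLS operator (sign $+$).
   Context: One-dimensional equation. Consider $i w_t=w_{xx}+\zeta f(|w|^2)w$, where $f$ is a real-valued smooth function and $F$ is an antiderivative, $F'=f$. After using Galilean, translation and $U(1)$ invariance, traveling waves have the form $w=e^{i\omega t}e^{iS(y)}A(y)$ (with $y=x$), with real $A,S$ satisfying $$S_y=\frac{\kappa}{A^2},\qquad A_{yy}=-\omega A+A S_y^2-\zeta f(A^2)A,\qquad A_y^2=R(A):=2E-\omega A^2-\frac{\kappa^2}{A^2}-\zeta F(A^2).$$ Parameter domain. $\Omega$ is the open set of real parameter values $(E,\kappa,\omega,\zeta)$ with $\kappa>0$ such that $R$ is real and positive on some interval $(a_-,a_+)$ of the positive real axis and has simple roots at $a_\pm$. Such an interval is fixed, and its endpoints vary smoothly with the parameters. $A(y)=A(y;E,\kappa,\omega,\zeta)$ is the periodic solution oscillating between $a_-$ and $a_+$, translated so that $A(0)=a_-$; $T$ is its period and $S$ is normalized by $S(0)=0$. Standing assumptions: $(E,\kappa,\omega,\zeta)\in\Omega$, $F(x)$ is linearly independent from $1,x,1/x$, and $A$ is non-constant. Moments. With $\oint g\,dA$ the integral over a simple closed contour encircling $[a_-,a_+]$ (equivalently $2\int_{a_-}^{a_+}g\,dA$, with the positive square root), $$T=\oint\frac{dA}{\sqrt{R}},\quad \eta=\oint\frac{\kappa\,dA}{A^2\sqrt{R}}=S(T)-S(0),\quad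 M=\oint\frac{A^2dA}{\sqrt{R}},\quad K=\oint\sqrt{R}\,dA ,$$ functions of the independent parameters $(\kappa,E,\omega,\zeta)$. Subscripts $E,\kappa,\omega$ denote partial derivatives (for $A,S$: at fixed $y$), $\{P,Q\}_{a,b}=P_aQ_b-P_bQ_a$, and $$\sigma=\{T,\eta\}_{E,\kappa},\quad\gamma=\{T,\eta\}_{\kappa,\omega},\quad\rho=\{T,\eta\}_{\omega,E},\quad\tau=\tfrac{TT_\kappa}{2},\quad\nu=-\tfrac{TT_E}{2}.$$ Linearized operator. Linearizing the 2D equation with $w=e^{i\omega t}e^{iS(y)}(A(y)+\epsilon(R+iI)(y,z,t))$ (here $R,I$ are the real and imaginary parts of the perturbation) gives the operator $\mathcal L\mp\mathcal J\partial_z^2$ acting on $(R,I)^t$, where $\mathcal J=\begin{pmatrix}0&-1\\ 1&0\end{pmatrix}$ and $$\mathcal L=\begin{pmatrix}\mathcal K&-\mathcal L_-\\ \mathcal L_+&\mathcal K\end{pmatrix},\quad \mathcal K=S_{yy}+2S_y\partial_y,\quad \mathcal L_-=-\omega-\partial_{yy}+S_y^2-\zeta f(A^2),\quad \mathcal L_+=\mathcal L_--2\zeta f'(A^2)A^2 ,$$ with $T$-periodic boundary conditions in $y$. Taking the Fourier transform in $z$ gives $\mathcal L(k)=\mathcal L\pm k^2\mathcal L^{(2)}$ with $\mathcal L^{(2)}=\begin{pmatrix}0&-1\\ 1&0\end{pmatrix}$. The $+$ sign in the 2D equation is the elliptic case, the $-$ sign the hyperbolic case. Basis of the generalized kernel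 of $\mathcal L$ (under $T$-periodic boundary conditions). $$\mathbf u_0=\sigma\begin{pmatrix}0\\ A\end{pmatrix},\quad \mathbf u_1=\gamma\begin{pmatrix}A_E\\ A S_E\end{pmatrix}+\rho\begin{pmatrix}A_\kappa\\ A S_\kappa\end{pmatrix}+\sigma\begin{pmatrix}A_\omega\\ A S_\omega\end{pmatrix},\quad \mathbf u_2=\sigma\begin{pmatrix}A_y\\ A S_y\end{pmatrix},$$ $$\mathbf u_3=\tau\begin{pmatrix}A_E\\ A S_E\end{pmatrix}+\nu\begin{pmatrix}A_\kappa\\ A S_\kappa\end{pmatrix}+\sigma\begin{pmatrix}0\\ y A/2\end{pmatrix},\qquad \mathbf v_1=-\mathbf u_0^t\mathcal J,\quad \mathbf v_3=-\mathbf u_2^t\mathcal J .$$ Left vectors act by $\mathbf v\mathbf u=\int_0^T\mathbf v(y)\mathbf u(y)\,dy$ (no complex conjugation). Genericity conditions: $\sigma\ne0$ and $$\begin{vmatrix}K_{\kappa\kappa}&K_{\kappa E}&K_{\kappa\omega}&T\\ K_{\kappa E}&K_{EE}&K_{E\omega}&0\\ K_{\kappa\omega}&K_{E\omega}&K_{\omega\omega}&0\\ T&0&0&-M\end{vmatrix}\ne0 .$$ *)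

theory Defs
  imports "HOL-Analysis.Analysis"
begin

text \<open>Parameters are tuples \<open>(E, \<kappa>, \<omega>, \<zeta>)\<close>.\<close>

type_synonym params = "real \<times> real \<times> real \<times> real"

definition dE :: "(params \<Rightarrow> real) \<Rightarrow> params \<Rightarrow> real" where
  "dE G = (\<lambda>(E, \<kappa>, \<omega>, \<zeta>). deriv (\<lambda>e. G (e, \<kappa>, \<omega>, \<zeta>)) E)"

definition dkappa :: "(params \<Rightarrow> real) \<Rightarrow> params \<Rightarrow> real" where
  "dkappa G = (\<lambda>(E, \<kappa>, \<omega>, \<zeta>). deriv (\<lambda>k. G (E, k, \<omega>, \<zeta>)) \<kappa>)"

definition domega :: "(params \<Rightarrow> real) \<Rightarrow> params \<Rightarrow> real" where
  "domega G = (\<lambda>(E, \<kappa>, \<omega>, \<zeta>). deriv (\<lambda>o'. G (E, \<kappa>, o', \<zeta>)) \<omega>)"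

text \<open>
  The functions \<open>f\<close> and \<open>F\<close> are only ever evaluated at \<open>A\<^sup>2 > 0\<close>, so smoothness, \<open>F' = f\<close> and
  the linear independence of \<open>1, x, 1/x, F\<close> are conditions on the positive half-line.
\<close>

definition admissible_nonlinearity :: "(real \<Rightarrow> real) \<Rightarrow> (real \<Rightarrow> real) \<Rightarrow> bool" where
  "admissible_nonlinearity f F \<longleftrightarrow>
     (\<forall>n. \<forall>x>0. (deriv ^^ n) f field_differentiable (at x)) \<and>
     (\<forall>x>0. (F has_real_derivative f x) (at x)) \<and>
     (\<forall>c0 c1 c2 c3. (\<forall>x>0. c0 + c1 * x + c2 / x + c3 * F x = 0) \<longrightarrow>
        c0 = 0 \<and> c1 = 0 \<and> c2 = 0 \<and> c3 = 0)"

definition Rfun :: "(real \<Rightarrow> real) \<Rightarrow> params \<Rightarrow> real \<Rightarrow> real" where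
  "Rfun F = (\<lambda>(E, \<kappa>, \<omega>, \<zeta>) a. 2 * E - \<omega> * a\<^sup>2 - \<kappa>\<^sup>2 / a\<^sup>2 - \<zeta> * F (a\<^sup>2))"

definition admissible_interval :: "(real \<Rightarrow> real) \<Rightarrow> params \<Rightarrow> real \<Rightarrow> real \<Rightarrow> bool" where
  "admissible_interval F p a b \<longleftrightarrow>
     0 < a \<and> a < b \<and> (\<forall>x\<in>{a<..<b}. 0 < Rfun F p x) \<and>
     Rfun F p a = 0 \<and> deriv (Rfun F p) a \<noteq> 0 \<and>
     Rfun F p b = 0 \<and> deriv (Rfun F p) b \<noteq> 0"

definition Omega :: "(real \<Rightarrow> real) \<Rightarrow> params set" where
  "Omega F = {(E, \<kappa>, \<omega>, \<zeta>). \<kappa> > 0 \<and> (\<exists>a b. admissible_interval F (E, \<kappa>, \<omega>, \<zeta>) a b)}"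

text \<open>
  A family of waves: the nonlinearity \<open>f\<close> with antiderivative \<open>F\<close>, the endpoints \<open>a\<^sub>-\<close>, \<open>a\<^sub>+\<close> of the
  chosen interval, the amplitude \<open>A(y)\<close> and the phase \<open>S(y)\<close>, each depending on the parameters.
\<close>

record wave =
  nlf :: "real \<Rightarrow> real"
  nlF :: "real \<Rightarrow> real"
  lo :: "params \<Rightarrow> real"
  hi :: "params \<Rightarrow> real"
  amp :: "params \<Rightarrow> real \<Rightarrow> real"
  phs :: "params \<Rightarrow> real \<Rightarrow> real"

text \<open>
  The contour integrals are twice the integrals over \<open>[a\<^sub>-, a\<^sub>+]\<close>. The endpoint singularities of
  \<open>1 / sqrt R\<close> are integrable.
\<close>

definition moment :: "wave \<Rightarrow> (params \<Rightarrow> real \<Rightarrow> real) \<Rightarrow> params \<Rightarrow> real" where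
  "moment w g p = 2 * integral {lo w p..hi w p} (g p)"

definition period :: "wave \<Rightarrow> params \<Rightarrow> real" where
  "period w = moment w (\<lambda>p a. 1 / sqrt (Rfun (nlF w) p a))"

definition eta :: "wave \<Rightarrow> params \<Rightarrow> real" where
  "eta w = moment w (\<lambda>(E, \<kappa>, \<omega>, \<zeta>) a. \<kappa> / (a\<^sup>2 * sqrt (Rfun (nlF w) (E, \<kappa>, \<omega>, \<zeta>) a)))"

definition Mmom :: "wave \<Rightarrow> params \<Rightarrow> real" where
  "Mmom w = moment w (\<lambda>p a. a\<^sup>2 / sqrt (Rfun (nlF w) p a))"

definition Kmom :: "wave \<Rightarrow> params \<Rightarrow> real" where
  "Kmom w = moment w (\<lambda>p a. sqrt (Rfun (nlF w) p a))"

definition Umom :: "wave \<Rightarrow> params \<Rightarrow> real" where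
  "Umom w p = integral {0..period w p} (\<lambda>y. nlF w ((amp w p y)\<^sup>2))"

definition is_profile :: "wave \<Rightarrow> params \<Rightarrow> bool" where
  "is_profile w = (\<lambda>(E, \<kappa>, \<omega>, \<zeta>).
     let p = (E, \<kappa>, \<omega>, \<zeta>); A = amp w p; S = phs w p in
       (\<forall>y. (S has_real_derivative \<kappa> / (A y)\<^sup>2) (at y)) \<and>
       (\<forall>y. (A has_real_derivative deriv A y) (at y)) \<and>
       (\<forall>y. (deriv A has_real_derivative
              - \<omega> * A y + A y * (deriv S y)\<^sup>2 - \<zeta> * nlf w ((A y)\<^sup>2) * A y) (at y)) \<and>
       (\<forall>y. (deriv A y)\<^sup>2 = Rfun (nlF w) p (A y)) \<and>
       range A = {lo w p..hi w p} \<and> (\<forall>y. A (y + period w p) = A y) \<and>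
       A 0 = lo w p \<and> S 0 = 0)"

text \<open>
  The choice of interval need only be made on some open set \<open>W\<close> of parameters. As the roots are
  simple, a continuous choice of the endpoints is automatically smooth.
\<close>

definition wave_family :: "wave \<Rightarrow> params set \<Rightarrow> bool" where
  "wave_family w W \<longleftrightarrow>
     admissible_nonlinearity (nlf w) (nlF w) \<and>
     open W \<and> W \<subseteq> Omega (nlF w) \<and>
     (\<forall>p\<in>W. admissible_interval (nlF w) p (lo w p) (hi w p)) \<and>
     continuous_on W (lo w) \<and> continuous_on W (hi w) \<and>
     (\<forall>p\<in>W. is_profile w p)"

definition sigma :: "wave \<Rightarrow> params \<Rightarrow> real" where
  "sigma w p = dE (period w) p * dkappa (eta w) p - dkappa (period w) p * dE (eta w) p"

definition gam :: "wave \<Rightarrow> params \<Rightarrow> real" where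
  "gam w p = dkappa (period w) p * domega (eta w) p - domega (period w) p * dkappa (eta w) p"

definition rho :: "wave \<Rightarrow> params \<Rightarrow> real" where
  "rho w p = domega (period w) p * dE (eta w) p - dE (period w) p * domega (eta w) p"

definition tau :: "wave \<Rightarrow> params \<Rightarrow> real" where
  "tau w p = period w p * dkappa (period w) p / 2"

definition nu :: "wave \<Rightarrow> params \<Rightarrow> real" where
  "nu w p = - (period w p * dE (period w) p / 2)"

definition generic :: "wave \<Rightarrow> params \<Rightarrow> bool" where
  "generic w p \<longleftrightarrow> sigma w p \<noteq> 0 \<and>
     (let K = Kmom w; T = period w p; M = Mmom w p in
      det (vector
        [vector [dkappa (dkappa K) p, dE (dkappa K) p, domega (dkappa K) p, T],
         vector [dE (dkappa K) p, dE (dE K) p, domega (dE K) p, 0],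
         vector [domega (dkappa K) p, domega (dE K) p, domega (domega K) p, 0],
         vector [T, 0, 0, - M]] :: real^4^4) \<noteq> 0)"

definition Jmat :: "'a::comm_ring_1 ^ 2 ^ 2" where
  "Jmat = vector [vector [0, - 1], vector [1, 0]]"

definition Kop :: "wave \<Rightarrow> params \<Rightarrow> (real \<Rightarrow> complex) \<Rightarrow> real \<Rightarrow> complex" where
  "Kop w p g y = of_real (deriv (deriv (phs w p)) y) * g y
     + 2 * of_real (deriv (phs w p) y) * vector_derivative g (at y)"

definition Lminus :: "wave \<Rightarrow> params \<Rightarrow> (real \<Rightarrow> complex) \<Rightarrow> real \<Rightarrow> complex" where
  "Lminus w = (\<lambda>(E, \<kappa>, \<omega>, \<zeta>) g y. let p = (E, \<kappa>, \<omega>, \<zeta>) in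
     of_real (- \<omega> + (deriv (phs w p) y)\<^sup>2 - \<zeta> * nlf w ((amp w p y)\<^sup>2)) * g y
     - vector_derivative (\<lambda>x. vector_derivative g (at x)) (at y))"

definition Lplus :: "wave \<Rightarrow> params \<Rightarrow> (real \<Rightarrow> complex) \<Rightarrow> real \<Rightarrow> complex" where
  "Lplus w = (\<lambda>(E, \<kappa>, \<omega>, \<zeta>) g y. let p = (E, \<kappa>, \<omega>, \<zeta>) in
     Lminus w p g y
     - of_real (2 * \<zeta> * deriv (nlf w) ((amp w p y)\<^sup>2) * (amp w p y)\<^sup>2) * g y)"

definition Lop :: "wave \<Rightarrow> params \<Rightarrow> (real \<Rightarrow> complex^2) \<Rightarrow> real \<Rightarrow> complex^2" where
  "Lop w p u y = (let r = (\<lambda>x. u x $ 1); i = (\<lambda>x. u x $ 2) in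
     vector [Kop w p r y - Lminus w p i y, Lplus w p r y + Kop w p i y])"

text \<open>
  \<open>Lk w p s k\<close> is the operator for wave number \<open>k\<close>, with \<open>s = 1\<close> in the elliptic and \<open>s = -1\<close>
  in the hyperbolic case.
\<close>

definition Lk :: "wave \<Rightarrow> params \<Rightarrow> real \<Rightarrow> real \<Rightarrow> (real \<Rightarrow> complex^2) \<Rightarrow> real \<Rightarrow> complex^2" where
  "Lk w p s k u y = Lop w p u y + of_real (s * k\<^sup>2) *s (Jmat *v u y)"

definition is_eigenvalue :: "wave \<Rightarrow> params \<Rightarrow> real \<Rightarrow> real \<Rightarrow> complex \<Rightarrow> bool" where
  "is_eigenvalue w p s k \<mu> \<longleftrightarrow>
     (\<exists>u. u C1_differentiable_on UNIV \<and>
          (\<lambda>y. vector_derivative u (at y)) C1_differentiable_on UNIV \<and>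
          (\<forall>y. u (y + period w p) = u y) \<and>
          (\<exists>y. u y \<noteq> 0) \<and>
          (\<forall>y. Lk w p s k u y = \<mu> *s u y))"

definition tE :: "wave \<Rightarrow> params \<Rightarrow> real \<Rightarrow> real^2" where
  "tE w p y = vector [dE (\<lambda>q. amp w q y) p, amp w p y * dE (\<lambda>q. phs w q y) p]"

definition tkappa :: "wave \<Rightarrow> params \<Rightarrow> real \<Rightarrow> real^2" where
  "tkappa w p y = vector [dkappa (\<lambda>q. amp w q y) p, amp w p y * dkappa (\<lambda>q. phs w q y) p]"

definition tomega :: "wave \<Rightarrow> params \<Rightarrow> real \<Rightarrow> real^2" where
  "tomega w p y = vector [domega (\<lambda>q. amp w q y) p, amp w p y * domega (\<lambda>q. phs w q y) p]"

definition u0 :: "wave \<Rightarrow> params \<Rightarrow> real \<Rightarrow> real^2" where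
  "u0 w p y = sigma w p *s vector [0, amp w p y]"

definition u1 :: "wave \<Rightarrow> params \<Rightarrow> real \<Rightarrow> real^2" where
  "u1 w p y = gam w p *s tE w p y + rho w p *s tkappa w p y + sigma w p *s tomega w p y"

definition u2 :: "wave \<Rightarrow> params \<Rightarrow> real \<Rightarrow> real^2" where
  "u2 w p y = sigma w p *s vector [deriv (amp w p) y, amp w p y * deriv (phs w p) y]"

definition u3 :: "wave \<Rightarrow> params \<Rightarrow> real \<Rightarrow> real^2" where
  "u3 w p y = tau w p *s tE w p y + nu w p *s tkappa w p y
     + sigma w p *s vector [0, y * amp w p y / 2]"

definition v1 :: "wave \<Rightarrow> params \<Rightarrow> real \<Rightarrow> real^2" where
  "v1 w p y = - (u0 w p y v* Jmat)"

definition v3 :: "wave \<Rightarrow> params \<Rightarrow> real \<Rightarrow> real^2" where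
  "v3 w p y = - (u2 w p y v* Jmat)"

definition L2op :: "(real \<Rightarrow> real^2) \<Rightarrow> real \<Rightarrow> real^2" where
  "L2op u y = Jmat *v u y"

definition pairing :: "wave \<Rightarrow> params \<Rightarrow> (real \<Rightarrow> real^2) \<Rightarrow> (real \<Rightarrow> real^2) \<Rightarrow> real" where
  "pairing w p v u = integral {0..period w p} (\<lambda>y. v y \<bullet> u y)"

definition mat2 :: "wave \<Rightarrow> params \<Rightarrow> real^2^2" where
  "mat2 w p =
     (let a2 = pairing w p (v1 w p) (u1 w p);
          b2 = pairing w p (v1 w p) (u3 w p);
          d2 = pairing w p (v3 w p) (u3 w p)
      in vector [vector [a2, b2], vector [b2, d2]])"

definition mat0 :: "wave \<Rightarrow> params \<Rightarrow> real^2^2" where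
  "mat0 w p =
     (let a0 = - pairing w p (v1 w p) (L2op (u0 w p));
          b0 = - pairing w p (v1 w p) (L2op (u2 w p));
          d0 = - pairing w p (v3 w p) (L2op (u2 w p))
      in vector [vector [a0, b0], vector [b0, d0]])"

definition normal_form :: "wave \<Rightarrow> params \<Rightarrow> real \<Rightarrow> complex \<Rightarrow> complex \<Rightarrow> complex" where
  "normal_form w p s \<mu> k =
     det (\<chi> i j. \<mu>\<^sup>2 * of_real (mat2 w p $ i $ j) + of_real s * k\<^sup>2 * of_real (mat0 w p $ i $ j)
          :: complex^2^2)"

end

theory Submission imports Defs "HOL-Complex_Analysis.Complex_Analysis"
begin

text \<open>
  A periodic solution of \<open>L(k) u = \<lambda> u\<close> solves \<open>L u = \<Theta> u\<close> with \<open>\<Theta> = \<lambda> -/+ k\<^sup>2 J\<close> small. The four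
  solutions \<open>(0, A)\<close>, \<open>(A\<^sub>y, A S\<^sub>y)\<close>, \<open>(A\<^sub>E, A S\<^sub>E)\<close>, \<open>(A\<^sub>\<kappa>, A S\<^sub>\<kappa>)\<close> of \<open>L u = 0\<close> form a
  symplectic basis for the conserved bilinear form of \<open>L\<close>; the first two are periodic, and the
  monodromy of the others is governed by \<open>T\<close> and \<open>\<eta>\<close>. If \<open>\<sigma> \<noteq> 0\<close>, variation of constants yields a
  bounded periodic right inverse \<open>G\<close> of \<open>L\<close> modulo the two solvability conditions. Every periodic
  solution is then \<open>(1 - G \<Theta>)\<^sup>-\<^sup>1\<close> of a combination of \<open>u\<^sub>0\<close> and \<open>u\<^sub>2\<close>, and the solvability conditions
  become the vanishing of a 2 by 2 determinant. The Neumann series expands its entries into a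
  double power series in \<open>\<lambda>\<close> and \<open>k\<close> whose quadratic part is the normal form.

  The moments are expressed through the profile by substituting \<open>a = A(y)\<close>; the derivatives of the
  profile in the parameters come from Gronwall's inequality. Evaluating the conserved bilinear form
  of two parameter derivatives over a period gives the reciprocity relations \<open>T\<^sub>\<kappa> = - \<eta>\<^sub>E\<close>,
  \<open>M\<^sub>E = - 2 T\<^sub>\<omega>\<close>, \<open>M\<^sub>\<kappa> = 2 \<eta>\<^sub>\<omega>\<close>, by which the determinant of the \<open>\<lambda>\<^sup>2\<close>-matrix is a nonzero
  multiple of the genericity determinant. The matrix of \<open>k\<^sup>2\<close> is minus the Gram matrix of \<open>u\<^sub>0\<close> and
  \<open>u\<^sub>2\<close>, so the four roots of the homogeneous normal form are nonzero. Rouche's theorem follows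
  them to the eigenvalues, and changing the sign of \<open>k\<^sup>2\<close> multiplies the roots by \<open>\<i>\<close>.
\<close>

section \<open>Double power series and their zeros\<close>

text \<open>Two obstacles shape the argument. The integrands of the moments are singular at
  endpoints that move with the parameters, so these integrals cannot be differentiated directly. In
  the variable y the integrands are smooth, and T/2 becomes the first positive zero of A_y, to which
  implicit differentiation applies. Secondly, the roots of the homogeneous normal form may coincide,
  so single eigenvalues cannot be followed by the implicit function theorem. After the scaling mu =
  k z the determinant is k^4 times a fixed quartic plus O(k); its zeros are followed in clusters,
  one around each distinct root, and labels are distributed inside each cluster.

  The order 5 of the remainder has a simple source. L \<open>u1\<close> = \<open>u0\<close> and L
  \<open>u3\<close> = \<open>u2\<close> put the kernel in the range of L, so the solvability
  conditions have no linear term in mu. Each matrix entry is a quadratic form plus order 3, and the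
  determinant is a quartic form plus order 5. The coefficients in \<open>u1\<close> and
  \<open>u3\<close> are those that cancel the jumps of the parameter derivatives over a
  period.\<close>

lemma has_sum_double_Cauchy_product:
  fixes A B :: "nat \<times> nat \<Rightarrow> 'a::{real_normed_field,banach}"
  assumes A: "(\<lambda>x. norm (A x)) summable_on UNIV" and B: "(\<lambda>x. norm (B x)) summable_on UNIV"
  shows "((\<lambda>(n,m). \<Sum>(i,t)\<in>{..n}\<times>{..m}. A (i,t) * B (n-i,m-t)) has_sum (infsum A UNIV * infsum B UNIV)) UNIV"
proof -
  have AB: "(\<lambda>x. norm (case x of (p,q) \<Rightarrow> A p * B q)) summable_on (UNIV \<times> UNIV)"
  proof (intro Infinite_Sum.abs_summable_on_Sigma_iff[where f="\<lambda>(p,q). A p * B q", THEN iffD2] conjI ballI)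
    show "(\<lambda>y. norm (case (x,y) of (p,q) \<Rightarrow> A p * B q)) summable_on UNIV" for x
      using B by (simp add: norm_mult summable_on_cmult_right)
    show "(\<lambda>x. norm (\<Sum>\<^sub>\<infinity>y. norm (case (x,y) of (p,q) \<Rightarrow> A p * B q))) summable_on UNIV"
    proof -
      have "norm (\<Sum>\<^sub>\<infinity>y. norm (case (x,y) of (p,q) \<Rightarrow> A p * B q)) = norm (A x) * infsum (\<lambda>q. norm (B q)) UNIV" for x
        by (simp only: prod.case norm_mult infsum_cmult_right') (simp add: infsum_nonneg abs_mult)
      thus ?thesis using summable_on_cmult_left[OF A, of "infsum (\<lambda>q. norm (B q)) UNIV"] by simp
    qed
  qed
  hence s: "(\<lambda>x. case x of (p,q) \<Rightarrow> A p * B q) summable_on (UNIV \<times> UNIV)"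
    by (rule abs_summable_summable)
  have Bs: "B summable_on UNIV" using B by (rule abs_summable_summable)
  have val: "infsum (\<lambda>x. case x of (p,q) \<Rightarrow> A p * B q) (UNIV \<times> UNIV) = infsum A UNIV * infsum B UNIV"
  proof -
    have "infsum (\<lambda>x. case x of (p,q) \<Rightarrow> A p * B q) (UNIV \<times> UNIV) = (\<Sum>\<^sub>\<infinity>p. \<Sum>\<^sub>\<infinity>q. A p * B q)"
      using infsum_Sigma'_banach[of "\<lambda>p q. A p * B q" UNIV "\<lambda>_. UNIV"] s by simp
    also have "\<dots> = infsum A UNIV * infsum B UNIV"
      by (simp only: infsum_cmult_right' infsum_cmult_left')
    finally show ?thesis .
  qed
  have hs: "((\<lambda>x. case x of (p,q) \<Rightarrow> A p * B q) has_sum (infsum A UNIV * infsum B UNIV)) (UNIV \<times> UNIV)"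
    using s val by (metis has_sum_infsum)
  \<comment> \<open>\<open>?h\<close> splits a total degree into the degrees of the two factors. It
    is a bijection onto all pairs of index pairs, so grouping by total degree is a reindexing
    followed by sums over finite fibres.\<close>
  let ?S = "Sigma UNIV (\<lambda>(n,m). {..n}\<times>{..m::nat}) :: ((nat\<times>nat)\<times>(nat\<times>nat)) set"
  let ?h = "\<lambda>((n,m),(i,t)). ((i,t),(n-i,m-t)) :: ((nat\<times>nat)\<times>(nat\<times>nat))"
  have inj: "inj_on ?h ?S" by (auto simp: inj_on_def)
  have im: "?h ` ?S = UNIV \<times> UNIV"
  proof -
    have "((a,b),(c,d)) \<in> ?h ` ?S" for a b c d
      by (rule image_eqI[of _ _ "((a+c,b+d),(a,b))"]) auto
    thus ?thesis by auto
  qed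
  have hs2: "(((\<lambda>x. case x of (p,q) \<Rightarrow> A p * B q) \<circ> ?h) has_sum (infsum A UNIV * infsum B UNIV)) ?S"
  proof (rule iffD1[OF has_sum_reindex[OF inj]])
    show "((\<lambda>x. case x of (p,q) \<Rightarrow> A p * B q) has_sum (infsum A UNIV * infsum B UNIV)) (?h ` ?S)"
      unfolding im by (rule hs)
  qed
  show ?thesis
  proof (rule has_sum_Sigma[OF isUCont_plus hs2])
    fix x :: "nat \<times> nat"
    obtain n m where x: "x = (n,m)" by (cases x)
    have *: "(\<lambda>y. ((\<lambda>x. case x of (p,q) \<Rightarrow> A p * B q) \<circ> ?h) ((n,m),y)) = (\<lambda>(i,t). A (i,t) * B (n-i,m-t))"
      by (simp add: fun_eq_iff)
    show "((\<lambda>y. ((\<lambda>x. case x of (p,q) \<Rightarrow> A p * B q) \<circ> ?h) (x,y)) has_sum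
       (case x of (n,m) \<Rightarrow> \<Sum>(i,t)\<in>{..n}\<times>{..m}. A (i,t) * B (n-i,m-t))) (case x of (n,m) \<Rightarrow> {..n}\<times>{..m})"
      unfolding x * prod.case by (rule has_sum_finite) simp
  qed
qed

lemma summable_on_comparison_double:
  fixes F G :: "nat \<Rightarrow> nat \<Rightarrow> real"
  assumes "(\<lambda>(j,l). G j l) summable_on UNIV" "\<And>j l. F j l \<le> G j l" "\<And>j l. 0 \<le> F j l"
  shows "(\<lambda>(j,l). F j l) summable_on UNIV"
proof (rule summable_on_comparison_test[OF assms(1)])
qed (use assms(2,3) in auto)

text \<open>The coefficients do not depend on \<open>\<mu>\<close> and \<open>k\<close>, and
  \<open>n\<close> bounds the total order from below, so an O(5) remainder is a
  \<open>double_series 5\<close>. Absolute convergence at one radius for both variables is what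
  makes products work.\<close>

definition double_series :: "nat \<Rightarrow> (complex \<Rightarrow> real \<Rightarrow> complex) \<Rightarrow> bool" where
  "double_series n f \<longleftrightarrow> (\<exists>c r. 0 < r \<and> (\<forall>j l. j + l < n \<longrightarrow> c j l = 0) \<and>
     (\<lambda>(j,l). norm (c j l) * r^j * r^l) summable_on UNIV \<and>
     (\<forall>\<mu> k. cmod \<mu> < r \<and> \<bar>k\<bar> < r \<longrightarrow>
        ((\<lambda>(j,l). c j l * \<mu>^j * of_real k^l) has_sum f \<mu> k) UNIV))"

lemma double_series_majorant:
  assumes "(\<lambda>(j,l). norm (c j l :: complex) * r^j * r^l) summable_on UNIV" "0 \<le> \<rho>" "\<rho> \<le> r"
  shows "(\<lambda>(j,l). norm (c j l) * \<rho>^j * \<rho>^l) summable_on UNIV"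
  using assms(1)
  by (rule summable_on_comparison_double)
     (use assms(2,3) in \<open>auto intro!: mult_mono power_mono\<close>)

lemma double_series_terms_summable:
  assumes "(\<lambda>(j,l). norm (c j l :: complex) * r^j * r^l) summable_on UNIV"
    "cmod \<mu> \<le> r" "\<bar>k\<bar> \<le> r"
  shows "(\<lambda>x. norm ((\<lambda>(j,l). c j l * \<mu>^j * of_real k^l) x)) summable_on UNIV"
proof -
  have "(\<lambda>(j,l). norm (c j l * \<mu>^j * of_real k^l)) summable_on UNIV"
    by (rule summable_on_comparison_double[OF assms(1)])
       (use assms(2,3) in \<open>auto simp: norm_mult norm_power intro!: mult_mono power_mono\<close>)
  thus ?thesis by (simp add: case_prod_unfold)
qed

lemma double_series_mono: "double_series n f \<Longrightarrow> m \<le> n \<Longrightarrow> double_series m f"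
  unfolding double_series_def
  by (elim exE conjE, rename_tac c r, rule_tac x=c in exI, rule_tac x=r in exI) auto

lemma double_series_add:
  assumes "double_series n f" "double_series n g" shows "double_series n (\<lambda>\<mu> k. f \<mu> k + g \<mu> k)"
proof -
  from assms(1) obtain c r where c: "0 < r" "\<forall>j l. j + l < n \<longrightarrow> c j l = 0"
     "(\<lambda>(j,l). norm (c j l) * r^j * r^l) summable_on UNIV"
     "\<forall>\<mu> k. cmod \<mu> < r \<and> \<bar>k\<bar> < r \<longrightarrow> ((\<lambda>(j,l). c j l * \<mu>^j * of_real k^l) has_sum f \<mu> k) UNIV"
    unfolding double_series_def by blast
  from assms(2) obtain d q where d: "0 < q" "\<forall>j l. j + l < n \<longrightarrow> d j l = 0"
     "(\<lambda>(j,l). norm (d j l) * q^j * q^l) summable_on UNIV"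
     "\<forall>\<mu> k. cmod \<mu> < q \<and> \<bar>k\<bar> < q \<longrightarrow> ((\<lambda>(j,l). d j l * \<mu>^j * of_real k^l) has_sum g \<mu> k) UNIV"
    unfolding double_series_def by blast
  define \<rho> where "\<rho> = min r q"
  have \<rho>: "0 < \<rho>" "\<rho> \<le> r" "\<rho> \<le> q" using c d by (auto simp: \<rho>_def)
  have "(\<lambda>x. (\<lambda>(j,l). norm (c j l) * \<rho>^j * \<rho>^l) x + (\<lambda>(j,l). norm (d j l) * \<rho>^j * \<rho>^l) x) summable_on UNIV"
    by (intro summable_on_add double_series_majorant[OF c(3)] double_series_majorant[OF d(3)]) (use \<rho> in auto)
  hence s: "(\<lambda>(j,l). norm (c j l + d j l) * \<rho>^j * \<rho>^l) summable_on UNIV"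
    unfolding case_prod_unfold
    by (rule summable_on_comparison_test)
       (use \<rho> in \<open>auto simp: distrib_right[symmetric] intro!: mult_right_mono norm_triangle_ineq\<close>)
  show ?thesis unfolding double_series_def
  proof (rule exI[of _ "\<lambda>j l. c j l + d j l"], rule exI[of _ \<rho>], intro conjI allI impI)
    fix \<mu> k assume "cmod \<mu> < \<rho> \<and> \<bar>k\<bar> < \<rho>"
    hence "((\<lambda>(j,l). c j l * \<mu>^j * of_real k^l) has_sum f \<mu> k) UNIV"
      "((\<lambda>(j,l). d j l * \<mu>^j * of_real k^l) has_sum g \<mu> k) UNIV" using c(4) d(4) \<rho> by auto
    from has_sum_add[OF this] show "((\<lambda>(j,l). (c j l + d j l) * \<mu>^j * of_real k^l) has_sum f \<mu> k + g \<mu> k) UNIV"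
      by (simp add: case_prod_unfold distrib_right)
  next
    show "c j l + d j l = 0" if "j + l < n" for j l using that c(2) d(2) by simp
  qed (use \<rho> s in simp_all)
qed

text \<open>The coefficients are multiplied by the Cauchy product. Below order n + m, each of its
  terms has a factor below its own order, hence vanishes.\<close>

lemma double_series_mult:
  assumes "double_series n f" "double_series m g" shows "double_series (n + m) (\<lambda>\<mu> k. f \<mu> k * g \<mu> k)"
proof -
  from assms(1) obtain c r where c: "0 < r" "\<forall>j l. j + l < n \<longrightarrow> c j l = 0"
     "(\<lambda>(j,l). norm (c j l) * r^j * r^l) summable_on UNIV"
     "\<forall>\<mu> k. cmod \<mu> < r \<and> \<bar>k\<bar> < r \<longrightarrow> ((\<lambda>(j,l). c j l * \<mu>^j * of_real k^l) has_sum f \<mu> k) UNIV"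
    unfolding double_series_def by blast
  from assms(2) obtain d q where d: "0 < q" "\<forall>j l. j + l < m \<longrightarrow> d j l = 0"
     "(\<lambda>(j,l). norm (d j l) * q^j * q^l) summable_on UNIV"
     "\<forall>\<mu> k. cmod \<mu> < q \<and> \<bar>k\<bar> < q \<longrightarrow> ((\<lambda>(j,l). d j l * \<mu>^j * of_real k^l) has_sum g \<mu> k) UNIV"
    unfolding double_series_def by blast
  define \<rho> where "\<rho> = min r q"
  have \<rho>: "0 < \<rho>" "\<rho> \<le> r" "\<rho> \<le> q" using c d by (auto simp: \<rho>_def)
  define e where "e n m = (\<Sum>(i,t)\<in>{..n}\<times>{..m}. c i t * d (n-i) (m-t))" for n m
  have cs: "(\<lambda>(j,l). norm (c j l) * \<rho>^j * \<rho>^l) summable_on UNIV"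
    and ds: "(\<lambda>(j,l). norm (d j l) * \<rho>^j * \<rho>^l) summable_on UNIV"
    by (intro double_series_majorant[OF c(3)] double_series_majorant[OF d(3)]; use \<rho> in simp)+
  have trm: "(\<Sum>(i,t)\<in>{..a}\<times>{..b}. (\<lambda>(j,l). c j l * \<mu>^j * \<nu>^l) (i,t) * (\<lambda>(j,l). d j l * \<mu>^j * \<nu>^l) (a-i,b-t))
      = e a b * \<mu>^a * \<nu>^b" for \<mu> \<nu> a b
  proof -
    have "(\<lambda>(j,l). c j l * \<mu>^j * \<nu>^l) (i,t) * (\<lambda>(j,l). d j l * \<mu>^j * \<nu>^l) (a-i,b-t)
       = c i t * d (a-i) (b-t) * (\<mu>^a * \<nu>^b)" if "i \<le> a" "t \<le> b" for i t
    proof -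
      have "\<mu>^a = \<mu>^i * \<mu>^(a-i)" "\<nu>^b = \<nu>^t * \<nu>^(b-t)" using that by (simp_all flip: power_add)
      thus ?thesis by (simp add: algebra_simps)
    qed
    thus ?thesis unfolding e_def
      by (auto simp: sum_distrib_right mult.assoc case_prod_unfold intro!: sum.cong)
  qed
  have s: "(\<lambda>(a,b). norm (e a b) * \<rho>^a * \<rho>^b) summable_on UNIV"
  proof -
    have "(\<lambda>x. norm ((\<lambda>(j,l). norm (c j l) * \<rho>^j * \<rho>^l) x)) summable_on UNIV"
      "(\<lambda>x. norm ((\<lambda>(j,l). norm (d j l) * \<rho>^j * \<rho>^l) x)) summable_on UNIV"
      using cs ds \<rho> by (simp_all add: case_prod_unfold abs_mult)
    from has_sum_double_Cauchy_product[OF this]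
    have 1: "(\<lambda>(a,b). \<Sum>(i,t)\<in>{..a}\<times>{..b}. (\<lambda>(j,l). norm (c j l) * \<rho>^j * \<rho>^l) (i,t) *
       (\<lambda>(j,l). norm (d j l) * \<rho>^j * \<rho>^l) (a-i,b-t)) summable_on UNIV"
      by (rule has_sum_imp_summable)
    show ?thesis
    proof (rule summable_on_comparison_double[OF 1])
      fix a b :: nat
      have "norm (e a b) * \<rho>^a * \<rho>^b = norm (e a b * of_real \<rho>^a * of_real \<rho>^b)"
        using \<rho> by (simp add: norm_mult norm_power)
      also have "\<dots> \<le> (\<Sum>(i,t)\<in>{..a}\<times>{..b}. (\<lambda>(j,l). norm (c j l) * \<rho>^j * \<rho>^l) (i,t) *
       (\<lambda>(j,l). norm (d j l) * \<rho>^j * \<rho>^l) (a-i,b-t))"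
        unfolding trm[symmetric]
        by (rule order_trans[OF norm_sum sum_mono]) (use \<rho> in \<open>auto simp: norm_mult norm_power\<close>)
      finally show "norm (e a b) * \<rho>^a * \<rho>^b \<le>
        (\<Sum>(i,t)\<in>{..a}\<times>{..b}. (\<lambda>(j,l). norm (c j l) * \<rho>^j * \<rho>^l) (i,t) *
       (\<lambda>(j,l). norm (d j l) * \<rho>^j * \<rho>^l) (a-i,b-t))" .
    qed (use \<rho> in auto)
  qed
  have zero: "e a b = 0" if "a + b < n + m" for a b
  proof -
    have "c i t * d (a-i) (b-t) = 0" if "i \<le> a" "t \<le> b" for i t
    proof (cases "i + t < n")
      case False
      hence "(a - i) + (b - t) < m" using that \<open>a + b < n + m\<close> by linarith
      thus ?thesis using d(2) by simp
    qed (use c(2) in simp)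
    thus ?thesis unfolding e_def by (auto intro!: sum.neutral)
  qed
  show ?thesis unfolding double_series_def
  proof (rule exI[of _ e], rule exI[of _ \<rho>], intro conjI allI impI)
    fix \<mu> k assume *: "cmod \<mu> < \<rho> \<and> \<bar>k\<bar> < \<rho>"
    have 1: "infsum (\<lambda>(j,l). c j l * \<mu>^j * of_real k^l) UNIV = f \<mu> k"
      by (rule infsumI) (use c(4) \<rho> * in auto)
    have 2: "infsum (\<lambda>(j,l). d j l * \<mu>^j * of_real k^l) UNIV = g \<mu> k"
      by (rule infsumI) (use d(4) \<rho> * in auto)
    have "((\<lambda>(a,b). \<Sum>(i,t)\<in>{..a}\<times>{..b}. (\<lambda>(j,l). c j l * \<mu>^j * of_real k^l) (i,t) *
       (\<lambda>(j,l). d j l * \<mu>^j * of_real k^l) (a-i,b-t)) has_sum f \<mu> k * g \<mu> k) UNIV"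
      using has_sum_double_Cauchy_product[of "\<lambda>(j,l). c j l * \<mu>^j * of_real k^l" "\<lambda>(j,l). d j l * \<mu>^j * of_real k^l"]
        double_series_terms_summable[OF cs, of \<mu> k] double_series_terms_summable[OF ds, of \<mu> k] * 1 2 by simp
    thus "((\<lambda>(a,b). e a b * \<mu>^a * of_real k^b) has_sum f \<mu> k * g \<mu> k) UNIV"
      unfolding trm .
  qed (use zero \<rho> s in simp_all)
qed

lemma double_series_monomial: "double_series (i + t) (\<lambda>\<mu> k. a * \<mu>^i * of_real k^t)"
proof -
  define c where "c j l = (if (j,l) = (i,t) then a else 0)" for j l
  have 1: "((\<lambda>(j,l). c j l * \<mu>^j * of_real k^l) has_sum a * \<mu>^i * of_real k^t) UNIV" for \<mu> k
  proof (rule has_sum_finite_neutralI[of "{(i,t)}"])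
    show "(\<lambda>(j,l). c j l * \<mu>^j * of_real k^l) x = 0" if "x \<in> UNIV - {(i,t)}" for x
      using that unfolding c_def by (cases x) auto
  qed (simp_all add: c_def)
  have 2: "((\<lambda>(j,l). norm (c j l) * 1^j * 1^l) has_sum norm a) UNIV"
  proof (rule has_sum_finite_neutralI[of "{(i,t)}"])
    show "(\<lambda>(j,l). norm (c j l) * 1^j * 1^l) x = 0" if "x \<in> UNIV - {(i,t)}" for x
      using that unfolding c_def by (cases x) auto
  qed (simp_all add: c_def)
  show ?thesis unfolding double_series_def
  proof (rule exI[of _ c], rule exI[of _ 1], intro conjI allI impI)
    show "(\<lambda>(j,l). norm (c j l) * 1^j * 1^l) summable_on UNIV" using 2 by (rule has_sum_imp_summable)
    show "c j l = 0" if "j + l < i + t" for j l using that by (auto simp: c_def)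
  qed (use 1 in simp_all)
qed

lemma double_series_cmult: "double_series n f \<Longrightarrow> double_series n (\<lambda>\<mu> k. a * f \<mu> k)"
  using double_series_mult[OF double_series_monomial[of 0 0 a], of n f] by simp

lemma double_series_diff: "double_series n f \<Longrightarrow> double_series n g \<Longrightarrow> double_series n (\<lambda>\<mu> k. f \<mu> k - g \<mu> k)"
  using double_series_add[OF _ double_series_cmult[of n g "-1"], of f] by simp

text \<open>With x = |mu| + |k| <= r, a term of degree at least n is at most its value at radius r
  times (x/r)^n. Halving the radius for each variable ensures x <= r.\<close>

lemma double_series_bound:
  assumes "double_series n f"
  obtains C r where "0 < r" "0 \<le> C" "\<And>\<mu> k. cmod \<mu> < r \<Longrightarrow> \<bar>k\<bar> < r \<Longrightarrow> cmod (f \<mu> k) \<le> C * (cmod \<mu> + \<bar>k\<bar>)^n"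
proof -
  from assms(1) obtain c r where c: "0 < r" "\<forall>j l. j + l < n \<longrightarrow> c j l = 0"
     "(\<lambda>(j,l). norm (c j l) * r^j * r^l) summable_on UNIV"
     "\<forall>\<mu> k. cmod \<mu> < r \<and> \<bar>k\<bar> < r \<longrightarrow> ((\<lambda>(j,l). c j l * \<mu>^j * of_real k^l) has_sum f \<mu> k) UNIV"
    unfolding double_series_def by blast
  define S where "S = infsum (\<lambda>(j,l). norm (c j l) * r^j * r^l) UNIV"
  have S0: "0 \<le> S" unfolding S_def using c(1) by (intro infsum_nonneg) auto
  have "cmod (f \<mu> k) \<le> S / r^n * (cmod \<mu> + \<bar>k\<bar>)^n" if "cmod \<mu> < r/2" "\<bar>k\<bar> < r/2" for \<mu> k
  proof -
    define x where "x = cmod \<mu> + \<bar>k\<bar>"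
    have x: "0 \<le> x" "x \<le> r" using that by (auto simp: x_def)
    have hs: "((\<lambda>(j,l). c j l * \<mu>^j * of_real k^l) has_sum f \<mu> k) UNIV" using c(1,4) that by auto
    have sm: "(\<lambda>y. norm ((\<lambda>(j,l). c j l * \<mu>^j * of_real k^l) y)) summable_on UNIV"
      by (rule double_series_terms_summable[OF c(3)]) (use that c(1) in auto)
    have "cmod (f \<mu> k) = norm (infsum (\<lambda>(j,l). c j l * \<mu>^j * of_real k^l) UNIV)"
      using hs by (simp add: infsumI)
    also have "\<dots> \<le> infsum (\<lambda>y. norm ((\<lambda>(j,l). c j l * \<mu>^j * of_real k^l) y)) UNIV"
      by (rule norm_infsum_bound[OF sm])
    also have "\<dots> \<le> infsum (\<lambda>y. (\<lambda>(j,l). norm (c j l) * r^j * r^l) y * (x/r)^n) UNIV"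
    proof (rule infsum_mono[OF sm])
      show "(\<lambda>y. (\<lambda>(j,l). norm (c j l) * r^j * r^l) y * (x/r)^n) summable_on UNIV"
        using c(3) by (rule summable_on_cmult_left)
      fix y :: "nat \<times> nat" obtain j l where y: "y = (j,l)" by (cases y)
      show "norm ((\<lambda>(j,l). c j l * \<mu>^j * of_real k^l) y) \<le> (\<lambda>(j,l). norm (c j l) * r^j * r^l) y * (x/r)^n"
      proof (cases "j + l < n")
        case False
        have "cmod \<mu>^j * \<bar>k\<bar>^l \<le> x^j * x^l" by (intro mult_mono power_mono) (auto simp: x_def)
        also have "\<dots> = r^j * r^l * (x/r)^(j+l)" using c(1) by (simp add: power_add power_divide)
        also have "\<dots> \<le> r^j * r^l * (x/r)^n" using c(1) x False
          by (intro mult_left_mono power_decreasing) auto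
        finally have "norm (c j l) * (cmod \<mu>^j * \<bar>k\<bar>^l) \<le> norm (c j l) * (r^j * r^l * (x/r)^n)"
          by (intro mult_left_mono) auto
        thus ?thesis by (simp add: y norm_mult norm_power mult.assoc)
      qed (use c(2) y in simp)
    qed
    also have "\<dots> = S * (x/r)^n" unfolding S_def by (rule infsum_cmult_left')
    finally show ?thesis by (simp add: x_def power_divide)
  qed
  thus ?thesis using that[of "r/2" "S / r^n"] c(1) S0 by simp
qed

text \<open>For fixed k the sum over \<open>l\<close> is carried out first, which leaves an ordinary
  power series in mu.\<close>

lemma double_series_holomorphic:
  assumes "double_series n f"
  obtains r where "0 < r" "\<And>k. \<bar>k\<bar> < r \<Longrightarrow> (\<lambda>\<mu>. f \<mu> k) holomorphic_on ball 0 r"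
proof -
  from assms(1) obtain c r where c: "0 < r" "\<forall>j l. j + l < n \<longrightarrow> c j l = 0"
     "(\<lambda>(j,l). norm (c j l) * r^j * r^l) summable_on UNIV"
     "\<forall>\<mu> k. cmod \<mu> < r \<and> \<bar>k\<bar> < r \<longrightarrow> ((\<lambda>(j,l). c j l * \<mu>^j * of_real k^l) has_sum f \<mu> k) UNIV"
    unfolding double_series_def by blast
  have "(\<lambda>\<mu>. f \<mu> k) holomorphic_on ball 0 r" if k: "\<bar>k\<bar> < r" for k
  proof (rule power_series_holomorphic)
    fix \<mu> :: complex assume \<mu>: "\<mu> \<in> ball 0 r"
    define a where "a j = (\<Sum>\<^sub>\<infinity>l. c j l * of_real k^l)" for j
    have hs: "((\<lambda>(j,l). c j l * \<mu>^j * of_real k^l) has_sum f \<mu> k) (UNIV\<times>UNIV)" using c(4) k \<mu> by auto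
    have inner: "(\<lambda>l. c j l * of_real k^l) summable_on UNIV" for j
    proof -
      have "(\<lambda>x. norm ((\<lambda>(j,l). c j l * (of_real (r))^j * of_real k^l) x)) summable_on (UNIV\<times>UNIV)"
        using double_series_terms_summable[OF c(3), of "of_real r" k] k c(1) by simp
      hence "(\<lambda>l. norm (c j l * (of_real (r))^j * of_real k^l)) summable_on UNIV"
        using bspec[OF conjunct1[OF iffD1[OF Infinite_Sum.abs_summable_on_Sigma_iff[where f="\<lambda>(j,l). c j l * (of_real (r))^j * of_real k^l" and A=UNIV and B="\<lambda>_. UNIV"]]], of j] by simp
      hence "(\<lambda>l. c j l * (of_real (r))^j * of_real k^l) summable_on UNIV" by (rule abs_summable_summable)
      from summable_on_cmult_left[OF this, of "1/of_real r^j"] show ?thesis using c(1) by (simp add: field_simps)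
    qed
    have "((\<lambda>j. a j * \<mu>^j) has_sum f \<mu> k) UNIV"
    proof (rule has_sum_Sigma[OF isUCont_plus hs])
      fix j
      show "((\<lambda>l. (\<lambda>(j,l). c j l * \<mu>^j * of_real k^l) (j,l)) has_sum a j * \<mu>^j) UNIV"
        using has_sum_cmult_left[OF has_sum_infsum[OF inner[of j]], of "\<mu>^j"]
        by (simp add: a_def mult_ac)
    qed
    thus "(\<lambda>j. (\<Sum>\<^sub>\<infinity>l. c j l * of_real k^l) * (\<mu> - 0)^j) sums f \<mu> k"
      unfolding a_def by (simp add: has_sum_imp_sums)
  qed
  thus ?thesis using that c(1) by blast
qed

section \<open>Zeros of a perturbed polynomial\<close>

text \<open>By Rouche on the circle of radius \<open>\<epsilon>\<close>, the orders of the zeros of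
  P + E in the disc add up to m. Every order is at least 1, so there are between 1 and m distinct
  zeros. This suffices because eigenvalues are compared as sets.\<close>

lemma few_zeros_near_root:
  fixes P E :: "complex \<Rightarrow> complex"
  assumes S: "open S" "connected S" "convex S" and P: "P holomorphic_on S" and E: "E holomorphic_on S"
    and ball: "cball v \<epsilon> \<subseteq> S" "0 < \<epsilon>"
    and less: "\<And>z. cmod (z - v) = \<epsilon> \<Longrightarrow> cmod (E z) < cmod (P z)"
    and g: "g holomorphic_on S" "g v \<noteq> 0" "\<And>z. z \<in> S \<Longrightarrow> P z = g z * (z - v)^m" "0 < m"
    and only: "\<And>z. z \<in> S \<Longrightarrow> P z = 0 \<Longrightarrow> z \<in> ball v \<epsilon> \<Longrightarrow> z = v"
    and fin: "finite {z\<in>S. P z = 0}" "finite {z\<in>S. P z + E z = 0}"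
  shows "{z\<in>ball v \<epsilon>. P z + E z = 0} \<noteq> {} \<and> card {z\<in>ball v \<epsilon>. P z + E z = 0} \<le> m"
proof -
  let ?Z = "{z\<in>S. P z + E z = 0}"
  let ?Zb = "{z\<in>ball v \<epsilon>. P z + E z = 0}"
  have vS: "v \<in> S" using ball by auto
  have sub: "?Zb \<subseteq> ?Z" using ball by (auto simp: subset_iff)
  have w0: "winding_number (circlepath v \<epsilon>) z = 0" if "cmod (z - v) > \<epsilon>" for z
  proof (rule winding_number_zero_outside[of _ "cball v \<epsilon>"])
    show "z \<notin> cball v \<epsilon>" using that by (simp add: dist_norm norm_minus_commute)
  qed (use ball in auto)
  have w1: "winding_number (circlepath v \<epsilon>) z = 1" if "cmod (z - v) < \<epsilon>" for z
    using that by (rule winding_number_circlepath)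
  have nz: "P z + E z \<noteq> 0" if "cmod (z - v) = \<epsilon>" for z
  proof
    assume "P z + E z = 0"
    hence "cmod (P z) = cmod (E z)" by (metis add_eq_0_iff norm_minus_cancel)
    thus False using less[OF that] by simp
  qed
  have Rouche: "(\<Sum>p\<in>?Z. winding_number (circlepath v \<epsilon>) p * zorder (\<lambda>p. P p + E p) p)
     = (\<Sum>p\<in>{z\<in>S. P z = 0}. winding_number (circlepath v \<epsilon>) p * zorder P p)"
  proof (rule Rouche_theorem)
    show "path_image (circlepath v \<epsilon>) \<subseteq> S" using ball by auto
    show "\<forall>z\<in>path_image (circlepath v \<epsilon>). cmod (E z) < cmod (P z)"
      using less ball by (auto simp: path_image_circlepath dist_norm norm_minus_commute)
    show "\<forall>z. z \<notin> S \<longrightarrow> winding_number (circlepath v \<epsilon>) z = 0"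
    proof (intro allI impI w0)
      fix z assume "z \<notin> S"
      hence "z \<notin> cball v \<epsilon>" using ball by auto
      thus "cmod (z - v) > \<epsilon>" by (simp add: dist_norm norm_minus_commute)
    qed
  qed (use S P E fin in auto)
  have holo: "(\<lambda>p. P p + E p) holomorphic_on S" using P E by (intro holomorphic_intros)
  \<comment> \<open>An order at least 1 at a zero requires that the function does not vanish
    identically; a point of the circle shows this.\<close>
  have nonconst: "\<exists>w\<in>S. P w + E w \<noteq> 0"
  proof
    have "cmod (v + of_real \<epsilon> - v) = \<epsilon>" using ball by simp
    thus "P (v + of_real \<epsilon>) + E (v + of_real \<epsilon>) \<noteq> 0" by (rule nz)
    show "v + of_real \<epsilon> \<in> S" using ball by (auto simp: dist_norm)
  qed
  have ord_pos: "1 \<le> zorder (\<lambda>p. P p + E p) p" if "p \<in> ?Z" for p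
    using zorder_exist_zero[OF holo S(1,2) _ nonconst, of p] that by auto
  have ordP: "zorder P v = int m"
    by (rule zorder_eqI[OF S(1) vS g(1,2)]) (use g(3) in simp)
  have left: "(\<Sum>p\<in>?Z. winding_number (circlepath v \<epsilon>) p * zorder (\<lambda>p. P p + E p) p)
      = of_int (\<Sum>p\<in>?Zb. zorder (\<lambda>p. P p + E p) p)"
  proof -
    have "(\<Sum>p\<in>?Z. winding_number (circlepath v \<epsilon>) p * zorder (\<lambda>p. P p + E p) p)
      = (\<Sum>p\<in>?Zb. of_int (zorder (\<lambda>p. P p + E p) p))"
    proof (rule sum.mono_neutral_cong_right[OF fin(2) sub])
      show "\<forall>p\<in>?Z - ?Zb. winding_number (circlepath v \<epsilon>) p * zorder (\<lambda>p. P p + E p) p = 0"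
      proof
        fix p assume p: "p \<in> ?Z - ?Zb"
        hence "cmod (p - v) \<ge> \<epsilon>" by (auto simp: dist_norm norm_minus_commute)
        moreover have "cmod (p - v) \<noteq> \<epsilon>" using nz p by auto
        ultimately show "winding_number (circlepath v \<epsilon>) p * zorder (\<lambda>p. P p + E p) p = 0"
          using w0 by simp
      qed
    qed (use w1 in \<open>auto simp: dist_norm norm_minus_commute\<close>)
    thus ?thesis by simp
  qed
  have right: "(\<Sum>p\<in>{z\<in>S. P z = 0}. winding_number (circlepath v \<epsilon>) p * zorder P p) = of_nat m"
  proof -
    have "(\<Sum>p\<in>{z\<in>S. P z = 0}. winding_number (circlepath v \<epsilon>) p * zorder P p) =
       (\<Sum>p\<in>{v}. winding_number (circlepath v \<epsilon>) p * zorder P p)"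
    proof (rule sum.mono_neutral_right[OF fin(1)])
      show "{v} \<subseteq> {z \<in> S. P z = 0}" using vS g by auto
      show "\<forall>i\<in>{z \<in> S. P z = 0} - {v}. winding_number (circlepath v \<epsilon>) i * of_int (zorder P i) = 0"
      proof
        fix i assume i: "i \<in> {z \<in> S. P z = 0} - {v}"
        hence "i \<notin> ball v \<epsilon>" using only by blast
        moreover have "cmod (i - v) \<noteq> \<epsilon>" using less[of i] i by auto
        ultimately have "cmod (i - v) > \<epsilon>" by (auto simp: dist_norm norm_minus_commute)
        thus "winding_number (circlepath v \<epsilon>) i * of_int (zorder P i) = 0" by (simp add: w0)
      qed
    qed
    thus ?thesis using w1[of v] ball ordP by simp
  qed
  have "(of_int (\<Sum>p\<in>?Zb. zorder (\<lambda>p. P p + E p) p) :: complex) = of_int (int m)"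
    using Rouche left right by simp
  hence tot: "(\<Sum>p\<in>?Zb. zorder (\<lambda>p. P p + E p) p) = int m" by (simp only: of_int_eq_iff)
  have "int (card ?Zb) = (\<Sum>p\<in>?Zb. 1)" by simp
  also have "\<dots> \<le> (\<Sum>p\<in>?Zb. zorder (\<lambda>p. P p + E p) p)"
    using ord_pos sub by (intro sum_mono) blast
  finally have "card ?Zb \<le> m" using tot by simp
  moreover have "?Zb \<noteq> {}"
  proof
    assume "?Zb = {}"
    hence "(\<Sum>p\<in>?Zb. zorder (\<lambda>p. P p + E p) p) = 0" by (simp only: sum.empty)
    thus False using tot g(4) by simp
  qed
  ultimately show ?thesis by blast
qed

text \<open>When there are more labels than zeros, some zeros receive several labels. This is how a
  multiple root of the quartic is matched with fewer distinct eigenvalues.\<close>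

lemma surjection_exists:
  assumes "finite A" "finite B" "B \<noteq> {}" "card B \<le> card A"
  shows "\<exists>g. g ` A = B"
  using inj_on_iff_surj[OF assms(3), of A] card_le_inj[OF assms(2,1,4)] by blast

lemma prod_root_lower_bound:
  fixes c :: "nat \<Rightarrow> complex"
  assumes "\<And>j. j < n \<Longrightarrow> \<epsilon> \<le> cmod (z - c j)" "0 \<le> \<epsilon>"
  shows "\<epsilon>^n \<le> cmod (\<Prod>j<n. z - c j)"
proof -
  have "\<epsilon>^n = (\<Prod>j<n. \<epsilon>)" by simp
  also have "\<dots> \<le> (\<Prod>j<n. cmod (z - c j))" using assms by (intro prod_mono) auto
  finally show ?thesis by (simp add: prod_norm)
qed

text \<open>The substitution mu = k z allows division by k^4 and leaves a fixed quartic with roots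
  \<open>c j\<close> plus a term O(k). Zeros that are not O(k) are excluded by comparing degrees 4
  and 5. The radius \<open>r\<close> may be any small number, with \<open>\<delta>\<close> depending
  on it, so that two problems can share one \<open>r\<close>.\<close>

lemma root_labelling:
  fixes Rem :: "complex \<Rightarrow> real \<Rightarrow> complex" and c :: "nat \<Rightarrow> complex"
  assumes Rem: "double_series 5 Rem" and a: "a \<noteq> 0"
  shows "\<exists>r0>0. \<forall>r. 0 < r \<and> r \<le> r0 \<longrightarrow> (\<exists>\<delta>>0. \<exists>\<alpha> :: nat \<Rightarrow> real \<Rightarrow> complex.
     (\<forall>k. \<bar>k\<bar> < \<delta> \<longrightarrow> {\<mu>. cmod \<mu> < r \<and> a * (\<Prod>j<4. \<mu> - of_real k * c j) + Rem \<mu> k = 0} = (\<lambda>j. \<alpha> j k) ` {..<4}) \<and>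
     (\<forall>j<4. ((\<lambda>k. \<alpha> j k / of_real k) \<longlongrightarrow> c j) (at 0)))"
proof -
  obtain C5 \<rho>1 where C5: "0 < \<rho>1" "0 \<le> C5"
     "\<And>\<mu> k. cmod \<mu> < \<rho>1 \<Longrightarrow> \<bar>k\<bar> < \<rho>1 \<Longrightarrow> cmod (Rem \<mu> k) \<le> C5 * (cmod \<mu> + \<bar>k\<bar>)^5"
    using double_series_bound[OF Rem] by metis
  obtain \<rho>2 where \<rho>2: "0 < \<rho>2" "\<And>k. \<bar>k\<bar> < \<rho>2 \<Longrightarrow> (\<lambda>\<mu>. Rem \<mu> k) holomorphic_on ball 0 \<rho>2"
    using double_series_holomorphic[OF Rem] by metis
  define \<rho> where "\<rho> = min \<rho>1 \<rho>2"
  have \<rho>: "0 < \<rho>" "\<rho> \<le> \<rho>1" "\<rho> \<le> \<rho>2" using C5 \<rho>2 by (auto simp: \<rho>_def)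
  define Cc where "Cc = 1 + (\<Sum>j<4. cmod (c j))"
  have Cc: "1 \<le> Cc" "\<And>j. j < 4 \<Longrightarrow> cmod (c j) \<le> Cc"
  proof -
    show "1 \<le> Cc" by (simp add: Cc_def sum_nonneg)
    show "cmod (c j) \<le> Cc" if "j < 4" for j
      using member_le_sum[of j "{..<4}" "\<lambda>j. cmod (c j)"] that by (simp add: Cc_def)
  qed
  \<comment> \<open>For |mu| >= C |k| each factor mu - k c_j has modulus at least |mu|/2.\<close>
  define C where "C = 2 * Cc"
  have C: "2 \<le> C" using Cc by (simp add: C_def)
  \<comment> \<open>512 = 16 * 32 collects the factors from (|mu|/2)^4 and (2 |mu|)^5 in the
    comparison below. The added 1 covers the case \<open>C5 = 0\<close>.\<close>
  define r0 where "r0 = min (\<rho>/2) (cmod a / (512 * C5 + 1) / 2)"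
  have r0: "0 < r0" "r0 < \<rho>" "r0 * (512 * C5) < cmod a"
  proof -
    show "0 < r0" using \<rho> a C5 by (simp add: r0_def add_nonneg_pos)
    show "r0 < \<rho>" using \<rho> by (simp add: r0_def)
    have "r0 * (512 * C5) \<le> cmod a / (512 * C5 + 1) / 2 * (512 * C5)"
      using C5 by (intro mult_right_mono) (auto simp: r0_def)
    also have "\<dots> < cmod a" using C5(2) a by (simp add: field_simps add_pos_nonneg)
    finally show "r0 * (512 * C5) < cmod a" .
  qed
  let ?D = "\<lambda>\<mu> k. a * (\<Prod>j<4. \<mu> - of_real k * c j) + Rem \<mu> k"
  have apriori: "\<mu> = 0 \<and> k = 0 \<or> cmod \<mu> < C * \<bar>k\<bar>" if D0: "?D \<mu> k = 0" and \<mu>: "cmod \<mu> < r0" and k: "\<bar>k\<bar> < r0" for \<mu> k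
  proof (rule ccontr)
    assume neg: "\<not> ?thesis"
    hence ge: "C * \<bar>k\<bar> \<le> cmod \<mu>" by auto
    have \<mu>0: "cmod \<mu> > 0"
    proof -
      have False if "\<mu> = 0" using ge that C neg by (auto simp: mult_le_0_iff)
      thus ?thesis by auto
    qed
    have "cmod \<mu> / 2 \<le> cmod (\<mu> - of_real k * c j)" if "j < 4" for j
    proof -
      have "cmod (of_real k * c j) \<le> \<bar>k\<bar> * Cc" using Cc(2)[OF that] by (simp add: norm_mult mult_left_mono)
      also have "\<dots> \<le> cmod \<mu> / 2" using ge by (simp add: C_def mult_ac)
      finally show ?thesis using norm_triangle_ineq2[of \<mu> "of_real k * c j"] by linarith
    qed
    hence "(cmod \<mu> / 2)^4 \<le> cmod (\<Prod>j<4. \<mu> - of_real k * c j)" using \<mu>0 by (intro prod_root_lower_bound) auto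
    hence "cmod a * (cmod \<mu> / 2)^4 \<le> cmod (a * (\<Prod>j<4. \<mu> - of_real k * c j))"
      by (simp add: norm_mult mult_left_mono)
    also have "\<dots> = cmod (Rem \<mu> k)" using D0 by (metis add_eq_0_iff norm_minus_cancel)
    also have "\<dots> \<le> C5 * (cmod \<mu> + \<bar>k\<bar>)^5" using \<mu> k r0 \<rho> by (intro C5(3)) auto
    also have "\<dots> \<le> C5 * (2 * cmod \<mu>)^5"
    proof (intro mult_left_mono power_mono)
      have "\<bar>k\<bar> \<le> C * \<bar>k\<bar>" using C mult_right_mono[of 1 C "\<bar>k\<bar>"] by simp
      thus "cmod \<mu> + \<bar>k\<bar> \<le> 2 * cmod \<mu>" using ge by linarith
    qed (use C5 in auto)
    also have "\<dots> = (32 * C5 * cmod \<mu>) * cmod \<mu>^4" by (simp add: power_mult_distrib eval_nat_numeral)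
    finally have "cmod a / 16 * cmod \<mu>^4 \<le> (32 * C5 * cmod \<mu>) * cmod \<mu>^4"
      by (simp add: power_divide)
    hence "cmod a / 16 \<le> 32 * C5 * cmod \<mu>" using \<mu>0 by (simp add: mult_le_cancel_right)
    also have "\<dots> \<le> 32 * C5 * r0" using \<mu> C5 by (intro mult_left_mono) auto
    finally show False using r0(3) by (simp add: mult_ac)
  qed
  define V where "V = c ` {..<4}"
  have finV: "finite V" by (simp add: V_def)
  \<comment> \<open>Half the least distance between distinct roots, capped at 1: the discs around
    the roots are disjoint and stay inside the ball of radius \<open>C + 1\<close>.\<close>
  obtain \<epsilon>0 where \<epsilon>0: "0 < \<epsilon>0" "\<epsilon>0 \<le> 1" "\<And>v v'. v \<in> V \<Longrightarrow> v' \<in> V \<Longrightarrow> v \<noteq> v' \<Longrightarrow> 2 * \<epsilon>0 \<le> cmod (v - v')"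
  proof -
    let ?Q = "{(v,v'). v \<in> V \<and> v' \<in> V \<and> v \<noteq> v'}"
    have fQ: "finite ?Q" using finite_cartesian_product[OF finV finV] by (rule rev_finite_subset) auto
    define m where "m = Min (insert 1 ((\<lambda>(v,v'). cmod (v - v') / 2) ` ?Q))"
    have "0 < m" unfolding m_def using fQ by (subst Min_gr_iff) auto
    moreover have "m \<le> 1" unfolding m_def using fQ by (intro Min_le) auto
    moreover have "2 * m \<le> cmod (v - v')" if "v \<in> V" "v' \<in> V" "v \<noteq> v'" for v v'
    proof -
      have "m \<le> cmod (v - v') / 2" unfolding m_def
        using fQ that by (intro Min_le) (auto intro!: image_eqI[of _ _ "(v,v')"])
      thus ?thesis by simp
    qed
    ultimately show ?thesis using that by blast
  qed
  define P where "P z = a * (\<Prod>j<4. z - c j)" for z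
  define E where "E k z = Rem (of_real k * z) k / of_real k^4" for k z
  define Z where "Z k = {z\<in>ball 0 (C+1). P z + E k z = 0}" for k
  have scale: "?D (of_real k * z) k = of_real k^4 * (P z + E k z)" if "k \<noteq> 0" for k z
  proof -
    have "(\<Prod>j<4. of_real k * z - of_real k * c j) = (\<Prod>j<4. of_real k * (z - c j))"
      by (simp add: right_diff_distrib)
    also have "\<dots> = of_real k^4 * (\<Prod>j<4. z - c j)" by (simp add: prod.distrib)
    finally show ?thesis using that by (simp add: P_def E_def algebra_simps)
  qed
  have Eb: "cmod (E k z) \<le> C5 * (C+2)^5 * \<bar>k\<bar>" if "k \<noteq> 0" "\<bar>k\<bar> * (C+1) < \<rho>" "cmod z < C + 1" for k z
  proof -
    have k\<rho>: "\<bar>k\<bar> < \<rho>" using that(2) C mult_left_mono[of 1 "C+1" "\<bar>k\<bar>"] by simp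
    have kz: "cmod (of_real k * z) < \<rho>"
    proof -
      have "cmod (of_real k * z) \<le> \<bar>k\<bar> * (C+1)" using that by (auto simp: norm_mult intro!: mult_left_mono)
      thus ?thesis using that by linarith
    qed
    have "cmod (Rem (of_real k * z) k) \<le> C5 * (cmod (of_real k * z) + \<bar>k\<bar>)^5"
      using kz k\<rho> \<rho> by (intro C5(3)) auto
    also have "\<dots> \<le> C5 * (\<bar>k\<bar> * (C+2))^5"
    proof (intro mult_left_mono power_mono)
      have "\<bar>k\<bar> * cmod z \<le> \<bar>k\<bar> * (C+1)" using that by (intro mult_left_mono) auto
      thus "cmod (of_real k * z) + \<bar>k\<bar> \<le> \<bar>k\<bar> * (C+2)" by (simp add: norm_mult algebra_simps)
    qed (use C5 in auto)
    also have "\<dots> = C5 * (C+2)^5 * \<bar>k\<bar> * \<bar>k\<bar>^4" by (simp add: power_mult_distrib eval_nat_numeral)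
    finally show ?thesis using that(1)
      by (simp add: E_def norm_divide norm_power divide_le_eq)
  qed
  have Eh: "E k holomorphic_on ball 0 (C+1)" if "k \<noteq> 0" "\<bar>k\<bar> * (C+1) < \<rho>" for k
  proof -
    have k\<rho>: "\<bar>k\<bar> < \<rho>" using that(2) C mult_left_mono[of 1 "C+1" "\<bar>k\<bar>"] by simp
    have "((\<lambda>\<mu>. Rem \<mu> k) \<circ> (\<lambda>z. of_real k * z)) holomorphic_on ball 0 (C+1)"
    proof (rule holomorphic_on_compose_gen[of _ _ _ "ball 0 \<rho>2"])
      show "(\<lambda>\<mu>. Rem \<mu> k) holomorphic_on ball 0 \<rho>2" using \<rho>2 k\<rho> \<rho> by auto
      show "(\<lambda>z. complex_of_real k * z) ` ball 0 (C+1) \<subseteq> ball 0 \<rho>2"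
      proof clarsimp
        fix z :: complex assume "cmod z < C + 1"
        hence "\<bar>k\<bar> * cmod z \<le> \<bar>k\<bar> * (C+1)" by (intro mult_left_mono) auto
        hence "\<bar>k\<bar> * cmod z < \<rho>2" using that(2) \<rho> by linarith
        thus "cmod (complex_of_real k * z) < \<rho>2" by (simp add: norm_mult)
      qed
    qed (auto intro!: holomorphic_intros)
    thus ?thesis unfolding E_def o_def using that(1) by (auto intro!: holomorphic_intros)
  qed
  have Ph: "P holomorphic_on A" for A unfolding P_def[abs_def] by (intro holomorphic_intros)
  \<comment> \<open>The first bound keeps k z within the radius of the series. The second makes the
    O(k) term smaller than |a| \<epsilon>^4, a lower bound for |P| at distance at least \<epsilon>
    from all roots.\<close>
  define \<delta>f where "\<delta>f \<epsilon> = min (\<rho> / (C+1)) (cmod a * \<epsilon>^4 / (C5 * (C+2)^5 + 1))" for \<epsilon>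
  have \<delta>f: "0 < \<delta>f \<epsilon>" if "0 < \<epsilon>" for \<epsilon> using that \<rho> C a C5(2)
    by (auto simp: \<delta>f_def intro!: divide_pos_pos mult_pos_pos add_nonneg_pos)
  have k\<rho>: "\<bar>k\<bar> * (C+1) < \<rho>" if "\<bar>k\<bar> < \<delta>f \<epsilon>" for k \<epsilon>
  proof -
    have "\<bar>k\<bar> < \<rho> / (C+1)" using that by (simp add: \<delta>f_def)
    thus ?thesis using C by (simp add: pos_less_divide_eq)
  qed
  have less: "cmod (E k z) < cmod (P z)" if "\<bar>k\<bar> < \<delta>f \<epsilon>" "k \<noteq> 0" "0 < \<epsilon>" "cmod z < C + 1" "\<And>v. v \<in> V \<Longrightarrow> \<epsilon> \<le> cmod (z - v)" for k \<epsilon> z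
  proof -
    have "\<bar>k\<bar> < cmod a * \<epsilon>^4 / (C5 * (C+2)^5 + 1)" using that(1) by (simp add: \<delta>f_def)
    moreover have pos: "0 < C5 * (C+2)^5 + 1" using C5 C by (auto intro!: add_nonneg_pos)
    ultimately have *: "\<bar>k\<bar> * (C5 * (C+2)^5 + 1) < cmod a * \<epsilon>^4" by (simp add: pos_less_divide_eq)
    have "cmod (E k z) \<le> C5 * (C+2)^5 * \<bar>k\<bar>" using that k\<rho> by (intro Eb) auto
    also have "\<dots> \<le> \<bar>k\<bar> * (C5 * (C+2)^5 + 1)" by (simp add: algebra_simps)
    also have "\<dots> < cmod a * \<epsilon>^4" by (rule *)
    also have "\<dots> \<le> cmod (P z)" unfolding P_def norm_mult
      using that by (intro mult_left_mono prod_root_lower_bound) (auto simp: V_def)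
    finally show ?thesis .
  qed
  have near: "\<exists>v\<in>V. cmod (z - v) < \<epsilon>" if "\<bar>k\<bar> < \<delta>f \<epsilon>" "k \<noteq> 0" "0 < \<epsilon>" "z \<in> Z k" for k \<epsilon> z
  proof (rule ccontr)
    assume "\<not> ?thesis"
    hence "cmod (E k z) < cmod (P z)" using that by (intro less[of k \<epsilon>]) (auto simp: Z_def not_less)
    moreover have "P z + E k z = 0" using that by (simp add: Z_def)
    hence "cmod (P z) = cmod (E k z)" by (metis add_eq_0_iff norm_minus_cancel)
    ultimately show False by simp
  qed
  have VC: "cmod v \<le> Cc" if "v \<in> V" for v using that Cc(2) by (auto simp: V_def)
  have finP: "finite {z\<in>ball 0 (C+1). P z = 0}"
  proof (rule finite_subset[OF _ finV])
    show "{z\<in>ball 0 (C+1). P z = 0} \<subseteq> V" using a by (auto simp: P_def V_def)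
  qed
  have finZ: "finite (Z k)" if k: "\<bar>k\<bar> < \<delta>f \<epsilon>0" "k \<noteq> 0" for k
  proof -
    have "finite {z \<in> cball 0 (Cc + \<epsilon>0). P z + E k z = 0}"
    proof (cases "(\<lambda>z. P z + E k z) constant_on ball 0 (C+1)")
      case False
      show ?thesis
      proof (rule holomorphic_compact_finite_zeros[OF _ _ _ _ _ False])
        show "(\<lambda>z. P z + E k z) holomorphic_on ball 0 (C+1)" using Ph Eh k k\<rho> by (intro holomorphic_intros) auto
        show "cball 0 (Cc + \<epsilon>0) \<subseteq> ball 0 (C+1)" using \<epsilon>0 Cc by (auto simp: C_def)
      qed auto
    next
      \<comment> \<open>The constant cannot be 0: otherwise every point of the ball would be a zero,
        including a real \<open>t\<close> farther than \<open>\<epsilon>0\<close> from all roots,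
        against \<open>near\<close>.\<close>
      case True
      then obtain q where q: "\<And>z. z \<in> ball 0 (C+1) \<Longrightarrow> P z + E k z = q" by (auto simp: constant_on_def)
      have Ct: "Cc + \<epsilon>0 < C + 1" using \<epsilon>0 Cc by (auto simp: C_def)
      have "q \<noteq> 0"
      proof
        assume "q = 0"
        hence Zk: "Z k = ball 0 (C+1)" using q by (auto simp: Z_def)
        from Ct obtain t where t: "Cc + \<epsilon>0 < t" "t < C + 1" using dense by blast
        have "of_real t \<in> Z k" using t \<epsilon>0 Cc unfolding Zk by auto
        from near[OF k \<epsilon>0(1) this] obtain v where v: "v \<in> V" "cmod (of_real t - v) < \<epsilon>0" by blast
        have "t \<le> cmod (of_real t - v) + cmod v" using norm_triangle_ineq[of "of_real t - v" v] t Cc \<epsilon>0 by simp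
        thus False using v VC[OF v(1)] t by linarith
      qed
      hence "{z \<in> cball 0 (Cc + \<epsilon>0). P z + E k z = 0} = {}" using q Ct by auto
      thus ?thesis by (simp only: finite.emptyI)
    qed
    moreover have "Z k \<subseteq> {z \<in> cball 0 (Cc + \<epsilon>0). P z + E k z = 0}"
    proof
      fix z assume z: "z \<in> Z k"
      from near[OF k \<epsilon>0(1) this] obtain v where v: "v \<in> V" "cmod (z - v) < \<epsilon>0" by blast
      have "cmod z \<le> cmod (z - v) + cmod v" using norm_triangle_ineq[of "z - v" v] by simp
      thus "z \<in> {z \<in> cball 0 (Cc + \<epsilon>0). P z + E k z = 0}" using v VC[OF v(1)] z by (auto simp: Z_def)
    qed
    ultimately show ?thesis by (rule rev_finite_subset)
  qed
  have count: "Z k \<inter> ball v \<epsilon>0 \<noteq> {} \<and> card (Z k \<inter> ball v \<epsilon>0) \<le> card {j\<in>{..<4}. c j = v}"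
    if k: "\<bar>k\<bar> < \<delta>f \<epsilon>0" "k \<noteq> 0" and v: "v \<in> V" for k v
  proof -
    let ?m = "card {j\<in>{..<4}. c j = v}"
    let ?g = "\<lambda>z. a * (\<Prod>j\<in>{j\<in>{..<4}. c j \<noteq> v}. z - c j)"
    have cb: "cball v \<epsilon>0 \<subseteq> ball 0 (C+1)"
    proof
      fix z assume "z \<in> cball v \<epsilon>0"
      hence "cmod (z - v) \<le> \<epsilon>0" by (simp add: dist_norm norm_minus_commute)
      moreover have "cmod z \<le> cmod (z - v) + cmod v" using norm_triangle_ineq[of "z - v" v] by simp
      ultimately have "cmod z \<le> \<epsilon>0 + Cc" using VC[OF v] by linarith
      also have "\<dots> < C + 1" using \<epsilon>0 Cc by (auto simp: C_def)
      finally show "z \<in> ball 0 (C+1)" by simp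
    qed
    have "{z\<in>ball v \<epsilon>0. P z + E k z = 0} \<noteq> {} \<and> card {z\<in>ball v \<epsilon>0. P z + E k z = 0} \<le> ?m"
    proof (rule few_zeros_near_root[of "ball 0 (C+1)", OF _ _ _ Ph Eh cb \<epsilon>0(1)])
      fix z assume z: "cmod (z - v) = \<epsilon>0"
      show "cmod (E k z) < cmod (P z)"
      proof (rule less[OF k \<epsilon>0(1)])
        have "z \<in> cball v \<epsilon>0" using z by (simp add: dist_norm norm_minus_commute)
        hence "z \<in> ball 0 (C+1)" using cb by blast
        thus "cmod z < C + 1" by simp
        fix v' assume v': "v' \<in> V"
        show "\<epsilon>0 \<le> cmod (z - v')"
        proof (cases "v' = v")
          case False
          have "2 * \<epsilon>0 \<le> cmod (v - v')" using \<epsilon>0(3)[OF v v'] False by auto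
          also have "\<dots> \<le> cmod (z - v) + cmod (z - v')"
            using norm_triangle_ineq4[of "z - v'" "z - v"] by (simp add: algebra_simps)
          finally show ?thesis using z by simp
        qed (use z in simp)
      qed
    next
      show "?g holomorphic_on ball 0 (C+1)" by (intro holomorphic_intros)
      show "?g v \<noteq> 0" using a by auto
      show "P z = ?g z * (z - v)^?m" for z
      proof -
        have "(\<Prod>j<4. z - c j) = (\<Prod>j\<in>{j\<in>{..<4}. c j \<noteq> v} \<union> {j\<in>{..<4}. c j = v}. z - c j)"
          by (rule prod.cong) auto
        also have "\<dots> = (\<Prod>j\<in>{j\<in>{..<4}. c j \<noteq> v}. z - c j) * (\<Prod>j\<in>{j\<in>{..<4}. c j = v}. z - c j)"
          by (rule prod.union_disjoint) auto
        also have "(\<Prod>j\<in>{j\<in>{..<4}. c j = v}. z - c j) = (z - v)^?m" by simp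
        finally show ?thesis by (simp add: P_def)
      qed
      show "0 < ?m" using v by (auto simp: V_def card_gt_0_iff)
      fix z assume z: "P z = 0" "z \<in> ball v \<epsilon>0"
      hence "z \<in> V" using a by (auto simp: P_def V_def)
      show "z = v"
      proof (rule ccontr)
        assume "z \<noteq> v"
        from \<epsilon>0(3)[OF \<open>z \<in> V\<close> v this] z(2) \<epsilon>0(1) show False by (simp add: dist_norm norm_minus_commute)
      qed
    next
      show "finite {z \<in> ball 0 (C + 1). P z + E k z = 0}" using finZ[OF k] by (simp add: Z_def)
    qed (use finP k k\<rho> in auto)
    moreover have "{z\<in>ball v \<epsilon>0. P z + E k z = 0} = Z k \<inter> ball v \<epsilon>0"
      using subset_trans[OF ball_subset_cball cb] unfolding Z_def by blast
    ultimately show ?thesis by (simp only: simp_thms)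
  qed
  \<comment> \<open>Over each distinct root v, the indices j with \<open>c j = v\<close> are mapped
    onto the zeros near v, of which there are at most as many.\<close>
  have sel: "\<exists>g. g ` {..<4} = Z k \<and> (\<forall>j<4. g j \<in> ball (c j) \<epsilon>0)" if k: "\<bar>k\<bar> < \<delta>f \<epsilon>0" "k \<noteq> 0" for k
  proof -
    have "\<forall>v\<in>V. \<exists>g. g ` {j\<in>{..<4}. c j = v} = Z k \<inter> ball v \<epsilon>0"
      using count[OF k] finZ[OF k] by (intro ballI surjection_exists) auto
    then obtain G where G: "\<And>v. v \<in> V \<Longrightarrow> G v ` {j\<in>{..<4}. c j = v} = Z k \<inter> ball v \<epsilon>0" by metis
    define g where "g j = G (c j) j" for j
    have gj: "g j \<in> Z k \<inter> ball (c j) \<epsilon>0" if "j < 4" for j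
      using G[of "c j"] that by (force simp: g_def V_def)
    have "z \<in> g ` {..<4}" if z: "z \<in> Z k" for z
    proof -
      from near[OF k \<epsilon>0(1) z] obtain v where v: "v \<in> V" "cmod (z - v) < \<epsilon>0" by blast
      hence "z \<in> Z k \<inter> ball v \<epsilon>0" using z by (simp add: dist_norm norm_minus_commute)
      hence "z \<in> G v ` {j\<in>{..<4}. c j = v}" unfolding G[OF v(1)] .
      then obtain j where "j < 4" "c j = v" "z = G v j" by auto
      thus ?thesis by (auto simp: g_def)
    qed
    thus ?thesis using gj by blast
  qed
  then obtain g where g: "\<And>k. \<bar>k\<bar> < \<delta>f \<epsilon>0 \<Longrightarrow> k \<noteq> 0 \<Longrightarrow> g k ` {..<4} = Z k \<and> (\<forall>j<4. g k j \<in> ball (c j) \<epsilon>0)"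
    by metis
  show ?thesis
  proof (rule exI[of _ r0], intro conjI allI impI)
    show "0 < r0" by (rule r0)
    fix r assume "0 < r \<and> r \<le> r0"
    hence r: "0 < r" "r \<le> r0" by auto
    define \<delta> where "\<delta> = Min {\<delta>f \<epsilon>0, r / (C+1), r0}"
    have \<delta>: "0 < \<delta>" "\<delta> \<le> \<delta>f \<epsilon>0" "\<delta> \<le> r / (C+1)" "\<delta> \<le> r0" using \<delta>f[OF \<epsilon>0(1)] r C r0 by (auto simp: \<delta>_def)
    \<comment> \<open>\<open>g k\<close> is meaningful only for k \<noteq> 0; at k = 0 the only
      small zero is 0.\<close>
    define \<alpha> where "\<alpha> j k = (if k = 0 then 0 else of_real k * g k j)" for j k
    have sets: "{\<mu>. cmod \<mu> < r \<and> ?D \<mu> k = 0} = (\<lambda>j. \<alpha> j k) ` {..<4}" if k: "\<bar>k\<bar> < \<delta>" for k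
    proof (cases "k = 0")
      case True
      have "cmod (Rem 0 0) \<le> C5 * (cmod 0 + \<bar>0\<bar>)^5" using C5 by (intro C5(3)) auto
      hence R0: "Rem 0 0 = 0" by simp
      have "{\<mu>. cmod \<mu> < r \<and> ?D \<mu> k = 0} = {0}"
      proof (intro equalityI subsetI)
        fix \<mu> assume "\<mu> \<in> {\<mu>. cmod \<mu> < r \<and> ?D \<mu> k = 0}"
        hence "cmod \<mu> < r" "?D \<mu> k = 0" by auto
        from apriori[OF this(2)] this(1) r r0 True show "\<mu> \<in> {0}" by simp
      next
        fix \<mu> :: complex assume "\<mu> \<in> {0}"
        thus "\<mu> \<in> {\<mu>. cmod \<mu> < r \<and> ?D \<mu> k = 0}" using r R0 True by simp
      qed
      moreover have "(\<lambda>j. \<alpha> j k) ` {..<4} = {0}" using True by (auto simp: \<alpha>_def intro!: image_eqI[of _ _ 0])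
      ultimately show ?thesis by simp
    next
      case False
      have kC: "\<bar>k\<bar> * (C+1) < r"
      proof -
        have "\<bar>k\<bar> < r / (C+1)" using k \<delta> by linarith
        thus ?thesis using C by (simp add: pos_less_divide_eq)
      qed
      have "{\<mu>. cmod \<mu> < r \<and> ?D \<mu> k = 0} = (\<lambda>z. of_real k * z) ` Z k"
      proof (intro equalityI subsetI)
        fix \<mu> assume "\<mu> \<in> {\<mu>. cmod \<mu> < r \<and> ?D \<mu> k = 0}"
        hence \<mu>: "cmod \<mu> < r" "?D \<mu> k = 0" by auto
        have "cmod \<mu> < C * \<bar>k\<bar>" using apriori[OF \<mu>(2)] \<mu>(1) r k \<delta> False by auto
        define z where "z = \<mu> / of_real k"
        have z: "\<mu> = of_real k * z" using False by (simp add: z_def)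
        have "\<bar>k\<bar> * cmod z < \<bar>k\<bar> * C" using \<open>cmod \<mu> < C * \<bar>k\<bar>\<close> by (simp add: z norm_mult mult.commute)
        hence "cmod z < C" using False by (simp add: mult_less_cancel_left)
        moreover have "P z + E k z = 0" using \<mu>(2) scale[OF False, of z] False by (simp add: z)
        ultimately have "z \<in> Z k" by (simp add: Z_def)
        thus "\<mu> \<in> (\<lambda>z. of_real k * z) ` Z k" using z by blast
      next
        fix \<mu> assume "\<mu> \<in> (\<lambda>z. of_real k * z) ` Z k"
        then obtain z where z: "\<mu> = of_real k * z" "z \<in> Z k" by auto
        have "\<bar>k\<bar> * cmod z \<le> \<bar>k\<bar> * (C+1)" using z(2) by (intro mult_left_mono) (auto simp: Z_def)
        hence "\<bar>k\<bar> * cmod z < r" using kC by linarith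
        hence "cmod \<mu> < r" by (simp add: z norm_mult)
        moreover have "?D \<mu> k = 0" using scale[OF False, of z] z by (simp add: Z_def)
        ultimately show "\<mu> \<in> {\<mu>. cmod \<mu> < r \<and> ?D \<mu> k = 0}" by simp
      qed
      also have "\<dots> = (\<lambda>j. \<alpha> j k) ` {..<4}"
      proof -
        have "Z k = g k ` {..<4}" using g[of k] k \<delta> False by simp
        thus ?thesis using False by (simp add: \<alpha>_def image_image)
      qed
      finally show ?thesis .
    qed
    have lim: "((\<lambda>k. \<alpha> j k / of_real k) \<longlongrightarrow> c j) (at 0)" if j: "j < 4" for j
    proof (rule LIM_I)
      fix e :: real assume e: "0 < e"
      \<comment> \<open>Applying \<open>near\<close> with a smaller radius shows that the same
        labelled zeros converge. The root within \<epsilon> of the zero labelled j can only be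
        \<open>c j\<close>, because distinct roots are at least \<open>2 * \<epsilon>0\<close>
        apart.\<close>
      define \<epsilon> where "\<epsilon> = min e \<epsilon>0"
      have \<epsilon>: "0 < \<epsilon>" "\<epsilon> \<le> e" "\<epsilon> \<le> \<epsilon>0" using e \<epsilon>0 by (auto simp: \<epsilon>_def)
      show "\<exists>s>0. \<forall>k. k \<noteq> 0 \<and> norm (k - 0) < s \<longrightarrow> norm (\<alpha> j k / of_real k - c j) < e"
      proof (rule exI[of _ "min \<delta> (\<delta>f \<epsilon>)"], intro conjI allI impI)
        show "0 < min \<delta> (\<delta>f \<epsilon>)" using \<delta> \<delta>f \<epsilon> by simp
        fix k :: real assume "k \<noteq> 0 \<and> norm (k - 0) < min \<delta> (\<delta>f \<epsilon>)"
        hence k: "k \<noteq> 0" "\<bar>k\<bar> < \<delta>f \<epsilon>" "\<bar>k\<bar> < \<delta>f \<epsilon>0" using \<delta> by auto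
        have gZ: "g k j \<in> Z k" "g k j \<in> ball (c j) \<epsilon>0" using g[OF k(3,1)] j by auto
        from near[OF k(2,1) \<epsilon>(1) gZ(1)] obtain v where v: "v \<in> V" "cmod (g k j - v) < \<epsilon>" by blast
        have "v = c j"
        proof (rule ccontr)
          assume "v \<noteq> c j"
          hence "2 * \<epsilon>0 \<le> cmod (v - c j)" using \<epsilon>0(3) v j by (auto simp: V_def)
          also have "\<dots> \<le> cmod (g k j - v) + cmod (g k j - c j)"
            using norm_triangle_ineq4[of "g k j - c j" "g k j - v"] by (simp add: algebra_simps)
          finally show False using v(2) \<epsilon> gZ(2) by (simp add: dist_norm norm_minus_commute)
        qed
        thus "norm (\<alpha> j k / of_real k - c j) < e" using v \<epsilon> k by (simp add: \<alpha>_def)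
      qed
    qed
    show "\<exists>\<delta>>0. \<exists>\<alpha> :: nat \<Rightarrow> real \<Rightarrow> complex.
     (\<forall>k. \<bar>k\<bar> < \<delta> \<longrightarrow> {\<mu>. cmod \<mu> < r \<and> ?D \<mu> k = 0} = (\<lambda>j. \<alpha> j k) ` {..<4}) \<and>
     (\<forall>j<4. ((\<lambda>k. \<alpha> j k / of_real k) \<longlongrightarrow> c j) (at 0))"
      using \<delta>(1) sets lim by blast
  qed
qed

section \<open>Periodic solutions of the linearized equation\<close>

text \<open>The oriented integral from 0 to y, defined for both signs because the solutions live on
  the whole line. One of the two intervals is always empty or a point.\<close>

definition prim :: "(real \<Rightarrow> 'a::banach) \<Rightarrow> real \<Rightarrow> 'a" where
  "prim f y = integral {0..y} f - integral {y..0} f"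

lemma prim_0 [simp]: "prim f 0 = 0"
  by (simp add: prim_def)

lemma prim_nonneg: "0 \<le> y \<Longrightarrow> prim f y = integral {0..y} f"
  by (cases "y = 0") (simp_all add: prim_def)

lemma prim_has_vector_derivative:
  assumes f: "continuous_on UNIV f"
  shows "(prim f has_vector_derivative f y) (at y)"
proof -
  define c where "c = min y 0 - 1"
  define d where "d = max y 0 + 1"
  have cd: "c < y" "y < d" by (auto simp: c_def d_def)
  have int: "f integrable_on {a..b}" for a b
    by (rule integrable_continuous_interval[OF continuous_on_subset[OF f]]) auto
  have eq: "prim f t = integral {c..t} f - integral {c..0} f" if "t \<in> {c<..<d}" for t
  proof (cases "0 \<le> t")
    case True
    have "integral {c..0} f + integral {0..t} f = integral {c..t} f"
      by (rule Henstock_Kurzweil_Integration.integral_combine) (use True int in \<open>auto simp: c_def\<close>)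
    thus ?thesis using True by (simp add: prim_nonneg algebra_simps)
  next
    case False
    have "integral {c..t} f + integral {t..0} f = integral {c..0} f"
      by (rule Henstock_Kurzweil_Integration.integral_combine) (use False that int in auto)
    thus ?thesis using False by (simp add: prim_def algebra_simps)
  qed
  have "((\<lambda>t. integral {c..t} f) has_vector_derivative f y) (at y within {c..d})"
    by (rule integral_has_vector_derivative[OF continuous_on_subset[OF f]]) (auto simp: c_def d_def)
  from has_vector_derivative_diff[OF this has_vector_derivative_const]
  have "((\<lambda>t. integral {c..t} f - integral {c..0} f) has_vector_derivative f y) (at y within {c..d})"
    by simp
  hence "((\<lambda>t. integral {c..t} f - integral {c..0} f) has_vector_derivative f y) (at y)"
    using at_within_interior[of y "{c..d}"] cd by (simp add: interior_atLeastAtMost_real)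
  thus ?thesis
    by (rule has_vector_derivative_transform_within_open[of _ _ _ "{c<..<d}"]) (auto simp: eq, auto simp: c_def d_def)
qed

lemma eq_prim:
  assumes f: "continuous_on UNIV f" and F: "\<And>y. (F has_vector_derivative f y) (at y)"
  shows "F y = F 0 + prim f y"
proof -
  have "((\<lambda>y. F y - prim f y) has_vector_derivative 0) (at y)" for y
    using has_vector_derivative_diff[OF F prim_has_vector_derivative[OF f]] by simp
  then obtain c where "\<And>y. y \<in> UNIV \<Longrightarrow> F y - prim f y = c"
    using has_vector_derivative_zero_constant[of UNIV "\<lambda>y. F y - prim f y"] convex_UNIV by blast
  from this[of y] this[of 0] show ?thesis by (simp add: algebra_simps)
qed

lemma prim_bound:
  assumes f: "continuous_on UNIV f" and B: "\<And>y. y \<in> {0..T} \<Longrightarrow> norm (f y) \<le> B" and y: "y \<in> {0..T}"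
  shows "norm (prim f y) \<le> T * B"
proof -
  have B0: "0 \<le> B" using B[OF y] norm_ge_zero[of "f y"] by linarith
  have "norm (integral {0..y} f) \<le> B * (y - 0)"
    by (rule integral_bound) (use y B in \<open>auto intro: continuous_on_subset[OF f]\<close>)
  also have "\<dots> \<le> B * T" using y B0 by (intro mult_left_mono) auto
  finally show ?thesis using y by (simp add: prim_nonneg mult.commute)
qed

lemma prim_linear:
  fixes f g :: "real \<Rightarrow> 'a::{real_normed_field,banach}"
  assumes "continuous_on UNIV f" "continuous_on UNIV g"
  shows "prim (\<lambda>y. a * f y + b * g y) y = a * prim f y + b * prim g y"
proof -
  have "((\<lambda>y. a * prim f y + b * prim g y) has_vector_derivative a * f y + b * g y) (at y)" for y
    by (intro derivative_intros prim_has_vector_derivative assms)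
  moreover have "continuous_on UNIV (\<lambda>y. a * f y + b * g y)" by (intro continuous_intros assms)
  ultimately show ?thesis using eq_prim[of "\<lambda>y. a * f y + b * g y" "\<lambda>y. a * prim f y + b * prim g y" y] by simp
qed

lemma vector_4:
  "vec_nth (vector [a,b,c,d] :: 'a::zero ^ 4) 1 = a" "vec_nth (vector [a,b,c,d] :: 'a::zero ^ 4) 2 = b"
  "vec_nth (vector [a,b,c,d] :: 'a::zero ^ 4) 3 = c" "vec_nth (vector [a,b,c,d] :: 'a::zero ^ 4) 4 = d"
  by (simp_all add: vector_def)

text \<open>\<open>w\<close> is the standard symplectic form in the conjugate pairs (X, p) and (Z,
  q). The six hypotheses say that \<open>N\<close>, the symplectic adjoint of the matrix
  \<open>M\<close> of basis vectors, is a left inverse of \<open>M\<close>. A left inverse of a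
  square matrix is a right inverse, and the conclusions are entries of
  \<open>M ** N\<close>.\<close>

lemma symplectic_completeness:
  fixes X Z p q :: "nat \<Rightarrow> real"
  defines "w i j \<equiv> X i * p j - p i * X j + Z i * q j - q i * Z j"
  assumes "w 0 3 = 1" "w 1 2 = 1" "w 0 1 = 0" "w 0 2 = 0" "w 1 3 = 0" "w 2 3 = 0"
  shows "Z 0 * X 3 + Z 1 * X 2 - Z 2 * X 1 - Z 3 * X 0 = 0"
    and "X 0 * p 3 + X 1 * p 2 - X 2 * p 1 - X 3 * p 0 = 1"
    and "X 0 * q 3 + X 1 * q 2 - X 2 * q 1 - X 3 * q 0 = 0"
    and "Z 0 * p 3 + Z 1 * p 2 - Z 2 * p 1 - Z 3 * p 0 = 0"
    and "Z 0 * q 3 + Z 1 * q 2 - Z 2 * q 1 - Z 3 * q 0 = 1"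
proof -
  define M :: "real^4^4" where "M = vector [vector [X 0, X 1, X 2, X 3], vector [Z 0, Z 1, Z 2, Z 3],
     vector [p 0, p 1, p 2, p 3], vector [q 0, q 1, q 2, q 3]]"
  define N :: "real^4^4" where "N = vector [vector [p 3, q 3, - X 3, - Z 3], vector [p 2, q 2, - X 2, - Z 2],
     vector [- p 1, - q 1, X 1, Z 1], vector [- p 0, - q 0, X 0, Z 0]]"
  have c: "p i * X j = X j * p i" "q i * Z j = Z j * q i" for i j by simp_all
  have "N ** M = mat 1"
    using assms(2-7) unfolding w_def c
    by (simp only: vec_eq_iff forall_4 matrix_matrix_mult_def sum_4 M_def N_def vector_4 mat_def vec_lambda_beta c)
       (simp add: c, linarith?)
  hence "M ** N = mat 1" by (simp add: matrix_left_right_inverse)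
  hence *: "vec_nth (vec_nth (M ** N) i) j = (if i = j then 1 else 0)" for i j by (simp add: mat_def)
  note ex = matrix_matrix_mult_def sum_4 M_def N_def vector_4
  show "Z 0 * X 3 + Z 1 * X 2 - Z 2 * X 1 - Z 3 * X 0 = 0"
    using *[of 2 3] by (simp add: ex)
  show "X 0 * p 3 + X 1 * p 2 - X 2 * p 1 - X 3 * p 0 = 1" using *[of 1 1] by (simp add: ex)
  show "X 0 * q 3 + X 1 * q 2 - X 2 * q 1 - X 3 * q 0 = 0" using *[of 1 2] by (simp add: ex)
  show "Z 0 * p 3 + Z 1 * p 2 - Z 2 * p 1 - Z 3 * p 0 = 0" using *[of 2 1] by (simp add: ex)
  show "Z 0 * q 3 + Z 1 * q 2 - Z 2 * q 1 - Z 3 * q 0 = 1" using *[of 2 2] by (simp add: ex)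
qed

text \<open>A pair of complex functions, \<open>True\<close> selecting the \<open>R\<close>- and \<open>False\<close> the \<open>I\<close>-component.\<close>

type_synonym cfield = "bool \<Rightarrow> real \<Rightarrow> complex"

lemma ex_common_bound:
  fixes f :: "'i \<Rightarrow> real \<Rightarrow> 'a::real_normed_vector"
  assumes "finite I" "\<And>i. i \<in> I \<Longrightarrow> continuous_on UNIV (f i)"
  shows "\<exists>M\<ge>0. \<forall>i\<in>I. \<forall>y\<in>{0..T}. norm (f i y) \<le> M"
proof -
  have "\<forall>i\<in>I. \<exists>m. \<forall>y\<in>{0..T}. norm (f i y) \<le> m"
  proof
    fix i assume "i \<in> I"
    hence "compact (f i ` {0..T})"
      by (intro compact_continuous_image continuous_on_subset[OF assms(2)]) auto
    from compact_imp_bounded[OF this] show "\<exists>m. \<forall>y\<in>{0..T}. norm (f i y) \<le> m"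
      by (auto simp: bounded_iff)
  qed
  then obtain m where m: "\<And>i y. i \<in> I \<Longrightarrow> y \<in> {0..T} \<Longrightarrow> norm (f i y) \<le> m i" by metis
  have "norm (f i y) \<le> (\<Sum>i\<in>I. \<bar>m i\<bar>)" if "i \<in> I" "y \<in> {0..T}" for i y
    using m[OF that] member_le_sum[of i I "\<lambda>i. \<bar>m i\<bar>"] that assms(1) by fastforce
  thus ?thesis by (intro exI[of _ "\<Sum>i\<in>I. \<bar>m i\<bar>"]) (auto intro: sum_nonneg)
qed

lemma periodic_reduce:
  fixes T :: real
  assumes "T > 0" "\<And>y. P (y + T) \<longleftrightarrow> P y" "\<And>y. y \<in> {0..T} \<Longrightarrow> P y"
  shows "P y"
proof -
  have nat: "P (y + of_nat n * T) \<longleftrightarrow> P y" for y n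
  proof (induction n)
    case (Suc n)
    have "P (y + of_nat n * T + T) \<longleftrightarrow> P y" using assms(2) Suc by simp
    thus ?case by (simp add: algebra_simps)
  qed simp
  have int: "P (y + of_int n * T) \<longleftrightarrow> P y" for y and n :: int
    using nat[of y "nat n"] nat[of "y + of_int n * T" "nat (- n)"] by (cases "0 \<le> n") auto
  have "y - of_int \<lfloor>y / T\<rfloor> * T \<in> {0..T}"
    using floor_divide_lower[OF assms(1), of y] floor_divide_upper[OF assms(1), of y] by (auto simp: algebra_simps)
  hence "P (y + of_int (- \<lfloor>y / T\<rfloor>) * T)" using assms(3) by simp
  thus ?thesis using int by blast
qed

text \<open>
  \<open>s\<close> is \<open>S\<^sub>y\<close>, and \<open>L\<^sub>- = qm - \<partial>\<^sub>y\<^sub>y\<close>, \<open>L\<^sub>+ = qp - \<partial>\<^sub>y\<^sub>y\<close>. The solutions \<open>E i\<close> with derivatives \<open>E1 i\<close>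
  form a symplectic basis of \<open>L u = 0\<close>; \<open>h0\<close> and \<open>h1\<close> are dual to the two solvability conditions.
\<close>

locale linearized_system =
  fixes s s1 qm qp :: "real \<Rightarrow> real" and T :: real and E E1 :: "nat \<Rightarrow> bool \<Rightarrow> real \<Rightarrow> real"
    and eE eK TE TK sig :: real and h0 h1 :: cfield
  assumes Tpos: "T > 0"
    and ds: "\<And>y. (s has_real_derivative s1 y) (at y)" and sper: "\<And>y. s (y + T) = s y"
    and dE: "\<And>i b y. i < 4 \<Longrightarrow> (E i b has_real_derivative E1 i b y) (at y)"
    and dE1: "\<And>i y. i < 4 \<Longrightarrow> (E1 i True has_real_derivative qp y * E i True y + s1 y * E i False y + 2 * s y * E1 i False y) (at y)"
       "\<And>i y. i < 4 \<Longrightarrow> (E1 i False has_real_derivative qm y * E i False y - s1 y * E i True y - 2 * s y * E1 i True y) (at y)"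
    and symp: "\<And>y i j. (i,j,c) \<in> {(0,3,1),(1,2,1),(0,1,0),(0,2,0),(1,3,0),(2,3,0)} \<Longrightarrow>
        E i True y * E1 j True y - E1 i True y * E j True y + E i False y * E1 j False y - E1 i False y * E j False y
         + 2 * s y * (E i False y * E j True y - E i True y * E j False y) = c"
    and jump0: "\<And>b y. E 0 b (y + T) = E 0 b y"
    and jump1: "\<And>b y. E 1 b (y + T) = E 1 b y"
    and jump2: "\<And>b y. E 2 b (y + T) = E 2 b y + eE * E 0 b y - TE * E 1 b y"
    and jump3: "\<And>b y. E 3 b (y + T) = E 3 b y + eK * E 0 b y - TK * E 1 b y"
    and sig: "sig = TE * eK - TK * eE" "sig \<noteq> 0" and sym: "TK = - eE"
    and h: "\<And>b. continuous_on UNIV (h0 b)" "\<And>b y. h0 b (y + T) = h0 b y"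
       "\<And>b. continuous_on UNIV (h1 b)" "\<And>b y. h1 b (y + T) = h1 b y"
       "prim (\<lambda>t. of_real (E 0 False t) * h0 True t - of_real (E 0 True t) * h0 False t) T = 1"
       "prim (\<lambda>t. of_real (E 1 False t) * h0 True t - of_real (E 1 True t) * h0 False t) T = 0"
       "prim (\<lambda>t. of_real (E 0 False t) * h1 True t - of_real (E 0 True t) * h1 False t) T = 0"
       "prim (\<lambda>t. of_real (E 1 False t) * h1 True t - of_real (E 1 True t) * h1 False t) T = 1"
begin

declare One_nat_def [simp del]

definition cper :: "cfield \<Rightarrow> bool" where
  "cper g \<longleftrightarrow> (\<forall>b. continuous_on UNIV (g b)) \<and> (\<forall>b y. g b (y + T) = g b y)"

text \<open>\<open>csol u u' g\<close>: \<open>L u = g\<close> with \<open>u' = \<partial>\<^sub>y u\<close>.\<close>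

definition csol :: "cfield \<Rightarrow> cfield \<Rightarrow> cfield \<Rightarrow> bool" where
  "csol u u' g \<longleftrightarrow> (\<forall>b y. (u b has_vector_derivative u' b y) (at y)) \<and>
    (\<forall>y. (u' True has_vector_derivative of_real (qp y) * u True y + of_real (s1 y) * u False y
        + 2 * of_real (s y) * u' False y - g False y) (at y)) \<and>
    (\<forall>y. (u' False has_vector_derivative of_real (qm y) * u False y - of_real (s1 y) * u True y
        - 2 * of_real (s y) * u' True y + g True y) (at y))"

text \<open>The conserved bilinear form of L, applied to the basis solution \<open>E i\<close> and
  to u; the term with \<open>s\<close> compensates the first-order part of L. If L u = g, its
  derivative is the density \<open>dens i g\<close> (Lagrange's identity).\<close>

definition Bw :: "cfield \<Rightarrow> cfield \<Rightarrow> nat \<Rightarrow> real \<Rightarrow> complex" where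
  "Bw u u' i y = of_real (E i True y) * u' True y - of_real (E1 i True y) * u True y
     + of_real (E i False y) * u' False y - of_real (E1 i False y) * u False y
     + 2 * of_real (s y) * (of_real (E i False y) * u True y - of_real (E i True y) * u False y)"

definition dens :: "nat \<Rightarrow> cfield \<Rightarrow> real \<Rightarrow> complex" where
  "dens i g t = of_real (E i False t) * g True t - of_real (E i True t) * g False t"

definition Pg :: "nat \<Rightarrow> cfield \<Rightarrow> real \<Rightarrow> complex" where
  "Pg i g = prim (dens i g)"

text \<open>For i < 2 these are the two solvability conditions, since \<open>E 0\<close> and
  \<open>E 1\<close> are periodic. For i = 2, 3 they enter the failure of periodicity in the
  variation of constants.\<close>

definition F :: "nat \<Rightarrow> cfield \<Rightarrow> complex" where
  "F i g = Pg i g T"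

lemma contE: "i < 4 \<Longrightarrow> continuous_on UNIV (E i b)"
  by (intro continuous_at_imp_continuous_on ballI DERIV_isCont[OF dE])

lemma dens_cont: "i < 4 \<Longrightarrow> (\<And>b. continuous_on UNIV (g b)) \<Longrightarrow> continuous_on UNIV (dens i g)"
  unfolding dens_def[abs_def] by (intro continuous_intros contE)

lemma Pg_deriv: "i < 4 \<Longrightarrow> (\<And>b. continuous_on UNIV (g b)) \<Longrightarrow> (Pg i g has_vector_derivative dens i g y) (at y)"
  unfolding Pg_def by (intro prim_has_vector_derivative dens_cont)

lemma Bw_deriv:
  assumes "csol u u' g" "i < 4"
  shows "(Bw u u' i has_vector_derivative dens i g y) (at y)"
proof -
  note A = assms(1)[unfolded csol_def, THEN conjunct1, rule_format]
     assms(1)[unfolded csol_def, THEN conjunct2, THEN conjunct1, rule_format]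
     assms(1)[unfolded csol_def, THEN conjunct2, THEN conjunct2, rule_format]
  show ?thesis unfolding Bw_def[abs_def] dens_def
    apply (rule has_vector_derivative_eq_rhs)
     apply (rule derivative_intros has_vector_derivative_of_real dE[OF assms(2)] dE1[OF assms(2)] ds A)+
    apply (simp add: algebra_simps)
    done
qed

text \<open>In the momenta \<open>E1 i True y - s y * E i False y\<close> and
  \<open>E1 i False y + s y * E i True y\<close> the conserved form becomes the standard symplectic
  form, the terms with \<open>s\<close> being absorbed.\<close>

lemma completeness:
  shows "E 0 False y * E 3 True y + E 1 False y * E 2 True y - E 2 False y * E 1 True y - E 3 False y * E 0 True y = 0"
    "E 0 True y * (E1 3 True y - s y * E 3 False y) + E 1 True y * (E1 2 True y - s y * E 2 False y)
      - E 2 True y * (E1 1 True y - s y * E 1 False y) - E 3 True y * (E1 0 True y - s y * E 0 False y) = 1"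
    "E 0 True y * (E1 3 False y + s y * E 3 True y) + E 1 True y * (E1 2 False y + s y * E 2 True y)
      - E 2 True y * (E1 1 False y + s y * E 1 True y) - E 3 True y * (E1 0 False y + s y * E 0 True y) = 0"
    "E 0 False y * (E1 3 True y - s y * E 3 False y) + E 1 False y * (E1 2 True y - s y * E 2 False y)
      - E 2 False y * (E1 1 True y - s y * E 1 False y) - E 3 False y * (E1 0 True y - s y * E 0 False y) = 0"
    "E 0 False y * (E1 3 False y + s y * E 3 True y) + E 1 False y * (E1 2 False y + s y * E 2 True y)
      - E 2 False y * (E1 1 False y + s y * E 1 True y) - E 3 False y * (E1 0 False y + s y * E 0 True y) = 1"
proof -
  have *: "E i True y * (E1 j True y - s y * E j False y) - (E1 i True y - s y * E i False y) * E j True y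
      + E i False y * (E1 j False y + s y * E j True y) - (E1 i False y + s y * E i True y) * E j False y = c"
    if "(i,j,c) \<in> {(0,3,1),(1,2,1),(0,1,0),(0,2,0),(1,3,0),(2,3,0)}" for i j c
    using symp[OF that, of y] by (simp add: algebra_simps)
  note C = symplectic_completeness[of "\<lambda>i. E i True y" "\<lambda>i. E1 i True y - s y * E i False y"
      "\<lambda>i. E i False y" "\<lambda>i. E1 i False y + s y * E i True y"]
  show "E 0 False y * E 3 True y + E 1 False y * E 2 True y - E 2 False y * E 1 True y - E 3 False y * E 0 True y = 0"
    by (rule C(1); rule *) simp_all
  show "E 0 True y * (E1 3 True y - s y * E 3 False y) + E 1 True y * (E1 2 True y - s y * E 2 False y)
      - E 2 True y * (E1 1 True y - s y * E 1 False y) - E 3 True y * (E1 0 True y - s y * E 0 False y) = 1"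
    by (rule C(2); rule *) simp_all
  show "E 0 True y * (E1 3 False y + s y * E 3 True y) + E 1 True y * (E1 2 False y + s y * E 2 True y)
      - E 2 True y * (E1 1 False y + s y * E 1 True y) - E 3 True y * (E1 0 False y + s y * E 0 True y) = 0"
    by (rule C(3); rule *) simp_all
  show "E 0 False y * (E1 3 True y - s y * E 3 False y) + E 1 False y * (E1 2 True y - s y * E 2 False y)
      - E 2 False y * (E1 1 True y - s y * E 1 False y) - E 3 False y * (E1 0 True y - s y * E 0 False y) = 0"
    by (rule C(4); rule *) simp_all
  show "E 0 False y * (E1 3 False y + s y * E 3 True y) + E 1 False y * (E1 2 False y + s y * E 2 True y)
      - E 2 False y * (E1 1 False y + s y * E 1 True y) - E 3 False y * (E1 0 False y + s y * E 0 True y) = 1"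
    by (rule C(5); rule *) simp_all
qed

lemma vd_unique:
  fixes f g :: "real \<Rightarrow> complex"
  assumes "\<And>y. (f has_vector_derivative d y) (at y)" "\<And>y. (g has_vector_derivative d y) (at y)" "f 0 = g 0"
  shows "f y = g y"
proof -
  have "((\<lambda>y. f y - g y) has_vector_derivative 0) (at y)" for y
    using has_vector_derivative_diff[OF assms(1,2)] by simp
  then obtain c where "\<And>y. y \<in> UNIV \<Longrightarrow> f y - g y = c"
    using has_vector_derivative_zero_constant[of UNIV "\<lambda>y. f y - g y"] convex_UNIV by blast
  from this[of y] this[of 0] assms(3) show ?thesis by simp
qed

text \<open>\<open>eE\<close>, \<open>eK\<close>, \<open>TE\<close>, \<open>TK\<close> will be the
  derivatives of eta and T in E and kappa. After one period the solutions 2 and 3 change by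
  multiples of the periodic solutions 0 and 1; differentiating in y gives the same jumps for the
  derivatives.\<close>

lemma E1_jump:
  "E1 0 b (y + T) = E1 0 b y" "E1 1 b (y + T) = E1 1 b y"
  "E1 2 b (y + T) = E1 2 b y + eE * E1 0 b y - TE * E1 1 b y"
  "E1 3 b (y + T) = E1 3 b y + eK * E1 0 b y - TK * E1 1 b y"
proof -
  have sh: "((\<lambda>y. E i b (y + T)) has_real_derivative E1 i b (y + T)) (at y)" if "i < 4" for i
    using DERIV_shift[of "E i b" "E1 i b (y + T)" y T] dE[OF that] by blast
  have d: "(E i b has_real_derivative E1 i b y) (at y)" if "i < 4" for i by (rule dE[OF that])
  show "E1 0 b (y + T) = E1 0 b y"
    by (rule DERIV_unique[OF sh]) (use d[of 0] in \<open>simp_all add: jump0\<close>)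
  show "E1 1 b (y + T) = E1 1 b y"
    by (rule DERIV_unique[OF sh]) (use d[of 1] in \<open>simp_all add: jump1\<close>)
  show "E1 2 b (y + T) = E1 2 b y + eE * E1 0 b y - TE * E1 1 b y"
  proof (rule DERIV_unique[OF sh])
    show "((\<lambda>y. E 2 b (y + T)) has_real_derivative E1 2 b y + eE * E1 0 b y - TE * E1 1 b y) (at y)"
      unfolding jump2 by (auto intro!: derivative_eq_intros d)
  qed simp
  show "E1 3 b (y + T) = E1 3 b y + eK * E1 0 b y - TK * E1 1 b y"
  proof (rule DERIV_unique[OF sh])
    show "((\<lambda>y. E 3 b (y + T)) has_real_derivative E1 3 b y + eK * E1 0 b y - TK * E1 1 b y) (at y)"
      unfolding jump3 by (auto intro!: derivative_eq_intros d)
  qed simp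
qed

text \<open>The field with symplectic coordinates \<open>p\<close>. Inverting the symplectic basis
  pairs index i with 3 - i, which explains the reversed order and the signs.\<close>

definition V :: "(nat \<Rightarrow> bool \<Rightarrow> real \<Rightarrow> real) \<Rightarrow> (nat \<Rightarrow> real \<Rightarrow> complex) \<Rightarrow> cfield" where
  "V e p b y = - p 3 y * of_real (e 0 b y) - p 2 y * of_real (e 1 b y) + p 1 y * of_real (e 2 b y) + p 0 y * of_real (e 3 b y)"

text \<open>Plain derivatives may replace the momenta: the terms with \<open>s\<close> cancel by
  antisymmetry or by the first identity.\<close>

lemma complex_completeness:
  fixes y
  defines "e \<equiv> \<lambda>i b. complex_of_real (E i b y)" and "f \<equiv> \<lambda>i b. complex_of_real (E1 i b y)"
  shows "e 0 False * e 3 True + e 1 False * e 2 True - e 2 False * e 1 True - e 3 False * e 0 True = 0"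
    "e 0 True * f 3 True + e 1 True * f 2 True - e 2 True * f 1 True - e 3 True * f 0 True = 1"
    "e 0 True * f 3 False + e 1 True * f 2 False - e 2 True * f 1 False - e 3 True * f 0 False = 0"
    "e 0 False * f 3 True + e 1 False * f 2 True - e 2 False * f 1 True - e 3 False * f 0 True = 0"
    "e 0 False * f 3 False + e 1 False * f 2 False - e 2 False * f 1 False - e 3 False * f 0 False = 1"
proof -
  let ?c = "E 0 False y * E 3 True y + E 1 False y * E 2 True y - E 2 False y * E 1 True y - E 3 False y * E 0 True y"
  have c: "?c = 0" by (rule completeness)
  have 2: "E 0 True y * E1 3 True y + E 1 True y * E1 2 True y - E 2 True y * E1 1 True y - E 3 True y * E1 0 True y + s y * ?c = 1"
    using completeness(2)[of y] by (simp add: algebra_simps)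
  have 3: "E 0 True y * E1 3 False y + E 1 True y * E1 2 False y - E 2 True y * E1 1 False y - E 3 True y * E1 0 False y = 0"
    using completeness(3)[of y] by (simp add: algebra_simps)
  have 4: "E 0 False y * E1 3 True y + E 1 False y * E1 2 True y - E 2 False y * E1 1 True y - E 3 False y * E1 0 True y = 0"
    using completeness(4)[of y] by (simp add: algebra_simps)
  have 5: "E 0 False y * E1 3 False y + E 1 False y * E1 2 False y - E 2 False y * E1 1 False y - E 3 False y * E1 0 False y + s y * ?c = 1"
    using completeness(5)[of y] by (simp add: algebra_simps)
  note C = arg_cong[where f = complex_of_real]
  show "e 0 False * e 3 True + e 1 False * e 2 True - e 2 False * e 1 True - e 3 False * e 0 True = 0"
    using C[OF c] unfolding e_def f_def by simp
  show "e 0 True * f 3 True + e 1 True * f 2 True - e 2 True * f 1 True - e 3 True * f 0 True = 1"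
    using C[OF 2[unfolded c]] unfolding e_def f_def by simp
  show "e 0 True * f 3 False + e 1 True * f 2 False - e 2 True * f 1 False - e 3 True * f 0 False = 0"
    using C[OF 3] unfolding e_def f_def by simp
  show "e 0 False * f 3 True + e 1 False * f 2 True - e 2 False * f 1 True - e 3 False * f 0 True = 0"
    using C[OF 4] unfolding e_def f_def by simp
  show "e 0 False * f 3 False + e 1 False * f 2 False - e 2 False * f 1 False - e 3 False * f 0 False = 1"
    using C[OF 5[unfolded c]] unfolding e_def f_def by simp
qed

text \<open>Variation of constants. The completeness relations make the contribution of the varying
  coefficients vanish in u' and equal the prescribed right-hand side in u''.\<close>

lemma V_csol:
  assumes "\<And>i y. i < 4 \<Longrightarrow> (p i has_vector_derivative dens i g y) (at y)"
  shows "csol (V E p) (V E1 p) g"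
  unfolding csol_def
proof (intro conjI allI)
  fix b y
  have "(V E p b has_vector_derivative V E1 p b y + g b y *
     (of_real (E 0 False y) * of_real (E 3 True y) + of_real (E 1 False y) * of_real (E 2 True y)
       - of_real (E 2 False y) * of_real (E 1 True y) - of_real (E 3 False y) * of_real (E 0 True y))) (at y)"
    unfolding V_def[abs_def]
    apply (rule has_vector_derivative_eq_rhs)
     apply (rule derivative_intros has_vector_derivative_of_real dE assms | simp)+
    apply (cases b; simp add: V_def dens_def algebra_simps)
    done
  thus "(V E p b has_vector_derivative V E1 p b y) (at y)"
    unfolding complex_completeness by simp
next
  fix y
  have "(V E1 p True has_vector_derivative of_real (qp y) * V E p True y + of_real (s1 y) * V E p False y + 2 * of_real (s y) * V E1 p False y
      + g True y * (of_real (E 0 False y) * of_real (E1 3 True y) + of_real (E 1 False y) * of_real (E1 2 True y)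
       - of_real (E 2 False y) * of_real (E1 1 True y) - of_real (E 3 False y) * of_real (E1 0 True y))
      - g False y * (of_real (E 0 True y) * of_real (E1 3 True y) + of_real (E 1 True y) * of_real (E1 2 True y)
       - of_real (E 2 True y) * of_real (E1 1 True y) - of_real (E 3 True y) * of_real (E1 0 True y))) (at y)"
    unfolding V_def[abs_def]
    apply (rule has_vector_derivative_eq_rhs)
     apply (rule derivative_intros has_vector_derivative_of_real dE1 assms | simp)+
    apply (simp add: dens_def algebra_simps)
    done
  thus "(V E1 p True has_vector_derivative of_real (qp y) * V E p True y + of_real (s1 y) * V E p False y
        + 2 * of_real (s y) * V E1 p False y - g False y) (at y)"
    unfolding complex_completeness by simp
next
  fix y
  have "(V E1 p False has_vector_derivative of_real (qm y) * V E p False y - of_real (s1 y) * V E p True y - 2 * of_real (s y) * V E1 p True y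
      + g True y * (of_real (E 0 False y) * of_real (E1 3 False y) + of_real (E 1 False y) * of_real (E1 2 False y)
       - of_real (E 2 False y) * of_real (E1 1 False y) - of_real (E 3 False y) * of_real (E1 0 False y))
      - g False y * (of_real (E 0 True y) * of_real (E1 3 False y) + of_real (E 1 True y) * of_real (E1 2 False y)
       - of_real (E 2 True y) * of_real (E1 1 False y) - of_real (E 3 True y) * of_real (E1 0 False y))) (at y)"
    unfolding V_def[abs_def]
    apply (rule has_vector_derivative_eq_rhs)
     apply (rule derivative_intros has_vector_derivative_of_real dE1 assms | simp)+
    apply (simp add: dens_def algebra_simps)
    done
  thus "(V E1 p False has_vector_derivative of_real (qm y) * V E p False y - of_real (s1 y) * V E p True y
        - 2 * of_real (s y) * V E1 p True y + g True y) (at y)"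
    unfolding complex_completeness by simp
qed

text \<open>The coordinates of a vector in a symplectic basis are its pairings with the basis
  vectors; completeness is this resolution of the identity.\<close>

lemma reconstruct: "u b y = V E (Bw u u') b y"
proof -
  define e where "e = (\<lambda>i b. complex_of_real (E i b y))"
  define f where "f = (\<lambda>i b. complex_of_real (E1 i b y))"
  let ?C1 = "e 0 False * e 3 True + e 1 False * e 2 True - e 2 False * e 1 True - e 3 False * e 0 True"
  have V: "V E (Bw u u') b y = - Bw u u' 3 y * e 0 b - Bw u u' 2 y * e 1 b + Bw u u' 1 y * e 2 b + Bw u u' 0 y * e 3 b"
    by (simp add: V_def e_def)
  have B: "Bw u u' i y = e i True * u' True y - f i True * u True y + e i False * u' False y - f i False * u False y
     + 2 * of_real (s y) * (e i False * u True y - e i True * u False y)" for i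
    by (simp add: Bw_def e_def f_def)
  show ?thesis
  proof (cases b)
    case True
    have "V E (Bw u u') True y = u True y * (e 0 True * f 3 True + e 1 True * f 2 True - e 2 True * f 1 True - e 3 True * f 0 True)
      + u False y * (e 0 True * f 3 False + e 1 True * f 2 False - e 2 True * f 1 False - e 3 True * f 0 False)
      + (2 * of_real (s y) * u True y + u' False y) * ?C1"
      using V True unfolding B by (simp add: algebra_simps)
    thus ?thesis using True unfolding e_def f_def complex_completeness by simp
  next
    case False
    have "V E (Bw u u') False y = u True y * (e 0 False * f 3 True + e 1 False * f 2 True - e 2 False * f 1 True - e 3 False * f 0 True)
      + u False y * (e 0 False * f 3 False + e 1 False * f 2 False - e 2 False * f 1 False - e 3 False * f 0 False)
      + (2 * of_real (s y) * u False y - u' True y) * ?C1"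
      using V False unfolding B by (simp add: algebra_simps)
    thus ?thesis using False unfolding e_def f_def complex_completeness by simp
  qed
qed

lemma Bw_eq:
  assumes "csol u u' g" "i < 4" "\<And>b. continuous_on UNIV (g b)"
  shows "Bw u u' i y = Bw u u' i 0 + Pg i g y"
  unfolding Pg_def by (rule eq_prim[OF dens_cont Bw_deriv]) (use assms in auto)

lemma csol_periodic:
  assumes "csol u u' g" "cper u"
  shows "u' b (y + T) = u' b y"
proof (rule vector_derivative_unique_at)
  have d: "(u b has_vector_derivative u' b y) (at y)" for y using assms(1) by (simp add: csol_def)
  have "((\<lambda>y. y + T) has_vector_derivative 1) (at y)" by (auto intro!: derivative_eq_intros)
  from vector_diff_chain_at[OF this d] show "((\<lambda>y. u b (y + T)) has_vector_derivative u' b (y + T)) (at y)"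
    by (simp add: o_def)
  show "((\<lambda>y. u b (y + T)) has_vector_derivative u' b y) (at y)"
    using d assms(2) by (simp add: cper_def)
qed

lemma Bw_jump:
  assumes "csol u u' g" "cper u"
  shows "Bw u u' 0 (y + T) = Bw u u' 0 y" "Bw u u' 1 (y + T) = Bw u u' 1 y"
    "Bw u u' 2 (y + T) = Bw u u' 2 y + of_real eE * Bw u u' 0 y - of_real TE * Bw u u' 1 y"
    "Bw u u' 3 (y + T) = Bw u u' 3 y + of_real eK * Bw u u' 0 y - of_real TK * Bw u u' 1 y"
proof -
  note J = csol_periodic[OF assms] assms(2)[unfolded cper_def, THEN conjunct2, rule_format] sper
    jump0 jump1 jump2 jump3 E1_jump
  show "Bw u u' 0 (y + T) = Bw u u' 0 y" "Bw u u' 1 (y + T) = Bw u u' 1 y"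
    unfolding Bw_def J by simp_all
  show "Bw u u' 2 (y + T) = Bw u u' 2 y + of_real eE * Bw u u' 0 y - of_real TE * Bw u u' 1 y"
    "Bw u u' 3 (y + T) = Bw u u' 3 y + of_real eK * Bw u u' 0 y - of_real TK * Bw u u' 1 y"
    unfolding Bw_def J by (simp_all add: algebra_simps)
qed

text \<open>The pairings of a periodic u with the periodic solutions 0 and 1 return to their values
  after a period, while their increments are \<open>F 0 g\<close> and \<open>F 1 g\<close>.\<close>

lemma solvability:
  assumes "csol u u' g" "cper u" "\<And>b. continuous_on UNIV (g b)"
  shows "F 0 g = 0" "F 1 g = 0"
  using Bw_eq[OF assms(1) _ assms(3), of 0 T] Bw_eq[OF assms(1) _ assms(3), of 1 T] Bw_jump(1,2)[OF assms(1,2), of 0]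
  by (simp_all add: F_def)

text \<open>All four pairings are constant. The jumps of the pairings 2 and 3 must vanish, which is
  a linear system for the pairings 0 and 1 with determinant \<open>sig\<close> up to sign. Hence
  these two are 0, and with them the coordinates along \<open>E 2\<close> and
  \<open>E 3\<close>.\<close>

lemma homogeneous_periodic:
  assumes "csol u u' (\<lambda>_ _. 0)" "cper u"
  shows "\<exists>\<alpha> \<beta>. \<forall>b y. u b y = \<alpha> * of_real (E 0 b y) + \<beta> * of_real (E 1 b y)"
proof -
  have P: "Pg i (\<lambda>_ _. 0) y = 0" for i y by (simp add: Pg_def dens_def[abs_def] prim_def)
  have B: "Bw u u' i y = Bw u u' i 0" if "i < 4" for i y
    using Bw_eq[OF assms(1) that, of y] by (simp add: P)
  define B0 where "B0 = Bw u u' 0 0"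
  define B1 where "B1 = Bw u u' 1 0"
  have "of_real eE * B0 - of_real TE * B1 = 0" "of_real eK * B0 - of_real TK * B1 = 0"
    using Bw_jump(3,4)[OF assms, of 0] B[of 2 T] B[of 3 T] by (simp_all add: B0_def B1_def)
  hence e: "of_real eE * B0 = of_real TE * B1" "of_real eK * B0 = of_real TK * B1" by simp_all
  have "of_real sig * B0 = of_real TE * (of_real eK * B0) - of_real TK * (of_real eE * B0)"
    by (simp add: sig algebra_simps)
  also have "\<dots> = 0" unfolding e by (simp add: algebra_simps)
  finally have B0: "B0 = 0" using sig(2) by simp
  have "of_real sig * B1 = of_real eK * (of_real TE * B1) - of_real eE * (of_real TK * B1)"
    by (simp add: sig algebra_simps)
  also have "\<dots> = 0" unfolding e[symmetric] by (simp add: algebra_simps)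
  finally have B1: "B1 = 0" using sig(2) by simp
  have "u b y = - Bw u u' 3 0 * of_real (E 0 b y) + - Bw u u' 2 0 * of_real (E 1 b y)" for b y
    using reconstruct[of u b y u'] B[of 0 y] B[of 1 y] B[of 2 y] B[of 3 y] B0 B1
    by (simp add: V_def B0_def B1_def)
  thus ?thesis by blast
qed

lemma csol_lincomb:
  assumes "csol u u' g" "csol v v' k"
  shows "csol (\<lambda>b y. a * u b y + c * v b y) (\<lambda>b y. a * u' b y + c * v' b y) (\<lambda>b y. a * g b y + c * k b y)"
proof -
  note A = assms(1)[unfolded csol_def, THEN conjunct1, rule_format]
     assms(1)[unfolded csol_def, THEN conjunct2, THEN conjunct1, rule_format]
     assms(1)[unfolded csol_def, THEN conjunct2, THEN conjunct2, rule_format]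
     assms(2)[unfolded csol_def, THEN conjunct1, rule_format]
     assms(2)[unfolded csol_def, THEN conjunct2, THEN conjunct1, rule_format]
     assms(2)[unfolded csol_def, THEN conjunct2, THEN conjunct2, rule_format]
  show ?thesis unfolding csol_def
  proof (intro conjI allI)
    fix b y
    show "((\<lambda>y. a * u b y + c * v b y) has_vector_derivative a * u' b y + c * v' b y) (at y)"
      by (intro derivative_intros A)
  next
    fix y
    show "((\<lambda>y. a * u' True y + c * v' True y) has_vector_derivative of_real (qp y) * (a * u True y + c * v True y)
      + of_real (s1 y) * (a * u False y + c * v False y) + 2 * of_real (s y) * (a * u' False y + c * v' False y)
      - (a * g False y + c * k False y)) (at y)"
      apply (rule has_vector_derivative_eq_rhs)
       apply (rule derivative_intros A)+
      apply (simp add: algebra_simps)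
      done
    show "((\<lambda>y. a * u' False y + c * v' False y) has_vector_derivative of_real (qm y) * (a * u False y + c * v False y)
      - of_real (s1 y) * (a * u True y + c * v True y) - 2 * of_real (s y) * (a * u' True y + c * v' True y)
      + (a * g True y + c * k True y)) (at y)"
      apply (rule has_vector_derivative_eq_rhs)
       apply (rule derivative_intros A)+
      apply (simp add: algebra_simps)
      done
  qed
qed

lemma csol_E:
  assumes "i < 4"
  shows "csol (\<lambda>b y. of_real (E i b y)) (\<lambda>b y. of_real (E1 i b y)) (\<lambda>_ _. 0)"
  unfolding csol_def
proof (intro conjI allI)
  fix b y
  show "((\<lambda>y. complex_of_real (E i b y)) has_vector_derivative of_real (E1 i b y)) (at y)"
    by (intro has_vector_derivative_of_real dE assms)
  fix y
  show "((\<lambda>y. complex_of_real (E1 i True y)) has_vector_derivative of_real (qp y) * of_real (E i True y)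
      + of_real (s1 y) * of_real (E i False y) + 2 * of_real (s y) * of_real (E1 i False y) - 0) (at y)"
    using has_vector_derivative_of_real[OF dE1(1)[OF assms]] by simp
  show "((\<lambda>y. complex_of_real (E1 i False y)) has_vector_derivative of_real (qm y) * of_real (E i False y)
      - of_real (s1 y) * of_real (E i True y) - 2 * of_real (s y) * of_real (E1 i True y) + 0) (at y)"
    using has_vector_derivative_of_real[OF dE1(2)[OF assms]] by simp
qed

lemma F_linear:
  assumes "i < 4" "\<And>b. continuous_on UNIV (g b)" "\<And>b. continuous_on UNIV (k b)"
  shows "F i (\<lambda>b y. a * g b y + c * k b y) = a * F i g + c * F i k"
    "Pg i (\<lambda>b y. a * g b y + c * k b y) y = a * Pg i g y + c * Pg i k y"
proof -
  have "dens i (\<lambda>b y. a * g b y + c * k b y) = (\<lambda>y. a * dens i g y + c * dens i k y)"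
    by (simp add: dens_def fun_eq_iff algebra_simps)
  hence *: "Pg i (\<lambda>b y. a * g b y + c * k b y) y = a * Pg i g y + c * Pg i k y" for y
    unfolding Pg_def using prim_linear[OF dens_cont dens_cont] assms by simp
  show "Pg i (\<lambda>b y. a * g b y + c * k b y) y = a * Pg i g y + c * Pg i k y" by (rule *)
  show "F i (\<lambda>b y. a * g b y + c * k b y) = a * F i g + c * F i k" unfolding F_def by (rule *)
qed

lemma cper_lincomb: "cper g \<Longrightarrow> cper k \<Longrightarrow> cper (\<lambda>b y. a * g b y + c * k b y)"
  unfolding cper_def by (auto intro!: continuous_intros)

lemma cper_E01: "cper (\<lambda>b y. of_real (E 0 b y))" "cper (\<lambda>b y. of_real (E 1 b y))"
  unfolding cper_def by (auto intro!: continuous_intros contE simp: jump0 jump1)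

text \<open>As \<open>h0\<close> and \<open>h1\<close> are dual to \<open>F 0\<close> and
  \<open>F 1\<close>, the result satisfies both solvability conditions whatever g is. This makes
  \<open>G\<close> defined on all periodic fields.\<close>

definition Proj :: "cfield \<Rightarrow> cfield" where
  "Proj g b y = g b y - F 0 g * h0 b y - F 1 g * h1 b y"

lemma cper_h: "cper h0" "cper h1"
  using h by (simp_all add: cper_def)

lemma cper_cont: "cper g \<Longrightarrow> continuous_on UNIV (g b)"
  by (simp add: cper_def)

lemma F_h: "F 0 h0 = 1" "F 1 h0 = 0" "F 0 h1 = 0" "F 1 h1 = 1"
  using h(5-8) by (simp_all add: F_def Pg_def dens_def[abs_def])

lemma Proj_alt: "Proj g = (\<lambda>b y. 1 * (1 * g b y + (- F 0 g) * h0 b y) + (- F 1 g) * h1 b y)"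
  by (simp add: Proj_def fun_eq_iff)

lemma Proj_cper: "cper g \<Longrightarrow> cper (Proj g)"
  unfolding Proj_alt by (intro cper_lincomb cper_h)

lemma F_Proj:
  assumes "cper g" shows "F 0 (Proj g) = 0" "F 1 (Proj g) = 0"
proof -
  have *: "F i (Proj g) = F i g - F 0 g * F i h0 - F 1 g * F i h1" if "i < 4" for i
  proof -
    have k: "cper (\<lambda>b y. 1 * g b y + (- F 0 g) * h0 b y)" by (rule cper_lincomb[OF assms cper_h(1)])
    show ?thesis
      using F_linear(1)[OF that cper_cont[OF k] cper_cont[OF cper_h(2)], where a=1 and c="- F 1 g"]
        F_linear(1)[OF that cper_cont[OF assms] cper_cont[OF cper_h(1)], where a=1 and c="- F 0 g"]
      unfolding Proj_alt by simp
  qed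
  show "F 0 (Proj g) = 0" "F 1 (Proj g) = 0" using *[of 0] *[of 1] by (simp_all add: F_h)
qed

text \<open>\<open>ca\<close> and \<open>cb\<close> make the variation of constants formula periodic; this needs \<open>sig \<noteq> 0\<close>.\<close>

definition ca :: "cfield \<Rightarrow> complex" where
  "ca g = - (F 3 (Proj g) * of_real TK + F 2 (Proj g) * of_real eK) / of_real sig"
definition cb :: "cfield \<Rightarrow> complex" where
  "cb g = (of_real eE * F 2 (Proj g) + of_real TE * F 3 (Proj g)) / of_real sig"

text \<open>Variation of constants for \<open>Proj g\<close>, with multiples of the two non-periodic
  homogeneous solutions added to cancel its jump.\<close>

definition G :: "cfield \<Rightarrow> cfield" where
  "G g b y = V E (\<lambda>i. Pg i (Proj g)) b y + ca g * of_real (E 2 b y) + cb g * of_real (E 3 b y)"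
definition G' :: "cfield \<Rightarrow> cfield" where
  "G' g b y = V E1 (\<lambda>i. Pg i (Proj g)) b y + ca g * of_real (E1 2 b y) + cb g * of_real (E1 3 b y)"

lemma G_csol:
  assumes "cper g" shows "csol (G g) (G' g) (Proj g)"
proof -
  have 1: "csol (V E (\<lambda>i. Pg i (Proj g))) (V E1 (\<lambda>i. Pg i (Proj g))) (Proj g)"
    by (intro V_csol Pg_deriv cper_cont Proj_cper assms)
  have 2: "csol (\<lambda>b y. of_real (E 2 b y)) (\<lambda>b y. of_real (E1 2 b y)) (\<lambda>_ _. 0)"
    "csol (\<lambda>b y. of_real (E 3 b y)) (\<lambda>b y. of_real (E1 3 b y)) (\<lambda>_ _. 0)" by (simp_all add: csol_E)
  from csol_lincomb[OF csol_lincomb[OF 1 2(1), of 1 "ca g"] 2(2), of 1 "cb g"]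
  show ?thesis by (simp add: G_def[abs_def] G'_def[abs_def])
qed

lemma csol_cont: "csol u u' g \<Longrightarrow> continuous_on UNIV (u b)"
  unfolding csol_def by (intro continuous_at_imp_continuous_on ballI) (blast intro: has_vector_derivative_continuous)

lemma Pg_shift:
  assumes "cper g"
  shows "Pg 0 g (y + T) = Pg 0 g y + F 0 g" "Pg 1 g (y + T) = Pg 1 g y + F 1 g"
   "Pg 2 g (y + T) = Pg 2 g y + F 2 g + of_real eE * Pg 0 g y - of_real TE * Pg 1 g y"
   "Pg 3 g (y + T) = Pg 3 g y + F 3 g + of_real eK * Pg 0 g y - of_real TK * Pg 1 g y"
proof -
  have d: "(Pg i g has_vector_derivative dens i g y) (at y)" if "i < 4" for i y
    by (intro Pg_deriv that cper_cont assms)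
  have sh: "((\<lambda>y. Pg i g (y + T)) has_vector_derivative dens i g (y + T)) (at y)" if "i < 4" for i y
  proof -
    have "((\<lambda>y. y + T) has_vector_derivative 1) (at y)" by (auto intro!: derivative_eq_intros)
    from vector_diff_chain_at[OF this d[OF that]] show ?thesis by (simp add: o_def)
  qed
  have p0: "Pg i g 0 = 0" for i by (simp add: Pg_def)
  have gp: "g b (y + T) = g b y" for b y using assms by (simp add: cper_def)
  show "Pg 0 g (y + T) = Pg 0 g y + F 0 g"
  proof (rule vd_unique[OF sh])
    show "((\<lambda>y. Pg 0 g y + F 0 g) has_vector_derivative dens 0 g (y + T)) (at y)" for y
      using has_vector_derivative_add[OF d[of 0] has_vector_derivative_const] by (simp add: dens_def jump0 gp)
  qed (simp_all add: p0 F_def)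
  show "Pg 1 g (y + T) = Pg 1 g y + F 1 g"
  proof (rule vd_unique[OF sh])
    show "((\<lambda>y. Pg 1 g y + F 1 g) has_vector_derivative dens 1 g (y + T)) (at y)" for y
      using has_vector_derivative_add[OF d[of 1] has_vector_derivative_const] by (simp add: dens_def jump1 gp)
  qed (simp_all add: p0 F_def)
  show "Pg 2 g (y + T) = Pg 2 g y + F 2 g + of_real eE * Pg 0 g y - of_real TE * Pg 1 g y"
  proof (rule vd_unique[OF sh])
    show "((\<lambda>y. Pg 2 g y + F 2 g + of_real eE * Pg 0 g y - of_real TE * Pg 1 g y) has_vector_derivative dens 2 g (y + T)) (at y)" for y
      apply (rule has_vector_derivative_eq_rhs)
       apply (rule derivative_intros d | simp)+
      apply (unfold dens_def jump2 gp, simp add: algebra_simps)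
      done
  qed (simp_all add: p0 F_def)
  show "Pg 3 g (y + T) = Pg 3 g y + F 3 g + of_real eK * Pg 0 g y - of_real TK * Pg 1 g y"
  proof (rule vd_unique[OF sh])
    show "((\<lambda>y. Pg 3 g y + F 3 g + of_real eK * Pg 0 g y - of_real TK * Pg 1 g y) has_vector_derivative dens 3 g (y + T)) (at y)" for y
      apply (rule has_vector_derivative_eq_rhs)
       apply (rule derivative_intros d | simp)+
      apply (unfold dens_def jump3 gp, simp add: algebra_simps)
      done
  qed (simp_all add: p0 F_def)
qed

text \<open>Cramer's rule: these are the two equations that periodicity imposes on the coefficients,
  and their determinant is \<open>sig\<close>.\<close>

lemma ca_cb:
  "F 3 (Proj g) = ca g * of_real eE + cb g * of_real eK"
  "- F 2 (Proj g) = ca g * of_real TE + cb g * of_real TK"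
proof -
  have s1: "complex_of_real sig = of_real TE * of_real eK - of_real TK * of_real eE" by (simp add: sig(1))
  have s2: "complex_of_real sig \<noteq> 0" using sig(2) by simp
  note s = s1 s2
  have "(ca g * of_real eE + cb g * of_real eK) * of_real sig = F 3 (Proj g) * (of_real TE * of_real eK - of_real TK * of_real eE)"
    unfolding ca_def cb_def using s(2) by (simp add: field_simps)
  thus "F 3 (Proj g) = ca g * of_real eE + cb g * of_real eK" using s by simp
  have "(ca g * of_real TE + cb g * of_real TK) * of_real sig = - F 2 (Proj g) * (of_real TE * of_real eK - of_real TK * of_real eE)"
    unfolding ca_def cb_def using s(2) by (simp add: field_simps)
  thus "- F 2 (Proj g) = ca g * of_real TE + cb g * of_real TK" using s by (metis mult_cancel_right)
qed

lemma G_cper: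
  assumes "cper g" shows "cper (G g)"
proof -
  have "G g b (y + T) = G g b y" for b y
  proof -
    note S = Pg_shift[OF Proj_cper[OF assms], unfolded F_Proj[OF assms]]
    define p where "p i = Pg i (Proj g) y" for i
    define e where "e i = complex_of_real (E i b y)" for i :: nat
    have TK: "complex_of_real TK = - of_real eE" using sym by simp
    have F2: "F 2 (Proj g) = - (ca g * of_real TE + cb g * of_real TK)" using ca_cb(2)[of g] by (metis minus_minus)
    have "G g b (y + T) = - (p 3 + F 3 (Proj g) + of_real eK * p 0 - of_real TK * p 1) * e 0
      - (p 2 + F 2 (Proj g) + of_real eE * p 0 - of_real TE * p 1) * e 1
      + p 1 * (e 2 + of_real eE * e 0 - of_real TE * e 1) + p 0 * (e 3 + of_real eK * e 0 - of_real TK * e 1)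
      + ca g * (e 2 + of_real eE * e 0 - of_real TE * e 1) + cb g * (e 3 + of_real eK * e 0 - of_real TK * e 1)"
      unfolding G_def V_def S jump0 jump1 jump2 jump3 p_def e_def by simp
    \<comment> \<open>The terms with \<open>F 2\<close> and \<open>F 3\<close> cancel by the choice
      of \<open>ca\<close> and \<open>cb\<close>. The mixed terms in \<open>p 0\<close> and
      \<open>p 1\<close> cancel because TK = - eE, that is, by the reciprocity relation between T
      and eta.\<close>
    also have "\<dots> = - p 3 * e 0 - p 2 * e 1 + p 1 * e 2 + p 0 * e 3 + ca g * e 2 + cb g * e 3"
      unfolding ca_cb(1) F2 TK by (simp add: algebra_simps)
    also have "\<dots> = G g b y" unfolding G_def V_def p_def e_def by simp
    finally show ?thesis .
  qed
  thus ?thesis unfolding cper_def using csol_cont[OF G_csol[OF assms]] by blast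
qed

lemma G_linear:
  assumes "cper g" "cper k"
  shows "G (\<lambda>b y. a * g b y + c * k b y) b y = a * G g b y + c * G k b y"
proof -
  have Pj: "Proj (\<lambda>b y. a * g b y + c * k b y) = (\<lambda>b y. a * Proj g b y + c * Proj k b y)"
    using assms by (simp add: Proj_def fun_eq_iff F_linear cper_cont algebra_simps)
  have P: "Pg i (Proj (\<lambda>b y. a * g b y + c * k b y)) y = a * Pg i (Proj g) y + c * Pg i (Proj k) y" if "i < 4" for i y
    unfolding Pj using that assms by (intro F_linear cper_cont Proj_cper)
  have FF: "F i (Proj (\<lambda>b y. a * g b y + c * k b y)) = a * F i (Proj g) + c * F i (Proj k)" if "i < 4" for i
    unfolding Pj using that assms by (intro F_linear cper_cont Proj_cper)
  show ?thesis unfolding G_def V_def ca_def cb_def using P FF sig(2) by (simp add: field_simps)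
qed

text \<open>All integrals run over one period, and periodicity extends the pointwise bound to the
  line. The constant is a sum of the separate bounds, so that it serves both \<open>G\<close> and
  \<open>F\<close>.\<close>

lemma bounded_ops:
  obtains C where "1 \<le> C"
    "\<And>g B b y. cper g \<Longrightarrow> (\<And>b y. cmod (g b y) \<le> B) \<Longrightarrow> cmod (G g b y) \<le> C * B"
    "\<And>g B i. cper g \<Longrightarrow> (\<And>b y. cmod (g b y) \<le> B) \<Longrightarrow> i < 4 \<Longrightarrow> cmod (F i g) \<le> C * B"
proof -
  obtain M where M: "M \<ge> 0" "\<And>i b y. i < 4 \<Longrightarrow> y \<in> {0..T} \<Longrightarrow> \<bar>E i b y\<bar> \<le> M"
    using ex_common_bound[of "{..<4} \<times> UNIV" "\<lambda>(i,b). E i b" T] contE by fastforce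
  obtain H0 where H0: "H0 \<ge> 0" "\<And>b y. y \<in> {0..T} \<Longrightarrow> cmod (h0 b y) \<le> H0"
    using ex_common_bound[of UNIV h0 T] h(1) by auto
  obtain H1 where H1: "H1 \<ge> 0" "\<And>b y. y \<in> {0..T} \<Longrightarrow> cmod (h1 b y) \<le> H1"
    using ex_common_bound[of UNIV h1 T] h(3) by auto
  define c1 where "c1 = T * (2 * M)"
  have c1: "0 \<le> c1" using Tpos M by (simp add: c1_def)
  have Pb: "cmod (Pg i g y) \<le> c1 * B" if "cper g" "\<And>b y. y \<in> {0..T} \<Longrightarrow> cmod (g b y) \<le> B" "i < 4" "y \<in> {0..T}" for g B i y
  proof -
    have "cmod (Pg i g y) \<le> T * (2 * M * B)" unfolding Pg_def
    proof (rule prim_bound[OF dens_cont[OF that(3) cper_cont[OF that(1)]] _ that(4)])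
      fix y assume y: "y \<in> {0..T}"
      have "cmod (dens i g y) \<le> \<bar>E i False y\<bar> * cmod (g True y) + \<bar>E i True y\<bar> * cmod (g False y)"
        unfolding dens_def using norm_triangle_ineq4[of "of_real (E i False y) * g True y" "of_real (E i True y) * g False y"]
        by (simp add: norm_mult)
      also have "\<dots> \<le> M * B + M * B"
        using y that M by (intro add_mono mult_mono) auto
      finally show "cmod (dens i g y) \<le> 2 * M * B" by (simp add: mult_ac)
    qed
    thus ?thesis by (simp add: c1_def mult_ac)
  qed
  define c2 where "c2 = 1 + c1 * H0 + c1 * H1"
  have c2: "0 \<le> c2" using c1 H0 H1 by (simp add: c2_def)
  define c3 where "c3 = c1 * c2"
  have c3: "0 \<le> c3" using c1 c2 by (simp add: c3_def)
  define c4 where "c4 = (\<bar>TK\<bar> + \<bar>eK\<bar>) * c3 / \<bar>sig\<bar>"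
  define c5 where "c5 = (\<bar>eE\<bar> + \<bar>TE\<bar>) * c3 / \<bar>sig\<bar>"
  define C where "C = 1 + c1 + 4 * (c3 * M) + c4 * M + c5 * M"
  have c45: "0 \<le> c4" "0 \<le> c5" using c3 by (simp_all add: c4_def c5_def)
  have Fb: "cmod (F i g) \<le> c1 * B" if "cper g" "\<And>b y. cmod (g b y) \<le> B" "i < 4" for g B i
    unfolding F_def using that Tpos by (intro Pb) auto
  have Gb: "cmod (G g b y) \<le> C * B" if g: "cper g" and B: "\<And>b y. cmod (g b y) \<le> B" for g B b y
  proof -
    have B0: "0 \<le> B" using order_trans[OF norm_ge_zero B[of True 0]] .
    have Pib: "cmod (Proj g b y) \<le> c2 * B" if y: "y \<in> {0..T}" for b y
    proof -
      have "cmod (Proj g b y) \<le> cmod (g b y) + cmod (F 0 g * h0 b y) + cmod (F 1 g * h1 b y)"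
        unfolding Proj_def by (meson norm_triangle_ineq4 norm_triangle_le_diff order_trans add_right_mono)
      also have "\<dots> \<le> B + (c1 * B) * H0 + (c1 * B) * H1"
        unfolding norm_mult using Fb[OF g B] H0 H1 y B c1 B0 by (intro add_mono mult_mono) auto
      finally show ?thesis by (simp add: c2_def algebra_simps)
    qed
    have P3: "cmod (Pg i (Proj g) y) \<le> c3 * B" if "i < 4" "y \<in> {0..T}" for i y
      using Pb[OF Proj_cper[OF g] Pib that] by (simp add: c3_def mult_ac)
    hence F3: "cmod (F i (Proj g)) \<le> c3 * B" if "i < 4" for i unfolding F_def using that Tpos by auto
    have ca: "cmod (ca g) \<le> c4 * B"
    proof -
      have "cmod (F 3 (Proj g) * of_real TK + F 2 (Proj g) * of_real eK) \<le> (c3 * B) * \<bar>TK\<bar> + (c3 * B) * \<bar>eK\<bar>"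
        by (rule order_trans[OF norm_triangle_ineq])
           (unfold norm_mult norm_of_real, use F3[of 2] F3[of 3] in \<open>auto intro!: add_mono mult_right_mono\<close>)
      hence "cmod (ca g) \<le> ((c3 * B) * \<bar>TK\<bar> + (c3 * B) * \<bar>eK\<bar>) / \<bar>sig\<bar>"
        unfolding ca_def norm_divide norm_minus_cancel norm_of_real by (rule divide_right_mono) simp
      thus ?thesis by (simp add: c4_def algebra_simps)
    qed
    have cb: "cmod (cb g) \<le> c5 * B"
    proof -
      have "cmod (of_real eE * F 2 (Proj g) + of_real TE * F 3 (Proj g)) \<le> \<bar>eE\<bar> * (c3 * B) + \<bar>TE\<bar> * (c3 * B)"
        by (rule order_trans[OF norm_triangle_ineq])
           (unfold norm_mult norm_of_real, use F3[of 2] F3[of 3] in \<open>auto intro!: add_mono mult_left_mono\<close>)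
      hence "cmod (cb g) \<le> (\<bar>eE\<bar> * (c3 * B) + \<bar>TE\<bar> * (c3 * B)) / \<bar>sig\<bar>"
        unfolding cb_def norm_divide norm_minus_cancel norm_of_real by (rule divide_right_mono) simp
      thus ?thesis by (simp add: c5_def algebra_simps)
    qed
    show ?thesis
    proof (rule periodic_reduce[OF Tpos, of "\<lambda>y. cmod (G g b y) \<le> C * B"])
      show "(cmod (G g b (y + T)) \<le> C * B) = (cmod (G g b y) \<le> C * B)" for y
        using G_cper[OF g] by (simp add: cper_def)
      fix y assume y: "y \<in> {0..T}"
      have t: "cmod (Pg i (Proj g) y * of_real (E j b y)) \<le> (c3 * B) * M" if "i < 4" "j < 4" for i j
        unfolding norm_mult norm_of_real using P3[OF that(1) y] M(2)[OF that(2) y] c3 B0 by (intro mult_mono) auto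
      have t2: "cmod (ca g * of_real (E 2 b y)) \<le> (c4 * B) * M" "cmod (cb g * of_real (E 3 b y)) \<le> (c5 * B) * M"
        unfolding norm_mult norm_of_real using ca cb M(2)[OF _ y] c45 B0 by (auto intro!: mult_mono)
      have "cmod (G g b y) \<le> (c3 * B) * M + (c3 * B) * M + (c3 * B) * M + (c3 * B) * M + (c4 * B) * M + (c5 * B) * M"
        unfolding G_def V_def
        by (intro norm_triangle_le[OF add_mono] norm_triangle_le_diff[OF add_mono]) (use t t2 in simp_all)
      also have "\<dots> \<le> C * B" using c1 B0 by (simp add: C_def algebra_simps)
      finally show "cmod (G g b y) \<le> C * B" .
    qed
  qed
  have Fb': "cmod (F i g) \<le> C * B" if "cper g" "\<And>b y. cmod (g b y) \<le> B" "i < 4" for g B i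
  proof -
    have B0: "0 \<le> B" using order_trans[OF norm_ge_zero that(2)[of True 0]] .
    have "c1 \<le> C" using c1 c3 c45 M by (simp add: C_def)
    hence "c1 * B \<le> C * B" using B0 by (rule mult_right_mono)
    thus ?thesis using Fb[OF that] by linarith
  qed
  have "1 \<le> C" using c1 c3 c45 M by (simp add: C_def)
  thus ?thesis using that Gb Fb' by blast
qed

end

section \<open>The Neumann series as a double power series\<close>

lemma has_sum_diff_complex:
  fixes f g :: "'a \<Rightarrow> complex"
  assumes "(f has_sum a) A" "(g has_sum b) A"
  shows "((\<lambda>x. f x - g x) has_sum (a - b)) A"
  using has_sum_add[OF assms(1) has_sum_cmult_right[OF assms(2), of "-1"]] by simp

lemma double_series_tail:
  assumes r: "0 < r" and s: "(\<lambda>(j,l). norm (c j l) * r^j * r^l) summable_on UNIV"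
    and f: "\<And>\<mu> k. cmod \<mu> < r \<Longrightarrow> \<bar>k\<bar> < r \<Longrightarrow> ((\<lambda>(j,l). c j l * \<mu>^j * of_real k^l) has_sum f \<mu> k) UNIV"
  shows "double_series n (\<lambda>\<mu> k. f \<mu> k - (\<Sum>(j,l)\<in>{(j,l). j + l < n}. c j l * \<mu>^j * of_real k^l))"
proof -
  let ?A = "{(j,l). j + l < n} :: (nat \<times> nat) set"
  have finA: "finite ?A"
    by (rule finite_subset[of _ "{..n} \<times> {..n}"]) auto
  define d where "d j l = (if j + l < n then 0 else c j l)" for j l
  show ?thesis unfolding double_series_def
  proof (rule exI[of _ d], rule exI[of _ r], intro conjI allI impI)
    show "(\<lambda>(j,l). norm (d j l) * r^j * r^l) summable_on UNIV"
      by (rule summable_on_comparison_double[OF s]) (use r in \<open>simp_all add: d_def\<close>)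
    fix \<mu> k assume "cmod \<mu> < r \<and> \<bar>k\<bar> < r"
    hence hs: "((\<lambda>(j,l). c j l * \<mu>^j * of_real k^l) has_sum f \<mu> k) UNIV" using f by simp
    have "((\<lambda>(j,l). if j + l < n then c j l * \<mu>^j * of_real k^l else 0) has_sum
        (\<Sum>(j,l)\<in>?A. c j l * \<mu>^j * of_real k^l)) UNIV"
    proof (rule has_sum_finite_neutralI[OF finA])
      show "(\<lambda>(j,l). if j + l < n then c j l * \<mu>^j * of_real k^l else 0) x = 0" if "x \<in> UNIV - ?A" for x
        using that by (cases x) simp
      show "(\<Sum>(j,l)\<in>?A. c j l * \<mu>^j * of_real k^l) = (\<Sum>x\<in>?A. (\<lambda>(j,l). if j + l < n then c j l * \<mu>^j * of_real k^l else 0) x)"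
        by (rule sum.cong) auto
    qed simp
    from has_sum_diff_complex[OF hs this]
    have "((\<lambda>x. (\<lambda>(j,l). c j l * \<mu>^j * of_real k^l) x - (\<lambda>(j,l). if j + l < n then c j l * \<mu>^j * of_real k^l else 0) x)
       has_sum f \<mu> k - (\<Sum>(j,l)\<in>?A. c j l * \<mu>^j * of_real k^l)) UNIV" .
    moreover have "(\<lambda>x. (\<lambda>(j,l). c j l * \<mu>^j * of_real k^l) x - (\<lambda>(j,l). if j + l < n then c j l * \<mu>^j * of_real k^l else 0) x)
      = (\<lambda>(j,l). d j l * \<mu>^j * of_real k^l)" by (auto simp: fun_eq_iff d_def)
    ultimately show "((\<lambda>(j,l). d j l * \<mu>^j * of_real k^l) has_sum f \<mu> k - (\<Sum>(j,l)\<in>?A. c j l * \<mu>^j * of_real k^l)) UNIV"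
      by simp
  qed (use r in \<open>simp_all add: d_def\<close>)
qed

lemma geometric_double_summable:
  "(\<lambda>(j,l). B * (1/2)^j * (1/2)^l :: real) summable_on (UNIV :: (nat \<times> nat) set)"
proof -
  have g: "(\<lambda>l. (1/2)^l :: real) summable_on (UNIV :: nat set)"
    by (rule norm_summable_imp_summable_on) (simp add: summable_geometric power_abs)
  have "(\<lambda>x. norm ((\<lambda>(j,l). (1/2)^j * (1/2)^l :: real) x)) summable_on (UNIV \<times> UNIV :: (nat \<times> nat) set)"
  proof (intro Infinite_Sum.abs_summable_on_Sigma_iff[THEN iffD2] conjI ballI)
    show "(\<lambda>l. norm ((\<lambda>(j,l). (1/2)^j * (1/2)^l :: real) (j,l))) summable_on UNIV" for j :: nat
      using summable_on_cmult_right[OF g, of "(1/2)^j"] by (simp add: power_abs abs_mult)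
    have "(\<lambda>j. norm (infsum (\<lambda>l. norm ((\<lambda>(j,l). (1/2)^j * (1/2)^l :: real) (j,l))) UNIV)) =
        (\<lambda>j::nat. (1/2)^j * infsum (\<lambda>l::nat. (1/2)^l :: real) UNIV)"
      by (simp add: fun_eq_iff abs_mult power_abs infsum_cmult_right' infsum_nonneg)
    thus "(\<lambda>j. norm (infsum (\<lambda>l. norm ((\<lambda>(j,l). (1/2)^j * (1/2)^l :: real) (j,l))) UNIV)) summable_on (UNIV :: nat set)"
      using summable_on_cmult_left[OF g] by simp
  qed
  hence "(\<lambda>(j,l). (1/2)^j * (1/2)^l :: real) summable_on (UNIV :: (nat \<times> nat) set)"
    by (simp add: abs_summable_summable)
  from summable_on_cmult_right[OF this, of B] show ?thesis by (simp add: case_prod_unfold mult.assoc)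
qed

context linearized_system
begin

definition Jf :: "cfield \<Rightarrow> cfield" where
  "Jf g b y = (if b then - g False y else g True y)"

lemma Jf_cper: "cper g \<Longrightarrow> cper (Jf g)"
proof -
  assume "cper g"
  hence "continuous_on UNIV (Jf g b)" for b
    by (cases b) (auto simp: Jf_def[abs_def] cper_def intro!: continuous_intros)
  thus ?thesis using \<open>cper g\<close> by (simp add: cper_def Jf_def)
qed

lemma Jf_bound: "(\<And>b y. cmod (g b y) \<le> B) \<Longrightarrow> cmod (Jf g b y) \<le> B"
  by (simp add: Jf_def)

lemma Jf_linear: "Jf (\<lambda>b y. a * g b y + c * k b y) = (\<lambda>b y. a * Jf g b y + c * Jf k b y)"
  by (simp add: Jf_def fun_eq_iff)

text \<open>The coefficient of \<open>\<mu>\<^sup>j k\<^sup>l\<close> in \<open>(1 - G \<Theta>)\<^sup>-\<^sup>1 w\<close>.\<close>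

fun Uc :: "complex \<Rightarrow> cfield \<Rightarrow> nat \<Rightarrow> nat \<Rightarrow> cfield" where
  "Uc sg w j l = (\<lambda>b y. (if j = 0 \<and> l = 0 then w b y else 0)
     + (if j = 0 then 0 else G (Uc sg w (j - 1) l) b y)
     - (if l < 2 then 0 else sg * G (Jf (Uc sg w j (l - 2))) b y))"

declare Uc.simps [simp del]

lemma cper_0: "cper (\<lambda>_ _. 0)"
  by (simp add: cper_def)

lemma Uc_cper:
  assumes "cper w" shows "cper (Uc sg w j l)"
  using assms
proof (induction sg w j l rule: Uc.induct)
  case (1 sg w j l)
  have A: "cper (\<lambda>b y. if j = 0 \<and> l = 0 then w b y else 0)" using 1(3) cper_0 by (cases "j = 0 \<and> l = 0") auto
  have B: "cper (\<lambda>b y. if j = 0 then 0 else G (Uc sg w (j - 1) l) b y)"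
    using G_cper[OF 1(1)] 1(3) cper_0 by (cases "j = 0") auto
  have C: "cper (\<lambda>b y. if l < 2 then 0 else sg * G (Jf (Uc sg w j (l - 2))) b y)"
    using cper_lincomb[OF G_cper[OF Jf_cper[OF 1(2)]] cper_0, of sg 0] 1(3) cper_0 by (cases "l < 2") auto
  show ?case unfolding Uc.simps[of sg w j l]
    using cper_lincomb[OF cper_lincomb[OF A B, of 1 1] C, of 1 "-1"] by simp
qed

text \<open>Boundedness is in the sup norm. Both the functionals \<open>F i\<close> and the point
  evaluations of \<open>G\<close> are of this kind, so one statement on termwise application covers
  the fixed point equation and the matrix entries.\<close>

definition blin :: "real \<Rightarrow> (cfield \<Rightarrow> complex) \<Rightarrow> bool" where
  "blin C \<Lambda> \<longleftrightarrow> (\<forall>g k a c. cper g \<longrightarrow> cper k \<longrightarrow> \<Lambda> (\<lambda>b y. a * g b y + c * k b y) = a * \<Lambda> g + c * \<Lambda> k) \<and>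
     (\<forall>g B. cper g \<longrightarrow> (\<forall>b y. cmod (g b y) \<le> B) \<longrightarrow> cmod (\<Lambda> g) \<le> C * B)"

definition opC :: real where
  "opC = (SOME C. 1 \<le> C \<and> (\<forall>b y. blin C (\<lambda>g. G g b y)) \<and> (\<forall>i<4. blin C (F i)))"

lemma opC: "1 \<le> opC" "blin opC (\<lambda>g. G g b y)" "i < 4 \<Longrightarrow> blin opC (F i)"
proof -
  obtain C where "1 \<le> C"
    "\<And>g B b y. cper g \<Longrightarrow> (\<And>b y. cmod (g b y) \<le> B) \<Longrightarrow> cmod (G g b y) \<le> C * B"
    "\<And>g B i. cper g \<Longrightarrow> (\<And>b y. cmod (g b y) \<le> B) \<Longrightarrow> i < 4 \<Longrightarrow> cmod (F i g) \<le> C * B"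
    using bounded_ops by blast
  hence "1 \<le> C \<and> (\<forall>b y. blin C (\<lambda>g. G g b y)) \<and> (\<forall>i<4. blin C (F i))"
    unfolding blin_def by (simp add: G_linear F_linear cper_cont)
  hence "1 \<le> opC \<and> (\<forall>b y. blin opC (\<lambda>g. G g b y)) \<and> (\<forall>i<4. blin opC (F i))"
    unfolding opC_def by (rule someI)
  thus "1 \<le> opC" "blin opC (\<lambda>g. G g b y)" "i < 4 \<Longrightarrow> blin opC (F i)" by auto
qed

lemma blin_Jf: "blin C \<Lambda> \<Longrightarrow> blin C (\<lambda>g. \<Lambda> (Jf g))"
  unfolding blin_def Jf_linear using Jf_cper Jf_bound by blast

lemma G_bound: "cper g \<Longrightarrow> (\<And>b y. cmod (g b y) \<le> B) \<Longrightarrow> cmod (G g b y) \<le> opC * B"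
  using opC(2) unfolding blin_def by blast

text \<open>The recursion has two terms, and each is at most half of the claimed bound; this is why
  the growth rate is twice the operator bound.\<close>

lemma Uc_bound:
  assumes "cper w" "\<And>b y. cmod (w b y) \<le> B" "cmod sg \<le> 1"
  shows "cmod (Uc sg w j l b y) \<le> B * (2 * opC)^(j + l)"
  using assms
proof (induction sg w j l arbitrary: b y rule: Uc.induct)
  case (1 sg w j l)
  have B0: "0 \<le> B" using order_trans[OF norm_ge_zero 1(4)[of True 0]] .
  let ?q = "B * (2 * opC)^(j + l)"
  have q0: "0 \<le> ?q" using B0 opC(1) by simp
  show ?case
  proof (cases "j = 0 \<and> l = 0")
    case True
    thus ?thesis using 1(4)[of b y] by (simp add: Uc.simps[of sg w 0 0])
  next
    case False
    have b1: "cmod (if j = 0 then 0 else G (Uc sg w (j - 1) l) b y) \<le> ?q / 2"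
    proof (cases "j = 0")
      case False
      then obtain m where m: "j = Suc m" by (cases j) auto
      have "cmod (G (Uc sg w (j - 1) l) b y) \<le> opC * (B * (2 * opC)^(j - 1 + l))"
        by (rule G_bound[OF Uc_cper[OF 1(3)] 1(1)[OF False 1(3,4,5)]])
      thus ?thesis by (simp add: m mult_ac)
    qed (use q0 in simp)
    have b2: "cmod (if l < 2 then 0 else sg * G (Jf (Uc sg w j (l - 2))) b y) \<le> ?q / 2"
    proof (cases "l < 2")
      case False
      then obtain m where m: "l = Suc (Suc m)" by (metis Suc_1 add_2_eq_Suc le_Suc_ex not_less)
      have "cmod (G (Jf (Uc sg w j (l - 2))) b y) \<le> opC * (B * (2 * opC)^(j + (l - 2)))"
        by (rule G_bound[OF Jf_cper[OF Uc_cper[OF 1(3)]] Jf_bound[OF 1(2)[OF False 1(3,4,5)]]])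
      hence "cmod (sg * G (Jf (Uc sg w j (l - 2))) b y) \<le> 1 * (opC * (B * (2 * opC)^(j + (l - 2))))"
        unfolding norm_mult using 1(5) by (intro mult_mono) auto
      \<comment> \<open>The step in k lowers \<open>l\<close> by 2 but applies \<open>G\<close> only
        once; the spare factor \<open>2 * opC\<close> is at least 1.\<close>
      also have "\<dots> \<le> opC * (B * (2 * opC)^(j + m)) * (2 * opC)"
      proof -
        have "0 \<le> opC * (B * (2 * opC)^(j + m))" using B0 opC(1) by simp
        moreover have "1 \<le> 2 * opC" using opC(1) by simp
        ultimately show ?thesis using mult_left_mono[of 1 "2 * opC" "opC * (B * (2 * opC)^(j + m))"] by (simp add: m)
      qed
      also have "\<dots> = ?q / 2" by (simp add: m mult_ac)
      finally show ?thesis using False by simp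
    qed (use q0 in simp)
    show ?thesis unfolding Uc.simps[of sg w j l] using False b1 b2
      by (simp only: if_False add_0_left) (rule order_trans[OF norm_triangle_ineq4], linarith)
  qed
qed

text \<open>The Neumann series for u = w + G \<Theta> u, regrouped by powers of mu and k.\<close>

definition us :: "complex \<Rightarrow> cfield \<Rightarrow> complex \<Rightarrow> real \<Rightarrow> cfield" where
  "us sg w \<mu> k b y = (\<Sum>\<^sub>\<infinity>(j,l). \<mu>^j * of_real k^l * Uc sg w j l b y)"

lemma cper_bounded:
  assumes "cper g" obtains B where "\<And>b y. cmod (g b y) \<le> B"
proof -
  obtain H where "\<forall>b\<in>UNIV. \<forall>y\<in>{0..T}. cmod (g b y) \<le> H"
    using ex_common_bound[of UNIV g T] cper_cont[OF assms] by (metis finite)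
  hence H: "\<And>b y. y \<in> {0..T} \<Longrightarrow> cmod (g b y) \<le> H" by blast
  have "cmod (g b y) \<le> H" for b y
    by (rule periodic_reduce[OF Tpos, of "\<lambda>y. cmod (g b y) \<le> H"]) (use H assms in \<open>auto simp: cper_def\<close>)
  thus ?thesis using that by blast
qed

text \<open>In the radius 1 / (4 opC), one factor 2 offsets the growth rate 2 opC of the
  coefficients and the other leaves a geometric series with ratio 1/2.\<close>

lemma small_params:
  assumes "cmod \<mu> \<le> 1 / (4 * opC)" "\<bar>k\<bar> \<le> 1 / (4 * opC)"
  shows "cmod \<mu>^j * \<bar>k\<bar>^l * (2 * opC)^(j + l) \<le> (1/2)^j * (1/2)^l"
proof -
  have o: "0 < opC" using opC(1) by simp
  have "cmod \<mu> * (2 * opC) \<le> 1 / (4 * opC) * (2 * opC)" using assms(1) o by (intro mult_right_mono) auto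
  hence 1: "cmod \<mu> * (2 * opC) \<le> 1/2" using o by simp
  have "\<bar>k\<bar> * (2 * opC) \<le> 1 / (4 * opC) * (2 * opC)" using assms(2) o by (intro mult_right_mono) auto
  hence 2: "\<bar>k\<bar> * (2 * opC) \<le> 1/2" using o by simp
  have "cmod \<mu>^j * \<bar>k\<bar>^l * (2 * opC)^(j + l) = (cmod \<mu> * (2 * opC))^j * (\<bar>k\<bar> * (2 * opC))^l"
    by (simp add: power_mult_distrib power_add)
  also have "\<dots> \<le> (1/2)^j * (1/2)^l" using 1 2 o by (intro mult_mono power_mono) auto
  finally show ?thesis .
qed

context
  fixes sg :: complex and w :: cfield and B :: real
  assumes w: "cper w" "\<And>b y. cmod (w b y) \<le> B" and sg: "cmod sg \<le> 1"
begin

lemma B0: "0 \<le> B"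
  using order_trans[OF norm_ge_zero w(2)[of True 0]] .

context
  fixes \<mu> :: complex and k :: real
  assumes mk: "cmod \<mu> \<le> 1 / (4 * opC)" "\<bar>k\<bar> \<le> 1 / (4 * opC)"
begin

lemma us_term_bound:
  "cmod ((\<lambda>(j,l). \<mu>^j * of_real k^l * Uc sg w j l b y) x) \<le> (\<lambda>(j,l). B * (1/2)^j * (1/2)^l) x"
proof (cases x)
  case (Pair j l)
  have "cmod (\<mu>^j * of_real k^l * Uc sg w j l b y) \<le> cmod \<mu>^j * \<bar>k\<bar>^l * (B * (2 * opC)^(j + l))"
    unfolding norm_mult norm_power norm_of_real
    by (intro mult_left_mono Uc_bound w sg) auto
  also have "\<dots> = B * (cmod \<mu>^j * \<bar>k\<bar>^l * (2 * opC)^(j + l))" by simp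
  also have "\<dots> \<le> B * ((1/2)^j * (1/2)^l)" by (intro mult_left_mono small_params mk B0)
  finally show ?thesis by (simp add: Pair)
qed

lemma us_uniform:
  "uniform_limit UNIV (\<lambda>X (b,y). \<Sum>(j,l)\<in>X. \<mu>^j * of_real k^l * Uc sg w j l b y) (\<lambda>(b,y). us sg w \<mu> k b y) (finite_subsets_at_top UNIV)"
proof -
  have "uniform_limit UNIV (\<lambda>X z. \<Sum>x\<in>X. (\<lambda>(j,l). \<mu>^j * of_real k^l * Uc sg w j l (fst z) (snd z)) x)
     (\<lambda>z. \<Sum>\<^sub>\<infinity>x. (\<lambda>(j,l). \<mu>^j * of_real k^l * Uc sg w j l (fst z) (snd z)) x) (finite_subsets_at_top UNIV)"
    by (rule Weierstrass_m_test_general[OF us_term_bound geometric_double_summable])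
  thus ?thesis by (simp add: us_def case_prod_unfold)
qed

lemma us_cper: "cper (us sg w \<mu> k)"
proof -
  have "continuous_on UNIV (us sg w \<mu> k b)" for b
  proof (rule uniform_limit_theorem)
    show "uniform_limit UNIV (\<lambda>X y. \<Sum>x\<in>X. (\<lambda>(j,l). \<mu>^j * of_real k^l * Uc sg w j l b y) x) (us sg w \<mu> k b) (finite_subsets_at_top UNIV)"
      unfolding us_def[abs_def]
      by (rule Weierstrass_m_test_general[OF us_term_bound geometric_double_summable])
    show "\<forall>\<^sub>F X in finite_subsets_at_top UNIV. continuous_on UNIV (\<lambda>y. \<Sum>x\<in>X. (\<lambda>(j,l). \<mu>^j * of_real k^l * Uc sg w j l b y) x)"
      using cper_cont[OF Uc_cper[OF w(1)]]
      by (intro always_eventually allI) (auto simp: case_prod_unfold intro!: continuous_intros)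
  qed simp
  moreover have "us sg w \<mu> k b (y + T) = us sg w \<mu> k b y" for b y
    using Uc_cper[OF w(1)] by (simp add: us_def cper_def)
  ultimately show ?thesis by (simp add: cper_def)
qed

lemma us_has_sum: "((\<lambda>(j,l). \<mu>^j * of_real k^l * Uc sg w j l b y) has_sum us sg w \<mu> k b y) UNIV"
proof -
  have "(\<lambda>x. norm ((\<lambda>(j,l). \<mu>^j * of_real k^l * Uc sg w j l b y) x)) summable_on UNIV"
    by (rule summable_on_comparison_test[OF geometric_double_summable[of B] us_term_bound norm_ge_zero])
  from has_sum_infsum[OF abs_summable_summable[OF this]] show ?thesis unfolding us_def .
qed

text \<open>Finite partial sums are covered by linearity. They converge uniformly, and the
  functional is bounded in the sup norm.\<close>

lemma blin_has_sum:
  assumes L: "blin C \<Lambda>" and C: "0 < C"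
  shows "((\<lambda>(j,l). \<mu>^j * of_real k^l * \<Lambda> (Uc sg w j l)) has_sum \<Lambda> (us sg w \<mu> k)) UNIV"
proof -
  define S where "S X b y = (\<Sum>(j,l)\<in>X. \<mu>^j * of_real k^l * Uc sg w j l b y)" for X b y
  have lin: "\<Lambda> (\<lambda>b y. a * g b y + c * h b y) = a * \<Lambda> g + c * \<Lambda> h" if "cper g" "cper h" for a c g h
    using L that unfolding blin_def by blast
  have L0: "\<Lambda> (\<lambda>_ _. 0) = 0" using lin[OF cper_0 cper_0, of 0 0] by simp
  have SL: "cper (S X) \<and> \<Lambda> (S X) = (\<Sum>(j,l)\<in>X. \<mu>^j * of_real k^l * \<Lambda> (Uc sg w j l))" if "finite X" for X
    using that
  proof (induction X rule: finite_induct)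
    case empty
    thus ?case using cper_0 L0 by (simp add: S_def[abs_def])
  next
    case (insert x X)
    obtain j l where x: "x = (j,l)" by (cases x)
    have "S (insert x X) = (\<lambda>b y. \<mu>^j * of_real k^l * Uc sg w j l b y + 1 * S X b y)"
      using insert by (simp add: S_def x fun_eq_iff)
    thus ?case using insert lin[OF Uc_cper[OF w(1)], of "S X" "\<mu>^j * of_real k^l" sg j l 1]
      cper_lincomb[OF Uc_cper[OF w(1)], of "S X" "\<mu>^j * of_real k^l" sg j l 1] by (simp add: x)
  qed
  show ?thesis unfolding has_sum_def
  proof (rule tendstoI)
    fix e :: real assume e: "0 < e"
    have "\<forall>\<^sub>F X in finite_subsets_at_top UNIV. \<forall>z\<in>UNIV. dist ((\<lambda>(b,y). S X b y) z) ((\<lambda>(b,y). us sg w \<mu> k b y) z) < e / (2 * C)"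
      using us_uniform[unfolded uniform_limit_iff, rule_format, of "e / (2 * C)"] e C by (simp add: S_def)
    moreover have "\<forall>\<^sub>F X in finite_subsets_at_top UNIV. finite X \<and> X \<subseteq> (UNIV :: (nat \<times> nat) set)"
      by (rule eventually_finite_subsets_at_top_weakI) simp
    ultimately show "\<forall>\<^sub>F X in finite_subsets_at_top UNIV. dist (\<Sum>(j,l)\<in>X. \<mu>^j * of_real k^l * \<Lambda> (Uc sg w j l)) (\<Lambda> (us sg w \<mu> k)) < e"
    proof eventually_elim
      case (elim X)
      hence X: "finite X" by simp
      have "cmod (\<Lambda> (\<lambda>b y. 1 * S X b y + (-1) * us sg w \<mu> k b y)) \<le> C * (e / (2 * C))"
      proof -
        have "cper (\<lambda>b y. 1 * S X b y + (-1) * us sg w \<mu> k b y)"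
          using SL[OF X] us_cper by (intro cper_lincomb) auto
        moreover have "cmod (1 * S X b y + (-1) * us sg w \<mu> k b y) \<le> e / (2 * C)" for b y
          using elim by (auto simp: dist_norm less_imp_le)
        ultimately show ?thesis using L unfolding blin_def by blast
      qed
      moreover have "\<Lambda> (\<lambda>b y. 1 * S X b y + (-1) * us sg w \<mu> k b y) = \<Lambda> (S X) - \<Lambda> (us sg w \<mu> k)"
        using lin[OF _ us_cper, of "S X" 1 "-1"] SL[OF X] by simp
      ultimately have "cmod (\<Lambda> (S X) - \<Lambda> (us sg w \<mu> k)) \<le> C * (e / (2 * C))" by simp
      also have "\<dots> < e" using e C by simp
      finally show ?case using SL[OF X] by (simp add: dist_norm)
    qed
  qed
qed

text \<open>Multiplication by mu shifts \<open>j\<close> by 1 and multiplication by k^2 shifts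
  \<open>l\<close> by 2; after these reindexings the identity is the recursion for the coefficients,
  summed.\<close>

lemma us_fixed_point:
  "us sg w \<mu> k b y = w b y + \<mu> * G (us sg w \<mu> k) b y - sg * of_real (k^2) * G (Jf (us sg w \<mu> k)) b y"
proof -
  have o: "0 < opC" using opC(1) by simp
  note hG = blin_has_sum[OF opC(2) o, of b y]
  note hJ = blin_has_sum[OF blin_Jf[OF opC(2)] o, of b y]
  have 1: "((\<lambda>(j,l). if j = 0 \<and> l = 0 then w b y else 0) has_sum w b y) (UNIV :: (nat \<times> nat) set)"
  proof (rule has_sum_finite_neutralI[of "{(0,0)}"])
    show "(\<lambda>(j,l). if j = 0 \<and> l = 0 then w b y else 0) x = 0" if "x \<in> UNIV - {(0,0)}" for x :: "nat \<times> nat"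
      using that by (cases x) auto
  qed simp_all
  have 2: "((\<lambda>(j,l). if j = 0 then 0 else \<mu>^j * of_real k^l * G (Uc sg w (j - 1) l) b y) has_sum \<mu> * G (us sg w \<mu> k) b y) UNIV"
  proof -
    let ?f = "\<lambda>(j,l). if j = 0 then 0 else \<mu>^j * of_real k^l * G (Uc sg w (j - 1) l) b y"
    let ?h = "\<lambda>(j,l). (Suc j, l) :: nat \<times> nat"
    have "((\<lambda>x. \<mu> * (\<lambda>(j,l). \<mu>^j * of_real k^l * G (Uc sg w j l) b y) x) has_sum \<mu> * G (us sg w \<mu> k) b y) UNIV"
      by (rule has_sum_cmult_right[OF hG])
    moreover have "(\<lambda>x. \<mu> * (\<lambda>(j,l). \<mu>^j * of_real k^l * G (Uc sg w j l) b y) x) = ?f \<circ> ?h"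
      by (simp add: fun_eq_iff)
    ultimately have "((?f \<circ> ?h) has_sum \<mu> * G (us sg w \<mu> k) b y) UNIV" by simp
    hence "(?f has_sum \<mu> * G (us sg w \<mu> k) b y) (?h ` UNIV)"
      by (rule has_sum_reindex[THEN iffD2, rotated]) (auto simp: inj_on_def)
    thus ?thesis
    proof (rule has_sum_cong_neutral[THEN iffD1, rotated 3])
      fix x :: "nat \<times> nat" assume x: "x \<in> UNIV - ?h ` UNIV"
      obtain j l where "x = (j,l)" by (cases x)
      moreover have "j = 0"
      proof (rule ccontr)
        assume "j \<noteq> 0"
        hence "x = ?h (j - 1, l)" using \<open>x = (j,l)\<close> by simp
        thus False using x by blast
      qed
      ultimately show "?f x = 0" by simp
    qed auto
  qed
  have 3: "((\<lambda>(j,l). if l < 2 then 0 else \<mu>^j * of_real k^l * (sg * G (Jf (Uc sg w j (l - 2))) b y)) has_sum sg * of_real (k^2) * G (Jf (us sg w \<mu> k)) b y) UNIV"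
  proof -
    let ?f = "\<lambda>(j,l). if l < 2 then 0 else \<mu>^j * of_real k^l * (sg * G (Jf (Uc sg w j (l - 2))) b y)"
    let ?h = "\<lambda>(j,l). (j, l + 2) :: nat \<times> nat"
    have "((\<lambda>x. sg * of_real (k^2) * (\<lambda>(j,l). \<mu>^j * of_real k^l * G (Jf (Uc sg w j l)) b y) x) has_sum sg * of_real (k^2) * G (Jf (us sg w \<mu> k)) b y) UNIV"
      by (rule has_sum_cmult_right[OF hJ])
    moreover have "(\<lambda>x. sg * of_real (k^2) * (\<lambda>(j,l). \<mu>^j * of_real k^l * G (Jf (Uc sg w j l)) b y) x) = ?f \<circ> ?h"
      by (simp add: fun_eq_iff power2_eq_square)
    ultimately have "((?f \<circ> ?h) has_sum sg * of_real (k^2) * G (Jf (us sg w \<mu> k)) b y) UNIV" by simp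
    hence "(?f has_sum sg * of_real (k^2) * G (Jf (us sg w \<mu> k)) b y) (?h ` UNIV)"
      by (rule has_sum_reindex[THEN iffD2, rotated]) (auto simp: inj_on_def)
    thus ?thesis
    proof (rule has_sum_cong_neutral[THEN iffD1, rotated 3])
      fix x :: "nat \<times> nat" assume x: "x \<in> UNIV - ?h ` UNIV"
      obtain j l where "x = (j,l)" by (cases x)
      moreover have "l < 2"
      proof (rule ccontr)
        assume "\<not> l < 2"
        hence "x = ?h (j, l - 2)" using \<open>x = (j,l)\<close> by simp
        thus False using x by blast
      qed
      ultimately show "?f x = 0" by simp
    qed auto
  qed
  have "((\<lambda>x. ((\<lambda>(j,l). if j = 0 \<and> l = 0 then w b y else 0) x
       + (\<lambda>(j,l). if j = 0 then 0 else \<mu>^j * of_real k^l * G (Uc sg w (j - 1) l) b y) x)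
       - (\<lambda>(j,l). if l < 2 then 0 else \<mu>^j * of_real k^l * (sg * G (Jf (Uc sg w j (l - 2))) b y)) x)
     has_sum (w b y + \<mu> * G (us sg w \<mu> k) b y) - sg * of_real (k^2) * G (Jf (us sg w \<mu> k)) b y) UNIV"
    by (intro has_sum_diff_complex has_sum_add 1 2 3)
  moreover have "(\<lambda>x. ((\<lambda>(j,l). if j = 0 \<and> l = 0 then w b y else 0) x
       + (\<lambda>(j,l). if j = 0 then 0 else \<mu>^j * of_real k^l * G (Uc sg w (j - 1) l) b y) x)
       - (\<lambda>(j,l). if l < 2 then 0 else \<mu>^j * of_real k^l * (sg * G (Jf (Uc sg w j (l - 2))) b y)) x)
     = (\<lambda>(j,l). \<mu>^j * of_real k^l * Uc sg w j l b y)" (is "?L = ?R")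
  proof
    fix x :: "nat \<times> nat"
    obtain j l where x: "x = (j,l)" by (cases x)
    show "?L x = ?R x" unfolding x prod.case Uc.simps[of sg w j l] by (simp add: algebra_simps)
  qed
  ultimately show ?thesis using us_has_sum[of b y] has_sum_unique by (metis (no_types, lifting))
qed

end

lemma blin_ps:
  assumes L: "blin opC \<Lambda>"
  shows "double_series n (\<lambda>\<mu> k. \<Lambda> (us sg w \<mu> k) - (\<Sum>(j,l)\<in>{(j,l). j + l < n}. \<Lambda> (Uc sg w j l) * \<mu>^j * of_real k^l))"
proof (rule double_series_tail)
  have o: "0 < opC" using opC(1) by simp
  show "0 < 1 / (4 * opC)" using o by simp
  show "(\<lambda>(j,l). norm (\<Lambda> (Uc sg w j l)) * (1 / (4 * opC))^j * (1 / (4 * opC))^l) summable_on UNIV"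
  proof (rule summable_on_comparison_double[OF geometric_double_summable[of "opC * B"]])
    fix j l :: nat
    have "cmod (\<Lambda> (Uc sg w j l)) \<le> opC * (B * (2 * opC)^(j + l))"
      using L Uc_cper[OF w(1)] Uc_bound[OF w sg] unfolding blin_def by blast
    hence "norm (\<Lambda> (Uc sg w j l)) * ((1 / (4 * opC))^j * (1 / (4 * opC))^l) \<le> opC * (B * (2 * opC)^(j + l)) * ((1 / (4 * opC))^j * (1 / (4 * opC))^l)"
      using o by (intro mult_right_mono) auto
    also have "\<dots> = opC * B * ((1 / (4 * opC))^j * (1 / (4 * opC))^l * (2 * opC)^(j + l))" by simp
    also have "\<dots> \<le> opC * B * ((1/2)^j * (1/2)^l)"
      using small_params[of "of_real (1 / (4 * opC))" "1 / (4 * opC)" j l] o B0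
      by (intro mult_left_mono) (auto simp: norm_divide norm_mult)
    finally show "norm (\<Lambda> (Uc sg w j l)) * (1 / (4 * opC))^j * (1 / (4 * opC))^l \<le> opC * B * (1/2)^j * (1/2)^l"
      by (simp add: mult.assoc)
  qed (use o in simp)
  fix \<mu> k assume "cmod \<mu> < 1 / (4 * opC)" "\<bar>k\<bar> < 1 / (4 * opC)"
  hence "((\<lambda>(j,l). \<mu>^j * of_real k^l * \<Lambda> (Uc sg w j l)) has_sum \<Lambda> (us sg w \<mu> k)) UNIV"
    by (intro blin_has_sum[OF _ _ L o]) auto
  thus "((\<lambda>(j,l). \<Lambda> (Uc sg w j l) * \<mu>^j * of_real k^l) has_sum \<Lambda> (us sg w \<mu> k)) UNIV"
    by (simp add: mult_ac)
qed

end

text \<open>For small mu and k the map v -> G \<Theta> v halves every sup bound, so a bounded fixed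
  point is 0.\<close>

lemma small_fixed_point_zero:
  assumes v: "cper v" and sg: "cmod sg \<le> 1" and mk: "cmod \<mu> \<le> 1 / (4 * opC)" "\<bar>k\<bar> \<le> 1 / (4 * opC)"
    and fp: "\<And>b y. v b y = \<mu> * G v b y - sg * of_real (k^2) * G (Jf v) b y"
  shows "v b y = 0"
proof -
  obtain B where B: "\<And>b y. cmod (v b y) \<le> B" using cper_bounded[OF v] by blast
  have o: "0 < opC" "1 \<le> opC" using opC(1) by auto
  have m: "cmod \<mu> * opC \<le> 1/4" using mult_right_mono[OF mk(1), of opC] o by simp
  have k1: "\<bar>k\<bar> \<le> 1" using mk(2) o by (smt (verit) divide_le_eq_1)
  have "k^2 * opC \<le> \<bar>k\<bar> * opC"
    using mult_right_mono[OF k1, of "\<bar>k\<bar>"] o by (intro mult_right_mono) (auto simp: power2_eq_square abs_mult_self_eq)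
  also have "\<dots> \<le> 1/4" using mult_right_mono[OF mk(2), of opC] o by simp
  finally have k: "k^2 * opC \<le> 1/4" .
  have bd: "\<forall>b y. cmod (v b y) \<le> B * (1/2)^n" for n
  proof (induction n)
    case (Suc n)
    show ?case
    proof (intro allI)
      fix b y
      have IH: "\<And>b y. cmod (v b y) \<le> B * (1/2)^n" using Suc by blast
      have q: "0 \<le> B * (1/2)^n" using order_trans[OF norm_ge_zero IH[of True 0]] .
      have g1: "cmod (\<mu> * G v b y) \<le> 1/4 * (B * (1/2)^n)"
      proof -
        have "cmod (\<mu> * G v b y) \<le> cmod \<mu> * (opC * (B * (1/2)^n))"
          unfolding norm_mult by (intro mult_left_mono G_bound v IH) simp
        also have "\<dots> = cmod \<mu> * opC * (B * (1/2)^n)" by simp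
        also have "\<dots> \<le> 1/4 * (B * (1/2)^n)" by (rule mult_right_mono[OF m q])
        finally show ?thesis .
      qed
      have g2: "cmod (sg * of_real (k^2) * G (Jf v) b y) \<le> 1/4 * (B * (1/2)^n)"
      proof -
        have "cmod (sg * of_real (k^2) * G (Jf v) b y) \<le> 1 * k^2 * (opC * (B * (1/2)^n))"
          unfolding norm_mult norm_of_real by (intro mult_mono G_bound Jf_cper v Jf_bound IH) (use sg in auto)
        also have "\<dots> = k^2 * opC * (B * (1/2)^n)" by simp
        also have "\<dots> \<le> 1/4 * (B * (1/2)^n)" by (rule mult_right_mono[OF k q])
        finally show ?thesis .
      qed
      have "cmod (v b y) \<le> 1/4 * (B * (1/2)^n) + 1/4 * (B * (1/2)^n)"
        unfolding fp[of b y] using norm_triangle_ineq4[of "\<mu> * G v b y" "sg * of_real (k^2) * G (Jf v) b y"] g1 g2 by linarith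
      thus "cmod (v b y) \<le> B * (1/2)^Suc n" by simp
    qed
  qed (use B in simp)
  have "(\<lambda>n. B * (1/2)^n) \<longlonglongrightarrow> B * 0" by (intro tendsto_intros LIMSEQ_power_zero) simp
  hence "cmod (v b y) \<le> B * 0" by (rule Lim_bounded2) (use bd in auto)
  thus ?thesis by simp
qed

end

section \<open>Lyapunov--Schmidt reduction to a 2 by 2 determinant\<close>

context linearized_system
begin

definition Th :: "complex \<Rightarrow> complex \<Rightarrow> real \<Rightarrow> cfield \<Rightarrow> cfield" where
  "Th sg \<mu> k g b y = \<mu> * g b y - sg * of_real (k^2) * Jf g b y"

lemma Th_alt: "Th sg \<mu> k g = (\<lambda>b y. \<mu> * g b y + (- (sg * of_real (k^2))) * Jf g b y)"
  by (simp add: Th_def fun_eq_iff)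

lemma F_lin: "i < 4 \<Longrightarrow> cper g \<Longrightarrow> cper h \<Longrightarrow> F i (\<lambda>b y. a * g b y + c * h b y) = a * F i g + c * F i h"
  by (rule F_linear(1)) (simp_all add: cper_cont)

lemma Th_cper: "cper g \<Longrightarrow> cper (Th sg \<mu> k g)"
  unfolding Th_alt by (intro cper_lincomb Jf_cper)

lemma Th_linear: "Th sg \<mu> k (\<lambda>b y. a * g b y + c * h b y) = (\<lambda>b y. a * Th sg \<mu> k g b y + c * Th sg \<mu> k h b y)"
  by (simp add: Th_def Jf_linear fun_eq_iff algebra_simps)

lemma G_Th: "cper g \<Longrightarrow> G (Th sg \<mu> k g) b y = \<mu> * G g b y - sg * of_real (k^2) * G (Jf g) b y"
  unfolding Th_alt using G_linear[OF _ Jf_cper, of g g \<mu> "- (sg * of_real (k^2))" b y] by simp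

lemma F_Th: "cper g \<Longrightarrow> i < 4 \<Longrightarrow> F i (Th sg \<mu> k g) = \<mu> * F i g - sg * of_real (k^2) * F i (Jf g)"
  unfolding Th_alt using F_lin[OF _ _ Jf_cper, of i g g \<mu> "- (sg * of_real (k^2))"] by simp

definition eig :: "complex \<Rightarrow> complex \<Rightarrow> real \<Rightarrow> bool" where
  "eig sg \<mu> k \<longleftrightarrow> (\<exists>u u'. (\<exists>b y. u b y \<noteq> 0) \<and> cper u \<and> csol u u' (Th sg \<mu> k u))"

definition EE :: "nat \<Rightarrow> cfield" where
  "EE i b y = of_real (E i b y)"

lemma cper_EE: "i < 2 \<Longrightarrow> cper (EE i)"
  using cper_E01 by (cases "i = 0") (auto simp: EE_def[abs_def] less_2_cases_iff One_nat_def)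

lemma csol_EE: "i < 4 \<Longrightarrow> csol (EE i) (\<lambda>b y. of_real (E1 i b y)) (\<lambda>_ _. 0)"
  unfolding EE_def[abs_def] by (rule csol_E)

text \<open>If the combination vanishes identically, so does its derivative. Pairing both at y = 0
  with \<open>E 3\<close> and with \<open>E 2\<close> in the conserved form isolates the two
  coefficients.\<close>

lemma EE_independent:
  assumes "\<And>b y. \<alpha> * EE 0 b y + \<beta> * EE 1 b y = 0"
  shows "\<alpha> = 0" "\<beta> = 0"
proof -
  have "((\<lambda>y. \<alpha> * EE 0 b y + \<beta> * EE 1 b y) has_vector_derivative \<alpha> * of_real (E1 0 b y) + \<beta> * of_real (E1 1 b y)) (at y)" for b y
    unfolding EE_def by (intro derivative_intros has_vector_derivative_of_real dE) auto
  hence d: "\<alpha> * of_real (E1 0 b y) + \<beta> * of_real (E1 1 b y) = 0" for b y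
    using vector_derivative_unique_at[OF _ has_vector_derivative_const] assms by fastforce
  let ?W = "\<lambda>i j. complex_of_real (E i True 0 * E1 j True 0 - E1 i True 0 * E j True 0 + E i False 0 * E1 j False 0 - E1 i False 0 * E j False 0
         + 2 * s 0 * (E i False 0 * E j True 0 - E i True 0 * E j False 0))"
  have c: "\<alpha> * ?W 0 j + \<beta> * ?W 1 j = 0" for j
  proof -
    have "\<alpha> * ?W 0 j + \<beta> * ?W 1 j = (\<alpha> * EE 0 True 0 + \<beta> * EE 1 True 0) * of_real (E1 j True 0)
      - (\<alpha> * of_real (E1 0 True 0) + \<beta> * of_real (E1 1 True 0)) * of_real (E j True 0)
      + (\<alpha> * EE 0 False 0 + \<beta> * EE 1 False 0) * of_real (E1 j False 0)
      - (\<alpha> * of_real (E1 0 False 0) + \<beta> * of_real (E1 1 False 0)) * of_real (E j False 0)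
      + 2 * of_real (s 0) * ((\<alpha> * EE 0 False 0 + \<beta> * EE 1 False 0) * of_real (E j True 0) - (\<alpha> * EE 0 True 0 + \<beta> * EE 1 True 0) * of_real (E j False 0))"
      by (simp add: EE_def algebra_simps)
    thus ?thesis unfolding assms d by simp
  qed
  have "?W 0 3 = 1" "?W 1 3 = 0" "?W 0 2 = 0" "?W 1 2 = 1"
    using symp[of 0 3 1 0] symp[of 1 3 0 0] symp[of 0 2 0 0] symp[of 1 2 1 0] by simp_all
  thus "\<alpha> = 0" "\<beta> = 0" using c[of 3] c[of 2] by simp_all
qed

lemma Proj_eq: "F 0 g = 0 \<Longrightarrow> F 1 g = 0 \<Longrightarrow> Proj g = g"
  by (simp add: Proj_def fun_eq_iff)

lemma F_zero: "F i (\<lambda>_ _. 0) = 0"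
  by (simp add: F_def Pg_def dens_def[abs_def] prim_def)

lemma G_zero: "G (\<lambda>_ _. 0) b y = 0"
  using G_linear[OF cper_0 cper_0, of 0 0] by simp

lemma cper_scale: "cper g \<Longrightarrow> cper (\<lambda>b y. c * g b y)"
  using cper_lincomb[of g "\<lambda>_ _. 0" c 0] cper_0 by simp

lemma det2_singular:
  fixes a b c d :: complex
  shows "a * d - b * c = 0 \<longleftrightarrow> (\<exists>\<alpha> \<beta>. (\<alpha>,\<beta>) \<noteq> (0,0) \<and> \<alpha> * a + \<beta> * b = 0 \<and> \<alpha> * c + \<beta> * d = 0)"
proof
  assume d0: "a * d - b * c = 0"
  show "\<exists>\<alpha> \<beta>. (\<alpha>,\<beta>) \<noteq> (0,0) \<and> \<alpha> * a + \<beta> * b = 0 \<and> \<alpha> * c + \<beta> * d = 0"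
  proof (cases "a = 0 \<and> b = 0")
    case True
    show ?thesis
    proof (cases "c = 0 \<and> d = 0")
      case False
      thus ?thesis using True by (simp, rule_tac exI[of _ d], rule_tac exI[of _ "- c"]) auto
    qed (use True in \<open>auto intro!: exI[of _ 1]\<close>)
  next
    case False
    show ?thesis
    proof (rule exI[of _ b], rule exI[of _ "- a"], intro conjI)
      show "b * c + - a * d = 0" using d0 by (simp add: algebra_simps)
    qed (use False in auto)
  qed
next
  assume "\<exists>\<alpha> \<beta>. (\<alpha>,\<beta>) \<noteq> (0,0) \<and> \<alpha> * a + \<beta> * b = 0 \<and> \<alpha> * c + \<beta> * d = 0"
  then obtain \<alpha> \<beta> where ab: "(\<alpha>,\<beta>) \<noteq> (0,0)" "\<alpha> * a + \<beta> * b = 0" "\<alpha> * c + \<beta> * d = 0" by blast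
  have "\<alpha> * (a * d - b * c) = d * (\<alpha> * a + \<beta> * b) - b * (\<alpha> * c + \<beta> * d)" by (simp add: algebra_simps)
  moreover have "\<beta> * (a * d - b * c) = a * (\<alpha> * c + \<beta> * d) - c * (\<alpha> * a + \<beta> * b)" by (simp add: algebra_simps)
  ultimately show "a * d - b * c = 0" using ab by (auto simp: ab)
qed

context
  fixes sg :: complex and c :: complex and wv wv1 :: "nat \<Rightarrow> cfield"
  assumes c: "c \<noteq> 0" and sg: "cmod sg \<le> 1"
    and wv: "\<And>i. i < 2 \<Longrightarrow> csol (wv i) (wv1 i) (\<lambda>b y. c * EE i b y)" "\<And>i. i < 2 \<Longrightarrow> cper (wv i)"
begin

abbreviation ww :: "nat \<Rightarrow> cfield" where
  "ww i \<equiv> (\<lambda>b y. c * EE i b y)"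

lemma ww_cper: "i < 2 \<Longrightarrow> cper (ww i)"
  by (intro cper_scale cper_EE)

text \<open>The kernel element \<open>ww j\<close> is L applied to the periodic field
  \<open>wv j\<close>, so it meets the solvability conditions. This is the Jordan chain that makes
  the matrix start at order 2.\<close>

lemma F_ww: "i < 2 \<Longrightarrow> j < 2 \<Longrightarrow> F i (ww j) = 0"
  using solvability[OF wv(1,2) cper_cont[OF ww_cper], of j] by (cases "i = 0") (auto simp: less_2_cases_iff One_nat_def)

lemma F_EE: "i < 2 \<Longrightarrow> j < 2 \<Longrightarrow> F i (EE j) = 0"
  using F_lin[OF _ cper_EE cper_EE, of i j j c 0] F_ww[of i j] c by simp

lemma F_span:
  assumes "i < 2" "\<And>b y. g b y = \<alpha> * EE 0 b y + \<beta> * EE 1 b y" shows "F i g = 0"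
proof -
  have g: "g = (\<lambda>b y. \<alpha> * EE 0 b y + \<beta> * EE 1 b y)" using assms(2) by (simp add: fun_eq_iff)
  show ?thesis unfolding g
    using F_lin[OF _ cper_EE cper_EE, of i 0 1 \<alpha> \<beta>] F_EE[of i 0] F_EE[of i 1] assms(1) by simp
qed

text \<open>\<open>G (ww j)\<close> and \<open>wv j\<close> are periodic solutions of the same
  equation. They differ by a kernel element, on which \<open>F\<close> vanishes.\<close>

lemma F_G_ww:
  assumes "i < 2" "j < 2" shows "F i (G (ww j)) = F i (wv j)"
proof -
  have P: "Proj (ww j) = ww j" using F_ww[of 0 j] F_ww[of 1 j] assms by (intro Proj_eq) auto
  have "csol (\<lambda>b y. 1 * G (ww j) b y + (-1) * wv j b y) (\<lambda>b y. 1 * G' (ww j) b y + (-1) * wv1 j b y) (\<lambda>b y. 1 * ww j b y + (-1) * ww j b y)"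
    using csol_lincomb[OF G_csol[OF ww_cper[OF assms(2)]] wv(1)[OF assms(2)], of 1 "-1"] unfolding P .
  hence "csol (\<lambda>b y. 1 * G (ww j) b y + (-1) * wv j b y) (\<lambda>b y. 1 * G' (ww j) b y + (-1) * wv1 j b y) (\<lambda>b y. 0)" by simp
  from homogeneous_periodic[OF this cper_lincomb[OF G_cper[OF ww_cper[OF assms(2)]] wv(2)[OF assms(2)]]]
  obtain \<alpha> \<beta> where "\<And>b y. 1 * G (ww j) b y + (-1) * wv j b y = \<alpha> * EE 0 b y + \<beta> * EE 1 b y" unfolding EE_def by blast
  from F_span[OF assms(1), OF this] have "F i (\<lambda>b y. 1 * G (ww j) b y + (-1) * wv j b y) = 0" .
  thus ?thesis
    using F_lin[OF _ G_cper[OF ww_cper[OF assms(2)]] wv(2)[OF assms(2)], of i 1 "-1"] assms(1) by simp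
qed

definition Mx :: "nat \<Rightarrow> nat \<Rightarrow> complex \<Rightarrow> real \<Rightarrow> complex" where
  "Mx i j \<mu> k = F i (Th sg \<mu> k (us sg (ww j) \<mu> k))"

definition Qx :: "nat \<Rightarrow> nat \<Rightarrow> complex \<Rightarrow> real \<Rightarrow> complex" where
  "Qx i j \<mu> k = \<mu>^2 * F i (wv j) - sg * of_real (k^2) * F i (Jf (ww j))"

text \<open>The coefficient of mu is \<open>F i (ww j) = 0\<close>, and that of mu^2 is
  \<open>F i (G (ww j)) = F i (wv j)\<close>. What remains is mu times a series of order 2 and k^2
  times a series of order 1.\<close>

lemma Mx_ps:
  assumes i: "i < 2" and j: "j < 2"
  obtains e r where "double_series 3 e" "0 < r" "\<And>\<mu> k. cmod \<mu> < r \<Longrightarrow> \<bar>k\<bar> < r \<Longrightarrow> Mx i j \<mu> k = Qx i j \<mu> k + e \<mu> k"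
proof -
  have i4: "i < 4" using i by simp
  obtain B where B: "\<And>b y. cmod (ww j b y) \<le> B" using cper_bounded[OF ww_cper[OF j]] by blast
  note hyp = ww_cper[OF j] B sg
  have set2: "{(j,l). j + l < 2} = {(0,0),(1,0),(0,1::nat)} " for P :: "nat \<Rightarrow> nat \<Rightarrow> bool"
    by (auto simp: One_nat_def)
  have set1: "{(j,l). j + l < (1::nat)} = {(0,0::nat)}" by auto
  have U00: "Uc sg (ww j) 0 0 = ww j" by (simp add: Uc.simps[of sg _ 0 0] fun_eq_iff)
  have U10: "Uc sg (ww j) 1 0 = G (ww j)" by (simp add: Uc.simps[of sg _ 1 0] U00 fun_eq_iff)
  have U01: "Uc sg (ww j) 0 1 = (\<lambda>_ _. 0)" by (simp add: Uc.simps[of sg _ 0 1] fun_eq_iff)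
  define e2 where "e2 = (\<lambda>\<mu> k. F i (us sg (ww j) \<mu> k) - \<mu> * F i (wv j))"
  have e2: "double_series 2 e2"
    using blin_ps[OF hyp opC(3)[OF i4], of 2] unfolding set2
    by (simp add: U00 U10 U01 F_ww[OF i j] F_zero F_G_ww[OF i j] e2_def mult.commute)
  define e1 where "e1 = (\<lambda>\<mu> k. F i (Jf (us sg (ww j) \<mu> k)) - F i (Jf (ww j)))"
  have e1: "double_series 1 e1"
    using blin_ps[OF hyp blin_Jf[OF opC(3)[OF i4]], of 1] unfolding set1
    by (simp add: U00 e1_def)
  have p: "double_series 1 (\<lambda>\<mu> k. \<mu>)" "double_series 2 (\<lambda>\<mu> k. of_real (k^2))"
    using double_series_monomial[of 1 0 1, unfolded add_0_right] double_series_monomial[of 0 2 1, unfolded add_0_left] by simp_all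
  define e where "e = (\<lambda>\<mu> k. \<mu> * e2 \<mu> k - sg * (of_real (k^2) * e1 \<mu> k))"
  have "double_series 3 e" unfolding e_def
    using double_series_mult[OF p(1) e2] double_series_mult[OF p(2) e1] by (intro double_series_diff double_series_cmult) simp_all
  moreover have "0 < 1 / (4 * opC)" using opC(1) by simp
  moreover have "Mx i j \<mu> k = Qx i j \<mu> k + e \<mu> k" if "cmod \<mu> < 1 / (4 * opC)" "\<bar>k\<bar> < 1 / (4 * opC)" for \<mu> k
  proof -
    have "cper (us sg (ww j) \<mu> k)" using that by (intro us_cper[OF hyp]) auto
    hence "Mx i j \<mu> k = \<mu> * F i (us sg (ww j) \<mu> k) - sg * of_real (k^2) * F i (Jf (us sg (ww j) \<mu> k))"
      unfolding Mx_def by (rule F_Th[OF _ i4])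
    thus ?thesis by (simp add: Qx_def e_def e1_def e2_def algebra_simps power2_eq_square)
  qed
  ultimately show ?thesis using that by blast
qed

text \<open>A combination of the two Neumann series solves the equation with \<Theta> u replaced by
  its projection. It is an eigenfunction exactly when the projection changes nothing, which is a
  linear 2 by 2 system for the coefficients.\<close>

lemma eig_iff_det:
  assumes mk: "cmod \<mu> \<le> 1 / (4 * opC)" "\<bar>k\<bar> \<le> 1 / (4 * opC)"
  shows "eig sg \<mu> k \<longleftrightarrow> Mx 0 0 \<mu> k * Mx 1 1 \<mu> k - Mx 0 1 \<mu> k * Mx 1 0 \<mu> k = 0"
proof -
  let ?u = "\<lambda>j. us sg (ww j) \<mu> k"
  let ?Th = "Th sg \<mu> k"
  have ucper: "cper (?u j)" if j2: "j < 2" for j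
  proof -
    obtain B where "\<And>b y. cmod (ww j b y) \<le> B" using cper_bounded[OF ww_cper[OF j2]] by blast
    from us_cper[OF ww_cper[OF j2] this sg mk] show ?thesis .
  qed
  have ufp: "?u j b y = ww j b y + G (?Th (?u j)) b y" if j2: "j < 2" for j b y
  proof -
    obtain B where "\<And>b y. cmod (ww j b y) \<le> B" using cper_bounded[OF ww_cper[OF j2]] by blast
    from us_fixed_point[OF ww_cper[OF j2] this sg mk] show ?thesis using G_Th[OF ucper[OF j2]] by simp
  qed
  define comb where "comb \<alpha> \<beta> = (\<lambda>b y. \<alpha> * ?u 0 b y + \<beta> * ?u 1 b y)" for \<alpha> \<beta>
  have comb_cper: "cper (comb \<alpha> \<beta>)" for \<alpha> \<beta> unfolding comb_def by (intro cper_lincomb ucper) auto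
  have FTh: "F i (?Th (comb \<alpha> \<beta>)) = \<alpha> * Mx i 0 \<mu> k + \<beta> * Mx i 1 \<mu> k" if "i < 4" for i \<alpha> \<beta>
    unfolding comb_def Th_linear Mx_def
    by (rule F_linear(1)[OF that]) (intro cper_cont[OF Th_cper[OF ucper]]; simp)+
  have comb_fp: "comb \<alpha> \<beta> b y = c * (\<alpha> * EE 0 b y + \<beta> * EE 1 b y) + G (?Th (comb \<alpha> \<beta>)) b y" for \<alpha> \<beta> b y
  proof -
    have "G (?Th (comb \<alpha> \<beta>)) b y = \<alpha> * G (?Th (?u 0)) b y + \<beta> * G (?Th (?u 1)) b y"
      unfolding comb_def Th_linear by (intro G_linear Th_cper ucper) auto
    thus ?thesis using ufp[of 0 b y] ufp[of 1 b y] by (simp add: comb_def algebra_simps)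
  qed
  show ?thesis unfolding det2_singular
  proof
    assume "\<exists>\<alpha> \<beta>. (\<alpha>,\<beta>) \<noteq> (0,0) \<and> \<alpha> * Mx 0 0 \<mu> k + \<beta> * Mx 0 1 \<mu> k = 0 \<and> \<alpha> * Mx 1 0 \<mu> k + \<beta> * Mx 1 1 \<mu> k = 0"
    then obtain \<alpha> \<beta> where ab: "(\<alpha>,\<beta>) \<noteq> (0,0)" "\<alpha> * Mx 0 0 \<mu> k + \<beta> * Mx 0 1 \<mu> k = 0" "\<alpha> * Mx 1 0 \<mu> k + \<beta> * Mx 1 1 \<mu> k = 0" by blast
    have P: "Proj (?Th (comb \<alpha> \<beta>)) = ?Th (comb \<alpha> \<beta>)"
      using FTh[of 0 \<alpha> \<beta>] FTh[of 1 \<alpha> \<beta>] ab by (intro Proj_eq) simp_all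
    have hom: "csol (\<lambda>b y. \<alpha> * EE 0 b y + \<beta> * EE 1 b y) (\<lambda>b y. \<alpha> * of_real (E1 0 b y) + \<beta> * of_real (E1 1 b y)) (\<lambda>b y. 0)"
      using csol_lincomb[OF csol_EE[of 0] csol_EE[of 1], of \<alpha> \<beta>] by simp
    obtain v' where v': "csol (\<lambda>b y. c * (\<alpha> * EE 0 b y + \<beta> * EE 1 b y) + 1 * G (?Th (comb \<alpha> \<beta>)) b y) v' (\<lambda>b y. c * 0 + 1 * Proj (?Th (comb \<alpha> \<beta>)) b y)"
      using csol_lincomb[OF hom G_csol[OF Th_cper[OF comb_cper]]] by blast
    have "(\<lambda>b y. c * (\<alpha> * EE 0 b y + \<beta> * EE 1 b y) + 1 * G (?Th (comb \<alpha> \<beta>)) b y) = comb \<alpha> \<beta>"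
      by (simp add: fun_eq_iff comb_fp[symmetric])
    hence "csol (comb \<alpha> \<beta>) v' (?Th (comb \<alpha> \<beta>))" using v' by (simp add: P)
    moreover have "\<exists>b y. comb \<alpha> \<beta> b y \<noteq> 0"
    proof (rule ccontr)
      assume "\<not> (\<exists>b y. comb \<alpha> \<beta> b y \<noteq> 0)"
      hence z: "comb \<alpha> \<beta> = (\<lambda>_ _. 0)" by (simp add: fun_eq_iff)
      have "?Th (comb \<alpha> \<beta>) = (\<lambda>_ _. 0)" unfolding z by (simp add: Th_def Jf_def fun_eq_iff)
      hence "\<alpha> * EE 0 b y + \<beta> * EE 1 b y = 0" for b y
        using comb_fp[of \<alpha> \<beta> b y] c G_zero by (simp add: z)
      from EE_independent[OF this] ab(1) show False by simp
    qed
    ultimately show "eig sg \<mu> k" unfolding eig_def using comb_cper by blast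
  next
    assume "eig sg \<mu> k"
    then obtain u u' where u: "\<exists>b y. u b y \<noteq> 0" "cper u" "csol u u' (?Th u)" unfolding eig_def by blast
    have F0: "F 0 (?Th u) = 0" "F 1 (?Th u) = 0" by (rule solvability[OF u(3,2) cper_cont[OF Th_cper[OF u(2)]]])+
    hence P: "Proj (?Th u) = ?Th u" by (intro Proj_eq)
    have "csol (\<lambda>b y. 1 * u b y + (-1) * G (?Th u) b y) (\<lambda>b y. 1 * u' b y + (-1) * G' (?Th u) b y) (\<lambda>b y. 1 * ?Th u b y + (-1) * ?Th u b y)"
      using csol_lincomb[OF u(3) G_csol[OF Th_cper[OF u(2), of sg \<mu> k]], of 1 "-1"] unfolding P .
    hence "csol (\<lambda>b y. 1 * u b y + (-1) * G (?Th u) b y) (\<lambda>b y. 1 * u' b y + (-1) * G' (?Th u) b y) (\<lambda>b y. 0)" by simp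
    from homogeneous_periodic[OF this cper_lincomb[OF u(2) G_cper[OF Th_cper[OF u(2)]]]]
    obtain \<alpha>' \<beta>' where lc: "\<And>b y. 1 * u b y + (-1) * G (?Th u) b y = \<alpha>' * EE 0 b y + \<beta>' * EE 1 b y" unfolding EE_def by blast
    have uab0: "u b y = \<alpha>' * EE 0 b y + \<beta>' * EE 1 b y + G (?Th u) b y" for b y
      unfolding lc[of b y, symmetric] by simp
    \<comment> \<open>The Neumann series start from \<open>ww i\<close>, which carries the factor
      \<open>c\<close>; the kernel coefficients are divided by it.\<close>
    define \<alpha> where "\<alpha> = \<alpha>' / c"
    define \<beta> where "\<beta> = \<beta>' / c"
    have uab: "u b y = c * (\<alpha> * EE 0 b y + \<beta> * EE 1 b y) + G (?Th u) b y" for b y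
      using uab0[of b y] c by (simp add: \<alpha>_def \<beta>_def field_simps)
    \<comment> \<open>The difference from the matching combination has no kernel part, so it is a
      fixed point of the contraction and vanishes.\<close>
    define v where "v = (\<lambda>b y. 1 * u b y + (-1) * comb \<alpha> \<beta> b y)"
    have vc: "cper v" unfolding v_def by (intro cper_lincomb u comb_cper)
    have "v b y = G (?Th v) b y" for b y
    proof -
      have "G (?Th v) b y = 1 * G (?Th u) b y + (-1) * G (?Th (comb \<alpha> \<beta>)) b y"
        unfolding v_def Th_linear by (intro G_linear Th_cper u comb_cper)
      thus ?thesis using uab[of b y] comb_fp[of \<alpha> \<beta> b y] by (simp add: v_def)
    qed
    hence "v b y = \<mu> * G v b y - sg * of_real (k^2) * G (Jf v) b y" for b y using G_Th[OF vc] by simp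
    from small_fixed_point_zero[OF vc sg mk this] have "v b y = 0" for b y .
    hence ueq: "u = comb \<alpha> \<beta>" by (simp add: v_def fun_eq_iff)
    have "(\<alpha>,\<beta>) \<noteq> (0,0)"
    proof
      assume "(\<alpha>,\<beta>) = (0,0)"
      hence "u b y = 0" for b y by (simp add: ueq comb_def)
      thus False using u(1) by blast
    qed
    moreover have "\<alpha> * Mx i 0 \<mu> k + \<beta> * Mx i 1 \<mu> k = 0" if "i = 0 \<or> i = 1" for i
      using FTh[of i \<alpha> \<beta>] F0 that by (auto simp: ueq)
    ultimately show "\<exists>\<alpha> \<beta>. (\<alpha>,\<beta>) \<noteq> (0,0) \<and> \<alpha> * Mx 0 0 \<mu> k + \<beta> * Mx 0 1 \<mu> k = 0 \<and> \<alpha> * Mx 1 0 \<mu> k + \<beta> * Mx 1 1 \<mu> k = 0"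
      by blast
  qed
qed

text \<open>An entry is a quadratic form plus order 3. In the determinant the mixed products have
  order 2 + 3 = 5, and the products of two remainders have order 6.\<close>

theorem eig_normal_form:
  "\<exists>Rem r. double_series 5 Rem \<and> 0 < r \<and> (\<forall>\<mu> k. cmod \<mu> < r \<and> \<bar>k\<bar> < r \<longrightarrow>
     (eig sg \<mu> k \<longleftrightarrow> Qx 0 0 \<mu> k * Qx 1 1 \<mu> k - Qx 0 1 \<mu> k * Qx 1 0 \<mu> k + Rem \<mu> k = 0))"
proof -
  have Q: "double_series 2 (Qx i j)" for i j
  proof -
    have "double_series 2 (\<lambda>\<mu> k. F i (wv j) * \<mu>^2 * of_real k^0 - (sg * F i (Jf (ww j))) * \<mu>^0 * of_real k^2)"
      by (rule double_series_diff[OF double_series_monomial[of 2 0, unfolded add_0_right] double_series_monomial[of 0 2, unfolded add_0_left]])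
    moreover have "(\<lambda>\<mu> k. F i (wv j) * \<mu>^2 * of_real k^0 - (sg * F i (Jf (ww j))) * \<mu>^0 * of_real k^2) = Qx i j"
      by (simp add: Qx_def fun_eq_iff)
    ultimately show ?thesis by simp
  qed
  obtain e00 r00 where 00: "double_series 3 e00" "0 < r00" "\<And>\<mu> k. cmod \<mu> < r00 \<Longrightarrow> \<bar>k\<bar> < r00 \<Longrightarrow> Mx 0 0 \<mu> k = Qx 0 0 \<mu> k + e00 \<mu> k"
    using Mx_ps[of 0 0] by auto
  obtain e01 r01 where 01: "double_series 3 e01" "0 < r01" "\<And>\<mu> k. cmod \<mu> < r01 \<Longrightarrow> \<bar>k\<bar> < r01 \<Longrightarrow> Mx 0 1 \<mu> k = Qx 0 1 \<mu> k + e01 \<mu> k"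
    using Mx_ps[of 0 1] by auto
  obtain e10 r10 where 10: "double_series 3 e10" "0 < r10" "\<And>\<mu> k. cmod \<mu> < r10 \<Longrightarrow> \<bar>k\<bar> < r10 \<Longrightarrow> Mx 1 0 \<mu> k = Qx 1 0 \<mu> k + e10 \<mu> k"
    using Mx_ps[of 1 0] by auto
  obtain e11 r11 where 11: "double_series 3 e11" "0 < r11" "\<And>\<mu> k. cmod \<mu> < r11 \<Longrightarrow> \<bar>k\<bar> < r11 \<Longrightarrow> Mx 1 1 \<mu> k = Qx 1 1 \<mu> k + e11 \<mu> k"
    using Mx_ps[of 1 1] by auto
  define Rem where "Rem \<mu> k = (Qx 0 0 \<mu> k * e11 \<mu> k + Qx 1 1 \<mu> k * e00 \<mu> k) - (Qx 0 1 \<mu> k * e10 \<mu> k + Qx 1 0 \<mu> k * e01 \<mu> k)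
     + (e00 \<mu> k * e11 \<mu> k - e01 \<mu> k * e10 \<mu> k)" for \<mu> k
  have "double_series 5 Rem"
  proof -
    have 6: "double_series 5 (\<lambda>\<mu> k. e00 \<mu> k * e11 \<mu> k)" "double_series 5 (\<lambda>\<mu> k. e01 \<mu> k * e10 \<mu> k)"
      using double_series_mono[OF double_series_mult[OF 00(1) 11(1)], of 5] double_series_mono[OF double_series_mult[OF 01(1) 10(1)], of 5] by simp_all
    have 5: "double_series 5 (\<lambda>\<mu> k. Qx i j \<mu> k * e \<mu> k)" if "double_series 3 e" for i j e
      using double_series_mult[OF Q that] by simp
    show ?thesis unfolding Rem_def[abs_def]
      by (rule double_series_add[OF double_series_diff[OF double_series_add[OF 5[OF 11(1)] 5[OF 00(1)]] double_series_add[OF 5[OF 10(1)] 5[OF 01(1)]]] double_series_diff[OF 6]])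
  qed
  define r where "r = Min {r00, r01, r10, r11, 1 / (4 * opC)}"
  have r: "0 < r" "r \<le> r00" "r \<le> r01" "r \<le> r10" "r \<le> r11" "r \<le> 1 / (4 * opC)"
    using 00 01 10 11 opC(1) by (simp_all add: r_def)
  have "eig sg \<mu> k \<longleftrightarrow> Qx 0 0 \<mu> k * Qx 1 1 \<mu> k - Qx 0 1 \<mu> k * Qx 1 0 \<mu> k + Rem \<mu> k = 0" if "cmod \<mu> < r" "\<bar>k\<bar> < r" for \<mu> k
  proof -
    have "eig sg \<mu> k \<longleftrightarrow> Mx 0 0 \<mu> k * Mx 1 1 \<mu> k - Mx 0 1 \<mu> k * Mx 1 0 \<mu> k = 0"
      using that r by (intro eig_iff_det) auto
    also have "Mx 0 0 \<mu> k * Mx 1 1 \<mu> k - Mx 0 1 \<mu> k * Mx 1 0 \<mu> k = Qx 0 0 \<mu> k * Qx 1 1 \<mu> k - Qx 0 1 \<mu> k * Qx 1 0 \<mu> k + Rem \<mu> k"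
      using that r by (simp add: 00(3) 01(3) 10(3) 11(3) Rem_def algebra_simps)
    finally show ?thesis .
  qed
  thus ?thesis using \<open>double_series 5 Rem\<close> r(1) by blast
qed

end

end

section \<open>Gronwall estimates for second-order equations\<close>

lemma compact_interval_bound:
  fixes g :: "real \<Rightarrow> real"
  assumes "continuous_on {m..M} g" shows "\<exists>C. \<forall>a\<in>{m..M}. \<bar>g a\<bar> \<le> C"
  using compact_imp_bounded[OF compact_continuous_image[OF assms compact_Icc]] by (auto simp: bounded_iff)

text \<open>x^2 + x1^2 + \<epsilon>^2, damped by exp (- (2 + C) y), does not increase.\<close>

lemma gronwall_right:
  fixes x x1 x2 :: "real \<Rightarrow> real"
  assumes d: "\<And>y. (x has_real_derivative x1 y) (at y)" "\<And>y. (x1 has_real_derivative x2 y) (at y)"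
    and b: "\<And>y. 0 \<le> y \<Longrightarrow> y \<le> Y \<Longrightarrow> \<bar>x2 y\<bar> \<le> C * \<bar>x y\<bar> + \<epsilon>" and C: "0 \<le> C" and e: "0 \<le> \<epsilon>"
    and y: "0 \<le> y" "y \<le> Y"
  shows "\<bar>x y\<bar> \<le> exp ((2 + C) * Y) * (\<bar>x 0\<bar> + \<bar>x1 0\<bar> + \<epsilon>) \<and> \<bar>x1 y\<bar> \<le> exp ((2 + C) * Y) * (\<bar>x 0\<bar> + \<bar>x1 0\<bar> + \<epsilon>)"
proof -
  \<comment> \<open>Including \<epsilon>^2 absorbs the inhomogeneous term, by 2 |x1| \<epsilon> <=
    x1^2 + \<epsilon>^2.\<close>
  define p where "p y = ((x y)\<^sup>2 + (x1 y)\<^sup>2 + \<epsilon>\<^sup>2) * exp (- ((2 + C) * y))" for y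
  have "p y \<le> p 0"
  proof (rule DERIV_nonpos_imp_nonincreasing[OF y(1)])
    fix t assume t: "0 \<le> t" "t \<le> y"
    let ?z = "(x t)\<^sup>2 + (x1 t)\<^sup>2 + \<epsilon>\<^sup>2"
    have der: "(p has_real_derivative (2 * x t * x1 t + 2 * x1 t * x2 t - (2 + C) * ?z) * exp (- ((2 + C) * t))) (at t)"
      unfolding p_def by (auto intro!: derivative_eq_intros d simp: algebra_simps)
    have 1: "2 * x t * x1 t \<le> (x t)\<^sup>2 + (x1 t)\<^sup>2" using sum_squares_bound[of "x t" "x1 t"] by simp
    have "2 * x1 t * x2 t \<le> 2 * (\<bar>x1 t\<bar> * \<bar>x2 t\<bar>)" using abs_ge_self[of "x1 t * x2 t"] by (simp add: abs_mult)
    also have "\<dots> \<le> 2 * (\<bar>x1 t\<bar> * (C * \<bar>x t\<bar> + \<epsilon>))" using b[of t] t y by (intro mult_left_mono) auto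
    also have "\<dots> = C * (2 * \<bar>x t\<bar> * \<bar>x1 t\<bar>) + 2 * \<bar>x1 t\<bar> * \<epsilon>" by (simp add: algebra_simps)
    also have "\<dots> \<le> C * ((x t)\<^sup>2 + (x1 t)\<^sup>2) + ((x1 t)\<^sup>2 + \<epsilon>\<^sup>2)"
      using sum_squares_bound[of "\<bar>x t\<bar>" "\<bar>x1 t\<bar>"] sum_squares_bound[of "\<bar>x1 t\<bar>" \<epsilon>] C
      by (intro add_mono mult_left_mono) auto
    finally have 2: "2 * x1 t * x2 t \<le> C * ((x t)\<^sup>2 + (x1 t)\<^sup>2) + ((x1 t)\<^sup>2 + \<epsilon>\<^sup>2)" .
    have 3: "0 \<le> C * \<epsilon>\<^sup>2" using C by simp
    have "2 * x t * x1 t + 2 * x1 t * x2 t - (2 + C) * ?z \<le> 0"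
    proof -
      have "(2 + C) * ?z = 2 * (x t)\<^sup>2 + 2 * (x1 t)\<^sup>2 + 2 * \<epsilon>\<^sup>2 + C * ((x t)\<^sup>2 + (x1 t)\<^sup>2) + C * \<epsilon>\<^sup>2"
        by (simp add: algebra_simps)
      thus ?thesis using 1 2 3 zero_le_power2[of "x t"] zero_le_power2[of \<epsilon>] by linarith
    qed
    hence "(2 * x t * x1 t + 2 * x1 t * x2 t - (2 + C) * ?z) * exp (- ((2 + C) * t)) \<le> 0"
      by (intro mult_nonpos_nonneg) auto
    thus "\<exists>q. (p has_real_derivative q) (at t) \<and> q \<le> 0" using der by blast
  qed
  hence "((x y)\<^sup>2 + (x1 y)\<^sup>2 + \<epsilon>\<^sup>2) \<le> exp ((2 + C) * y) * ((x 0)\<^sup>2 + (x1 0)\<^sup>2 + \<epsilon>\<^sup>2)"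
  proof -
    let ?a = "(x y)\<^sup>2 + (x1 y)\<^sup>2 + \<epsilon>\<^sup>2"
    have "?a = exp ((2 + C) * y) * p y" unfolding p_def by (simp add: exp_minus)
    also have "\<dots> \<le> exp ((2 + C) * y) * p 0" using \<open>p y \<le> p 0\<close> by (intro mult_left_mono) auto
    finally show ?thesis by (simp add: p_def)
  qed
  also have "\<dots> \<le> exp ((2 + C) * Y) * ((x 0)\<^sup>2 + (x1 0)\<^sup>2 + \<epsilon>\<^sup>2)"
    using y C by (intro mult_right_mono) (auto intro: mult_left_mono)
  \<comment> \<open>The exponential is at least 1, so it may be squared; the right-hand side becomes
    a perfect square and the root can be taken.\<close>
  also have "\<dots> \<le> (exp ((2 + C) * Y))\<^sup>2 * (\<bar>x 0\<bar> + \<bar>x1 0\<bar> + \<epsilon>)\<^sup>2"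
  proof (intro mult_mono)
    have "1 \<le> exp ((2 + C) * Y)" using y C by simp
    thus "exp ((2 + C) * Y) \<le> (exp ((2 + C) * Y))\<^sup>2" by (simp add: power2_eq_square mult_le_cancel_left1)
    have "0 \<le> \<bar>x 0\<bar> * \<bar>x1 0\<bar> + \<bar>x 0\<bar> * \<epsilon> + \<bar>x1 0\<bar> * \<epsilon>" using e by simp
    thus "(x 0)\<^sup>2 + (x1 0)\<^sup>2 + \<epsilon>\<^sup>2 \<le> (\<bar>x 0\<bar> + \<bar>x1 0\<bar> + \<epsilon>)\<^sup>2" by (simp add: power2_eq_square algebra_simps)
  qed auto
  finally have fin: "(x y)\<^sup>2 + (x1 y)\<^sup>2 + \<epsilon>\<^sup>2 \<le> (exp ((2 + C) * Y) * (\<bar>x 0\<bar> + \<bar>x1 0\<bar> + \<epsilon>))\<^sup>2"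
    by (simp add: power_mult_distrib)
  have nn: "0 \<le> exp ((2 + C) * Y) * (\<bar>x 0\<bar> + \<bar>x1 0\<bar> + \<epsilon>)" using e by simp
  have "\<bar>x y\<bar>\<^sup>2 \<le> (exp ((2 + C) * Y) * (\<bar>x 0\<bar> + \<bar>x1 0\<bar> + \<epsilon>))\<^sup>2"
    "\<bar>x1 y\<bar>\<^sup>2 \<le> (exp ((2 + C) * Y) * (\<bar>x 0\<bar> + \<bar>x1 0\<bar> + \<epsilon>))\<^sup>2"
    using fin zero_le_power2[of "x y"] zero_le_power2[of "x1 y"] zero_le_power2[of \<epsilon>] by (auto simp only: power2_abs)
  thus ?thesis using nn power2_le_imp_le by blast
qed

text \<open>Negative y is reduced to positive y by the reflection y -> - y, under which the equation
  keeps its form and the first derivative changes sign.\<close>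

lemma gronwall:
  fixes x x1 x2 :: "real \<Rightarrow> real"
  assumes d: "\<And>y. (x has_real_derivative x1 y) (at y)" "\<And>y. (x1 has_real_derivative x2 y) (at y)"
    and b: "\<And>y. \<bar>y\<bar> \<le> Y \<Longrightarrow> \<bar>x2 y\<bar> \<le> C * \<bar>x y\<bar> + \<epsilon>" and C: "0 \<le> C" and e: "0 \<le> \<epsilon>"
    and y: "\<bar>y\<bar> \<le> Y"
  shows "\<bar>x y\<bar> \<le> exp ((2 + C) * Y) * (\<bar>x 0\<bar> + \<bar>x1 0\<bar> + \<epsilon>) \<and> \<bar>x1 y\<bar> \<le> exp ((2 + C) * Y) * (\<bar>x 0\<bar> + \<bar>x1 0\<bar> + \<epsilon>)"
proof (cases "0 \<le> y")
  case True
  show ?thesis by (rule gronwall_right[OF d b C e True]) (use y in auto)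
next
  case False
  have d': "((\<lambda>y. x (- y)) has_real_derivative - x1 (- y)) (at y)" "((\<lambda>y. - x1 (- y)) has_real_derivative x2 (- y)) (at y)" for y
    using DERIV_mirror[of x "x1 (- y)" y] DERIV_minus[OF DERIV_mirror[THEN iffD1], of x1 "x2 (- y)" y] d by auto
  have "\<bar>x (- (- y))\<bar> \<le> exp ((2 + C) * Y) * (\<bar>x (- 0)\<bar> + \<bar>- x1 (- 0)\<bar> + \<epsilon>) \<and> \<bar>- x1 (- (- y))\<bar> \<le> exp ((2 + C) * Y) * (\<bar>x (- 0)\<bar> + \<bar>- x1 (- 0)\<bar> + \<epsilon>)"
  proof (rule gronwall_right[where x="\<lambda>y. x (- y)" and ?x1.0="\<lambda>y. - x1 (- y)" and ?x2.0="\<lambda>y. x2 (- y)", OF d' _ C e])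
    show "\<bar>x2 (- y)\<bar> \<le> C * \<bar>x (- y)\<bar> + \<epsilon>" if "0 \<le> y" "y \<le> Y" for y using b[of "- y"] that by simp
  qed (use False y in auto)
  thus ?thesis by simp
qed

lemma deriv_uniform_limit:
  fixes f f' :: "nat \<Rightarrow> real \<Rightarrow> real"
  assumes d: "\<And>n x. \<bar>x\<bar> < Y \<Longrightarrow> (f n has_real_derivative f' n x) (at x)"
    and u: "\<And>e. 0 < e \<Longrightarrow> \<forall>\<^sub>F n in sequentially. \<forall>x. \<bar>x\<bar> < Y \<longrightarrow> \<bar>f' n x - g' x\<bar> \<le> e"
    and l: "\<And>x. \<bar>x\<bar> < Y \<Longrightarrow> (\<lambda>n. f n x) \<longlonglongrightarrow> g x" and x: "\<bar>x\<bar> < Y"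
  shows "(g has_real_derivative g' x) (at x)"
proof -
  have mem: "t \<in> {-Y<..<Y} \<longleftrightarrow> \<bar>t\<bar> < Y" for t by auto
  have "\<exists>q. \<forall>t\<in>{-Y<..<Y}. (\<lambda>n. f n t) \<longlonglongrightarrow> q t \<and> (q has_derivative (\<lambda>h. g' t * h)) (at t within {-Y<..<Y})"
  proof (rule has_derivative_sequence)
    show "(f n has_derivative (\<lambda>h. f' n t * h)) (at t within {-Y<..<Y})" if "t \<in> {-Y<..<Y}" for n t
    proof -
      have "(f n has_derivative (*) (f' n t)) (at t)" using d[of t n] that unfolding mem has_field_derivative_def .
      thus ?thesis by (rule has_derivative_at_withinI)
    qed
    show "\<forall>\<^sub>F n in sequentially. \<forall>t\<in>{-Y<..<Y}. \<forall>h. norm (f' n t * h - g' t * h) \<le> e * norm h" if "0 < e" for e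
      using u[OF that]
    proof eventually_elim
      case (elim n)
      show ?case
      proof (intro ballI allI)
        fix t h :: real assume "t \<in> {-Y<..<Y}"
        hence "\<bar>f' n t - g' t\<bar> \<le> e" using elim by (auto simp: mem)
        hence "\<bar>f' n t - g' t\<bar> * \<bar>h\<bar> \<le> e * \<bar>h\<bar>" by (rule mult_right_mono) simp
        thus "norm (f' n t * h - g' t * h) \<le> e * norm h" by (simp flip: abs_mult add: left_diff_distrib)
      qed
    qed
    show "x \<in> {-Y<..<Y}" using x mem by simp
    show "(\<lambda>n. f n x) \<longlonglongrightarrow> g x" by (rule l[OF x])
  qed auto
  then obtain q where q: "\<And>t. t \<in> {-Y<..<Y} \<Longrightarrow> (\<lambda>n. f n t) \<longlonglongrightarrow> q t"
    "\<And>t. t \<in> {-Y<..<Y} \<Longrightarrow> (q has_derivative (\<lambda>h. g' t * h)) (at t within {-Y<..<Y})" by blast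
  have "q t = g t" if "t \<in> {-Y<..<Y}" for t
    using LIMSEQ_unique[OF q(1)[OF that] l[of t]] that unfolding mem by blast
  moreover have "(q has_real_derivative g' x) (at x)"
  proof -
    have xS: "x \<in> {-Y<..<Y}" using x mem by simp
    have "(q has_derivative (\<lambda>h. g' x * h)) (at x)"
      using q(2)[OF xS] unfolding at_within_open[OF xS open_greaterThanLessThan] .
    thus ?thesis by (simp add: has_field_derivative_def)
  qed
  ultimately show ?thesis
    using has_field_derivative_transform_within_open[of q "g' x" x "{-Y<..<Y}" g] x mem open_greaterThanLessThan by blast
qed

section \<open>Dependence of the profile on the parameters\<close>

text \<open>A one-parameter family of initial value problems A'' = N_h(A), A(0) = l(h), A'(0) = 0,
  with values in a fixed compact interval. \<open>n h\<close> is the difference quotient of the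
  right-hand side in h, and \<open>Na\<close> is the derivative of \<open>N 0\<close> in the
  amplitude.\<close>

locale ivp =
  fixes A A1 N n :: "real \<Rightarrow> real \<Rightarrow> real" and Na l :: "real \<Rightarrow> real" and h0 m M l' :: real
  assumes h0: "0 < h0" and mM: "m \<le> M"
    and dA: "\<And>h y. \<bar>h\<bar> < h0 \<Longrightarrow> (A h has_real_derivative A1 h y) (at y)"
    and dA1: "\<And>h y. \<bar>h\<bar> < h0 \<Longrightarrow> (A1 h has_real_derivative N h (A h y)) (at y)"
    and rng: "\<And>h y. \<bar>h\<bar> < h0 \<Longrightarrow> A h y \<in> {m..M}"
    and init: "\<And>h. \<bar>h\<bar> < h0 \<Longrightarrow> A h 0 = l h" "\<And>h. \<bar>h\<bar> < h0 \<Longrightarrow> A1 h 0 = 0"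
    and Nn: "\<And>h a. \<bar>h\<bar> < h0 \<Longrightarrow> a \<in> {m..M} \<Longrightarrow> N h a = N 0 a + h * n h a"
    and dN: "\<And>a. a \<in> {m..M} \<Longrightarrow> (N 0 has_real_derivative Na a) (at a)"
    and cNa: "continuous_on {m..M} Na"
    and un: "uniform_limit {m..M} n (n 0) (at 0)" and cn: "continuous_on {m..M} (n 0)"
    and dl: "(l has_real_derivative l') (at 0)"
begin

definition CN :: real where "CN = (SOME C. 0 \<le> C \<and> (\<forall>a\<in>{m..M}. \<bar>Na a\<bar> \<le> C))"

lemma CN: "0 \<le> CN" "a \<in> {m..M} \<Longrightarrow> \<bar>Na a\<bar> \<le> CN"
proof -
  obtain C where C: "\<And>a. a \<in> {m..M} \<Longrightarrow> \<bar>Na a\<bar> \<le> C"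
    using compact_interval_bound[OF cNa] by blast
  have "0 \<le> C" using C[of m] mM by simp
  hence "0 \<le> C \<and> (\<forall>a\<in>{m..M}. \<bar>Na a\<bar> \<le> C)" using C by blast
  hence "0 \<le> CN \<and> (\<forall>a\<in>{m..M}. \<bar>Na a\<bar> \<le> CN)" unfolding CN_def by (rule someI)
  thus "0 \<le> CN" "a \<in> {m..M} \<Longrightarrow> \<bar>Na a\<bar> \<le> CN" by auto
qed

lemma N_mvt:
  assumes "a \<in> {m..M}" "b \<in> {m..M}"
  obtains \<xi> where "\<xi> \<in> {m..M}" "\<bar>\<xi> - a\<bar> \<le> \<bar>b - a\<bar>" "N 0 b - N 0 a = Na \<xi> * (b - a)"
proof (cases a b rule: linorder_cases)
  case less
  from MVT2[OF less, of "N 0" Na] dN assms obtain z where "a < z" "z < b" "N 0 b - N 0 a = (b - a) * Na z" by auto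
  thus ?thesis using that[of z] assms by (auto simp: mult.commute)
next
  case equal
  thus ?thesis using that[of a] assms by auto
next
  case greater
  from MVT2[OF greater, of "N 0" Na] dN assms obtain z where "b < z" "z < a" "N 0 a - N 0 b = (a - b) * Na z" by auto
  thus ?thesis using that[of z] assms by (auto simp: algebra_simps)
qed

lemma n_bound: obtains Cn d where "0 < d" "d \<le> h0" "0 \<le> Cn" "\<And>h a. \<bar>h\<bar> < d \<Longrightarrow> a \<in> {m..M} \<Longrightarrow> \<bar>n h a\<bar> \<le> Cn"
proof -
  obtain C where C: "\<And>a. a \<in> {m..M} \<Longrightarrow> \<bar>n 0 a\<bar> \<le> C"
    using compact_interval_bound[OF cn] by blast
  have C0: "0 \<le> C" using C[of m] mM by simp
  have "\<forall>\<^sub>F h in at 0. \<forall>a\<in>{m..M}. dist (n h a) (n 0 a) < 1" using un by (auto simp: uniform_limit_iff)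
  then obtain d where d: "0 < d" "\<And>h a. h \<noteq> 0 \<Longrightarrow> \<bar>h\<bar> < d \<Longrightarrow> a \<in> {m..M} \<Longrightarrow> \<bar>n h a - n 0 a\<bar> < 1"
    unfolding eventually_at by (auto simp: dist_real_def)
  have "\<bar>n h a\<bar> \<le> C + 1" if "\<bar>h\<bar> < min d h0" "a \<in> {m..M}" for h a
    using d(2)[of h a] C[OF that(2)] that by (cases "h = 0") auto
  thus ?thesis using that[of "min d h0" "C + 1"] d(1) h0 C0 by auto
qed

text \<open>The difference of two solutions satisfies a Gronwall inequality with inhomogeneity and
  initial values of size |h|.\<close>

lemma Lipschitz_in_h:
  assumes "0 < Y"
  obtains C d where "0 < d" "d \<le> h0" "0 \<le> C"
    "\<And>h y. \<bar>h\<bar> < d \<Longrightarrow> \<bar>y\<bar> \<le> Y \<Longrightarrow> \<bar>A h y - A 0 y\<bar> \<le> C * \<bar>h\<bar> \<and> \<bar>A1 h y - A1 0 y\<bar> \<le> C * \<bar>h\<bar>"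
proof -
  obtain Cn d1 where d1: "0 < d1" "d1 \<le> h0" "0 \<le> Cn" "\<And>h a. \<bar>h\<bar> < d1 \<Longrightarrow> a \<in> {m..M} \<Longrightarrow> \<bar>n h a\<bar> \<le> Cn"
    by (rule n_bound, rule that; assumption)
  have "((\<lambda>h. (l h - l 0) / h) \<longlongrightarrow> l') (at 0)" using dl by (simp add: DERIV_def)
  hence "\<forall>\<^sub>F h in at 0. dist ((l h - l 0) / h) l' < 1" by (rule tendstoD) simp
  then obtain d2 where d2: "0 < d2" "\<And>h. h \<noteq> 0 \<Longrightarrow> \<bar>h\<bar> < d2 \<Longrightarrow> \<bar>(l h - l 0) / h - l'\<bar> < 1"
    unfolding eventually_at by (auto simp: dist_real_def)
  define Cl where "Cl = \<bar>l'\<bar> + 1"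
  have Cl: "\<bar>l h - l 0\<bar> \<le> Cl * \<bar>h\<bar>" if "\<bar>h\<bar> < d2" for h
  proof (cases "h = 0")
    case False
    have "\<bar>(l h - l 0) / h\<bar> \<le> Cl" using d2(2)[OF False that] by (simp add: Cl_def)
    thus ?thesis using False by (simp add: abs_divide divide_le_eq)
  qed simp
  define K where "K = exp ((2 + CN) * Y) * (Cl + Cn)"
  show ?thesis
  proof (rule that[of "min d1 d2" K])
    fix h y :: real assume h: "\<bar>h\<bar> < min d1 d2" and y: "\<bar>y\<bar> \<le> Y"
    have hh: "\<bar>h\<bar> < h0" using h d1 by simp
    have z: "\<bar>0\<bar> < h0" using h0 by simp
    have "\<bar>A h y - A 0 y\<bar> \<le> exp ((2 + CN) * Y) * (\<bar>A h 0 - A 0 0\<bar> + \<bar>A1 h 0 - A1 0 0\<bar> + Cn * \<bar>h\<bar>) \<and>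
          \<bar>A1 h y - A1 0 y\<bar> \<le> exp ((2 + CN) * Y) * (\<bar>A h 0 - A 0 0\<bar> + \<bar>A1 h 0 - A1 0 0\<bar> + Cn * \<bar>h\<bar>)"
    proof (rule gronwall[where x="\<lambda>y. A h y - A 0 y" and ?x1.0="\<lambda>y. A1 h y - A1 0 y" and ?x2.0="\<lambda>y. N h (A h y) - N 0 (A 0 y)", OF _ _ _ CN(1) _ y])
      fix y
      show "((\<lambda>y. A h y - A 0 y) has_real_derivative A1 h y - A1 0 y) (at y)"
        by (intro DERIV_diff dA hh z)
      show "((\<lambda>y. A1 h y - A1 0 y) has_real_derivative N h (A h y) - N 0 (A 0 y)) (at y)"
        by (intro DERIV_diff dA1 hh z)
      obtain \<xi> where \<xi>: "\<xi> \<in> {m..M}" "N 0 (A h y) - N 0 (A 0 y) = Na \<xi> * (A h y - A 0 y)"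
        using N_mvt[OF rng[OF z, of y] rng[OF hh, of y]] by blast
      have "N h (A h y) - N 0 (A 0 y) = Na \<xi> * (A h y - A 0 y) + h * n h (A h y)"
        using Nn[OF hh rng[OF hh]] \<xi>(2) by simp
      also have "\<bar>\<dots>\<bar> \<le> \<bar>Na \<xi>\<bar> * \<bar>A h y - A 0 y\<bar> + \<bar>h\<bar> * \<bar>n h (A h y)\<bar>"
        by (simp add: abs_triangle_ineq[THEN order_trans] abs_mult)
      also have "\<dots> \<le> CN * \<bar>A h y - A 0 y\<bar> + \<bar>h\<bar> * Cn"
        using CN(2)[OF \<xi>(1)] d1(4)[OF _ rng[OF hh]] h by (intro add_mono mult_right_mono mult_left_mono) auto
      finally show "\<bar>N h (A h y) - N 0 (A 0 y)\<bar> \<le> CN * \<bar>A h y - A 0 y\<bar> + Cn * \<bar>h\<bar>" by (simp add: mult.commute)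
    qed (use d1 in auto)
    moreover have "exp ((2 + CN) * Y) * (\<bar>A h 0 - A 0 0\<bar> + \<bar>A1 h 0 - A1 0 0\<bar> + Cn * \<bar>h\<bar>) \<le> K * \<bar>h\<bar>"
      unfolding init[OF hh] init[OF z] K_def mult.assoc using Cl[of h] h
      by (intro mult_left_mono) (auto simp: algebra_simps)
    ultimately show "\<bar>A h y - A 0 y\<bar> \<le> K * \<bar>h\<bar> \<and> \<bar>A1 h y - A1 0 y\<bar> \<le> K * \<bar>h\<bar>" by linarith
  qed (use d1 d2 in \<open>auto simp: K_def Cl_def\<close>)
qed

definition DQ :: "real \<Rightarrow> real \<Rightarrow> real" where "DQ h y = (A h y - A 0 y) / h"
definition DQ1 :: "real \<Rightarrow> real \<Rightarrow> real" where "DQ1 h y = (A1 h y - A1 0 y) / h"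

lemma DQ_deriv:
  assumes "\<bar>h\<bar> < h0"
  shows "(DQ h has_real_derivative DQ1 h y) (at y)"
    "(DQ1 h has_real_derivative (N h (A h y) - N 0 (A 0 y)) / h) (at y)"
  unfolding DQ_def[abs_def] DQ1_def[abs_def] using h0 assms by (auto intro!: DERIV_cdivide DERIV_diff dA dA1)

text \<open>The difference quotients solve the linearized equation up to an error that is small
  uniformly on [-Y, Y].\<close>

lemma N_quotient:
  assumes "0 < Y" "0 < e"
  obtains d where "0 < d" "d \<le> h0"
    "\<And>h y. h \<noteq> 0 \<Longrightarrow> \<bar>h\<bar> < d \<Longrightarrow> \<bar>y\<bar> \<le> Y \<Longrightarrow>
       \<bar>(N h (A h y) - N 0 (A 0 y)) / h - (Na (A 0 y) * DQ h y + n 0 (A 0 y))\<bar> \<le> e"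
proof -
  obtain C d1 where C: "0 < d1" "d1 \<le> h0" "0 \<le> C"
    "\<And>h y. \<bar>h\<bar> < d1 \<Longrightarrow> \<bar>y\<bar> \<le> Y \<Longrightarrow> \<bar>A h y - A 0 y\<bar> \<le> C * \<bar>h\<bar> \<and> \<bar>A1 h y - A1 0 y\<bar> \<le> C * \<bar>h\<bar>"
    by (rule Lipschitz_in_h[OF assms(1)], rule that; assumption)
  have ucN: "uniformly_continuous_on {m..M} Na" "uniformly_continuous_on {m..M} (n 0)"
    by (intro compact_uniformly_continuous cNa cn; simp)+
  define e1 where "e1 = e / (3 * (C + 1))"
  have e1: "0 < e1" using assms(2) C by (simp add: e1_def)
  have e3: "0 < e / 3" using assms(2) by simp
  obtain s1 where s1: "0 < s1" "\<And>a b. a \<in> {m..M} \<Longrightarrow> b \<in> {m..M} \<Longrightarrow> \<bar>b - a\<bar> < s1 \<Longrightarrow> \<bar>Na b - Na a\<bar> < e1"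
    using ucN(1)[unfolded uniformly_continuous_on_def, rule_format, OF e1] unfolding dist_real_def by blast
  obtain s2 where s2: "0 < s2" "\<And>a b. a \<in> {m..M} \<Longrightarrow> b \<in> {m..M} \<Longrightarrow> \<bar>b - a\<bar> < s2 \<Longrightarrow> \<bar>n 0 b - n 0 a\<bar> < e / 3"
    using ucN(2)[unfolded uniformly_continuous_on_def, rule_format, OF e3] unfolding dist_real_def by blast
  have "\<forall>\<^sub>F h in at 0. \<forall>a\<in>{m..M}. dist (n h a) (n 0 a) < e / 3" using uniform_limitD[OF un e3] .
  then obtain d2 where d2: "0 < d2" "\<And>h a. h \<noteq> 0 \<Longrightarrow> \<bar>h\<bar> < d2 \<Longrightarrow> a \<in> {m..M} \<Longrightarrow> \<bar>n h a - n 0 a\<bar> < e / 3"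
    unfolding eventually_at by (auto simp: dist_real_def)
  \<comment> \<open>The error splits into three parts: the oscillation of \<open>Na\<close> times
    the bound C of the quotient, the distance of \<open>n h\<close> from \<open>n 0\<close>, and the
    oscillation of \<open>n 0\<close>. Each is held below e / 3.\<close>
  define d where "d = Min {d1, d2, s1 / (C + 1), s2 / (C + 1)}"
  have d: "0 < d" "d \<le> d1" "d \<le> d2" "d \<le> s1 / (C + 1)" "d \<le> s2 / (C + 1)"
    using C d2 s1 s2 by (simp_all add: d_def)
  show ?thesis
  proof (rule that[of d])
    fix h y :: real assume h: "h \<noteq> 0" "\<bar>h\<bar> < d" and y: "\<bar>y\<bar> \<le> Y"
    have hh: "\<bar>h\<bar> < h0" and z: "\<bar>0\<bar> < h0" using h d C h0 by auto
    note r = rng[OF hh, of y] rng[OF z, of y]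
    have AC: "\<bar>A h y - A 0 y\<bar> \<le> C * \<bar>h\<bar>" using C(4)[of h y] h d y by simp
    have small: "\<bar>A h y - A 0 y\<bar> < s" if "d \<le> s / (C + 1)" "0 < s" for s
    proof -
      have "\<bar>h\<bar> < s / (C + 1)" using h that by simp
      hence "\<bar>h\<bar> * (C + 1) < s" using C(3) by (simp add: pos_less_divide_eq)
      moreover have "C * \<bar>h\<bar> \<le> \<bar>h\<bar> * (C + 1)" by (simp add: algebra_simps)
      ultimately show ?thesis using AC by linarith
    qed
    obtain \<xi> where \<xi>: "\<xi> \<in> {m..M}" "\<bar>\<xi> - A 0 y\<bar> \<le> \<bar>A h y - A 0 y\<bar>" "N 0 (A h y) - N 0 (A 0 y) = Na \<xi> * (A h y - A 0 y)"
      using N_mvt[OF r(2,1)] by blast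
    have eq: "(N h (A h y) - N 0 (A 0 y)) / h - (Na (A 0 y) * DQ h y + n 0 (A 0 y)) =
       (Na \<xi> - Na (A 0 y)) * DQ h y + ((n h (A h y) - n 0 (A h y)) + (n 0 (A h y) - n 0 (A 0 y)))"
    proof -
      have "N h (A h y) - N 0 (A 0 y) = Na \<xi> * (A h y - A 0 y) + h * n h (A h y)"
        using Nn[OF hh r(1)] \<xi>(3) by simp
      hence "(N h (A h y) - N 0 (A 0 y)) / h = Na \<xi> * DQ h y + n h (A h y)"
        using h by (simp add: DQ_def add_divide_distrib)
      thus ?thesis by (simp add: algebra_simps)
    qed
    have DQC: "\<bar>DQ h y\<bar> \<le> C" using AC h by (simp add: DQ_def abs_divide divide_le_eq)
    have "\<bar>Na \<xi> - Na (A 0 y)\<bar> < e1" using small[OF d(4) s1(1)] \<xi> r by (intro s1(2)) auto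
    hence "\<bar>(Na \<xi> - Na (A 0 y)) * DQ h y\<bar> \<le> e1 * C" unfolding abs_mult using DQC by (intro mult_mono) auto
    also have "\<dots> \<le> e / 3" using C(3) assms(2) by (simp add: e1_def field_simps)
    finally have 1: "\<bar>(Na \<xi> - Na (A 0 y)) * DQ h y\<bar> \<le> e / 3" .
    have 2: "\<bar>n h (A h y) - n 0 (A h y)\<bar> < e / 3" using h d r by (intro d2(2)) auto
    have 3: "\<bar>n 0 (A h y) - n 0 (A 0 y)\<bar> < e / 3" using small[OF d(5) s2(1)] r by (intro s2(2)) auto
    show "\<bar>(N h (A h y) - N 0 (A 0 y)) / h - (Na (A 0 y) * DQ h y + n 0 (A 0 y))\<bar> \<le> e"
      unfolding eq using 1 2 3 by linarith
  qed (use d C in auto)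
qed

text \<open>Two difference quotients solve nearly the same linear equation with nearly the same
  initial values, so Gronwall bounds their distance. The derivative in h thus arises as a Cauchy
  limit, and no solution of the linearized equation has to be constructed first.\<close>

lemma DQ_Cauchy:
  assumes "0 < Y" "0 < e"
  obtains d where "0 < d" "d \<le> h0"
    "\<And>h k y. h \<noteq> 0 \<Longrightarrow> \<bar>h\<bar> < d \<Longrightarrow> k \<noteq> 0 \<Longrightarrow> \<bar>k\<bar> < d \<Longrightarrow> \<bar>y\<bar> \<le> Y \<Longrightarrow> \<bar>DQ h y - DQ k y\<bar> \<le> e \<and> \<bar>DQ1 h y - DQ1 k y\<bar> \<le> e"
proof -
  define K where "K = exp ((2 + CN) * Y)"
  have K: "0 < K" by (simp add: K_def)
  \<comment> \<open>The initial values contribute \<open>2 * e1\<close> and the inhomogeneity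
    another \<open>2 * e1\<close>, both multiplied by K.\<close>
  define e1 where "e1 = e / (4 * K)"
  have e1: "0 < e1" using assms(2) K by (simp add: e1_def)
  obtain d1 where d1: "0 < d1" "d1 \<le> h0"
    "\<And>h y. h \<noteq> 0 \<Longrightarrow> \<bar>h\<bar> < d1 \<Longrightarrow> \<bar>y\<bar> \<le> Y \<Longrightarrow>
       \<bar>(N h (A h y) - N 0 (A 0 y)) / h - (Na (A 0 y) * DQ h y + n 0 (A 0 y))\<bar> \<le> e1"
    by (rule N_quotient[OF assms(1) e1], rule that; assumption)
  have "((\<lambda>h. (l h - l 0) / h) \<longlongrightarrow> l') (at 0)" using dl by (simp add: DERIV_def)
  hence "\<forall>\<^sub>F h in at 0. dist ((l h - l 0) / h) l' < e1" using e1 by (rule tendstoD)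
  then obtain d2 where d2: "0 < d2" "\<And>h. h \<noteq> 0 \<Longrightarrow> \<bar>h\<bar> < d2 \<Longrightarrow> \<bar>(l h - l 0) / h - l'\<bar> < e1"
    unfolding eventually_at by (auto simp: dist_real_def)
  show ?thesis
  proof (rule that[of "min d1 d2"])
    fix h k y :: real assume h: "h \<noteq> 0" "\<bar>h\<bar> < min d1 d2" and k: "k \<noteq> 0" "\<bar>k\<bar> < min d1 d2" and y: "\<bar>y\<bar> \<le> Y"
    have hk: "\<bar>h\<bar> < h0" "\<bar>k\<bar> < h0" "\<bar>0\<bar> < h0" using h k d1 h0 by auto
    have "\<bar>DQ h y - DQ k y\<bar> \<le> exp ((2 + CN) * Y) * (\<bar>DQ h 0 - DQ k 0\<bar> + \<bar>DQ1 h 0 - DQ1 k 0\<bar> + 2 * e1) \<and>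
          \<bar>DQ1 h y - DQ1 k y\<bar> \<le> exp ((2 + CN) * Y) * (\<bar>DQ h 0 - DQ k 0\<bar> + \<bar>DQ1 h 0 - DQ1 k 0\<bar> + 2 * e1)"
    proof (rule gronwall[where x="\<lambda>y. DQ h y - DQ k y" and ?x1.0="\<lambda>y. DQ1 h y - DQ1 k y"
          and ?x2.0="\<lambda>y. (N h (A h y) - N 0 (A 0 y)) / h - (N k (A k y) - N 0 (A 0 y)) / k", OF _ _ _ CN(1) _ y])
      fix y
      show "((\<lambda>y. DQ h y - DQ k y) has_real_derivative DQ1 h y - DQ1 k y) (at y)"
        by (intro DERIV_diff DQ_deriv hk)
      show "((\<lambda>y. DQ1 h y - DQ1 k y) has_real_derivative (N h (A h y) - N 0 (A 0 y)) / h - (N k (A k y) - N 0 (A 0 y)) / k) (at y)"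
        by (intro DERIV_diff DQ_deriv hk)
      assume y: "\<bar>y\<bar> \<le> Y"
      have 1: "\<bar>(N h (A h y) - N 0 (A 0 y)) / h - (Na (A 0 y) * DQ h y + n 0 (A 0 y))\<bar> \<le> e1" using h y by (intro d1(3)) auto
      have 2: "\<bar>(N k (A k y) - N 0 (A 0 y)) / k - (Na (A 0 y) * DQ k y + n 0 (A 0 y))\<bar> \<le> e1" using k y by (intro d1(3)) auto
      have 3: "\<bar>Na (A 0 y) * (DQ h y - DQ k y)\<bar> \<le> CN * \<bar>DQ h y - DQ k y\<bar>"
        unfolding abs_mult by (intro mult_right_mono CN(2) rng hk) simp
      show "\<bar>(N h (A h y) - N 0 (A 0 y)) / h - (N k (A k y) - N 0 (A 0 y)) / k\<bar> \<le> CN * \<bar>DQ h y - DQ k y\<bar> + 2 * e1"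
        using 1 2 3 unfolding right_diff_distrib by linarith
    qed (use e1 in auto)
    moreover have "\<bar>DQ h 0 - DQ k 0\<bar> \<le> 2 * e1"
      using d2(2)[of h] d2(2)[of k] h k unfolding DQ_def init(1)[OF hk(1)] init(1)[OF hk(2)] init(1)[OF hk(3)] by auto
    moreover have "DQ1 h 0 - DQ1 k 0 = 0" unfolding DQ1_def init(2)[OF hk(1)] init(2)[OF hk(2)] init(2)[OF hk(3)] by simp
    ultimately have "\<bar>DQ h y - DQ k y\<bar> \<le> K * (2 * e1 + 0 + 2 * e1) \<and> \<bar>DQ1 h y - DQ1 k y\<bar> \<le> K * (2 * e1 + 0 + 2 * e1)"
      unfolding K_def[symmetric] using K
      by (smt (verit, ccfv_SIG) mult_left_mono)
    moreover have "K * (2 * e1 + 0 + 2 * e1) = e" using K by (simp add: e1_def)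
    ultimately show "\<bar>DQ h y - DQ k y\<bar> \<le> e \<and> \<bar>DQ1 h y - DQ1 k y\<bar> \<le> e" by simp
  qed (use d1 d2 in auto)
qed

text \<open>Any sequence of nonzero parameters tending to 0 would do; the summand 2 keeps it
  strictly inside the radius \<open>h0\<close>.\<close>

definition hs :: "nat \<Rightarrow> real" where "hs j = h0 / (of_nat j + 2)"

lemma hs: "hs j \<noteq> 0" "\<bar>hs j\<bar> < h0" "hs \<longlonglongrightarrow> 0"
proof -
  show "hs j \<noteq> 0" using h0 by (simp add: hs_def)
  show "\<bar>hs j\<bar> < h0" using h0 by (simp add: hs_def divide_less_eq)
  have "(\<lambda>j. h0 * (1 / (real j + 2))) \<longlonglongrightarrow> h0 * 0"
    by (intro tendsto_intros) real_asymp
  thus "hs \<longlonglongrightarrow> 0" unfolding hs_def[abs_def] by simp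
qed

definition Da :: "real \<Rightarrow> real" where "Da y = lim (\<lambda>j. DQ (hs j) y)"
definition Da1 :: "real \<Rightarrow> real" where "Da1 y = lim (\<lambda>j. DQ1 (hs j) y)"

lemma hs_small: "0 < d \<Longrightarrow> \<forall>\<^sub>F j in sequentially. \<bar>hs j\<bar> < d"
  using tendstoD[OF hs(3), of d] by (simp add: dist_real_def)

lemma Da_lim: "(\<lambda>j. DQ (hs j) y) \<longlonglongrightarrow> Da y" "(\<lambda>j. DQ1 (hs j) y) \<longlonglongrightarrow> Da1 y"
proof -
  have "\<exists>J. \<forall>i\<ge>J. \<forall>j\<ge>J. \<bar>DQ (hs i) y - DQ (hs j) y\<bar> < e \<and> \<bar>DQ1 (hs i) y - DQ1 (hs j) y\<bar> < e" if epos: "0 < e" for e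
  proof -
    obtain d where d: "0 < d" "\<And>h k y'. h \<noteq> 0 \<Longrightarrow> \<bar>h\<bar> < d \<Longrightarrow> k \<noteq> 0 \<Longrightarrow> \<bar>k\<bar> < d \<Longrightarrow> \<bar>y'\<bar> \<le> \<bar>y\<bar> + 1 \<Longrightarrow> \<bar>DQ h y' - DQ k y'\<bar> \<le> e/2 \<and> \<bar>DQ1 h y' - DQ1 k y'\<bar> \<le> e/2"
      by (rule DQ_Cauchy[of "\<bar>y\<bar> + 1" "e/2"]) (use epos in auto)
    obtain J where J: "\<And>i. i \<ge> J \<Longrightarrow> \<bar>hs i\<bar> < d" using hs_small[OF d(1)] unfolding eventually_sequentially by blast
    have "\<bar>DQ (hs i) y - DQ (hs j) y\<bar> < e \<and> \<bar>DQ1 (hs i) y - DQ1 (hs j) y\<bar> < e" if "i \<ge> J" "j \<ge> J" for i j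
      using d(2)[OF hs(1) J[OF that(1)] hs(1) J[OF that(2)], of y] \<open>0 < e\<close> by auto
    thus ?thesis by blast
  qed
  hence "Cauchy (\<lambda>j. DQ (hs j) y)" "Cauchy (\<lambda>j. DQ1 (hs j) y)"
    unfolding Cauchy_def dist_real_def by blast+
  thus "(\<lambda>j. DQ (hs j) y) \<longlonglongrightarrow> Da y" "(\<lambda>j. DQ1 (hs j) y) \<longlonglongrightarrow> Da1 y"
    unfolding Da_def Da1_def by (auto simp: real_Cauchy_convergent convergent_LIMSEQ_iff[symmetric])
qed

text \<open>The second parameter in the Cauchy estimate is sent to 0 along \<open>hs\<close>, which
  shows that the limit is not tied to this sequence.\<close>

lemma Da_uniform:
  assumes "0 < Y" "0 < e"
  obtains d where "0 < d" "d \<le> h0"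
    "\<And>h y. h \<noteq> 0 \<Longrightarrow> \<bar>h\<bar> < d \<Longrightarrow> \<bar>y\<bar> \<le> Y \<Longrightarrow> \<bar>DQ h y - Da y\<bar> \<le> e \<and> \<bar>DQ1 h y - Da1 y\<bar> \<le> e"
proof -
  obtain d where d: "0 < d" "d \<le> h0"
    "\<And>h k y. h \<noteq> 0 \<Longrightarrow> \<bar>h\<bar> < d \<Longrightarrow> k \<noteq> 0 \<Longrightarrow> \<bar>k\<bar> < d \<Longrightarrow> \<bar>y\<bar> \<le> Y \<Longrightarrow> \<bar>DQ h y - DQ k y\<bar> \<le> e \<and> \<bar>DQ1 h y - DQ1 k y\<bar> \<le> e"
    by (rule DQ_Cauchy[OF assms], rule that; assumption)
  show ?thesis
  proof (rule that[OF d(1,2)])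
    fix h y :: real assume h: "h \<noteq> 0" "\<bar>h\<bar> < d" "\<bar>y\<bar> \<le> Y"
    have ev: "\<forall>\<^sub>F j in sequentially. \<bar>DQ h y - DQ (hs j) y\<bar> \<le> e" "\<forall>\<^sub>F j in sequentially. \<bar>DQ1 h y - DQ1 (hs j) y\<bar> \<le> e"
      using hs_small[OF d(1)] d(3)[OF h(1,2) hs(1) _ h(3)] by (auto elim!: eventually_mono)
    have "(\<lambda>j. \<bar>DQ h y - DQ (hs j) y\<bar>) \<longlonglongrightarrow> \<bar>DQ h y - Da y\<bar>" "(\<lambda>j. \<bar>DQ1 h y - DQ1 (hs j) y\<bar>) \<longlonglongrightarrow> \<bar>DQ1 h y - Da1 y\<bar>"
      by (intro tendsto_intros Da_lim)+
    from tendsto_upperbound[OF this(1) ev(1)] tendsto_upperbound[OF this(2) ev(2)]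
    show "\<bar>DQ h y - Da y\<bar> \<le> e \<and> \<bar>DQ1 h y - Da1 y\<bar> \<le> e" by simp
  qed
qed

lemma Da_uniform_limit:
  "uniform_limit {-Y..Y} (\<lambda>h y. (A h y - A 0 y) / h) Da (at 0)"
  "uniform_limit {-Y..Y} (\<lambda>h y. (A1 h y - A1 0 y) / h) Da1 (at 0)"
proof -
  have c: "\<forall>\<^sub>F h in at 0. \<forall>y\<in>{-Y..Y}. \<bar>DQ h y - Da y\<bar> < e \<and> \<bar>DQ1 h y - Da1 y\<bar> < e" if epos: "0 < e" for e
  proof -
    obtain d where d: "0 < d"
      "\<And>h y. h \<noteq> 0 \<Longrightarrow> \<bar>h\<bar> < d \<Longrightarrow> \<bar>y\<bar> \<le> \<bar>Y\<bar> + 1 \<Longrightarrow> \<bar>DQ h y - Da y\<bar> \<le> e/2 \<and> \<bar>DQ1 h y - Da1 y\<bar> \<le> e/2"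
      by (rule Da_uniform[of "\<bar>Y\<bar> + 1" "e/2"]) (use epos in auto)
    show ?thesis unfolding eventually_at
    proof (intro exI[of _ d] conjI ballI impI d(1))
      fix h y :: real assume "h \<noteq> 0 \<and> dist h 0 < d" "y \<in> {-Y..Y}"
      hence "h \<noteq> 0" "\<bar>h\<bar> < d" "\<bar>y\<bar> \<le> \<bar>Y\<bar> + 1" by (auto simp: dist_real_def)
      from d(2)[OF this] epos show "\<bar>DQ h y - Da y\<bar> < e" "\<bar>DQ1 h y - Da1 y\<bar> < e" by linarith+
    qed
  qed
  show "uniform_limit {-Y..Y} (\<lambda>h y. (A h y - A 0 y) / h) Da (at 0)"
    unfolding uniform_limit_iff dist_real_def DQ_def[symmetric]
  proof (intro allI impI)
    fix e :: real assume "0 < e"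
    from c[OF this] show "\<forall>\<^sub>F h in at 0. \<forall>y\<in>{-Y..Y}. \<bar>DQ h y - Da y\<bar> < e" by (rule eventually_mono) simp
  qed
  show "uniform_limit {-Y..Y} (\<lambda>h y. (A1 h y - A1 0 y) / h) Da1 (at 0)"
    unfolding uniform_limit_iff dist_real_def DQ1_def[symmetric]
  proof (intro allI impI)
    fix e :: real assume "0 < e"
    from c[OF this] show "\<forall>\<^sub>F h in at 0. \<forall>y\<in>{-Y..Y}. \<bar>DQ1 h y - Da1 y\<bar> < e" by (rule eventually_mono) simp
  qed
qed

lemma Da_deriv: "(Da has_real_derivative Da1 y) (at y)"
proof (rule deriv_uniform_limit[of "\<bar>y\<bar> + 1" "\<lambda>j. DQ (hs j)" "\<lambda>j. DQ1 (hs j)"])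
  show "(DQ (hs j) has_real_derivative DQ1 (hs j) x) (at x)" for j x by (intro DQ_deriv hs)
  show "\<forall>\<^sub>F j in sequentially. \<forall>x. \<bar>x\<bar> < \<bar>y\<bar> + 1 \<longrightarrow> \<bar>DQ1 (hs j) x - Da1 x\<bar> \<le> e" if epos: "0 < e" for e
  proof -
    obtain d where d: "0 < d" "\<And>h y'. h \<noteq> 0 \<Longrightarrow> \<bar>h\<bar> < d \<Longrightarrow> \<bar>y'\<bar> \<le> \<bar>y\<bar> + 1 \<Longrightarrow> \<bar>DQ1 h y' - Da1 y'\<bar> \<le> e"
      by (rule Da_uniform[of "\<bar>y\<bar> + 1" e]) (use epos in auto)
    from hs_small[OF d(1)] show ?thesis by eventually_elim (use d(2)[OF hs(1)] in auto)
  qed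
qed (auto intro: Da_lim)

lemma Da1_deriv: "(Da1 has_real_derivative Na (A 0 y) * Da y + n 0 (A 0 y)) (at y)"
proof (rule deriv_uniform_limit[of "\<bar>y\<bar> + 1" "\<lambda>j. DQ1 (hs j)" "\<lambda>j y. (N (hs j) (A (hs j) y) - N 0 (A 0 y)) / hs j"])
  show "(DQ1 (hs j) has_real_derivative (N (hs j) (A (hs j) x) - N 0 (A 0 x)) / hs j) (at x)" for j x by (intro DQ_deriv hs)
  show "\<forall>\<^sub>F j in sequentially. \<forall>x. \<bar>x\<bar> < \<bar>y\<bar> + 1 \<longrightarrow> \<bar>(N (hs j) (A (hs j) x) - N 0 (A 0 x)) / hs j - (Na (A 0 x) * Da x + n 0 (A 0 x))\<bar> \<le> e" if "0 < e" for e
  proof -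
    define e1 where "e1 = e / 2 / (CN + 1)"
    have e1: "0 < e1" "CN * e1 \<le> e / 2" using that CN(1) by (simp_all add: e1_def field_simps)
    have Y: "0 < \<bar>y\<bar> + 1" by simp
    obtain d where d: "0 < d" "\<And>h y'. h \<noteq> 0 \<Longrightarrow> \<bar>h\<bar> < d \<Longrightarrow> \<bar>y'\<bar> \<le> \<bar>y\<bar> + 1 \<Longrightarrow> \<bar>DQ h y' - Da y'\<bar> \<le> e1"
      by (rule Da_uniform[OF Y e1(1)]) auto
    have e2: "0 < e / 2" using that by simp
    obtain d' where d': "0 < d'" "\<And>h y'. h \<noteq> 0 \<Longrightarrow> \<bar>h\<bar> < d' \<Longrightarrow> \<bar>y'\<bar> \<le> \<bar>y\<bar> + 1 \<Longrightarrow>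
       \<bar>(N h (A h y') - N 0 (A 0 y')) / h - (Na (A 0 y') * DQ h y' + n 0 (A 0 y'))\<bar> \<le> e / 2"
      by (rule N_quotient[OF Y e2]) auto
    from hs_small[OF d(1)] hs_small[OF d'(1)] show ?thesis
    proof eventually_elim
      case (elim j)
      show ?case
      proof (intro allI impI)
        fix x :: real assume x: "\<bar>x\<bar> < \<bar>y\<bar> + 1"
        have 1: "\<bar>(N (hs j) (A (hs j) x) - N 0 (A 0 x)) / hs j - (Na (A 0 x) * DQ (hs j) x + n 0 (A 0 x))\<bar> \<le> e / 2"
          using d'(2)[OF hs(1) elim(2)] x by simp
        have "\<bar>Na (A 0 x) * (DQ (hs j) x - Da x)\<bar> \<le> CN * e1"
          unfolding abs_mult using d(2)[OF hs(1) elim(1), of x] x CN h0 rng[of 0 x] by (intro mult_mono) auto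
        hence 2: "\<bar>Na (A 0 x) * DQ (hs j) x - Na (A 0 x) * Da x\<bar> \<le> e / 2" using e1(2) by (simp add: right_diff_distrib)
        show "\<bar>(N (hs j) (A (hs j) x) - N 0 (A 0 x)) / hs j - (Na (A 0 x) * Da x + n 0 (A 0 x))\<bar> \<le> e"
          using 1 2 by linarith
      qed
    qed
  qed
qed (auto intro: Da_lim)

lemma Da_0: "Da 0 = l'" "Da1 0 = 0"
proof -
  have "((\<lambda>h. (l h - l 0) / h) \<longlongrightarrow> l') (at 0)" using dl by (simp add: DERIV_def)
  hence "(\<lambda>j. (l (hs j) - l 0) / hs j) \<longlonglongrightarrow> l'"
    by (rule filterlim_compose) (use hs in \<open>auto simp: filterlim_at\<close>)
  moreover have "(l (hs j) - l 0) / hs j = DQ (hs j) 0" for j using init(1)[OF hs(2)] init(1)[of 0] h0 by (simp add: DQ_def)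
  ultimately show "Da 0 = l'" using LIMSEQ_unique[OF Da_lim(1)] by simp
  have "DQ1 (hs j) 0 = 0" for j using init(2)[OF hs(2)] init(2)[of 0] h0 by (simp add: DQ1_def)
  thus "Da1 0 = 0" using LIMSEQ_unique[OF Da_lim(2)[of 0]] by simp
qed

lemma Da_param_deriv:
  "((\<lambda>h. A h y) has_real_derivative Da y) (at 0)" "((\<lambda>h. A1 h y) has_real_derivative Da1 y) (at 0)"
  using tendsto_uniform_limitI[OF Da_uniform_limit(1)[of "\<bar>y\<bar>"], of y] tendsto_uniform_limitI[OF Da_uniform_limit(2)[of "\<bar>y\<bar>"], of y]
  abs_ge_self[of y] abs_ge_minus_self[of y] by (auto simp: DERIV_def)

end

section \<open>Turning points, half period and moments of the profile\<close>

text \<open>Half the derivative of R in the amplitude. After S_y = kappa / A^2 is inserted, the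
  profile equation reads A_yy = \<open>Nf\<close>(A); \<open>Nd\<close> is the derivative of
  \<open>Nf\<close> in the amplitude.\<close>

definition Nf :: "wave \<Rightarrow> params \<Rightarrow> real \<Rightarrow> real" where
  "Nf w = (\<lambda>(E, \<kappa>, \<omega>, \<zeta>) a. - \<omega> * a + \<kappa>\<^sup>2 / a^3 - \<zeta> * nlf w (a\<^sup>2) * a)"

definition Nd :: "wave \<Rightarrow> params \<Rightarrow> real \<Rightarrow> real" where
  "Nd w = (\<lambda>(E, \<kappa>, \<omega>, \<zeta>) a. - \<omega> - 3 * \<kappa>\<^sup>2 / a^4 - \<zeta> * (nlf w (a\<^sup>2) + 2 * a\<^sup>2 * deriv (nlf w) (a\<^sup>2)))"

lemma uniqueness_on_interval:
  fixes A A1 B B1 N Na :: "real \<Rightarrow> real"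
  assumes "\<And>y. (A has_real_derivative A1 y) (at y)" "\<And>y. (A1 has_real_derivative N (A y)) (at y)"
    and "\<And>y. (B has_real_derivative B1 y) (at y)" "\<And>y. (B1 has_real_derivative N (B y)) (at y)"
    and rng: "\<And>y. A y \<in> {m..M}" "\<And>y. B y \<in> {m..M}"
    and N: "\<And>a. a \<in> {m..M} \<Longrightarrow> (N has_real_derivative Na a) (at a)" and c: "continuous_on {m..M} Na"
    and i: "A 0 = B 0" "A1 0 = B1 0"
  shows "A y = B y"
proof -
  obtain C where C: "\<And>a. a \<in> {m..M} \<Longrightarrow> \<bar>Na a\<bar> \<le> C" using compact_interval_bound[OF c] by blast
  have C0: "0 \<le> C" using C[OF rng(1)[of 0]] by linarith
  have lip: "\<bar>N a - N b\<bar> \<le> C * \<bar>a - b\<bar>" if "a \<in> {m..M}" "b \<in> {m..M}" for a b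
  proof -
    have "norm (N a - N b) \<le> C * norm (a - b)"
      by (rule field_differentiable_bound[of "{m..M}" N Na]) (use that N C in \<open>auto intro: has_field_derivative_at_within\<close>)
    thus ?thesis by simp
  qed
  have "\<bar>A y - B y\<bar> \<le> exp ((2 + C) * \<bar>y\<bar>) * (\<bar>A 0 - B 0\<bar> + \<bar>A1 0 - B1 0\<bar> + 0) \<and>
    \<bar>A1 y - B1 y\<bar> \<le> exp ((2 + C) * \<bar>y\<bar>) * (\<bar>A 0 - B 0\<bar> + \<bar>A1 0 - B1 0\<bar> + 0)"
    by (rule gronwall[where x="\<lambda>y. A y - B y" and ?x1.0="\<lambda>y. A1 y - B1 y" and ?x2.0="\<lambda>y. N (A y) - N (B y)"])
       (use assms(1-4) C0 lip rng in \<open>auto intro!: DERIV_diff\<close>)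
  thus ?thesis using i by simp
qed

locale family =
  fixes w :: wave and W :: "params set"
  assumes fam: "wave_family w W"
begin

lemma adm:
  "0 < x \<Longrightarrow> (nlf w has_real_derivative deriv (nlf w) x) (at x)"
  "0 < x \<Longrightarrow> isCont (deriv (nlf w)) x"
  "0 < x \<Longrightarrow> (nlF w has_real_derivative nlf w x) (at x)"
proof -
  have a: "\<forall>n. \<forall>x>0. (deriv ^^ n) (nlf w) field_differentiable (at x)" "\<forall>x>0. (nlF w has_real_derivative nlf w x) (at x)"
    using fam by (auto simp: wave_family_def admissible_nonlinearity_def)
  show "0 < x \<Longrightarrow> (nlf w has_real_derivative deriv (nlf w) x) (at x)"
    using a(1)[rule_format, of x 0] by (simp add: DERIV_deriv_iff_field_differentiable)
  show "0 < x \<Longrightarrow> isCont (deriv (nlf w)) x"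
    using a(1)[rule_format, of x 1] field_differentiable_imp_continuous_at by force
  show "0 < x \<Longrightarrow> (nlF w has_real_derivative nlf w x) (at x)" using a(2) by blast
qed

lemma R_deriv: "0 < a \<Longrightarrow> (Rfun (nlF w) q has_real_derivative 2 * Nf w q a) (at a)"
proof -
  assume a: "0 < a"
  obtain E \<kappa> \<omega> \<zeta> where q: "q = (E, \<kappa>, \<omega>, \<zeta>)" by (cases q)
  have d: "((\<lambda>a. nlF w (a\<^sup>2)) has_real_derivative nlf w (a\<^sup>2) * (2 * a)) (at a)"
    by (rule DERIV_chain2[where f="nlF w" and g="\<lambda>a. a\<^sup>2", OF adm(3)]) (use a in \<open>auto intro!: derivative_eq_intros\<close>)
  show ?thesis unfolding q Rfun_def Nf_def prod.case using a
    apply -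
    apply (rule DERIV_cong)
     apply (rule derivative_intros d | simp)+
    apply (simp add: field_simps eval_nat_numeral)
    done
qed

lemma Nf_deriv: "0 < a \<Longrightarrow> (Nf w q has_real_derivative Nd w q a) (at a)"
proof -
  assume a: "0 < a"
  obtain E \<kappa> \<omega> \<zeta> where q: "q = (E, \<kappa>, \<omega>, \<zeta>)" by (cases q)
  have d: "((\<lambda>a. nlf w (a\<^sup>2)) has_real_derivative deriv (nlf w) (a\<^sup>2) * (2 * a)) (at a)"
    by (rule DERIV_chain2[where f="nlf w" and g="\<lambda>a. a\<^sup>2", OF adm(1)]) (use a in \<open>auto intro!: derivative_eq_intros\<close>)
  show ?thesis unfolding q Nf_def Nd_def prod.case using a
    apply -
    apply (rule DERIV_cong)
     apply (rule derivative_intros d | simp)+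
    apply (simp add: field_simps eval_nat_numeral)
    done
qed

lemma nlf_cont: "0 < m \<Longrightarrow> continuous_on {m..M} (\<lambda>a. nlf w (a\<^sup>2))" "0 < m \<Longrightarrow> continuous_on {m..M} (\<lambda>a. deriv (nlf w) (a\<^sup>2))"
  "0 < m \<Longrightarrow> continuous_on {m..M} (\<lambda>a. nlF w (a\<^sup>2))"
proof -
  assume m: "0 < m"
  have i: "isCont g (a\<^sup>2) \<Longrightarrow> isCont (\<lambda>a. g (a\<^sup>2)) a" for g :: "real \<Rightarrow> real" and a
    by (rule isCont_o2[of _ "\<lambda>a. a\<^sup>2"]) auto
  have *: "continuous_on {m..M} (\<lambda>a. g (a\<^sup>2))" if "\<And>x. 0 < x \<Longrightarrow> isCont g x" for g :: "real \<Rightarrow> real"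
    by (intro continuous_at_imp_continuous_on ballI i that) (use m in auto)
  show "continuous_on {m..M} (\<lambda>a. nlf w (a\<^sup>2))" by (rule *[OF DERIV_isCont[OF adm(1)]])
  show "continuous_on {m..M} (\<lambda>a. deriv (nlf w) (a\<^sup>2))" by (rule *[OF adm(2)])
  show "continuous_on {m..M} (\<lambda>a. nlF w (a\<^sup>2))" by (rule *[OF DERIV_isCont[OF adm(3)]])
qed

lemma Nd_cont: "0 < m \<Longrightarrow> continuous_on {m..M} (Nd w q)"
proof -
  assume m: "0 < m"
  obtain E \<kappa> \<omega> \<zeta> where q: "q = (E, \<kappa>, \<omega>, \<zeta>)" by (cases q)
  show ?thesis unfolding q Nd_def prod.case
    by (intro continuous_intros nlf_cont m) (use m in auto)
qed

lemma R_cont: "0 < m \<Longrightarrow> continuous_on {m..M} (Rfun (nlF w) q)"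
  by (intro continuous_at_imp_continuous_on ballI DERIV_isCont[OF R_deriv]) auto

text \<open>R vanishes at the endpoints and is positive between them, so at a simple root its slope
  points inwards; a slope of the other sign would make R negative just inside.\<close>

lemma ends:
  assumes "q \<in> W"
  shows "0 < lo w q" "lo w q < hi w q" "\<And>a. lo w q < a \<Longrightarrow> a < hi w q \<Longrightarrow> 0 < Rfun (nlF w) q a"
    "Rfun (nlF w) q (lo w q) = 0" "Rfun (nlF w) q (hi w q) = 0" "0 < Nf w q (lo w q)" "Nf w q (hi w q) < 0"
proof -
  have i: "admissible_interval (nlF w) q (lo w q) (hi w q)" using fam assms by (auto simp: wave_family_def)
  show l: "0 < lo w q" and lh: "lo w q < hi w q" and pos: "\<And>a. lo w q < a \<Longrightarrow> a < hi w q \<Longrightarrow> 0 < Rfun (nlF w) q a"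
    and z: "Rfun (nlF w) q (lo w q) = 0" "Rfun (nlF w) q (hi w q) = 0" using i by (auto simp: admissible_interval_def)
  have h: "0 < hi w q" using l lh by simp
  have n0: "Nf w q (lo w q) \<noteq> 0" "Nf w q (hi w q) \<noteq> 0"
    using i DERIV_imp_deriv[OF R_deriv[OF l]] DERIV_imp_deriv[OF R_deriv[OF h]] by (auto simp: admissible_interval_def)
  show "0 < Nf w q (lo w q)"
  proof (rule ccontr)
    assume "\<not> ?thesis"
    hence "2 * Nf w q (lo w q) < 0" using n0 by simp
    from DERIV_neg_dec_right[OF R_deriv[OF l] this] obtain d where d: "0 < d" "\<And>h. 0 < h \<Longrightarrow> h < d \<Longrightarrow> Rfun (nlF w) q (lo w q + h) < 0"
      using z by auto
    define h where "h = min d (hi w q - lo w q) / 2"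
    have "0 < h" "h < d" "h < hi w q - lo w q" using d lh by (auto simp: h_def)
    thus False using d(2)[of h] pos[of "lo w q + h"] by auto
  qed
  show "Nf w q (hi w q) < 0"
  proof (rule ccontr)
    assume "\<not> ?thesis"
    hence "2 * Nf w q (hi w q) > 0" using n0 by simp
    from DERIV_pos_inc_left[OF R_deriv[OF h] this] obtain d where d: "0 < d" "\<And>h. 0 < h \<Longrightarrow> h < d \<Longrightarrow> Rfun (nlF w) q (hi w q - h) < 0"
      using z by auto
    define h where "h = min d (hi w q - lo w q) / 2"
    have "0 < h" "h < d" "h < hi w q - lo w q" using d lh by (auto simp: h_def)
    thus False using d(2)[of h] pos[of "hi w q - h"] by auto
  qed
qed

abbreviation A1 :: "params \<Rightarrow> real \<Rightarrow> real" where "A1 q \<equiv> deriv (amp w q)"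

lemma profile:
  assumes "q \<in> W"
  shows "(amp w q has_real_derivative A1 q y) (at y)"
    "(A1 q has_real_derivative Nf w q (amp w q y)) (at y)"
    "(A1 q y)\<^sup>2 = Rfun (nlF w) q (amp w q y)"
    "amp w q y \<in> {lo w q..hi w q}" "0 < amp w q y" "\<exists>y. amp w q y = hi w q"
    "amp w q (y + period w q) = amp w q y" "amp w q 0 = lo w q" "A1 q 0 = 0"
    "(phs w q has_real_derivative fst (snd q) / (amp w q y)\<^sup>2) (at y)" "phs w q 0 = 0"
proof -
  obtain E \<kappa> \<omega> \<zeta> where q: "q = (E, \<kappa>, \<omega>, \<zeta>)" by (cases q)
  have P: "is_profile w q" using fam assms by (simp add: wave_family_def)
  note P = P[unfolded q is_profile_def prod.case Let_def, folded q]
  show 1: "(amp w q has_real_derivative A1 q y) (at y)" for y using P by blast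
  have rng: "range (amp w q) = {lo w q..hi w q}" using P by blast
  show r: "amp w q y \<in> {lo w q..hi w q}" for y using rng by blast
  show pos: "0 < amp w q y" for y using r[of y] ends(1)[OF assms] by simp
  have "hi w q \<in> range (amp w q)" unfolding rng using ends(2)[OF assms] by simp
  thus "\<exists>y. amp w q y = hi w q" by (metis rangeE)
  show S: "(phs w q has_real_derivative fst (snd q) / (amp w q y)\<^sup>2) (at y)" for y using P by (simp add: q)
  have ds: "deriv (phs w q) y = \<kappa> / (amp w q y)\<^sup>2" using DERIV_imp_deriv[OF S] by (simp add: q)
  have "(A1 q has_real_derivative - \<omega> * amp w q y + amp w q y * (deriv (phs w q) y)\<^sup>2 - \<zeta> * nlf w ((amp w q y)\<^sup>2) * amp w q y) (at y)"
    using P by blast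
  moreover have "- \<omega> * amp w q y + amp w q y * (deriv (phs w q) y)\<^sup>2 - \<zeta> * nlf w ((amp w q y)\<^sup>2) * amp w q y = Nf w q (amp w q y)"
    using pos[of y] unfolding ds by (simp add: q Nf_def power_divide field_simps eval_nat_numeral)
  ultimately show "(A1 q has_real_derivative Nf w q (amp w q y)) (at y)" by simp
  show sq: "(A1 q y)\<^sup>2 = Rfun (nlF w) q (amp w q y)" for y using P by blast
  show "amp w q (y + period w q) = amp w q y" using P by blast
  show a0: "amp w q 0 = lo w q" using P by blast
  show "A1 q 0 = 0" using sq[of 0] a0 ends(4)[OF assms] by simp
  show "phs w q 0 = 0" using P by blast
qed

lemma amp_cont: "q \<in> W \<Longrightarrow> continuous_on S (amp w q)"
  by (intro continuous_at_imp_continuous_on ballI DERIV_isCont[OF profile(1)])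

lemma A1_cont: "q \<in> W \<Longrightarrow> continuous_on S (A1 q)"
  by (intro continuous_at_imp_continuous_on ballI DERIV_isCont[OF profile(2)])

text \<open>A_y(0) = 0, so A(- y) solves the same initial value problem.\<close>

lemma even:
  assumes "q \<in> W" shows "amp w q (- y) = amp w q y"
proof (rule uniqueness_on_interval[where A="\<lambda>y. amp w q (- y)" and ?A1.0="\<lambda>y. - A1 q (- y)" and ?B1.0="A1 q" and N="Nf w q"
      and Na="Nd w q" and m="lo w q" and M="hi w q"])
  fix y
  show "((\<lambda>y. amp w q (- y)) has_real_derivative - A1 q (- y)) (at y)"
    using profile(1)[OF assms, of "- y"] by (simp add: DERIV_mirror)
  have "((\<lambda>y. A1 q (- y)) has_real_derivative - Nf w q (amp w q (- y))) (at y)"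
    using profile(2)[OF assms, of "- y"] by (simp add: DERIV_mirror)
  from DERIV_minus[OF this] show "((\<lambda>y. - A1 q (- y)) has_real_derivative Nf w q (amp w q (- y))) (at y)" by simp
  show "\<And>a. a \<in> {lo w q..hi w q} \<Longrightarrow> (Nf w q has_real_derivative Nd w q a) (at a)"
    using ends(1)[OF assms] by (intro Nf_deriv) auto
qed (use profile[OF assms] ends[OF assms] Nd_cont in auto)

text \<open>The witness is the first positive zero of A_y. Up to it A increases, so its value there
  is a root of R above the lower endpoint, hence the upper one. A positive point where the upper
  endpoint is attained exists because A is even.\<close>

lemma half_period_exists:
  assumes q: "q \<in> W"
  shows "\<exists>t>0. (\<forall>y. 0 < y \<and> y < t \<longrightarrow> 0 < A1 q y) \<and> A1 q t = 0 \<and> amp w q t = hi w q"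
proof -
  obtain Y0 where Y0: "amp w q Y0 = hi w q" using profile(6)[OF q] by blast
  define Y where "Y = \<bar>Y0\<bar>"
  have Yhi: "amp w q Y = hi w q" using Y0 even[OF q, of Y0] by (simp add: Y_def abs_if)
  have Ypos: "0 < Y" using Yhi profile(8)[OF q] ends(2)[OF q] by (cases "Y0 = 0") (auto simp: Y_def)
  have A1Y: "A1 q Y = 0" using profile(3)[OF q, of Y] Yhi ends(5)[OF q] by simp
  have d0: "(A1 q has_real_derivative Nf w q (lo w q)) (at 0)" using profile(2)[OF q, of 0] profile(8)[OF q] by simp
  obtain d where d: "0 < d" "\<And>h. 0 < h \<Longrightarrow> h < d \<Longrightarrow> 0 < A1 q h"
    using DERIV_pos_inc_right[OF d0 ends(6)[OF q]] profile(9)[OF q] by auto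
  \<comment> \<open>A_yy(0) > 0 makes A_y positive on (0, d). Starting the search at d/2 removes the
    zero at y = 0 and leaves a compact set with a least element.\<close>
  define Z where "Z = {y \<in> {d/2..Y}. A1 q y = 0}"
  have dY: "d \<le> Y" using d(2)[OF Ypos] A1Y by (cases "Y < d") auto
  have "Y \<in> Z" using dY d(1) A1Y by (simp add: Z_def)
  have cZ: "compact Z"
  proof -
    have "closed Z" unfolding Z_def
      using continuous_closed_preimage_constant[OF A1_cont[OF q, of "{d/2..Y}"] closed_atLeastAtMost, of 0] by simp
    moreover have "bounded Z" by (rule bounded_subset[of "{d/2..Y}"]) (auto simp: Z_def)
    ultimately show ?thesis using compact_eq_bounded_closed by blast
  qed
  then obtain t where t: "t \<in> Z" "\<And>z. z \<in> Z \<Longrightarrow> t \<le> z" using compact_attains_inf[OF cZ] \<open>Y \<in> Z\<close> by auto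
  have tpos: "0 < t" using t(1) d by (simp add: Z_def)
  have nz: "A1 q y \<noteq> 0" if "0 < y" "y < t" for y
  proof
    assume z: "A1 q y = 0"
    have "d \<le> y" using d(2)[OF that(1)] z by (cases "y < d") auto
    hence "y \<in> Z" using z that t(1) d by (simp add: Z_def)
    thus False using t(2) that by fastforce
  qed
  have pos: "0 < A1 q y" if y: "0 < y" "y < t" for y
  proof (rule ccontr)
    assume "\<not> 0 < A1 q y"
    hence neg: "A1 q y < 0" using nz[OF y] by simp
    define z where "z = min (d/2) (y/2)"
    have z: "0 < z" "z < d" "z < y" using d y by (auto simp: z_def)
    have zp: "0 < A1 q z" using d(2) z by simp
    from IVT2'[of "A1 q" y 0 z] neg zp z A1_cont[OF q] obtain x where "z \<le> x" "x \<le> y" "A1 q x = 0" by auto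
    thus False using nz[of x] z y by simp
  qed
  have A1t: "A1 q t = 0" using t(1) by (simp add: Z_def)
  have "amp w q 0 < amp w q t"
    by (rule DERIV_pos_imp_increasing_open[OF tpos]) (use profile(1)[OF q] pos amp_cont[OF q] in auto)
  moreover have "Rfun (nlF w) q (amp w q t) = 0" using profile(3)[OF q, of t] A1t by simp
  ultimately have "amp w q t = hi w q"
    using ends(3)[OF q, of "amp w q t"] profile(4)[OF q, of t] profile(8)[OF q] by force
  thus ?thesis using tpos pos A1t by blast
qed

text \<open>On [0, t] the profile is an increasing bijection with A_y = sqrt R. The primitive in y,
  composed with the inverse, is continuous up to the endpoints and differentiable inside; this form
  of the fundamental theorem needs nothing at the singular endpoints.\<close>

lemma substitution:
  assumes q: "q \<in> W" and t: "0 < t" "\<And>y. 0 < y \<Longrightarrow> y < t \<Longrightarrow> 0 < A1 q y" "amp w q t = hi w q"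
    and g: "continuous_on {lo w q..hi w q} g"
  shows "((\<lambda>a. g a / sqrt (Rfun (nlF w) q a)) has_integral prim (\<lambda>y. g (amp w q y)) t) {lo w q..hi w q}"
proof -
  let ?A = "amp w q"
  have mono: "?A x < ?A y" if "0 \<le> x" "x < y" "y \<le> t" for x y
  proof (rule DERIV_pos_imp_increasing_open[OF that(2)])
    fix z assume "x < z" "z < y"
    hence "0 < A1 q z" using t(2) that by simp
    thus "\<exists>d. (?A has_real_derivative d) (at z) \<and> 0 < d" using profile(1)[OF q] by blast
  qed (rule amp_cont[OF q])
  have inj: "inj_on ?A {0..t}"
    by (rule inj_onI, rule ccontr) (metis atLeastAtMost_iff linorder_neqE_linordered_idom mono order_less_irrefl)
  have im: "?A ` {0..t} = {lo w q..hi w q}"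
  proof -
    have "?A ` {0..t} = {?A 0..?A t}"
    proof (intro equalityI subsetI)
      fix a assume "a \<in> {?A 0..?A t}"
      then obtain x where "0 \<le> x" "x \<le> t" "?A x = a"
        using IVT'[of ?A 0 a t] t(1) amp_cont[OF q] by auto
      thus "a \<in> ?A ` {0..t}" by auto
    next
      fix a assume "a \<in> ?A ` {0..t}"
      then obtain x where x: "0 \<le> x" "x \<le> t" "a = ?A x" by auto
      have "?A 0 \<le> ?A x" using mono[of 0 x] x by (cases "x = 0") auto
      moreover have "?A x \<le> ?A t" using mono[of x t] x by (cases "x = t") auto
      ultimately show "a \<in> {?A 0..?A t}" using x by simp
    qed
    thus ?thesis using profile(8)[OF q] t(3) by simp
  qed
  define B where "B = the_inv_into {0..t} ?A"
  have BA: "B (?A x) = x" if "x \<in> {0..t}" for x unfolding B_def by (rule the_inv_into_f_f[OF inj that])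
  have AB: "?A (B a) = a" "B a \<in> {0..t}" if "a \<in> {lo w q..hi w q}" for a
    using f_the_inv_into_f[OF inj, of a] the_inv_into_into[OF inj, of a "{0..t}"] that im by (auto simp: B_def)
  have Bc: "continuous_on {lo w q..hi w q} B"
    using continuous_on_inv[OF amp_cont[OF q] compact_Icc, of 0 t B] BA by (simp add: im)
  have Gc: "continuous_on UNIV (\<lambda>y. g (?A y))"
    by (rule continuous_on_compose2[OF g amp_cont[OF q]]) (use profile(4)[OF q] in auto)
  have primd: "(prim (\<lambda>y. g (?A y)) has_vector_derivative g (?A y)) (at y)" for y
    by (rule prim_has_vector_derivative[OF Gc])
  have Bi: "B a \<in> {0<..<t}" if "a \<in> {lo w q<..<hi w q}" for a
  proof -
    have a: "a \<in> {lo w q..hi w q}" using that by auto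
    have "B a \<noteq> 0" using AB(1)[OF a] profile(8)[OF q] that by auto
    moreover have "B a \<noteq> t" using AB(1)[OF a] t(3) that by auto
    ultimately show ?thesis using AB(2)[OF a] by auto
  qed
  have "((\<lambda>a. g a / sqrt (Rfun (nlF w) q a)) has_integral
     prim (\<lambda>y. g (?A y)) (B (hi w q)) - prim (\<lambda>y. g (?A y)) (B (lo w q))) {lo w q..hi w q}"
  proof (rule fundamental_theorem_of_calculus_interior)
    show "lo w q \<le> hi w q" using ends(2)[OF q] by simp
    have "continuous_on UNIV (prim (\<lambda>y. g (?A y)))"
      by (intro continuous_at_imp_continuous_on ballI has_vector_derivative_continuous[OF primd])
    from continuous_on_compose2[OF this Bc] show "continuous_on {lo w q..hi w q} (\<lambda>a. prim (\<lambda>y. g (?A y)) (B a))" by simp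
    fix a assume a: "a \<in> {lo w q<..<hi w q}"
    hence a': "a \<in> {lo w q..hi w q}" by auto
    have Apos: "0 < A1 q (B a)" using t(2) Bi[OF a] by auto
    have dB: "(B has_real_derivative inverse (A1 q (B a))) (at a)"
    proof (rule DERIV_inverse_function[of ?A])
      show "(?A has_real_derivative A1 q (B a)) (at (B a))" by (rule profile(1)[OF q])
      show "A1 q (B a) \<noteq> 0" using Apos by simp
      show "lo w q < a" "a < hi w q" using a by auto
      show "?A (B y) = y" if "lo w q < y" "y < hi w q" for y using AB(1)[of y] that by auto
      show "isCont B a" using continuous_on_interior[OF Bc] a by (simp add: interior_atLeastAtMost_real)
    qed
    have sq: "sqrt (Rfun (nlF w) q a) = A1 q (B a)"
      using profile(3)[OF q, of "B a"] AB(1)[OF a'] Apos by (intro real_sqrt_unique) auto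
    have "((\<lambda>y. prim (\<lambda>y. g (?A y)) y) has_real_derivative g (?A (B a))) (at (B a))"
      using primd[of "B a"] by (simp add: has_real_derivative_iff_has_vector_derivative)
    from DERIV_chain2[OF this dB]
    show "((\<lambda>a. prim (\<lambda>y. g (?A y)) (B a)) has_vector_derivative g a / sqrt (Rfun (nlF w) q a)) (at a)"
      unfolding has_real_derivative_iff_has_vector_derivative[symmetric] AB(1)[OF a'] sq by (simp add: divide_inverse)
  qed
  moreover have "B (hi w q) = t" using BA[of t] t by simp
  moreover have "B (lo w q) = 0" using BA[of 0] t profile(8)[OF q] by simp
  ultimately show ?thesis by simp
qed

text \<open>Substitution with g = 1 identifies the period, defined by the moment integral, with
  twice the first zero of A_y.\<close>

lemma half_period:
  assumes q: "q \<in> W"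
  shows "0 < period w q" "\<And>y. 0 < y \<Longrightarrow> y < period w q / 2 \<Longrightarrow> 0 < A1 q y" "A1 q (period w q / 2) = 0" "amp w q (period w q / 2) = hi w q"
proof -
  obtain t where t: "0 < t" "\<And>y. 0 < y \<Longrightarrow> y < t \<Longrightarrow> 0 < A1 q y" "A1 q t = 0" "amp w q t = hi w q"
    using half_period_exists[OF q] by blast
  have "((\<lambda>a. 1 / sqrt (Rfun (nlF w) q a)) has_integral prim (\<lambda>y. 1) t) {lo w q..hi w q}"
    by (rule substitution[OF q t(1,2,4)]) (auto intro!: continuous_intros)
  moreover have "prim (\<lambda>y. 1) t = t" using t(1) by (simp add: prim_nonneg)
  ultimately have "period w q = 2 * t" unfolding period_def moment_def by (simp add: integral_unique)
  thus "0 < period w q" "\<And>y. 0 < y \<Longrightarrow> y < period w q / 2 \<Longrightarrow> 0 < A1 q y" "A1 q (period w q / 2) = 0" "amp w q (period w q / 2) = hi w q"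
    using t by simp_all
qed

text \<open>Evenness and periodicity make A symmetric about T/2, so both halves of the period
  contribute equally.\<close>

lemma moment_eq:
  assumes q: "q \<in> W" and g: "continuous_on {lo w q..hi w q} g"
  shows "2 * integral {lo w q..hi w q} (\<lambda>a. g a / sqrt (Rfun (nlF w) q a)) = prim (\<lambda>y. g (amp w q y)) (period w q)"
proof -
  let ?T = "period w q" let ?G = "\<lambda>y. g (amp w q y)"
  have Gc: "continuous_on UNIV ?G"
    by (rule continuous_on_compose2[OF g amp_cont[OF q]]) (use profile(4)[OF q] in auto)
  have i: "integral {lo w q..hi w q} (\<lambda>a. g a / sqrt (Rfun (nlF w) q a)) = prim ?G (?T/2)"
    by (rule integral_unique, rule substitution[OF q _ _ _ g]) (use half_period[OF q] in auto)
  have refl: "amp w q (?T - y) = amp w q y" for y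
    using profile(7)[OF q, of "- y"] even[OF q, of y] by (simp add: add.commute)
  have "((\<lambda>y. prim ?G ?T - prim ?G (?T - y)) has_vector_derivative ?G y) (at y)" for y
  proof -
    have d: "(prim ?G has_real_derivative ?G (?T - y)) (at (?T - y))"
      using prim_has_vector_derivative[OF Gc, of "?T - y"] by (simp add: has_real_derivative_iff_has_vector_derivative)
    have "((\<lambda>y. prim ?G (?T - y)) has_real_derivative ?G (?T - y) * (- 1)) (at y)"
      by (rule DERIV_chain2[where f="prim ?G" and g="\<lambda>y. ?T - y", OF d]) (auto intro!: derivative_eq_intros)
    from DERIV_diff[OF DERIV_const this] show ?thesis by (simp add: refl has_real_derivative_iff_has_vector_derivative)
  qed
  from eq_prim[OF Gc this, of "?T/2"] show ?thesis unfolding i by simp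
qed

lemma moments:
  assumes q: "q \<in> W"
  shows "Mmom w q = prim (\<lambda>y. (amp w q y)\<^sup>2) (period w q)"
    "eta w q = phs w q (period w q)"
    "Kmom w q = prim (\<lambda>y. (A1 q y)\<^sup>2) (period w q)"
    "Umom w q = prim (\<lambda>y. nlF w ((amp w q y)\<^sup>2)) (period w q)"
    "phs w q y = prim (\<lambda>y. fst (snd q) / (amp w q y)\<^sup>2) y"
proof -
  have l: "0 < lo w q" by (rule ends[OF q])
  obtain E \<kappa> \<omega> \<zeta> where qq: "q = (E, \<kappa>, \<omega>, \<zeta>)" by (cases q)
  show "Mmom w q = prim (\<lambda>y. (amp w q y)\<^sup>2) (period w q)"
    unfolding Mmom_def moment_def by (rule moment_eq[OF q]) (intro continuous_intros)
  have c: "continuous_on UNIV (\<lambda>y. fst (snd q) / (amp w q y)\<^sup>2)"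
    using profile(5)[OF q] by (intro continuous_intros amp_cont[OF q]) (auto simp: less_imp_neq[symmetric])
  show S: "phs w q y = prim (\<lambda>y. fst (snd q) / (amp w q y)\<^sup>2) y" for y
    using eq_prim[OF c, of "phs w q" y] profile(10,11)[OF q] by (simp add: has_real_derivative_iff_has_vector_derivative)
  have "eta w q = prim (\<lambda>y. fst (snd q) / (amp w q y)\<^sup>2) (period w q)"
  proof -
    have "continuous_on {lo w q..hi w q} (\<lambda>a. \<kappa> / a\<^sup>2)" using l by (intro continuous_intros) auto
    from moment_eq[OF q this] show ?thesis
      unfolding eta_def moment_def by (simp add: qq)
  qed
  thus "eta w q = phs w q (period w q)" by (simp add: S)
  show "Kmom w q = prim (\<lambda>y. (A1 q y)\<^sup>2) (period w q)"
  proof -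
    \<comment> \<open>Written as R / sqrt R the integrand has the form required by the substitution,
      with g = R. At the endpoints both sides are 0.\<close>
    have "sqrt (Rfun (nlF w) q a) = Rfun (nlF w) q a / sqrt (Rfun (nlF w) q a)" if "a \<in> {lo w q..hi w q}" for a
    proof -
      have "0 \<le> Rfun (nlF w) q a"
      proof (cases "a = lo w q \<or> a = hi w q")
        case True thus ?thesis using ends(4,5)[OF q] by auto
      next
        case False
        hence "lo w q < a" "a < hi w q" using that by auto
        from ends(3)[OF q this] show ?thesis by simp
      qed
      thus ?thesis by (simp add: real_div_sqrt)
    qed
    hence "integral {lo w q..hi w q} (\<lambda>a. sqrt (Rfun (nlF w) q a)) = integral {lo w q..hi w q} (\<lambda>a. Rfun (nlF w) q a / sqrt (Rfun (nlF w) q a))"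
      by (rule integral_cong)
    thus ?thesis unfolding Kmom_def moment_def using moment_eq[OF q R_cont[OF l]] profile(3)[OF q] by simp
  qed
  show "Umom w q = prim (\<lambda>y. nlF w ((amp w q y)\<^sup>2)) (period w q)"
    unfolding Umom_def using half_period(1)[OF q] by (simp add: prim_nonneg)
qed

end

section \<open>Derivatives in a parameter, uniformly in y\<close>

lemma prim_bound_abs:
  fixes f :: "real \<Rightarrow> real"
  assumes f: "continuous_on UNIV f" and B: "\<And>t. \<bar>t\<bar> \<le> \<bar>y\<bar> \<Longrightarrow> \<bar>f t\<bar> \<le> B"
  shows "\<bar>prim f y\<bar> \<le> \<bar>y\<bar> * B"
proof (cases "0 \<le> y")
  case True
  have "norm (integral {0..y} f) \<le> B * (y - 0)"
    by (rule integral_bound) (use True B in \<open>auto intro: continuous_on_subset[OF f]\<close>)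
  thus ?thesis using True by (simp add: prim_nonneg mult.commute)
next
  case False
  have "norm (integral {y..0} f) \<le> B * (0 - y)"
    by (rule integral_bound) (use False B in \<open>auto intro: continuous_on_subset[OF f]\<close>)
  thus ?thesis using False by (simp add: prim_def mult.commute)
qed

text \<open>Difference quotients at h = 0 converging uniformly on compact y-intervals: strong enough
  to differentiate under the integral sign, and stable under products and reciprocals. Nothing is
  asked about derivatives at other h.\<close>

definition uniform_deriv0 :: "(real \<Rightarrow> real \<Rightarrow> real) \<Rightarrow> (real \<Rightarrow> real) \<Rightarrow> bool" where
  "uniform_deriv0 x q \<longleftrightarrow> continuous_on UNIV (x 0) \<and> continuous_on UNIV q \<and>
     (\<forall>Y. uniform_limit {-Y..Y} (\<lambda>h y. (x h y - x 0 y) / h) q (at 0))"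

lemma bounded_image_interval:
  fixes q :: "real \<Rightarrow> real"
  shows "continuous_on UNIV q \<Longrightarrow> bounded (q ` {-Y..Y})"
  by (rule compact_imp_bounded[OF compact_continuous_image[OF continuous_on_subset[OF _ subset_UNIV] compact_Icc]])

lemma bounded_zero_image: "bounded ((\<lambda>a. 0 :: real) ` S)"
  by (rule bounded_subset[of "{0}"]) auto

lemma uniform_deriv0_uniform_limit:
  assumes "uniform_deriv0 x q" shows "uniform_limit {-Y..Y} x (x 0) (at 0)"
proof -
  have q: "bounded (q ` {-Y..Y})" using assms bounded_image_interval by (auto simp: uniform_deriv0_def)
  have "uniform_limit {-Y..Y} (\<lambda>h y. h * ((x h y - x 0 y) / h) + x 0 y) (\<lambda>y. 0 * q y + x 0 y) (at 0)"
  proof (intro uniform_limit_add uniform_lim_mult)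
    show "uniform_limit {-Y..Y} (\<lambda>h y. h) (\<lambda>y. 0) (at (0::real))"
      by (auto simp: uniform_limit_iff eventually_at dist_real_def)
  qed (use assms q bounded_zero_image in \<open>auto simp: uniform_deriv0_def uniform_limit_const\<close>)
  moreover have "\<forall>\<^sub>F h in at 0. \<forall>y\<in>{-Y..Y}. h * ((x h y - x 0 y) / h) + x 0 y = x h y"
    by (auto simp: eventually_at intro!: exI[of _ 1])
  ultimately show ?thesis
    using iffD1[OF uniform_limit_cong[where f="\<lambda>h y. h * ((x h y - x 0 y) / h) + x 0 y" and g=x and h="\<lambda>y. 0 * q y + x 0 y" and i="x 0"]] by simp
qed

lemma uniform_deriv0_mult:
  assumes "uniform_deriv0 x q" "uniform_deriv0 z r" shows "uniform_deriv0 (\<lambda>h y. x h y * z h y) (\<lambda>y. q y * z 0 y + x 0 y * r y)"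
proof -
  have c: "continuous_on UNIV (x 0)" "continuous_on UNIV q" "continuous_on UNIV (z 0)" "continuous_on UNIV r"
    using assms by (auto simp: uniform_deriv0_def)
  have "uniform_limit {-Y..Y} (\<lambda>h y. (x h y - x 0 y) / h * z h y + x 0 y * ((z h y - z 0 y) / h)) (\<lambda>y. q y * z 0 y + x 0 y * r y) (at 0)" for Y
    using assms by (intro uniform_limit_add uniform_lim_mult uniform_deriv0_uniform_limit[OF assms(2)] uniform_limit_const bounded_image_interval c) (auto simp: uniform_deriv0_def)
  moreover have "(x h y - x 0 y) / h * z h y + x 0 y * ((z h y - z 0 y) / h) = (x h y * z h y - x 0 y * z 0 y) / h" for h y
    by (cases "h = 0") (auto simp: field_simps)
  ultimately show ?thesis unfolding uniform_deriv0_def using c by (auto intro!: continuous_intros)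
qed

lemma uniform_deriv0_inverse:
  assumes "uniform_deriv0 x q" "0 < m" "\<And>y. m \<le> x 0 y" "0 < h0" "\<And>h y. \<bar>h\<bar> < h0 \<Longrightarrow> m \<le> x h y"
  shows "uniform_deriv0 (\<lambda>h y. inverse (x h y)) (\<lambda>y. - q y * (inverse (x 0 y) * inverse (x 0 y)))"
proof -
  have c: "continuous_on UNIV (x 0)" "continuous_on UNIV q" using assms by (auto simp: uniform_deriv0_def)
  have nz: "x 0 y \<noteq> 0" for y using assms(2) assms(3)[of y] by simp
  have ci: "continuous_on UNIV (\<lambda>y. inverse (x 0 y))" using nz by (intro continuous_intros c) auto
  have cm: "continuous_on UNIV (\<lambda>y. - q y)" by (intro continuous_intros c)
  have inv: "uniform_limit {-Y..Y} (\<lambda>h y. inverse (x h y)) (\<lambda>y. inverse (x 0 y)) (at 0)" for Y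
  proof -
    have "uniform_limit {-Y..Y} (\<lambda>h y. inverse (x h y)) (inverse \<circ> x 0) (at 0)"
    proof (rule uniform_lim_inverse[OF uniform_deriv0_uniform_limit[OF assms(1)], of _ m])
      show "m \<le> norm (x 0 y)" for y using assms(3)[of y] by simp
    qed (rule assms(2))
    thus ?thesis by (simp add: o_def)
  qed
  have dx: "uniform_limit {-Y..Y} (\<lambda>h y. - ((x h y - x 0 y) / h)) (\<lambda>y. - q y) (at 0)" for Y
    using assms(1) by (intro uniform_limit_uminus) (auto simp: uniform_deriv0_def)
  have L: "uniform_limit {-Y..Y} (\<lambda>h y. - ((x h y - x 0 y) / h) * (inverse (x h y) * inverse (x 0 y))) (\<lambda>y. - q y * (inverse (x 0 y) * inverse (x 0 y))) (at 0)" for Y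
    by (intro uniform_lim_mult dx inv uniform_limit_const bounded_image_interval ci cm continuous_on_mult)
  have ev: "\<forall>\<^sub>F h in at 0. \<forall>y\<in>{-Y..Y}. - ((x h y - x 0 y) / h) * (inverse (x h y) * inverse (x 0 y)) = (inverse (x h y) - inverse (x 0 y)) / h" for Y
    unfolding eventually_at
  proof (intro exI[of _ h0] conjI ballI impI assms(4))
    fix h y :: real assume "h \<noteq> 0 \<and> dist h 0 < h0"
    hence "m \<le> x h y" "h \<noteq> 0" using assms(5) by (auto simp: dist_real_def)
    hence "x h y \<noteq> 0" using assms(2) by simp
    thus "- ((x h y - x 0 y) / h) * (inverse (x h y) * inverse (x 0 y)) = (inverse (x h y) - inverse (x 0 y)) / h"
      using nz[of y] \<open>h \<noteq> 0\<close> by (simp add: field_simps)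
  qed
  have "uniform_limit {-Y..Y} (\<lambda>h y. (inverse (x h y) - inverse (x 0 y)) / h) (\<lambda>y. - q y * (inverse (x 0 y) * inverse (x 0 y))) (at 0)" for Y
    by (rule iffD1[OF uniform_limit_cong[OF ev] L]) simp
  moreover have "continuous_on UNIV (\<lambda>y. - q y * (inverse (x 0 y) * inverse (x 0 y)))"
    by (intro continuous_on_mult cm ci)
  ultimately show ?thesis unfolding uniform_deriv0_def using ci by blast
qed

lemma uniform_deriv0_affine: "uniform_deriv0 (\<lambda>h y. c + h * e) (\<lambda>y. e)"
proof -
  have "uniform_limit {-Y..Y} (\<lambda>h y. (c + h * e - (c + 0 * e)) / h) (\<lambda>y. e) (at 0)" for Y :: real
    by (auto simp: uniform_limit_iff eventually_at intro!: exI[of _ 1])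
  thus ?thesis unfolding uniform_deriv0_def by auto
qed

lemma prim_param_deriv:
  assumes u: "uniform_deriv0 x q" and h0: "0 < h0" and c: "\<And>h. \<bar>h\<bar> < h0 \<Longrightarrow> continuous_on UNIV (x h)"
  shows "((\<lambda>h. prim (x h) y) has_real_derivative prim q y) (at 0)"
  unfolding DERIV_def add_0_left
proof (rule LIM_I)
  fix e :: real assume e: "0 < e"
  have cq: "continuous_on UNIV q" "continuous_on UNIV (x 0)" using u by (auto simp: uniform_deriv0_def)
  have e': "0 < e / (\<bar>y\<bar> + 1)" using e by (simp add: add_nonneg_pos)
  have "uniform_limit {-\<bar>y\<bar>..\<bar>y\<bar>} (\<lambda>h y. (x h y - x 0 y) / h) q (at 0)" using u unfolding uniform_deriv0_def by blast
  from uniform_limitD[OF this e'] obtain d where d0: "0 < d"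
    "\<And>h t. h \<noteq> 0 \<Longrightarrow> \<bar>h\<bar> < d \<Longrightarrow> t \<in> {-\<bar>y\<bar>..\<bar>y\<bar>} \<Longrightarrow> \<bar>(x h t - x 0 t) / h - q t\<bar> < e / (\<bar>y\<bar> + 1)"
    unfolding eventually_at dist_real_def by auto
  have d: "0 < d" "\<And>h t. h \<noteq> 0 \<Longrightarrow> \<bar>h\<bar> < d \<Longrightarrow> \<bar>t\<bar> \<le> \<bar>y\<bar> \<Longrightarrow> \<bar>(x h t - x 0 t) / h - q t\<bar> < e / (\<bar>y\<bar> + 1)"
    by (rule d0(1), rule d0(2)) (auto simp: abs_le_iff)
  show "\<exists>s>0. \<forall>h. h \<noteq> 0 \<and> norm (h - 0) < s \<longrightarrow> norm ((prim (x h) y - prim (x 0) y) / h - prim q y) < e"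
  proof (rule exI[of _ "min d h0"], intro conjI allI impI)
    fix h :: real assume "h \<noteq> 0 \<and> norm (h - 0) < min d h0"
    hence h: "h \<noteq> 0" "\<bar>h\<bar> < d" "\<bar>h\<bar> < h0" by auto
    have c1: "continuous_on UNIV (\<lambda>t. 1 * x h t + (-1) * x 0 t)" using c[OF h(3)] cq by (intro continuous_intros)
    have c2: "continuous_on UNIV (\<lambda>t. (1/h) * (1 * x h t + (-1) * x 0 t) + (-1) * q t)" by (intro continuous_intros c1 cq)
    have "prim (\<lambda>t. (1/h) * (1 * x h t + (-1) * x 0 t) + (-1) * q t) y = (1/h) * (1 * prim (x h) y + (-1) * prim (x 0) y) + (-1) * prim q y"
      unfolding prim_linear[OF c1 cq(1)] prim_linear[OF c[OF h(3)] cq(2)] ..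
    hence eq: "(prim (x h) y - prim (x 0) y) / h - prim q y = prim (\<lambda>t. (1/h) * (1 * x h t + (-1) * x 0 t) + (-1) * q t) y" by simp
    have "\<bar>prim (\<lambda>t. (1/h) * (1 * x h t + (-1) * x 0 t) + (-1) * q t) y\<bar> \<le> \<bar>y\<bar> * (e / (\<bar>y\<bar> + 1))"
      by (rule prim_bound_abs[OF c2]) (use d(2)[OF h(1,2)] in \<open>auto intro: less_imp_le\<close>)
    also have "\<dots> < e" using e by (simp add: divide_less_eq add_nonneg_pos algebra_simps)
    finally show "norm ((prim (x h) y - prim (x 0) y) / h - prim q y) < e" unfolding eq by simp
  qed (use d h0 in auto)
qed

lemma mvt_between:
  fixes f f' :: "real \<Rightarrow> real"
  assumes "\<And>t. (f has_real_derivative f' t) (at t)"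
  shows "\<exists>\<xi>. \<bar>\<xi> - a\<bar> \<le> \<bar>b - a\<bar> \<and> f b - f a = f' \<xi> * (b - a)"
proof (cases a b rule: linorder_cases)
  case less
  from MVT2[OF less, of f f'] assms obtain z where "a < z" "z < b" "f b - f a = (b - a) * f' z" by auto
  thus ?thesis by (intro exI[of _ z]) (auto simp: mult.commute)
next
  case greater
  from MVT2[OF greater, of f f'] assms obtain z where "b < z" "z < a" "f a - f b = (a - b) * f' z" by auto
  thus ?thesis by (intro exI[of _ z]) (auto simp: algebra_simps)
qed auto

text \<open>Leibniz rule. The mean value theorem in y writes the effect of the moving endpoint as a
  value of x at an intermediate point, and joint continuity at (0, \<tau> 0) identifies its
  limit.\<close>

lemma moving_endpoint_deriv:
  fixes X x :: "real \<Rightarrow> real \<Rightarrow> real" and \<tau> :: "real \<Rightarrow> real"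
  assumes h0: "0 < h0" and X: "\<And>h y. \<bar>h\<bar> < h0 \<Longrightarrow> (X h has_real_derivative x h y) (at y)"
    and \<tau>: "(\<tau> has_real_derivative \<tau>') (at 0)" and j: "isCont (\<lambda>z. x (fst z) (snd z)) (0, \<tau> 0)"
    and Xp: "((\<lambda>h. X h (\<tau> 0)) has_real_derivative X') (at 0)"
  shows "((\<lambda>h. X h (\<tau> h)) has_real_derivative X' + x 0 (\<tau> 0) * \<tau>') (at 0)"
proof -
  have "\<forall>h. \<exists>\<xi>. \<bar>h\<bar> < h0 \<longrightarrow> \<bar>\<xi> - \<tau> 0\<bar> \<le> \<bar>\<tau> h - \<tau> 0\<bar> \<and> X h (\<tau> h) - X h (\<tau> 0) = x h \<xi> * (\<tau> h - \<tau> 0)"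
    using mvt_between[OF X] by meson
  then obtain \<xi> where \<xi>: "\<And>h. \<bar>h\<bar> < h0 \<Longrightarrow> \<bar>\<xi> h - \<tau> 0\<bar> \<le> \<bar>\<tau> h - \<tau> 0\<bar>"
    "\<And>h. \<bar>h\<bar> < h0 \<Longrightarrow> X h (\<tau> h) - X h (\<tau> 0) = x h (\<xi> h) * (\<tau> h - \<tau> 0)" by metis
  have ev: "\<forall>\<^sub>F h in at 0. \<bar>h\<bar> < h0 \<and> h \<noteq> 0"
    unfolding eventually_at using h0 by (auto simp: dist_real_def)
  have tc: "(\<tau> \<longlongrightarrow> \<tau> 0) (at 0)" using DERIV_isCont[OF \<tau>] by (simp add: isCont_def)
  have "((\<lambda>h. \<xi> h - \<tau> 0) \<longlongrightarrow> 0) (at 0)"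
  proof (rule Lim_null_comparison)
    show "\<forall>\<^sub>F h in at 0. norm (\<xi> h - \<tau> 0) \<le> \<bar>\<tau> h - \<tau> 0\<bar>" using ev by eventually_elim (use \<xi>(1) in auto)
    show "((\<lambda>h. \<bar>\<tau> h - \<tau> 0\<bar>) \<longlongrightarrow> 0) (at 0)" using tendsto_rabs[OF tendsto_diff[OF tc tendsto_const[of "\<tau> 0"]]] by simp
  qed
  hence xic: "(\<xi> \<longlongrightarrow> \<tau> 0) (at 0)" by (simp add: LIM_zero_iff)
  have "((\<lambda>h. (h, \<xi> h)) \<longlongrightarrow> (0, \<tau> 0)) (at 0)" by (intro tendsto_Pair xic tendsto_ident_at)
  from isCont_tendsto_compose[OF j this] have xl: "((\<lambda>h. x h (\<xi> h)) \<longlongrightarrow> x 0 (\<tau> 0)) (at 0)" by simp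
  have dt: "((\<lambda>h. (\<tau> h - \<tau> 0) / h) \<longlongrightarrow> \<tau>') (at 0)" using \<tau> by (simp add: DERIV_def)
  have dX: "((\<lambda>h. (X h (\<tau> 0) - X 0 (\<tau> 0)) / h) \<longlongrightarrow> X') (at 0)" using Xp by (simp add: DERIV_def)
  have "((\<lambda>h. (X h (\<tau> 0) - X 0 (\<tau> 0)) / h + x h (\<xi> h) * ((\<tau> h - \<tau> 0) / h)) \<longlongrightarrow> X' + x 0 (\<tau> 0) * \<tau>') (at 0)"
    by (intro tendsto_intros xl dt dX)
  moreover have "\<forall>\<^sub>F h in at 0. (X h (\<tau> 0) - X 0 (\<tau> 0)) / h + x h (\<xi> h) * ((\<tau> h - \<tau> 0) / h) = (X h (\<tau> h) - X 0 (\<tau> 0)) / h"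
    using ev
  proof eventually_elim
    case (elim h)
    have "X h (\<tau> h) - X 0 (\<tau> 0) = (X h (\<tau> 0) - X 0 (\<tau> 0)) + x h (\<xi> h) * (\<tau> h - \<tau> 0)" using \<xi>(2)[of h] elim by simp
    thus ?case by (simp add: add_divide_distrib diff_divide_distrib right_diff_distrib)
  qed
  ultimately have "((\<lambda>h. (X h (\<tau> h) - X 0 (\<tau> 0)) / h) \<longlongrightarrow> X' + x 0 (\<tau> 0) * \<tau>') (at 0)"
    by (rule Lim_transform_eventually)
  thus ?thesis by (simp add: DERIV_def)
qed

section \<open>Derivatives of the profile along a direction of parameters\<close>

locale direction = family +
  fixes E \<kappa> \<omega> \<zeta> e1 e2 e3 :: real
  assumes pW: "(E, \<kappa>, \<omega>, \<zeta>) \<in> W"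
begin

text \<open>A line through the base point with velocity (e1, e2, e3) in (E, kappa, omega), zeta
  being fixed. One computation serves all three partial derivatives.\<close>

definition qq :: "real \<Rightarrow> params" where "qq h = (E + h * e1, \<kappa> + h * e2, \<omega> + h * e3, \<zeta>)"

abbreviation p0 :: params where "p0 \<equiv> (E, \<kappa>, \<omega>, \<zeta>)"
abbreviation T :: real where "T \<equiv> period w p0"

lemma qq0 [simp]: "qq 0 = p0" by (simp add: qq_def)

text \<open>Within this radius the waves exist and their amplitudes stay in one compact interval of
  the positive half-line, away from the singularity of kappa^2 / a^2.\<close>

definition h0 :: real where
  "h0 = (SOME h. 0 < h \<and> (\<forall>x. \<bar>x\<bar> < h \<longrightarrow> qq x \<in> W \<and> lo w p0 / 2 \<le> lo w (qq x) \<and> hi w (qq x) \<le> hi w p0 + 1))"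

definition m :: real where "m = lo w p0 / 2"
definition M :: real where "M = hi w p0 + 1"

lemma lohi_lim: "((\<lambda>h. lo w (qq h)) \<longlongrightarrow> lo w p0) (at 0)" "((\<lambda>h. hi w (qq h)) \<longlongrightarrow> hi w p0) (at 0)"
proof -
  have oW: "open W" and c: "continuous_on W (lo w)" "continuous_on W (hi w)" using fam by (auto simp: wave_family_def)
  have q: "(qq \<longlongrightarrow> p0) (at 0)" unfolding qq_def[abs_def] by (auto intro!: tendsto_eq_intros)
  have "isCont (lo w) p0" "isCont (hi w) p0" using c oW pW by (auto simp: continuous_on_eq_continuous_at)
  thus "((\<lambda>h. lo w (qq h)) \<longlongrightarrow> lo w p0) (at 0)" "((\<lambda>h. hi w (qq h)) \<longlongrightarrow> hi w p0) (at 0)"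
    by (auto intro: isCont_tendsto_compose[OF _ q])
qed

lemma h0: "0 < h0" "\<bar>x\<bar> < h0 \<Longrightarrow> qq x \<in> W" "\<bar>x\<bar> < h0 \<Longrightarrow> m \<le> lo w (qq x)" "\<bar>x\<bar> < h0 \<Longrightarrow> hi w (qq x) \<le> M"
proof -
  have oW: "open W" using fam by (auto simp: wave_family_def)
  have q: "(qq \<longlongrightarrow> p0) (at 0)" unfolding qq_def[abs_def] by (auto intro!: tendsto_eq_intros)
  have 1: "\<forall>\<^sub>F h in at 0. qq h \<in> W" by (rule topological_tendstoD[OF q oW pW])
  have l: "0 < lo w p0" by (rule ends[OF pW])
  have 2: "\<forall>\<^sub>F h in at 0. lo w p0 / 2 < lo w (qq h)" by (rule order_tendstoD(1)[OF lohi_lim(1)]) (use l in simp)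
  have 3: "\<forall>\<^sub>F h in at 0. hi w (qq h) < hi w p0 + 1" by (rule order_tendstoD(2)[OF lohi_lim(2)]) simp
  from eventually_conj[OF 1 eventually_conj[OF 2 3]] obtain h where h: "0 < h"
    "\<And>x. x \<noteq> 0 \<Longrightarrow> \<bar>x\<bar> < h \<Longrightarrow> qq x \<in> W \<and> lo w p0 / 2 < lo w (qq x) \<and> hi w (qq x) < hi w p0 + 1"
    unfolding eventually_at dist_real_def by auto
  have "qq x \<in> W \<and> lo w p0 / 2 \<le> lo w (qq x) \<and> hi w (qq x) \<le> hi w p0 + 1" if "\<bar>x\<bar> < h" for x
    using h(2)[of x] that pW l by (cases "x = 0") auto
  hence "\<exists>h. 0 < h \<and> (\<forall>x. \<bar>x\<bar> < h \<longrightarrow> qq x \<in> W \<and> lo w p0 / 2 \<le> lo w (qq x) \<and> hi w (qq x) \<le> hi w p0 + 1)" using h(1) by blast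
  from someI_ex[OF this, folded h0_def]
  show "0 < h0" "\<bar>x\<bar> < h0 \<Longrightarrow> qq x \<in> W" "\<bar>x\<bar> < h0 \<Longrightarrow> m \<le> lo w (qq x)" "\<bar>x\<bar> < h0 \<Longrightarrow> hi w (qq x) \<le> M"
    by (auto simp: m_def M_def)
qed

lemma mpos: "0 < m" "m \<le> M"
  using ends(1,2)[OF pW] by (auto simp: m_def M_def)

text \<open>The difference quotients in \<open>h\<close> of \<open>R\<close> and of \<open>R'/2\<close>.\<close>

definition rr :: "real \<Rightarrow> real \<Rightarrow> real" where "rr h a = 2 * e1 - e3 * a\<^sup>2 - (2 * \<kappa> * e2 + h * e2\<^sup>2) / a\<^sup>2"
definition nn :: "real \<Rightarrow> real \<Rightarrow> real" where "nn h a = - e3 * a + (2 * \<kappa> * e2 + h * e2\<^sup>2) / a^3"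
definition l' :: real where "l' = - rr 0 (lo w p0) / (2 * Nf w p0 (lo w p0))"

lemma R_split: "Rfun (nlF w) (qq h) a = Rfun (nlF w) p0 a + h * rr h a"
  by (simp add: Rfun_def qq_def rr_def power2_eq_square add_divide_distrib diff_divide_distrib algebra_simps)

lemma N_split: "Nf w (qq h) a = Nf w p0 a + h * nn h a"
  by (simp add: Nf_def qq_def nn_def power2_eq_square add_divide_distrib diff_divide_distrib algebra_simps)

text \<open>Implicit differentiation of R = 0 at the lower endpoint, which is only known to be
  continuous. The Caratheodory factor \<open>g\<close> of R turns the root equation directly into a
  formula for the difference quotient.\<close>

lemma lo_deriv: "((\<lambda>h. lo w (qq h)) has_real_derivative l') (at 0)"
proof -
  let ?l = "lo w p0"
  have l0: "0 < ?l" by (rule ends[OF pW])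
  obtain g where g: "\<And>z. Rfun (nlF w) p0 z - Rfun (nlF w) p0 ?l = g z * (z - ?l)" "isCont g ?l" "g ?l = 2 * Nf w p0 ?l"
    using R_deriv[OF l0, of p0] unfolding CARAT_DERIV by blast
  have gl: "((\<lambda>h. g (lo w (qq h))) \<longlongrightarrow> 2 * Nf w p0 ?l) (at 0)"
    using isCont_tendsto_compose[OF g(2) lohi_lim(1)] g(3) by simp
  have nz: "2 * Nf w p0 ?l \<noteq> 0" using ends(6)[OF pW] by simp
  have rl: "((\<lambda>h. rr h (lo w (qq h))) \<longlongrightarrow> rr 0 ?l) (at 0)"
    unfolding rr_def using l0 by (intro tendsto_intros lohi_lim) auto
  have "((\<lambda>h. - rr h (lo w (qq h)) / g (lo w (qq h))) \<longlongrightarrow> l') (at 0)"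
    unfolding l'_def by (intro tendsto_intros rl gl nz)
  moreover have "\<forall>\<^sub>F h in at 0. - rr h (lo w (qq h)) / g (lo w (qq h)) = (lo w (qq h) - lo w (qq 0)) / h"
  proof -
    have "\<forall>\<^sub>F h in at 0. \<bar>h\<bar> < h0 \<and> h \<noteq> 0" unfolding eventually_at using h0(1) by (auto simp: dist_real_def)
    moreover have "\<forall>\<^sub>F h in at 0. g (lo w (qq h)) \<noteq> 0" by (rule tendsto_imp_eventually_ne[OF gl nz])
    ultimately show ?thesis
    proof eventually_elim
      case (elim h)
      have "Rfun (nlF w) p0 (lo w (qq h)) + h * rr h (lo w (qq h)) = 0"
        using ends(4)[OF h0(2)] elim by (simp flip: R_split)
      hence "g (lo w (qq h)) * (lo w (qq h) - ?l) = - (h * rr h (lo w (qq h)))"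
        using g(1)[of "lo w (qq h)"] ends(4)[OF pW] by simp
      thus ?case using elim by (simp add: field_simps)
    qed
  qed
  ultimately have "((\<lambda>h. (lo w (qq h) - lo w (qq 0)) / h) \<longlongrightarrow> l') (at 0)" by (rule Lim_transform_eventually)
  thus ?thesis by (simp add: DERIV_def)
qed

lemma nn_limit: "uniform_limit {m..M} nn (nn 0) (at 0)" "continuous_on {m..M} (nn 0)"
proof -
  show "continuous_on {m..M} (nn 0)" unfolding nn_def[abs_def] using mpos by (intro continuous_intros) auto
  have c: "continuous_on {m..M} (\<lambda>a. e2\<^sup>2 / a^3)" using mpos by (intro continuous_intros) auto
  have b: "bounded ((\<lambda>a. e2\<^sup>2 / a^3) ` {m..M})" by (intro compact_imp_bounded compact_continuous_image c) auto
  have "uniform_limit {m..M} (\<lambda>h a. nn 0 a + h * (e2\<^sup>2 / a^3)) (\<lambda>a. nn 0 a + 0 * (e2\<^sup>2 / a^3)) (at 0)"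
  proof (intro uniform_limit_add uniform_lim_mult)
    show "uniform_limit {m..M} (\<lambda>h y. h) (\<lambda>y. 0) (at (0::real))"
      by (auto simp: uniform_limit_iff eventually_at dist_real_def)
  qed (use b bounded_zero_image in \<open>auto simp: uniform_limit_const\<close>)
  moreover have "(\<lambda>h a. nn 0 a + h * (e2\<^sup>2 / a^3)) = nn" by (simp add: nn_def fun_eq_iff add_divide_distrib)
  ultimately show "uniform_limit {m..M} nn (nn 0) (at 0)" by simp
qed

sublocale ivp "\<lambda>h. amp w (qq h)" "\<lambda>h. A1 (qq h)" "\<lambda>h. Nf w (qq h)" nn "Nd w p0" "\<lambda>h. lo w (qq h)" h0 m M l'
proof (unfold_locales, goal_cases)
  case (5 h y)
  have "amp w (qq h) y \<in> {lo w (qq h)..hi w (qq h)}" by (rule profile(4)[OF h0(2)[OF 5]])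
  thus ?case using h0(3,4)[OF 5] by simp
next
  case (9 a)
  thus ?case using mpos by (simp add: Nf_deriv)
qed (use h0 mpos profile[OF h0(2)] N_split Nd_cont nn_limit lo_deriv in auto)

end

lemma uniform_deriv0_joint_isCont:
  assumes "uniform_deriv0 x q" shows "isCont (\<lambda>z. x (fst z) (snd z)) (0, y0)"
  unfolding continuous_at_eps_delta
proof (intro allI impI)
  fix e :: real assume e: "0 < e"
  have e2: "0 < e / 2" using e by simp
  from uniform_limitD[OF uniform_deriv0_uniform_limit[OF assms, of "\<bar>y0\<bar> + 1"] e2] obtain d where d: "0 < d"
    "\<And>h y. h \<noteq> 0 \<Longrightarrow> \<bar>h\<bar> < d \<Longrightarrow> y \<in> {-(\<bar>y0\<bar> + 1)..\<bar>y0\<bar> + 1} \<Longrightarrow> \<bar>x h y - x 0 y\<bar> < e / 2"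
    unfolding eventually_at dist_real_def by auto
  have "isCont (x 0) y0" using assms by (simp add: uniform_deriv0_def continuous_on_eq_continuous_at)
  then obtain d' where d': "0 < d'" "\<And>y. \<bar>y - y0\<bar> < d' \<Longrightarrow> \<bar>x 0 y - x 0 y0\<bar> < e / 2"
    using e2 unfolding continuous_at_eps_delta dist_real_def by blast
  show "\<exists>s>0. \<forall>z. dist z (0, y0) < s \<longrightarrow> dist (x (fst z) (snd z)) (x (fst (0, y0)) (snd (0, y0))) < e"
  proof (rule exI[of _ "Min {d, d', 1}"], intro conjI allI impI)
    show "0 < Min {d, d', 1}" using d d' by simp
    fix z :: "real \<times> real" assume z: "dist z (0, y0) < Min {d, d', 1}"
    obtain h y where hy: "z = (h, y)" by (cases z)
    have 1: "\<bar>h\<bar> \<le> dist z (0, y0)" using dist_fst_le[of z "(0, y0)"] by (simp add: hy dist_real_def)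
    have 2: "\<bar>y - y0\<bar> \<le> dist z (0, y0)" using dist_snd_le[of z "(0, y0)"] by (simp add: hy dist_real_def)
    have h: "\<bar>h\<bar> < d" and y: "\<bar>y - y0\<bar> < d'" "\<bar>y - y0\<bar> < 1" using z 1 2 by auto
    have "\<bar>x h y - x 0 y\<bar> < e / 2"
    proof (cases "h = 0")
      case False
      have "y \<in> {-(\<bar>y0\<bar> + 1)..\<bar>y0\<bar> + 1}" using y(2) by auto
      from d(2)[OF False h this] show ?thesis .
    qed (use e2 in simp)
    moreover have "\<bar>x 0 y - x 0 y0\<bar> < e / 2" by (rule d'(2)[OF y(1)])
    ultimately have "\<bar>x h y - x 0 y0\<bar> < e" by linarith
    thus "dist (x (fst z) (snd z)) (x (fst (0, y0)) (snd (0, y0))) < e" by (simp add: hy dist_real_def)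
  qed
qed

context family
begin

lemma phs_shift:
  assumes q: "q \<in> W" shows "phs w q (y + period w q) = phs w q y + eta w q"
proof -
  have "((\<lambda>y. phs w q (y + period w q) - phs w q y) has_real_derivative 0) (at y)" for y
  proof -
    have "((\<lambda>y. phs w q (y + period w q)) has_real_derivative fst (snd q) / (amp w q (y + period w q))\<^sup>2) (at y)"
      using profile(10)[OF q, of "y + period w q"] by (simp add: DERIV_shift)
    from DERIV_diff[OF this profile(10)[OF q, of y]] show ?thesis using profile(7)[OF q] by simp
  qed
  hence "phs w q (y + period w q) - phs w q y = phs w q (0 + period w q) - phs w q 0"
    using DERIV_isconst_all[of "\<lambda>y. phs w q (y + period w q) - phs w q y" y 0] by blast
  thus ?thesis using moments(2)[OF q] profile(11)[OF q] by simp
qed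

lemma A1_shift: "q \<in> W \<Longrightarrow> A1 q (y + period w q) = A1 q y"
proof (rule DERIV_unique)
  assume q: "q \<in> W"
  show "((\<lambda>y. amp w q (y + period w q)) has_real_derivative A1 q (y + period w q)) (at y)"
    using profile(1)[OF q, of "y + period w q"] by (simp add: DERIV_shift)
  show "((\<lambda>y. amp w q (y + period w q)) has_real_derivative A1 q y) (at y)"
    using profile(1)[OF q] profile(7)[OF q] by simp
qed

lemma at_period:
  assumes "q \<in> W" shows "amp w q (period w q) = lo w q" "A1 q (period w q) = 0"
  using profile(7)[OF assms, of 0] A1_shift[OF assms, of 0] profile(8,9)[OF assms] by simp_all

end

context direction
begin

abbreviation A :: "real \<Rightarrow> real" where "A \<equiv> amp w p0"
abbreviation dA :: "real \<Rightarrow> real" where "dA \<equiv> A1 p0"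

lemma udA: "uniform_deriv0 (\<lambda>h. amp w (qq h)) Da" "uniform_deriv0 (\<lambda>h. A1 (qq h)) Da1"
proof -
  have "continuous_on UNIV Da" "continuous_on UNIV Da1"
    by (intro continuous_at_imp_continuous_on ballI DERIV_isCont[OF Da_deriv] DERIV_isCont[OF Da1_deriv])+
  thus "uniform_deriv0 (\<lambda>h. amp w (qq h)) Da" "uniform_deriv0 (\<lambda>h. A1 (qq h)) Da1"
    unfolding uniform_deriv0_def using Da_uniform_limit amp_cont[OF pW] A1_cont[OF pW] by auto
qed

lemma joint_N: "isCont (\<lambda>z. Nf w (qq (fst z)) (amp w (qq (fst z)) (snd z))) (0, y0)"
proof -
  note j = uniform_deriv0_joint_isCont[OF udA(1), of y0]
  have pos: "0 < A y0" by (rule profile(5)[OF pW])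
  have 1: "isCont (\<lambda>z. Nf w p0 (amp w (qq (fst z)) (snd z))) (0, y0)"
    by (rule isCont_o2[OF j]) (use DERIV_isCont[OF Nf_deriv[OF pos]] in simp)
  have 2: "isCont (\<lambda>z. nn (fst z) (amp w (qq (fst z)) (snd z))) (0, y0)"
    unfolding nn_def using pos by (intro continuous_intros j isCont_fst) auto
  show ?thesis unfolding N_split by (intro continuous_intros 1 2 isCont_fst)
qed

text \<open>The half period is the first positive zero of A_y, so for small h it must be kept from
  jumping. The perturbed A_y is still negative just after T/2, nonzero on a compact interval before
  it, and near y = 0 it increases from its zero there.\<close>

lemma half_period_tendsto: "((\<lambda>h. period w (qq h) / 2) \<longlongrightarrow> T / 2) (at 0)"
proof (rule LIM_I)
  fix e :: real assume e: "0 < e"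
  note P = half_period[OF pW]
  have "(dA has_real_derivative Nf w p0 (hi w p0)) (at (T/2))" using profile(2)[OF pW, of "T/2"] P(4) by simp
  from DERIV_neg_dec_right[OF this ends(7)[OF pW]] P(3) obtain d where d: "0 < d" "\<And>x. 0 < x \<Longrightarrow> x < d \<Longrightarrow> dA (T/2 + x) < 0" by auto
  define \<epsilon> where "\<epsilon> = Min {e, d, T/2} / 2"
  have \<epsilon>: "0 < \<epsilon>" "\<epsilon> < e" "\<epsilon> < d" "\<epsilon> \<le> T/4"
  proof -
    have m: "0 < Min {e, d, T/2}" "Min {e, d, T/2} \<le> e" "Min {e, d, T/2} \<le> d" "Min {e, d, T/2} \<le> T/2" using e d P(1) by simp_all
    show "0 < \<epsilon>" "\<epsilon> < e" "\<epsilon> < d" "\<epsilon> \<le> T/4" using m unfolding \<epsilon>_def by linarith+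
  qed
  have neg: "dA (T/2 + \<epsilon>) < 0" using d(2) \<epsilon> by simp
  have N0: "0 < Nf w p0 (lo w p0)" by (rule ends(6)[OF pW])
  \<comment> \<open>Near y = 0 the slope A_y itself is small and closeness gives no sign; the
    positivity of A_yy, uniform in h, is used instead.\<close>
  obtain \<delta>0 where \<delta>0: "0 < \<delta>0" "\<And>h y. \<bar>h\<bar> < \<delta>0 \<Longrightarrow> \<bar>y\<bar> < \<delta>0 \<Longrightarrow> 0 < Nf w (qq h) (amp w (qq h) y)"
  proof -
    from joint_N[of 0, unfolded continuous_at_eps_delta, rule_format, OF N0] profile(8)[OF pW]
    obtain s where s: "0 < s" "\<And>z. dist z (0,0) < s \<Longrightarrow> \<bar>Nf w (qq (fst z)) (amp w (qq (fst z)) (snd z)) - Nf w p0 (lo w p0)\<bar> < Nf w p0 (lo w p0)"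
      by (auto simp: dist_real_def)
    show ?thesis
    proof (rule that[of "s/2"])
      fix h y :: real assume "\<bar>h\<bar> < s/2" "\<bar>y\<bar> < s/2"
      hence "dist (h,y) (0,0) < s"
        using sqrt_sum_squares_le_sum_abs[of h y] by (simp add: dist_Pair_Pair dist_real_def)
      from s(2)[OF this] show "0 < Nf w (qq h) (amp w (qq h) y)" by simp
    qed (use s in simp)
  qed
  define d' where "d' = min \<delta>0 (T/4)"
  have d': "0 < d'" "d' \<le> \<delta>0" "d' \<le> T/4" using \<delta>0 P(1) by (auto simp: d'_def)
  have "\<exists>x\<in>{d'..T/2 - \<epsilon>}. \<forall>y\<in>{d'..T/2 - \<epsilon>}. dA x \<le> dA y"
    by (rule continuous_attains_inf) (use d' \<epsilon> A1_cont[OF pW] in auto)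
  then obtain x0 where x0: "x0 \<in> {d'..T/2 - \<epsilon>}" "\<And>y. y \<in> {d'..T/2 - \<epsilon>} \<Longrightarrow> dA x0 \<le> dA y" by blast
  \<comment> \<open>The margin by which A_y is positive on [d', T/2 - \<epsilon>] and negative at
    T/2 + \<epsilon>; a perturbation smaller than \<open>c\<close> keeps both signs.\<close>
  define c where "c = min (dA x0) (- dA (T/2 + \<epsilon>))"
  have c: "0 < c" "c \<le> dA x0" "c \<le> - dA (T/2 + \<epsilon>)" using P(2)[of x0] x0(1) d' \<epsilon> neg by (auto simp: c_def)
  have "0 < T" by (rule P(1))
  obtain C \<delta>1 where C: "0 < \<delta>1" "\<delta>1 \<le> h0" "0 \<le> C"
    "\<And>h y. \<bar>h\<bar> < \<delta>1 \<Longrightarrow> \<bar>y\<bar> \<le> T \<Longrightarrow> \<bar>amp w (qq h) y - amp w (qq 0) y\<bar> \<le> C * \<bar>h\<bar> \<and> \<bar>A1 (qq h) y - A1 (qq 0) y\<bar> \<le> C * \<bar>h\<bar>"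
    by (rule Lipschitz_in_h[OF \<open>0 < T\<close>], rule that; assumption)
  define \<delta> where "\<delta> = Min {\<delta>0, \<delta>1, c / (C + 1)}"
  have \<delta>: "0 < \<delta>" "\<delta> \<le> \<delta>0" "\<delta> \<le> \<delta>1" "\<delta> \<le> c / (C + 1)" using \<delta>0 C c by (simp_all add: \<delta>_def)
  show "\<exists>s>0. \<forall>h. h \<noteq> 0 \<and> norm (h - 0) < s \<longrightarrow> norm (period w (qq h) / 2 - T/2) < e"
  proof (rule exI[of _ \<delta>], intro conjI allI impI \<delta>(1))
    fix h :: real assume "h \<noteq> 0 \<and> norm (h - 0) < \<delta>"
    hence h: "\<bar>h\<bar> < \<delta>" by simp
    have q: "qq h \<in> W" using h \<delta> C h0 by simp
    note Q = half_period[OF q]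
    define t where "t = period w (qq h) / 2"
    have t: "0 < t" "\<And>y. 0 < y \<Longrightarrow> y < t \<Longrightarrow> 0 < A1 (qq h) y" "A1 (qq h) t = 0" using Q by (simp_all add: t_def)
    have "\<bar>h\<bar> < c / (C + 1)" using h \<delta> by simp
    hence "\<bar>h\<bar> * (C + 1) < c" using C(3) by (simp add: pos_less_divide_eq)
    moreover have "C * \<bar>h\<bar> \<le> \<bar>h\<bar> * (C + 1)" by (simp add: algebra_simps)
    ultimately have Ch: "C * \<bar>h\<bar> < c" by linarith
    have close: "\<bar>A1 (qq h) y - dA y\<bar> < c" if "0 \<le> y" "y \<le> T" for y
      using C(4)[of h y] h \<delta> that Ch by simp
    have "t \<le> T/2 + \<epsilon>"
    proof (rule ccontr)
      assume "\<not> t \<le> T/2 + \<epsilon>"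
      hence "0 < A1 (qq h) (T/2 + \<epsilon>)" using t(2) \<epsilon> P(1) by simp
      moreover have "\<bar>A1 (qq h) (T/2 + \<epsilon>) - dA (T/2 + \<epsilon>)\<bar> < c" using \<epsilon> P(1) by (intro close) auto
      ultimately show False using c(3) by linarith
    qed
    moreover have "T/2 - \<epsilon> < t"
    proof (rule ccontr)
      assume "\<not> T/2 - \<epsilon> < t"
      hence le: "t \<le> T/2 - \<epsilon>" by simp
      show False
      proof (cases "t < d'")
        case True
        have "A1 (qq h) 0 < A1 (qq h) t"
        proof (rule DERIV_pos_imp_increasing[OF t(1)])
          fix x assume x: "0 \<le> x" "x \<le> t"
          have "0 < Nf w (qq h) (amp w (qq h) x)" using x True d' h \<delta> by (intro \<delta>0(2)) auto
          thus "\<exists>y. (A1 (qq h) has_real_derivative y) (at x) \<and> 0 < y" using profile(2)[OF q] by blast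
        qed
        thus False using t(3) profile(9)[OF q] by simp
      next
        case False
        have "\<bar>A1 (qq h) t - dA t\<bar> < c" using t(1) le \<epsilon> P(1) by (intro close) auto
        moreover have "dA x0 \<le> dA t" using False le by (intro x0(2)) auto
        ultimately show False using c(2) t(3) by linarith
      qed
    qed
    ultimately show "norm (period w (qq h) / 2 - T/2) < e" using \<epsilon>(2) by (simp add: t_def abs_less_iff)
  qed
qed

text \<open>From A_y(T/2) = 0 by implicit differentiation: the derivative of T/2 is - (A_y)_h / A_yy
  at T/2, where the amplitude is the upper endpoint.\<close>

definition T' :: real where "T' = - 2 * Da1 (T/2) / Nf w p0 (hi w p0)"

lemma near0: "\<forall>\<^sub>F h in at 0. \<bar>h\<bar> < h0 \<and> h \<noteq> 0"
  unfolding eventually_at using h0(1) by (auto simp: dist_real_def)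

lemma period_deriv: "((\<lambda>h. period w (qq h)) has_real_derivative T') (at 0)"
proof -
  let ?t = "\<lambda>h. period w (qq h) / 2"
  have "\<forall>h. \<exists>\<xi>. \<bar>h\<bar> < h0 \<longrightarrow> \<bar>\<xi> - T/2\<bar> \<le> \<bar>?t h - T/2\<bar> \<and> A1 (qq h) (?t h) - A1 (qq h) (T/2) = Nf w (qq h) (amp w (qq h) \<xi>) * (?t h - T/2)"
    using mvt_between[OF profile(2)[OF h0(2)]] by meson
  then obtain \<xi> where \<xi>: "\<And>h. \<bar>h\<bar> < h0 \<Longrightarrow> \<bar>\<xi> h - T/2\<bar> \<le> \<bar>?t h - T/2\<bar>"
    "\<And>h. \<bar>h\<bar> < h0 \<Longrightarrow> A1 (qq h) (?t h) - A1 (qq h) (T/2) = Nf w (qq h) (amp w (qq h) (\<xi> h)) * (?t h - T/2)" by metis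
  have "((\<lambda>h. \<xi> h - T/2) \<longlongrightarrow> 0) (at 0)"
  proof (rule Lim_null_comparison)
    show "\<forall>\<^sub>F h in at 0. norm (\<xi> h - T/2) \<le> \<bar>?t h - T/2\<bar>" using near0 by eventually_elim (use \<xi>(1) in auto)
    show "((\<lambda>h. \<bar>?t h - T/2\<bar>) \<longlongrightarrow> 0) (at 0)"
      using tendsto_rabs[OF tendsto_diff[OF half_period_tendsto tendsto_const[of "T/2"]]] by simp
  qed
  hence xic: "(\<xi> \<longlongrightarrow> T/2) (at 0)" by (simp add: LIM_zero_iff)
  have "((\<lambda>h. (h, \<xi> h)) \<longlongrightarrow> (0, T/2)) (at 0)" by (intro tendsto_Pair xic tendsto_ident_at)
  from isCont_tendsto_compose[OF joint_N this]
  have Nl: "((\<lambda>h. Nf w (qq h) (amp w (qq h) (\<xi> h))) \<longlongrightarrow> Nf w p0 (hi w p0)) (at 0)"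
    using half_period(4)[OF pW] by simp
  have nz: "Nf w p0 (hi w p0) \<noteq> 0" using ends(7)[OF pW] by simp
  have D1: "((\<lambda>h. (A1 (qq h) (T/2) - dA (T/2)) / h) \<longlongrightarrow> Da1 (T/2)) (at 0)"
    using Da_param_deriv(2)[of "T/2"] by (simp add: DERIV_def)
  have "((\<lambda>h. - 2 * ((A1 (qq h) (T/2) - dA (T/2)) / h) / Nf w (qq h) (amp w (qq h) (\<xi> h))) \<longlongrightarrow> T') (at 0)"
    unfolding T'_def by (intro tendsto_intros D1 Nl nz)
  moreover have "\<forall>\<^sub>F h in at 0. - 2 * ((A1 (qq h) (T/2) - dA (T/2)) / h) / Nf w (qq h) (amp w (qq h) (\<xi> h)) = (period w (qq h) - T) / h"
    using near0 tendsto_imp_eventually_ne[OF Nl nz]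
  proof eventually_elim
    case (elim h)
    have "A1 (qq h) (?t h) = 0" "dA (T/2) = 0" using half_period(3)[OF h0(2)] half_period(3)[OF pW] elim by auto
    hence "- A1 (qq h) (T/2) = Nf w (qq h) (amp w (qq h) (\<xi> h)) * (?t h - T/2)" using \<xi>(2)[of h] elim by simp
    hence "- 2 * A1 (qq h) (T/2) = Nf w (qq h) (amp w (qq h) (\<xi> h)) * (period w (qq h) - T)" by (simp add: algebra_simps)
    thus ?case using elim \<open>dA (T/2) = 0\<close> by (simp add: divide_simps)
  qed
  ultimately have "((\<lambda>h. (period w (qq h) - T) / h) \<longlongrightarrow> T') (at 0)" by (rule Lim_transform_eventually)
  thus ?thesis by (simp add: DERIV_def)
qed

text \<open>The derivative of S_y = kappa / A^2 along the direction; its primitive \<open>DS\<close>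
  is the derivative of S at fixed y.\<close>

definition qS :: "real \<Rightarrow> real" where
  "qS y = e2 / (A y)\<^sup>2 - 2 * \<kappa> * Da y / (A y)^3"
definition DS :: "real \<Rightarrow> real" where "DS = prim qS"

lemma uniform_deriv0_S: "uniform_deriv0 (\<lambda>h y. (\<kappa> + h * e2) / (amp w (qq h) y)\<^sup>2) qS"
proof -
  have i: "uniform_deriv0 (\<lambda>h y. inverse (amp w (qq h) y)) (\<lambda>y. - Da y * (inverse (A y) * inverse (A y)))"
    using uniform_deriv0_inverse[OF udA(1), of m h0] mpos(1) h0(1) rng rng[of 0] by simp
  from uniform_deriv0_mult[OF uniform_deriv0_affine[of \<kappa> e2] uniform_deriv0_mult[OF i i]]
  have "uniform_deriv0 (\<lambda>h y. (\<kappa> + h * e2) * (inverse (amp w (qq h) y) * inverse (amp w (qq h) y)))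
    (\<lambda>y. e2 * (inverse (A y) * inverse (A y)) + \<kappa> * (- Da y * (inverse (A y) * inverse (A y)) * inverse (A y) + inverse (A y) * (- Da y * (inverse (A y) * inverse (A y)))))" by simp
  moreover have "(\<lambda>y. e2 * (inverse (A y) * inverse (A y)) + \<kappa> * (- Da y * (inverse (A y) * inverse (A y)) * inverse (A y) + inverse (A y) * (- Da y * (inverse (A y) * inverse (A y))))) = qS"
    by (simp add: qS_def fun_eq_iff divide_inverse power2_eq_square power3_eq_cube algebra_simps)
  moreover have "(\<lambda>h y. (\<kappa> + h * e2) * (inverse (amp w (qq h) y) * inverse (amp w (qq h) y))) = (\<lambda>h y. (\<kappa> + h * e2) / (amp w (qq h) y)\<^sup>2)"
    by (simp add: fun_eq_iff divide_inverse power2_eq_square)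
  ultimately show ?thesis by simp
qed

lemma qS_cont: "continuous_on UNIV qS"
  using uniform_deriv0_S by (simp add: uniform_deriv0_def)

lemma DS_deriv: "(DS has_real_derivative qS y) (at y)" "DS 0 = 0"
  using prim_has_vector_derivative[OF qS_cont] by (simp_all add: DS_def has_real_derivative_iff_has_vector_derivative)

lemma deriv_cong_near:
  assumes "(f has_real_derivative D) (at 0)" "\<And>h. \<bar>h\<bar> < h0 \<Longrightarrow> f h = g h"
  shows "(g has_real_derivative D) (at 0)"
  by (rule has_field_derivative_transform_within_open[OF assms(1), of "{-h0<..<h0}"]) (use assms(2) h0(1) in auto)

lemma phs_param_deriv: "((\<lambda>h. phs w (qq h) y) has_real_derivative DS y) (at 0)"
proof (rule deriv_cong_near)
  have c: "continuous_on UNIV (\<lambda>y. (\<kappa> + h * e2) / (amp w (qq h) y)\<^sup>2)" if "\<bar>h\<bar> < h0" for h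
    using profile(5)[OF h0(2)[OF that]] by (intro continuous_intros amp_cont[OF h0(2)[OF that]]) (auto simp: less_imp_neq[symmetric])
  show "((\<lambda>h. prim (\<lambda>y. (\<kappa> + h * e2) / (amp w (qq h) y)\<^sup>2) y) has_real_derivative DS y) (at 0)"
    unfolding DS_def by (rule prim_param_deriv[OF uniform_deriv0_S h0(1) c])
  show "prim (\<lambda>y. (\<kappa> + h * e2) / (amp w (qq h) y)\<^sup>2) y = phs w (qq h) y" if "\<bar>h\<bar> < h0" for h
    using moments(5)[OF h0(2)[OF that], of y] by (simp add: qq_def)
qed

text \<open>The chain rule for eta = S(T); the amplitude at T is the lower endpoint.\<close>

definition eta' :: real where "eta' = DS T + \<kappa> / (lo w p0)\<^sup>2 * T'"

lemma joint_S: "isCont (\<lambda>z. (\<kappa> + fst z * e2) / (amp w (qq (fst z)) (snd z))\<^sup>2) (0, y0)"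
  by (rule uniform_deriv0_joint_isCont[OF uniform_deriv0_S])

lemma shifted_period_deriv: "((\<lambda>h. y + period w (qq h)) has_real_derivative T') (at 0)"
  using DERIV_add[OF DERIV_const period_deriv] by simp

lemma phs_h_deriv: "\<bar>h\<bar> < h0 \<Longrightarrow> (phs w (qq h) has_real_derivative (\<kappa> + h * e2) / (amp w (qq h) y)\<^sup>2) (at y)"
  using profile(10)[OF h0(2), of h y] by (simp add: qq_def)

lemma phs_moving: "((\<lambda>h. phs w (qq h) (y + period w (qq h))) has_real_derivative DS (y + T) + \<kappa> / (A y)\<^sup>2 * T') (at 0)"
proof -
  have "((\<lambda>h. phs w (qq h) (y + period w (qq h))) has_real_derivative DS (y + T) + (\<kappa> + 0 * e2) / (amp w (qq 0) (y + period w (qq 0)))\<^sup>2 * T') (at 0)"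
  proof (rule moving_endpoint_deriv[OF h0(1) phs_h_deriv shifted_period_deriv])
    show "isCont (\<lambda>z. (\<kappa> + fst z * e2) / (amp w (qq (fst z)) (snd z))\<^sup>2) (0, y + period w (qq 0))" by (rule joint_S)
    show "((\<lambda>h. phs w (qq h) (y + period w (qq 0))) has_real_derivative DS (y + T)) (at 0)"
      using phs_param_deriv[of "y + T"] by simp
  qed
  thus ?thesis using profile(7)[OF pW, of y] by simp
qed

lemma eta_deriv: "((\<lambda>h. eta w (qq h)) has_real_derivative eta') (at 0)"
  by (rule deriv_cong_near[where f="\<lambda>h. phs w (qq h) (0 + period w (qq h))"])
     (use phs_moving[of 0] profile(8)[OF pW] moments(2)[OF h0(2)] in \<open>simp_all add: eta'_def\<close>)

text \<open>Both sides of S(y + T) = S(y) + eta are differentiated, the left one with its moving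
  argument. \<open>Da_jump\<close> follows in the same way from A(y + T) = A(y).\<close>

lemma DS_jump: "DS (y + T) = DS y + eta' - T' * (\<kappa> / (A y)\<^sup>2)"
proof -
  have "((\<lambda>h. phs w (qq h) (y + period w (qq h))) has_real_derivative DS y + eta') (at 0)"
    by (rule deriv_cong_near[OF DERIV_add[OF phs_param_deriv eta_deriv]]) (use phs_shift[OF h0(2)] in simp)
  from DERIV_unique[OF this phs_moving] show ?thesis by (simp add: algebra_simps)
qed

lemma Da_jump: "Da (y + T) = Da y - T' * dA y"
proof -
  have "((\<lambda>h. amp w (qq h) (y + period w (qq h))) has_real_derivative Da (y + T) + dA (y + T) * T') (at 0)"
    using moving_endpoint_deriv[OF h0(1) profile(1)[OF h0(2)] shifted_period_deriv[of y] uniform_deriv0_joint_isCont[OF udA(2), of "y + period w (qq 0)"]]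
      Da_param_deriv(1)[of "y + T"] by simp
  moreover have "((\<lambda>h. amp w (qq h) (y + period w (qq h))) has_real_derivative Da y) (at 0)"
    by (rule deriv_cong_near[OF Da_param_deriv(1)]) (use profile(7)[OF h0(2)] in simp)
  ultimately show ?thesis using DERIV_unique A1_shift[OF pW, of y] by (fastforce simp: algebra_simps)
qed

text \<open>The linearization of A_y^2 = R(A). The defect has zero y-derivative by the linearized
  equation, and it vanishes at y = 0 by the value of \<open>l'\<close>.\<close>

lemma energy: "2 * dA y * Da1 y = rr 0 (A y) + 2 * Nf w p0 (A y) * Da y"
proof -
  let ?f = "\<lambda>y. 2 * dA y * Da1 y - rr 0 (A y) - 2 * Nf w p0 (A y) * Da y"
  have d1: "(dA has_real_derivative Nf w p0 (A y)) (at y)" for y by (rule profile(2)[OF pW])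
  have d2: "(Da1 has_real_derivative Nd w p0 (A y) * Da y + nn 0 (A y)) (at y)" for y using Da1_deriv[of y] by simp
  have d3: "((\<lambda>y. Nf w p0 (A y)) has_real_derivative Nd w p0 (A y) * dA y) (at y)" for y
    by (rule DERIV_chain2[where f="Nf w p0" and g=A, OF Nf_deriv[OF profile(5)[OF pW]] profile(1)[OF pW]])
  have d4: "((\<lambda>y. rr 0 (A y)) has_real_derivative 2 * nn 0 (A y) * dA y) (at y)" for y
  proof -
    have pos: "A y \<noteq> 0" using profile(5)[OF pW, of y] by simp
    show ?thesis unfolding rr_def nn_def using pos
      apply -
      apply (rule DERIV_cong)
       apply (rule derivative_intros profile(1)[OF pW] | simp)+
      apply (simp add: field_simps eval_nat_numeral)
      done
  qed
  have "(?f has_real_derivative 0) (at y)" for y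
    apply (rule DERIV_cong)
     apply (rule derivative_intros d1 d2 d3 d4 Da_deriv)+
    apply (simp add: algebra_simps)
    done
  from DERIV_isconst_all[of ?f y 0] this have "?f y = ?f 0" by blast
  also have "?f 0 = 0"
    using profile(8,9)[OF pW] Da_0 ends(6)[OF pW] by (simp add: l'_def)
  finally show ?thesis by simp
qed

definition M' :: real where "M' = prim (\<lambda>y. 2 * A y * Da y) T + (lo w p0)\<^sup>2 * T'"

lemma cDa: "continuous_on S A" "continuous_on S dA" "continuous_on S Da" "continuous_on S Da1"
proof -
  have "continuous_on UNIV Da" "continuous_on UNIV Da1" using udA by (auto simp: uniform_deriv0_def)
  thus "continuous_on S A" "continuous_on S dA" "continuous_on S Da" "continuous_on S Da1"
    using amp_cont[OF pW] A1_cont[OF pW] by (auto intro: continuous_on_subset)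
qed

lemma prim_moving:
  assumes u: "uniform_deriv0 x q" and c: "\<And>h. \<bar>h\<bar> < h0 \<Longrightarrow> continuous_on UNIV (x h)"
  shows "((\<lambda>h. prim (x h) (period w (qq h))) has_real_derivative prim q T + x 0 T * T') (at 0)"
proof -
  have "((\<lambda>h. prim (x h) (period w (qq h))) has_real_derivative prim q T + x 0 (period w (qq 0)) * T') (at 0)"
  proof (rule moving_endpoint_deriv[OF h0(1) _ period_deriv])
    show "(prim (x h) has_real_derivative x h y) (at y)" if "\<bar>h\<bar> < h0" for h y
      using prim_has_vector_derivative[OF c[OF that]] by (simp add: has_real_derivative_iff_has_vector_derivative)
    show "isCont (\<lambda>z. x (fst z) (snd z)) (0, period w (qq 0))" by (rule uniform_deriv0_joint_isCont[OF u])
    show "((\<lambda>h. prim (x h) (period w (qq 0))) has_real_derivative prim q T) (at 0)"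
      using prim_param_deriv[OF u h0(1) c] by simp
  qed
  thus ?thesis by simp
qed

lemma M_deriv: "((\<lambda>h. Mmom w (qq h)) has_real_derivative M') (at 0)"
proof (rule deriv_cong_near[where f="\<lambda>h. prim (\<lambda>y. amp w (qq h) y * amp w (qq h) y) (period w (qq h))"])
  have "(\<lambda>y. Da y * A y + A y * Da y) = (\<lambda>y. 2 * A y * Da y)" by (simp add: fun_eq_iff)
  hence u: "uniform_deriv0 (\<lambda>h y. amp w (qq h) y * amp w (qq h) y) (\<lambda>y. 2 * A y * Da y)" using uniform_deriv0_mult[OF udA(1) udA(1)] by simp
  show "((\<lambda>h. prim (\<lambda>y. amp w (qq h) y * amp w (qq h) y) (period w (qq h))) has_real_derivative M') (at 0)"
    using prim_moving[OF u] amp_cont[OF h0(2)] at_period[OF pW] by (simp add: M'_def power2_eq_square continuous_on_mult)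
  show "prim (\<lambda>y. amp w (qq h) y * amp w (qq h) y) (period w (qq h)) = Mmom w (qq h)" if "\<bar>h\<bar> < h0" for h
    using moments(1)[OF h0(2)[OF that]] by (simp add: power2_eq_square)
qed

lemma prim_eq_deriv:
  assumes "\<And>y. (G has_real_derivative g y) (at y)" "continuous_on UNIV g" shows "prim g y = G y - G 0"
  using eq_prim[OF assms(2), of G y] assms(1) by (simp add: has_real_derivative_iff_has_vector_derivative)

text \<open>The moving endpoint contributes nothing since A_y(T) = 0. With I the integral of 2 A_y
  (A_y)_h and L that of 2 A_yy A_h, integration by parts gives I + L = 0, and the energy relation
  gives I - L as the integral of \<open>rr 0\<close>. Hence I is half the latter, a combination of
  T, M and eta.\<close>

lemma K_deriv: "((\<lambda>h. Kmom w (qq h)) has_real_derivative e1 * T - e3 * Mmom w p0 / 2 - e2 * eta w p0) (at 0)"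
proof (rule deriv_cong_near[where f="\<lambda>h. prim (\<lambda>y. A1 (qq h) y * A1 (qq h) y) (period w (qq h))"])
  have "(\<lambda>y. Da1 y * dA y + dA y * Da1 y) = (\<lambda>y. 2 * dA y * Da1 y)" by (simp add: fun_eq_iff)
  hence u: "uniform_deriv0 (\<lambda>h y. A1 (qq h) y * A1 (qq h) y) (\<lambda>y. 2 * dA y * Da1 y)" using uniform_deriv0_mult[OF udA(2) udA(2)] by simp
  have pos: "A y \<noteq> 0" for y using profile(5)[OF pW, of y] by simp
  have cN: "continuous_on UNIV (\<lambda>y. Nf w p0 (A y))"
    by (intro continuous_at_imp_continuous_on ballI isCont_o2[OF DERIV_isCont[OF profile(1)[OF pW]] DERIV_isCont[OF Nf_deriv]]) (rule profile(5)[OF pW])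
  have c1: "continuous_on UNIV (\<lambda>y. 2 * dA y * Da1 y)" by (intro continuous_intros cDa)
  have c2: "continuous_on UNIV (\<lambda>y. 2 * Nf w p0 (A y) * Da y)" by (intro continuous_intros cDa cN)
  have cA: "continuous_on UNIV (\<lambda>y. \<kappa> / (A y)\<^sup>2)" "continuous_on UNIV (\<lambda>y. (A y)\<^sup>2)" using pos by (intro continuous_intros cDa; simp)+
  let ?I = "prim (\<lambda>y. 2 * dA y * Da1 y) T" let ?L = "prim (\<lambda>y. 2 * Nf w p0 (A y) * Da y) T"
  have "prim (\<lambda>y. 1 * (2 * Nf w p0 (A y) * Da y) + 1 * (2 * dA y * Da1 y)) T = 2 * dA T * Da T - 2 * dA 0 * Da 0"
  proof (rule prim_eq_deriv)
    show "((\<lambda>y. 2 * dA y * Da y) has_real_derivative 1 * (2 * Nf w p0 (A y) * Da y) + 1 * (2 * dA y * Da1 y)) (at y)" for y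
      by (rule DERIV_cong, (rule derivative_intros profile(2)[OF pW] Da_deriv)+) (simp add: algebra_simps)
  qed (intro continuous_intros c1 c2)
  hence s: "?L + ?I = 0" unfolding prim_linear[OF c2 c1] using at_period[OF pW] profile(9)[OF pW] by simp
  have "(\<lambda>y. rr 0 (A y)) = (\<lambda>y. 1 * (2 * dA y * Da1 y) + (-1) * (2 * Nf w p0 (A y) * Da y))" using energy by (simp add: fun_eq_iff)
  hence r: "prim (\<lambda>y. rr 0 (A y)) T = 1 * ?I + (-1) * ?L" using prim_linear[OF c1 c2, of 1 "-1" T] by simp
  have "(\<lambda>y. rr 0 (A y)) = (\<lambda>y. 1 * (1 * (2 * e1) + (- e3) * (A y)\<^sup>2) + (- 2 * e2) * (\<kappa> / (A y)\<^sup>2))"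
    by (simp add: rr_def fun_eq_iff algebra_simps)
  hence "prim (\<lambda>y. rr 0 (A y)) T = 1 * (1 * prim (\<lambda>y. 2 * e1) T + (- e3) * prim (\<lambda>y. (A y)\<^sup>2) T) + (- 2 * e2) * prim (\<lambda>y. \<kappa> / (A y)\<^sup>2) T"
    using prim_linear[of "\<lambda>y. 1 * (2 * e1) + (- e3) * (A y)\<^sup>2" "\<lambda>y. \<kappa> / (A y)\<^sup>2" 1 "- 2 * e2" T]
      prim_linear[of "\<lambda>y. 2 * e1" "\<lambda>y. (A y)\<^sup>2" 1 "- e3" T] cA by (simp add: continuous_on_add continuous_on_mult_left continuous_on_diff)
  moreover have "prim (\<lambda>y. 2 * e1) T = 2 * e1 * T" using half_period(1)[OF pW] by (simp add: prim_nonneg)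
  moreover have "prim (\<lambda>y. (A y)\<^sup>2) T = Mmom w p0" using moments(1)[OF pW] by simp
  moreover have "prim (\<lambda>y. \<kappa> / (A y)\<^sup>2) T = eta w p0" using moments(2,5)[OF pW] by simp
  ultimately have I: "?I = e1 * T - e3 * Mmom w p0 / 2 - e2 * eta w p0" using r s by simp
  show "((\<lambda>h. prim (\<lambda>y. A1 (qq h) y * A1 (qq h) y) (period w (qq h))) has_real_derivative e1 * T - e3 * Mmom w p0 / 2 - e2 * eta w p0) (at 0)"
    using prim_moving[OF u] A1_cont[OF h0(2)] at_period[OF pW] I by (simp add: continuous_on_mult)
  show "prim (\<lambda>y. A1 (qq h) y * A1 (qq h) y) (period w (qq h)) = Kmom w (qq h)" if "\<bar>h\<bar> < h0" for h
    using moments(3)[OF h0(2)[OF that]] by (simp add: power2_eq_square)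
qed

end

section \<open>The linearized equation for the parameter derivatives\<close>

context direction
begin

text \<open>The second component A S_h of the parameter derivative, paired with the first component
  \<open>Da\<close>; \<open>PI1\<close> is its y-derivative.\<close>

definition PI :: "real \<Rightarrow> real" where "PI y = A y * DS y"
definition PI1 :: "real \<Rightarrow> real" where "PI1 y = dA y * DS y + A y * qS y"
definition Sy :: "real \<Rightarrow> real" where "Sy y = \<kappa> / (A y)\<^sup>2"
definition Syy :: "real \<Rightarrow> real" where "Syy y = - 2 * \<kappa> * dA y / (A y)^3"
definition Qm :: "real \<Rightarrow> real" where "Qm y = - \<omega> + (Sy y)\<^sup>2 - \<zeta> * nlf w ((A y)\<^sup>2)"
definition Qp :: "real \<Rightarrow> real" where "Qp y = Qm y - 2 * \<zeta> * deriv (nlf w) ((A y)\<^sup>2) * (A y)\<^sup>2"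

lemma Anz: "A y \<noteq> 0"
  using profile(5)[OF pW, of y] by simp

lemma Sy_deriv: "(Sy has_real_derivative Syy y) (at y)"
  unfolding Sy_def[abs_def] Syy_def using Anz[of y]
  apply -
  apply (rule DERIV_cong)
   apply (rule derivative_intros profile(1)[OF pW] | simp)+
  apply (simp add: field_simps eval_nat_numeral)
  done

lemma NQ: "Nf w p0 (A y) = Qm y * A y"
  using Anz[of y] by (simp add: Nf_def Qm_def Sy_def field_simps eval_nat_numeral)

lemma PI_deriv: "(PI has_real_derivative PI1 y) (at y)"
  unfolding PI_def[abs_def] PI1_def
  by (rule DERIV_cong, (rule derivative_intros profile(1)[OF pW] DS_deriv)+) (simp add: algebra_simps)

lemma qS_deriv: "(qS has_real_derivative - 2 * e2 * dA y / (A y)^3 - 2 * \<kappa> * Da1 y / (A y)^3 + 6 * \<kappa> * Da y * dA y / (A y)^4) (at y)"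
  unfolding qS_def[abs_def] using Anz[of y]
  apply -
  apply (rule DERIV_cong)
   apply (rule derivative_intros profile(1)[OF pW] Da_deriv | simp)+
  apply (simp add: field_simps eval_nat_numeral)
  done

text \<open>The profile equations are linearized in the rotating frame. E and kappa are integration
  constants and leave no trace; varying omega leaves the source (0, e3 A). Together with
  \<open>Phi_I\<close> this says L (A_h, A S_h) = (0, e3 A).\<close>

lemma Phi_R: "(Da1 has_real_derivative Qp y * Da y + Syy y * PI y + 2 * Sy y * PI1 y - e3 * A y) (at y)"
proof (rule DERIV_cong)
  show "(Da1 has_real_derivative Nd w p0 (A y) * Da y + nn 0 (A y)) (at y)" using Da1_deriv[of y] by simp
  have 1: "Syy y * PI y + 2 * Sy y * PI1 y = 2 * \<kappa> * qS y / A y"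
    using Anz[of y] by (simp add: Syy_def PI_def Sy_def PI1_def field_simps eval_nat_numeral)
  show "Nd w p0 (A y) * Da y + nn 0 (A y) = Qp y * Da y + Syy y * PI y + 2 * Sy y * PI1 y - e3 * A y"
    using 1 Anz[of y] by (simp add: add.assoc Nd_def nn_def Qp_def Qm_def Sy_def[of y] qS_def)
       (simp add: field_simps eval_nat_numeral)
qed

lemma Phi_I: "(PI1 has_real_derivative Qm y * PI y - Syy y * Da y - 2 * Sy y * Da1 y) (at y)"
proof (rule DERIV_cong)
  show "(PI1 has_real_derivative (Nf w p0 (A y) * DS y + dA y * qS y) + (dA y * qS y + A y * (- 2 * e2 * dA y / (A y)^3 - 2 * \<kappa> * Da1 y / (A y)^3 + 6 * \<kappa> * Da y * dA y / (A y)^4))) (at y)"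
    unfolding PI1_def[abs_def]
    by (rule DERIV_cong, (rule derivative_intros profile(1,2)[OF pW] DS_deriv qS_deriv)+) (simp add: algebra_simps)
  show "Nf w p0 (A y) * DS y + dA y * qS y + (dA y * qS y + A y * (- 2 * e2 * dA y / (A y)^3 - 2 * \<kappa> * Da1 y / (A y)^3 + 6 * \<kappa> * Da y * dA y / (A y)^4))
     = Qm y * PI y - Syy y * Da y - 2 * Sy y * Da1 y"
    unfolding NQ PI_def Syy_def Sy_def[of y] qS_def using Anz[of y] by (simp add: field_simps eval_nat_numeral)
qed

text \<open>The jump is \<open>eta'\<close> times the rotation field (0, A) minus \<open>T'\<close>
  times the translation field (A_y, kappa / A); the summand \<open>eta' * 0\<close> is the first
  component of the former.\<close>

lemma Phi_jump: "Da (y + T) = Da y + eta' * 0 - T' * dA y" "PI (y + T) = PI y + eta' * A y - T' * (\<kappa> / A y)"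
proof -
  show "Da (y + T) = Da y + eta' * 0 - T' * dA y" using Da_jump by simp
  show "PI (y + T) = PI y + eta' * A y - T' * (\<kappa> / A y)"
    unfolding PI_def profile(7)[OF pW] DS_jump using Anz[of y] by (simp add: field_simps power2_eq_square)
qed

text \<open>Noether's principle: the form pairs a symmetry with a variation to the variation of the
  conserved quantity. The rotation (0, A) gives kappa; in \<open>symp_w2\<close> the translation
  gives the energy E, with an extra term when omega varies.\<close>

lemma symp_w1: "A y * PI1 y - dA y * PI y + 2 * Sy y * (A y * Da y) = e2"
  using Anz[of y] by (simp add: PI1_def PI_def Sy_def qS_def field_simps eval_nat_numeral)

lemma symp_w2: "dA y * Da1 y - Nf w p0 (A y) * Da y + (\<kappa> / A y) * PI1 y - (- \<kappa> * dA y / (A y)\<^sup>2) * PI y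
    + 2 * Sy y * ((\<kappa> / A y) * Da y - dA y * PI y) = e1 - e3 * (A y)\<^sup>2 / 2"
proof -
  have "(\<kappa> / A y) * PI1 y - (- \<kappa> * dA y / (A y)\<^sup>2) * PI y + 2 * Sy y * ((\<kappa> / A y) * Da y - dA y * PI y) = \<kappa> * e2 / (A y)\<^sup>2"
    using Anz[of y] by (simp add: PI1_def PI_def Sy_def qS_def field_simps eval_nat_numeral)
  moreover have "dA y * Da1 y - Nf w p0 (A y) * Da y = (e1 - e3 * (A y)\<^sup>2 / 2) - \<kappa> * e2 / (A y)\<^sup>2"
    using energy[of y] by (simp add: rr_def field_simps)
  moreover have "x + p - q + r = x + (p - q + r)" for x p q r :: real by simp
  ultimately show ?thesis by (simp only:)
qed

lemma cPhi: "continuous_on S DS" "continuous_on S PI" "continuous_on S PI1" "continuous_on S qS"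
proof -
  have "continuous_on UNIV DS" by (intro continuous_at_imp_continuous_on ballI DERIV_isCont[OF DS_deriv(1)])
  thus d: "continuous_on S DS" by (rule continuous_on_subset) simp
  show q: "continuous_on S qS" by (rule continuous_on_subset[OF qS_cont]) simp
  show "continuous_on S PI" "continuous_on S PI1" unfolding PI_def[abs_def] PI1_def[abs_def]
    by (intro continuous_intros d q cDa)+
qed

text \<open>The integrand is exact, with primitive A^2 S_h / 2 - e2 y / 2.\<close>

lemma v3_integral: "prim (\<lambda>y. dA y * PI y - \<kappa> / A y * Da y) T = (lo w p0)\<^sup>2 * DS T / 2 - e2 * T / 2"
proof -
  have "prim (\<lambda>y. dA y * PI y - \<kappa> / A y * Da y) T = ((A T)\<^sup>2 * DS T / 2 - e2 * T / 2) - ((A 0)\<^sup>2 * DS 0 / 2 - e2 * 0 / 2)"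
  proof (rule prim_eq_deriv)
    fix y
    have "((\<lambda>y. (A y)\<^sup>2 * DS y / 2 - e2 * y / 2) has_real_derivative A y * dA y * DS y + (A y)\<^sup>2 * qS y / 2 - e2 / 2) (at y)"
      apply (rule DERIV_cong)
       apply (rule derivative_intros profile(1)[OF pW] DS_deriv | simp)+
      done
    moreover have "A y * dA y * DS y + (A y)\<^sup>2 * qS y / 2 - e2 / 2 = dA y * PI y - \<kappa> / A y * Da y"
      using Anz[of y] by (simp add: PI_def qS_def field_simps eval_nat_numeral)
    ultimately show "((\<lambda>y. (A y)\<^sup>2 * DS y / 2 - e2 * y / 2) has_real_derivative dA y * PI y - \<kappa> / A y * Da y) (at y)" by simp
  qed (use Anz in \<open>auto intro!: continuous_intros cDa cPhi\<close>)
  thus ?thesis using at_period[OF pW] DS_deriv(2) by simp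
qed

lemma v1_integral: "prim (\<lambda>y. A y * Da y) T = (M' - (lo w p0)\<^sup>2 * T') / 2"
proof -
  have "prim (\<lambda>y. 2 * (A y * Da y) + 0 * A y) T = 2 * prim (\<lambda>y. A y * Da y) T + 0 * prim A T"
    by (rule prim_linear) (intro continuous_intros cDa)+
  hence "prim (\<lambda>y. 2 * A y * Da y) T = 2 * prim (\<lambda>y. A y * Da y) T" by (simp add: mult.assoc)
  thus ?thesis by (simp add: M'_def)
qed

lemma DS_T: "DS T = eta' - T' * (\<kappa> / (lo w p0)\<^sup>2)"
  using DS_jump[of 0] DS_deriv(2) profile(8)[OF pW] by simp

lemma Da1_T: "Da1 T = - T' * Nf w p0 (lo w p0)"
proof -
  have "((\<lambda>y. Da (y + T)) has_real_derivative Da1 (0 + T)) (at 0)"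
    using Da_deriv[of "0 + T"] unfolding DERIV_shift .
  moreover have "((\<lambda>y. Da (y + T)) has_real_derivative Da1 0 - T' * Nf w p0 (A 0)) (at 0)"
    unfolding Da_jump by (intro DERIV_diff Da_deriv DERIV_cmult profile(2)[OF pW])
  ultimately show ?thesis using DERIV_unique Da_0(2) profile(8)[OF pW] by fastforce
qed

end

section \<open>Reciprocity between two parameter directions\<close>

locale direction_pair = a: direction w W E \<kappa> \<omega> \<zeta> a1 a2 a3 + b: direction w W E \<kappa> \<omega> \<zeta> b1 b2 b3
  for w W E \<kappa> \<omega> \<zeta> a1 a2 a3 b1 b2 b3
begin

text \<open>The bilinear form conserved by solutions of \<open>L u = 0\<close>.\<close>

definition BB :: "real \<Rightarrow> real" where
  "BB y = a.Da y * b.Da1 y - a.Da1 y * b.Da y + a.PI y * b.PI1 y - a.PI1 y * b.PI y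
    + 2 * a.Sy y * (a.PI y * b.Da y - a.Da y * b.PI y)"

text \<open>The form is conserved up to the sources (0, a3 A) and (0, b3 A), so it is constant when
  neither direction changes omega.\<close>

lemma BB_deriv: "(BB has_real_derivative a3 * a.A y * b.Da y - b3 * a.A y * a.Da y) (at y)"
  unfolding BB_def[abs_def]
  apply (rule DERIV_cong)
   apply (rule derivative_intros a.Da_deriv b.Da_deriv a.Phi_R b.Phi_R a.Phi_I b.Phi_I a.PI_deriv b.PI_deriv a.Sy_deriv)+
  apply (simp add: algebra_simps)
  done

lemma BB_0: "BB 0 = 0"
  by (simp add: BB_def a.PI_def b.PI_def a.DS_deriv(2) b.DS_deriv(2) a.Da_0(2) b.Da_0(2))

lemma BB_eq: "BB y = prim (\<lambda>y. a3 * (a.A y * b.Da y) + (- b3) * (a.A y * a.Da y)) y"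
proof -
  have "prim (\<lambda>y. a3 * (a.A y * b.Da y) + (- b3) * (a.A y * a.Da y)) y = BB y - BB 0"
  proof (rule a.prim_eq_deriv)
    show "(BB has_real_derivative a3 * (a.A y * b.Da y) + (- b3) * (a.A y * a.Da y)) (at y)" for y
      using BB_deriv[of y] by (simp add: mult.assoc)
  qed (intro continuous_intros a.cDa b.cDa)
  thus ?thesis by (simp add: BB_0)
qed

text \<open>The form at y = T is computed twice: by integrating the sources, and from the jumps over
  a period. The terms with the lower endpoint agree and cancel. Since K has the partial derivatives
  T, - eta, - M/2, the result is the symmetry of its second derivatives, obtained without proving
  these continuous.\<close>

theorem reciprocity: "a1 * b.T' - b1 * a.T' + b2 * a.eta' - a2 * b.eta' = (a3 * b.M' - b3 * a.M') / 2"
proof -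
  let ?l = "lo w (E, \<kappa>, \<omega>, \<zeta>)" let ?N = "Nf w (E, \<kappa>, \<omega>, \<zeta>) ?l"
  have l: "?l \<noteq> 0" using a.ends(1)[OF a.pW] by simp
  have "BB a.T = a3 * prim (\<lambda>y. a.A y * b.Da y) a.T + (- b3) * prim (\<lambda>y. a.A y * a.Da y) a.T"
    unfolding BB_eq by (rule prim_linear) (intro continuous_intros a.cDa b.cDa)+
  hence R: "BB a.T = (a3 * b.M' - b3 * a.M') / 2 - ?l\<^sup>2 / 2 * (a3 * b.T' - b3 * a.T')"
    unfolding a.v1_integral b.v1_integral by (simp add: field_simps)
  have AT: "a.A a.T = ?l" "a.dA a.T = 0" by (rule a.at_period[OF a.pW])+
  have aDa: "a.Da a.T = a.l'" using a.Da_jump[of 0] a.Da_0(1) a.profile(9)[OF a.pW] by simp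
  have bDa: "b.Da a.T = b.l'" using b.Da_jump[of 0] b.Da_0(1) a.profile(9)[OF a.pW] by simp
  have Nl: "?N * a.l' = - (a1 - a3 * ?l\<^sup>2 / 2 - \<kappa> * a2 / ?l\<^sup>2)" "?N * b.l' = - (b1 - b3 * ?l\<^sup>2 / 2 - \<kappa> * b2 / ?l\<^sup>2)"
    using a.ends(6)[OF a.pW] by (simp_all add: a.l'_def b.l'_def a.rr_def b.rr_def field_simps)
  have pi: "a.PI a.T = ?l * a.DS a.T" "b.PI a.T = ?l * b.DS a.T"
    "a.PI1 a.T = ?l * (a2 / ?l\<^sup>2 - 2 * \<kappa> * a.l' / ?l^3)" "b.PI1 a.T = ?l * (b2 / ?l\<^sup>2 - 2 * \<kappa> * b.l' / ?l^3)"
    by (simp_all add: a.PI_def b.PI_def a.PI1_def b.PI1_def AT a.qS_def b.qS_def aDa bDa)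
  have "BB a.T = b.T' * - (?N * a.l') - a.T' * - (?N * b.l') + a.DS a.T * b2 - b.DS a.T * a2"
  proof -
    have f1: "(?l * u) * (?l * (c / ?l\<^sup>2 - 2 * \<kappa> * d / ?l^3)) = u * c - 2 * (\<kappa> * d * u / ?l)"
      "(?l * (c / ?l\<^sup>2 - 2 * \<kappa> * d / ?l^3)) * (?l * u) = u * c - 2 * (\<kappa> * d * u / ?l)" for u c d
      using l by (simp_all add: field_simps eval_nat_numeral)
    have f2: "2 * (\<kappa> / ?l\<^sup>2) * (?l * u * d - d' * (?l * v)) = 2 * (\<kappa> * d * u / ?l) - 2 * (\<kappa> * d' * v / ?l)" for u d d' v
      using l by (simp add: field_simps eval_nat_numeral)
    show ?thesis unfolding BB_def aDa bDa a.Da1_T b.Da1_T pi a.Sy_def AT f1 f2 by simp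
  qed
  hence "BB a.T = b.T' * (a1 - a3 * ?l\<^sup>2 / 2 - \<kappa> * a2 / ?l\<^sup>2) - a.T' * (b1 - b3 * ?l\<^sup>2 / 2 - \<kappa> * b2 / ?l\<^sup>2)
     + (a.eta' - a.T' * (\<kappa> / ?l\<^sup>2)) * b2 - (b.eta' - b.T' * (\<kappa> / ?l\<^sup>2)) * a2"
    unfolding Nl a.DS_T b.DS_T by simp
  also have "\<dots> = a1 * b.T' - b1 * a.T' + b2 * a.eta' - a2 * b.eta' - ?l\<^sup>2 / 2 * (a3 * b.T' - b3 * a.T')"
    by (simp add: algebra_simps)
  finally show ?thesis using R by simp
qed

end

section \<open>The coefficients of the normal form\<close>

lemma det_4:
  fixes M :: "'a::comm_ring_1^4^4"
  assumes a: "\<And>i j. a i j = vec_nth (vec_nth M i) j"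
  shows "det M =
    a 1 1 * a 2 2 * a 3 3 * a 4 4 - a 1 1 * a 2 2 * a 3 4 * a 4 3 - a 1 1 * a 2 3 * a 3 2 * a 4 4
    + a 1 1 * a 2 3 * a 3 4 * a 4 2 + a 1 1 * a 2 4 * a 3 2 * a 4 3 - a 1 1 * a 2 4 * a 3 3 * a 4 2
    - a 1 2 * a 2 1 * a 3 3 * a 4 4 + a 1 2 * a 2 1 * a 3 4 * a 4 3 + a 1 2 * a 2 3 * a 3 1 * a 4 4
    - a 1 2 * a 2 3 * a 3 4 * a 4 1 - a 1 2 * a 2 4 * a 3 1 * a 4 3 + a 1 2 * a 2 4 * a 3 3 * a 4 1
    + a 1 3 * a 2 1 * a 3 2 * a 4 4 - a 1 3 * a 2 1 * a 3 4 * a 4 2 - a 1 3 * a 2 2 * a 3 1 * a 4 4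
    + a 1 3 * a 2 2 * a 3 4 * a 4 1 + a 1 3 * a 2 4 * a 3 1 * a 4 2 - a 1 3 * a 2 4 * a 3 2 * a 4 1
    - a 1 4 * a 2 1 * a 3 2 * a 4 3 + a 1 4 * a 2 1 * a 3 3 * a 4 2 + a 1 4 * a 2 2 * a 3 1 * a 4 3
    - a 1 4 * a 2 2 * a 3 3 * a 4 1 - a 1 4 * a 2 3 * a 3 1 * a 4 2 + a 1 4 * a 2 3 * a 3 2 * a 4 1"
proof -
  have f1: "finite {2::4, 3, 4}" "1 \<notin> {2::4, 3, 4}" by auto
  have f2: "finite {3::4, 4}" "2 \<notin> {3::4, 4}" by auto
  have f3: "finite {4::4}" "3 \<notin> {4::4}" by auto
  show ?thesis
    unfolding det_def UNIV_4 a[symmetric]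
    unfolding sum_over_permutations_insert[OF f1]
    unfolding sum_over_permutations_insert[OF f2]
    unfolding sum_over_permutations_insert[OF f3]
    unfolding permutes_sing
    by (simp add: sign_swap_id permutation_swap_id permutation_compose sign_compose sign_id swap_id_eq)
qed

lemma prim_linear3:
  fixes f g h :: "real \<Rightarrow> real"
  assumes "continuous_on UNIV f" "continuous_on UNIV g" "continuous_on UNIV h"
  shows "prim (\<lambda>y. a * f y + b * g y + c * h y) y = a * prim f y + b * prim g y + c * prim h y"
proof -
  have k: "continuous_on UNIV (\<lambda>y. a * f y + b * g y)" using assms by (intro continuous_intros)
  have "prim (\<lambda>y. 1 * (a * f y + b * g y) + c * h y) y = 1 * prim (\<lambda>y. a * f y + b * g y) y + c * prim h y"
    by (rule prim_linear[OF k assms(3)])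
  thus ?thesis using prim_linear[OF assms(1,2), of a b y] by simp
qed

locale wave_point = family +
  fixes E \<kappa> \<omega> \<zeta> :: real
  assumes pW: "(E, \<kappa>, \<omega>, \<zeta>) \<in> W"
begin

sublocale DE: direction w W E \<kappa> \<omega> \<zeta> 1 0 0 by unfold_locales (rule pW)
sublocale DK: direction w W E \<kappa> \<omega> \<zeta> 0 1 0 by unfold_locales (rule pW)
sublocale DO: direction w W E \<kappa> \<omega> \<zeta> 0 0 1 by unfold_locales (rule pW)
sublocale EK: direction_pair w W E \<kappa> \<omega> \<zeta> 1 0 0 0 1 0 by unfold_locales
sublocale EO: direction_pair w W E \<kappa> \<omega> \<zeta> 1 0 0 0 0 1 by unfold_locales
sublocale KO: direction_pair w W E \<kappa> \<omega> \<zeta> 0 1 0 0 0 1 by unfold_locales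

abbreviation p :: params where "p \<equiv> (E, \<kappa>, \<omega>, \<zeta>)"
abbreviation T :: real where "T \<equiv> period w p"
abbreviation A :: "real \<Rightarrow> real" where "A \<equiv> amp w p"
abbreviation dA :: "real \<Rightarrow> real" where "dA \<equiv> A1 p"
abbreviation L :: real where "L \<equiv> (lo w p)\<^sup>2"

lemma dE_eq: "((\<lambda>h. G (DE.qq h)) has_real_derivative D) (at 0) \<Longrightarrow> dE G p = D"
  using DERIV_shift[of "\<lambda>e. G (e, \<kappa>, \<omega>, \<zeta>)" D 0 E] by (auto simp: dE_def DE.qq_def add.commute intro: DERIV_imp_deriv)

lemma dK_eq: "((\<lambda>h. G (DK.qq h)) has_real_derivative D) (at 0) \<Longrightarrow> dkappa G p = D"
  using DERIV_shift[of "\<lambda>e. G (E, e, \<omega>, \<zeta>)" D 0 \<kappa>] by (auto simp: dkappa_def DK.qq_def add.commute intro: DERIV_imp_deriv)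

lemma dO_eq: "((\<lambda>h. G (DO.qq h)) has_real_derivative D) (at 0) \<Longrightarrow> domega G p = D"
  using DERIV_shift[of "\<lambda>e. G (E, \<kappa>, e, \<zeta>)" D 0 \<omega>] by (auto simp: domega_def DO.qq_def add.commute intro: DERIV_imp_deriv)

lemmas derivs =
  dE_eq[OF DE.period_deriv] dE_eq[OF DE.eta_deriv] dE_eq[OF DE.M_deriv] dE_eq[OF DE.Da_param_deriv(1)] dE_eq[OF DE.phs_param_deriv]
  dK_eq[OF DK.period_deriv] dK_eq[OF DK.eta_deriv] dK_eq[OF DK.M_deriv] dK_eq[OF DK.Da_param_deriv(1)] dK_eq[OF DK.phs_param_deriv]
  dO_eq[OF DO.period_deriv] dO_eq[OF DO.eta_deriv] dO_eq[OF DO.M_deriv] dO_eq[OF DO.Da_param_deriv(1)] dO_eq[OF DO.phs_param_deriv]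

lemma K_derivs: "dE (Kmom w) p = T" "dkappa (Kmom w) p = - eta w p" "domega (Kmom w) p = - Mmom w p / 2"
  using dE_eq[OF DE.K_deriv] dK_eq[OF DK.K_deriv] dO_eq[OF DO.K_deriv] by simp_all

lemma reciprocal: "DK.T' = - DE.eta'" "DE.M' = - 2 * DO.T'" "DK.M' = 2 * DO.eta'"
  using EK.reciprocity EO.reciprocity KO.reciprocity by simp_all

end

context family
begin

text \<open>These identities are needed on all of \<open>W\<close> because the second derivatives of
  K differentiate them along nearby parameters.\<close>

lemma K_first:
  assumes "q \<in> W"
  shows "dE (Kmom w) q = period w q" "dkappa (Kmom w) q = - eta w q" "domega (Kmom w) q = - Mmom w q / 2"
proof -
  obtain E \<kappa> \<omega> \<zeta> where q: "q = (E, \<kappa>, \<omega>, \<zeta>)" by (cases q)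
  interpret P: wave_point w W E \<kappa> \<omega> \<zeta> by unfold_locales (use assms q in simp)
  show "dE (Kmom w) q = period w q" "dkappa (Kmom w) q = - eta w q" "domega (Kmom w) q = - Mmom w q / 2"
    unfolding q by (rule P.K_derivs)+
qed

end

context wave_point
begin

lemma K_second:
  "dkappa (dkappa (Kmom w)) p = - DK.eta'" "dE (dkappa (Kmom w)) p = - DE.eta'" "domega (dkappa (Kmom w)) p = - DO.eta'"
  "dE (dE (Kmom w)) p = DE.T'" "domega (dE (Kmom w)) p = DO.T'" "domega (domega (Kmom w)) p = - DO.M' / 2"
proof -
  show "dkappa (dkappa (Kmom w)) p = - DK.eta'"
    by (rule dK_eq, rule DK.deriv_cong_near[OF DERIV_minus[OF DK.eta_deriv]]) (simp add: K_first(2)[OF DK.h0(2)])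
  show "dE (dkappa (Kmom w)) p = - DE.eta'"
    by (rule dE_eq, rule DE.deriv_cong_near[OF DERIV_minus[OF DE.eta_deriv]]) (simp add: K_first(2)[OF DE.h0(2)])
  show "domega (dkappa (Kmom w)) p = - DO.eta'"
    by (rule dO_eq, rule DO.deriv_cong_near[OF DERIV_minus[OF DO.eta_deriv]]) (simp add: K_first(2)[OF DO.h0(2)])
  show "dE (dE (Kmom w)) p = DE.T'"
    by (rule dE_eq, rule DE.deriv_cong_near[OF DE.period_deriv]) (simp add: K_first(1)[OF DE.h0(2)])
  show "domega (dE (Kmom w)) p = DO.T'"
    by (rule dO_eq, rule DO.deriv_cong_near[OF DO.period_deriv]) (simp add: K_first(1)[OF DO.h0(2)])
  show "domega (domega (Kmom w)) p = - DO.M' / 2"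
    by (rule dO_eq, rule DO.deriv_cong_near[OF DERIV_cdivide[OF DERIV_minus[OF DO.M_deriv]]]) (simp add: K_first(3)[OF DO.h0(2)])
qed

lemma coeffs:
  "sigma w p = DE.T' * DK.eta' - DK.T' * DE.eta'"
  "gam w p = DK.T' * DO.eta' - DO.T' * DK.eta'"
  "rho w p = DO.T' * DE.eta' - DE.T' * DO.eta'"
  "tau w p = T * DK.T' / 2" "nu w p = - (T * DE.T' / 2)"
  by (simp_all add: sigma_def gam_def rho_def tau_def nu_def derivs)

lemma Anz: "A y \<noteq> 0"
  by (rule DE.Anz)

lemma Lnz: "lo w p \<noteq> 0" "L \<noteq> 0"
  using ends(1)[OF pW] by simp_all

lemma Tpos: "0 < T"
  by (rule half_period(1)[OF pW])

lemma dphs: "deriv (phs w p) y = \<kappa> / (A y)\<^sup>2"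
  using DERIV_imp_deriv[OF profile(10)[OF pW, of y]] by simp

lemma A_dphs: "A y * deriv (phs w p) y = \<kappa> / A y"
  unfolding dphs using Anz[of y] by (simp add: power2_eq_square)

abbreviation (input) c1 :: "real^2 \<Rightarrow> real" where "c1 v \<equiv> vec_nth v 1"
abbreviation (input) c2 :: "real^2 \<Rightarrow> real" where "c2 v \<equiv> vec_nth v 2"

lemma Jmat_mult: "vec_nth (Jmat *v (v::'a::comm_ring_1^2)) 1 = - vec_nth v 2" "vec_nth (Jmat *v v) 2 = vec_nth v 1"
  "vec_nth (v v* Jmat) 1 = vec_nth v 2" "vec_nth (v v* Jmat) 2 = - vec_nth v 1"
  by (simp_all add: matrix_vector_mult_def vector_matrix_mult_def sum_2 Jmat_def)

lemma comps:
  "c1 (u0 w p y) = 0" "c2 (u0 w p y) = sigma w p * A y"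
  "c1 (u2 w p y) = sigma w p * dA y" "c2 (u2 w p y) = sigma w p * (\<kappa> / A y)"
  "c1 (v1 w p y) = - (sigma w p * A y)" "c2 (v1 w p y) = 0"
  "c1 (v3 w p y) = - (sigma w p * (\<kappa> / A y))" "c2 (v3 w p y) = sigma w p * dA y"
  "c1 (u1 w p y) = gam w p * DE.Da y + rho w p * DK.Da y + sigma w p * DO.Da y"
  "c2 (u1 w p y) = gam w p * DE.PI y + rho w p * DK.PI y + sigma w p * DO.PI y"
  "c1 (u3 w p y) = tau w p * DE.Da y + nu w p * DK.Da y"
  "c2 (u3 w p y) = tau w p * DE.PI y + nu w p * DK.PI y + sigma w p * (y * A y / 2)"
  "c1 (L2op u y) = - c2 (u y)" "c2 (L2op u y) = c1 (u y)"
  unfolding u0_def u2_def v1_def v3_def u1_def u3_def tE_def tkappa_def tomega_def L2op_def derivs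
  by (simp_all add: Jmat_mult A_dphs DE.PI_def DK.PI_def DO.PI_def)

lemma pairing_prim: "pairing w p v u = prim (\<lambda>y. c1 (v y) * c1 (u y) + c2 (v y) * c2 (u y)) T"
  using Tpos by (simp add: pairing_def prim_nonneg inner_vec_def sum_2)

lemma cont: "continuous_on S (\<lambda>y. A y * DE.Da y)" "continuous_on S (\<lambda>y. A y * DK.Da y)" "continuous_on S (\<lambda>y. A y * DO.Da y)"
  "continuous_on S (\<lambda>y. dA y * DE.PI y - \<kappa> / A y * DE.Da y)" "continuous_on S (\<lambda>y. dA y * DK.PI y - \<kappa> / A y * DK.Da y)"
  "continuous_on S (\<lambda>y. dA y * DO.PI y - \<kappa> / A y * DO.Da y)" "continuous_on S (\<lambda>y. y * A y * dA y)"
  "continuous_on S (\<lambda>y. \<kappa> / A y)" "continuous_on S (\<lambda>y. (A y)\<^sup>2)"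
  using Anz by (auto intro!: continuous_intros DE.cDa DK.cDa DO.cDa DE.cPhi DK.cPhi DO.cPhi)

text \<open>(gam, rho, sigma) is the cross product of the gradients of T and eta in (E, kappa,
  omega). Its orthogonality to the gradient of T removes the endpoint terms that separate the
  integral of 2 A A_h from the derivative of M.\<close>

lemma pair_v1u1: "pairing w p (v1 w p) (u1 w p) = - (sigma w p / 2) * (gam w p * DE.M' + rho w p * DK.M' + sigma w p * DO.M')"
proof -
  let ?s = "sigma w p" let ?g = "gam w p" let ?r = "rho w p"
  have "pairing w p (v1 w p) (u1 w p) = prim (\<lambda>y. (- ?s * ?g) * (A y * DE.Da y) + (- ?s * ?r) * (A y * DK.Da y) + (- ?s * ?s) * (A y * DO.Da y)) T"
    unfolding pairing_prim comps by (rule arg_cong[of _ _ "\<lambda>f. prim f T"]) (simp add: fun_eq_iff algebra_simps)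
  also have "\<dots> = (- ?s * ?g) * ((DE.M' - L * DE.T') / 2) + (- ?s * ?r) * ((DK.M' - L * DK.T') / 2) + (- ?s * ?s) * ((DO.M' - L * DO.T') / 2)"
    unfolding prim_linear3[OF cont(1-3)] DE.v1_integral DK.v1_integral DO.v1_integral ..
  also have "\<dots> = - (?s / 2) * (?g * DE.M' + ?r * DK.M' + ?s * DO.M') + ?s / 2 * L * (?g * DE.T' + ?r * DK.T' + ?s * DO.T')"
    by (simp add: algebra_simps add_divide_distrib diff_divide_distrib)
  also have "?g * DE.T' + ?r * DK.T' + ?s * DO.T' = 0" unfolding coeffs by (simp add: algebra_simps)
  finally show ?thesis by simp
qed

lemma pair_v1u3: "pairing w p (v1 w p) (u3 w p) = - (sigma w p / 2) * (tau w p * DE.M' + nu w p * DK.M')"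
proof -
  let ?s = "sigma w p" let ?t = "tau w p" let ?n = "nu w p"
  have "pairing w p (v1 w p) (u3 w p) = prim (\<lambda>y. (- ?s * ?t) * (A y * DE.Da y) + (- ?s * ?n) * (A y * DK.Da y) + 0 * (A y * DO.Da y)) T"
    unfolding pairing_prim comps by (rule arg_cong[of _ _ "\<lambda>f. prim f T"]) (simp add: fun_eq_iff algebra_simps)
  also have "\<dots> = (- ?s * ?t) * ((DE.M' - L * DE.T') / 2) + (- ?s * ?n) * ((DK.M' - L * DK.T') / 2) + 0 * ((DO.M' - L * DO.T') / 2)"
    unfolding prim_linear3[OF cont(1-3)] DE.v1_integral DK.v1_integral DO.v1_integral ..
  also have "\<dots> = - (?s / 2) * (?t * DE.M' + ?n * DK.M') + ?s / 2 * L * (?t * DE.T' + ?n * DK.T')"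
    by (simp add: algebra_simps add_divide_distrib diff_divide_distrib)
  also have "?t * DE.T' + ?n * DK.T' = 0" unfolding coeffs by (simp add: algebra_simps)
  finally show ?thesis by simp
qed

lemma LDS: "L * DE.DS T = L * DE.eta' - \<kappa> * DE.T'" "L * DK.DS T = L * DK.eta' - \<kappa> * DK.T'" "L * DO.DS T = L * DO.eta' - \<kappa> * DO.T'"
  unfolding DE.DS_T DK.DS_T DO.DS_T using Lnz by (simp_all add: field_simps)

text \<open>Orthogonality to the gradients of both T and eta removes the endpoint terms. Only the
  term e2 T / 2 of the kappa-direction survives.\<close>

lemma pair_v3u1: "pairing w p (v3 w p) (u1 w p) = - (sigma w p * rho w p * T / 2)"
proof -
  let ?s = "sigma w p" let ?g = "gam w p" let ?r = "rho w p"
  have "pairing w p (v3 w p) (u1 w p) = prim (\<lambda>y. (?s * ?g) * (dA y * DE.PI y - \<kappa> / A y * DE.Da y) + (?s * ?r) * (dA y * DK.PI y - \<kappa> / A y * DK.Da y)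
      + (?s * ?s) * (dA y * DO.PI y - \<kappa> / A y * DO.Da y)) T"
    unfolding pairing_prim comps by (rule arg_cong[of _ _ "\<lambda>f. prim f T"]) (simp add: fun_eq_iff algebra_simps)
  also have "\<dots> = (?s * ?g) * (L * DE.DS T / 2 - 0 * T / 2) + (?s * ?r) * (L * DK.DS T / 2 - 1 * T / 2) + (?s * ?s) * (L * DO.DS T / 2 - 0 * T / 2)"
    unfolding prim_linear3[OF cont(4-6)] DE.v3_integral DK.v3_integral DO.v3_integral ..
  also have "\<dots> = ?s / 2 * (L * (?g * DE.eta' + ?r * DK.eta' + ?s * DO.eta') - \<kappa> * (?g * DE.T' + ?r * DK.T' + ?s * DO.T')) - ?s * ?r * T / 2"
    unfolding LDS by (simp add: algebra_simps add_divide_distrib diff_divide_distrib)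
  also have "?g * DE.T' + ?r * DK.T' + ?s * DO.T' = 0" unfolding coeffs by (simp add: algebra_simps)
  also have "?g * DE.eta' + ?r * DK.eta' + ?s * DO.eta' = 0" unfolding coeffs by (simp add: algebra_simps)
  finally show ?thesis by simp
qed

lemma yAdA: "prim (\<lambda>y. y * A y * dA y) T = (T * L - Mmom w p) / 2"
proof -
  have "prim (\<lambda>y. 1 * (y * A y * dA y) + (1/2) * (A y)\<^sup>2) T = T * (A T)\<^sup>2 / 2 - 0 * (A 0)\<^sup>2 / 2"
  proof (rule DE.prim_eq_deriv)
    show "((\<lambda>y. y * (A y)\<^sup>2 / 2) has_real_derivative 1 * (y * A y * dA y) + (1/2) * (A y)\<^sup>2) (at y)" for y
      apply (rule DERIV_cong)
       apply (rule derivative_intros profile(1)[OF pW] | simp)+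
      done
  qed (intro continuous_intros DE.cDa)
  thus ?thesis unfolding prim_linear[OF cont(7,9)] moments(1)[OF pW, symmetric] at_period[OF pW] by (simp add: field_simps)
qed

text \<open>The endpoint terms cancel because tau, nu and the secular term y A / 2 are balanced: the
  jump of eta along (tau, nu) is compensated by sigma T / 2.\<close>

lemma pair_v3u3: "pairing w p (v3 w p) (u3 w p) = - (sigma w p / 2) * (nu w p * T + sigma w p * Mmom w p / 2)"
proof -
  let ?s = "sigma w p" let ?t = "tau w p" let ?n = "nu w p"
  have "pairing w p (v3 w p) (u3 w p) = prim (\<lambda>y. (?s * ?t) * (dA y * DE.PI y - \<kappa> / A y * DE.Da y) + (?s * ?n) * (dA y * DK.PI y - \<kappa> / A y * DK.Da y)
      + (?s * ?s / 2) * (y * A y * dA y)) T"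
    unfolding pairing_prim comps by (rule arg_cong[of _ _ "\<lambda>f. prim f T"]) (simp add: fun_eq_iff algebra_simps)
  also have "\<dots> = (?s * ?t) * (L * DE.DS T / 2 - 0 * T / 2) + (?s * ?n) * (L * DK.DS T / 2 - 1 * T / 2) + (?s * ?s / 2) * ((T * L - Mmom w p) / 2)"
    unfolding prim_linear3[OF cont(4,5,7)] DE.v3_integral DK.v3_integral yAdA ..
  also have "\<dots> = ?s / 2 * (L * (?t * DE.eta' + ?n * DK.eta' + ?s * T / 2) - \<kappa> * (?t * DE.T' + ?n * DK.T')) - ?s * ?n * T / 2 - ?s * ?s * Mmom w p / 4"
    unfolding LDS by (simp add: field_simps)
  also have "?t * DE.T' + ?n * DK.T' = 0" unfolding coeffs by (simp add: algebra_simps)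
  also have "?t * DE.eta' + ?n * DK.eta' + ?s * T / 2 = 0" unfolding coeffs by (simp add: field_simps)
  finally show ?thesis by (simp add: field_simps)
qed

text \<open>All three reciprocity relations enter: M_E and M_kappa become derivatives of T and eta
  in omega, and T_kappa = - eta_E turns the result into rho T.\<close>

lemma b2_eq: "- (sigma w p / 2) * (tau w p * DE.M' + nu w p * DK.M') = - (sigma w p * rho w p * T / 2)"
proof -
  have "tau w p * DE.M' + nu w p * DK.M' = rho w p * T"
    unfolding coeffs reciprocal by (simp add: field_simps)
  thus ?thesis by simp
qed

lemma pair_v1_L2u0: "pairing w p (v1 w p) (L2op (u0 w p)) = (sigma w p)\<^sup>2 * Mmom w p"
proof -
  have "pairing w p (v1 w p) (L2op (u0 w p)) = prim (\<lambda>y. (sigma w p)\<^sup>2 * (A y)\<^sup>2 + 0 * (A y)\<^sup>2) T"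
    unfolding pairing_prim comps by (rule arg_cong[of _ _ "\<lambda>f. prim f T"]) (simp add: fun_eq_iff power2_eq_square)
  thus ?thesis unfolding prim_linear[OF cont(9,9)] moments(1)[OF pW] by simp
qed

lemma prim_const: "prim (\<lambda>y. c::real) T = c * T"
  using Tpos by (simp add: prim_nonneg)

lemma pair_v1_L2u2: "pairing w p (v1 w p) (L2op (u2 w p)) = (sigma w p)\<^sup>2 * \<kappa> * T"
proof -
  have "pairing w p (v1 w p) (L2op (u2 w p)) = prim (\<lambda>y. (sigma w p)\<^sup>2 * \<kappa>) T"
    unfolding pairing_prim comps by (rule arg_cong[of _ _ "\<lambda>f. prim f T"]) (use Anz in \<open>simp add: fun_eq_iff power2_eq_square\<close>)
  thus ?thesis by (simp add: prim_const)
qed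

lemma pair_v3_L2u0: "pairing w p (v3 w p) (L2op (u0 w p)) = (sigma w p)\<^sup>2 * \<kappa> * T"
proof -
  have "pairing w p (v3 w p) (L2op (u0 w p)) = prim (\<lambda>y. (sigma w p)\<^sup>2 * \<kappa>) T"
    unfolding pairing_prim comps by (rule arg_cong[of _ _ "\<lambda>f. prim f T"]) (use Anz in \<open>simp add: fun_eq_iff power2_eq_square\<close>)
  thus ?thesis by (simp add: prim_const)
qed

lemma dA_sq: "(dA y)\<^sup>2 + (\<kappa> / A y)\<^sup>2 = 2 * E - \<omega> * (A y)\<^sup>2 - \<zeta> * nlF w ((A y)\<^sup>2)"
  using profile(3)[OF pW, of y] by (simp add: Rfun_def power_divide)

lemma pair_v3_L2u2_raw: "pairing w p (v3 w p) (L2op (u2 w p)) = (sigma w p)\<^sup>2 * prim (\<lambda>y. (dA y)\<^sup>2 + (\<kappa> / A y)\<^sup>2) T"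
proof -
  have c: "continuous_on UNIV (\<lambda>y. (dA y)\<^sup>2 + (\<kappa> / A y)\<^sup>2)" using Anz by (intro continuous_intros DE.cDa) auto
  have "pairing w p (v3 w p) (L2op (u2 w p)) = prim (\<lambda>y. (sigma w p)\<^sup>2 * ((dA y)\<^sup>2 + (\<kappa> / A y)\<^sup>2) + 0 * ((dA y)\<^sup>2 + (\<kappa> / A y)\<^sup>2)) T"
    unfolding pairing_prim comps by (rule arg_cong[of _ _ "\<lambda>f. prim f T"]) (simp add: fun_eq_iff power2_eq_square algebra_simps)
  thus ?thesis unfolding prim_linear[OF c c] by simp
qed

lemma pair_v3_L2u2: "pairing w p (v3 w p) (L2op (u2 w p)) = (sigma w p)\<^sup>2 * (2 * E * T - \<omega> * Mmom w p - \<zeta> * Umom w p)"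
proof -
  have cF: "continuous_on UNIV (\<lambda>y. nlF w ((A y)\<^sup>2))"
    by (rule continuous_on_compose2[OF nlf_cont(3)[OF ends(1)[OF pW], of "hi w p"] amp_cont[OF pW]]) (use profile(4)[OF pW] in auto)
  have "prim (\<lambda>y. (dA y)\<^sup>2 + (\<kappa> / A y)\<^sup>2) T = prim (\<lambda>y. 1 * (2 * E) + (- \<omega>) * (A y)\<^sup>2 + (- \<zeta>) * nlF w ((A y)\<^sup>2)) T"
    unfolding dA_sq by simp
  also have "\<dots> = 1 * prim (\<lambda>y. 2 * E) T + (- \<omega>) * prim (\<lambda>y. (A y)\<^sup>2) T + (- \<zeta>) * prim (\<lambda>y. nlF w ((A y)\<^sup>2)) T"
    by (rule prim_linear3[OF _ cont(9) cF]) (rule continuous_on_const)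
  finally show ?thesis unfolding pair_v3_L2u2_raw moments(1,4)[OF pW] prim_const by simp
qed

text \<open>\<open>mat2\<close> repeats one off-diagonal pairing; by reciprocity it also equals the
  pairing that the reduction produces in the lower left entry.\<close>

lemma mat2_eq: "vec_nth (vec_nth (mat2 w p) 1) 1 = pairing w p (v1 w p) (u1 w p)"
  "vec_nth (vec_nth (mat2 w p) 1) 2 = pairing w p (v1 w p) (u3 w p)"
  "vec_nth (vec_nth (mat2 w p) 2) 1 = pairing w p (v3 w p) (u1 w p)"
  "vec_nth (vec_nth (mat2 w p) 2) 2 = pairing w p (v3 w p) (u3 w p)"
  using pair_v1u3 pair_v3u1 b2_eq by (simp_all add: mat2_def Let_def)

lemma mat0_eq: "vec_nth (vec_nth (mat0 w p) 1) 1 = - pairing w p (v1 w p) (L2op (u0 w p))"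
  "vec_nth (vec_nth (mat0 w p) 1) 2 = - pairing w p (v1 w p) (L2op (u2 w p))"
  "vec_nth (vec_nth (mat0 w p) 2) 1 = - pairing w p (v3 w p) (L2op (u0 w p))"
  "vec_nth (vec_nth (mat0 w p) 2) 2 = - pairing w p (v3 w p) (L2op (u2 w p))"
  using pair_v1_L2u2 pair_v3_L2u0 by (simp_all add: mat0_def Let_def)

lemma det_mat2:
  assumes g: "generic w p" shows "det (mat2 w p) \<noteq> 0" "sigma w p \<noteq> 0"
proof -
  show s0: "sigma w p \<noteq> 0" using g by (simp add: generic_def)
  let ?e = DE.eta' let ?k = DK.eta' let ?o = DO.eta' let ?t = DE.T' let ?u = DO.T' let ?m = DO.M' let ?M = "Mmom w p"
  \<comment> \<open>The genericity determinant expanded in the second derivatives of K, which are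
    the first derivatives of T, eta and M up to constant factors.\<close>
  define d4 where "d4 = ?M * (?k * (?t * (- ?m / 2) - ?u * ?u) - ?e * (?e * (?m / 2) + ?u * ?o) - ?o * (?e * ?u - ?o * ?t)) - T * T * (?t * (- ?m / 2) - ?u * ?u)"
  have "det (vector
        [vector [dkappa (dkappa (Kmom w)) p, dE (dkappa (Kmom w)) p, domega (dkappa (Kmom w)) p, T],
         vector [dE (dkappa (Kmom w)) p, dE (dE (Kmom w)) p, domega (dE (Kmom w)) p, 0],
         vector [domega (dkappa (Kmom w)) p, domega (dE (Kmom w)) p, domega (domega (Kmom w)) p, 0],
         vector [T, 0, 0, - ?M]] :: real^4^4) = d4"
    by (subst det_4[OF refl]) (simp add: vector_4 K_second d4_def algebra_simps)
  hence d4: "d4 \<noteq> 0" using g by (simp add: generic_def Let_def)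
  \<comment> \<open>So the nonzero multiple is - sigma^3 / 4.\<close>
  have "4 * det (mat2 w p) = - ((sigma w p)^3 * d4)"
    unfolding det_2 mat2_eq pair_v1u1 pair_v1u3 pair_v3u1 pair_v3u3 b2_eq d4_def coeffs reciprocal
    by (simp add: field_simps power3_eq_cube)
  thus "det (mat2 w p) \<noteq> 0" using s0 d4 by auto
qed

lemma prim_pos:
  fixes g :: "real \<Rightarrow> real"
  assumes "continuous_on UNIV g" "\<And>y. 0 \<le> g y" "\<And>y. 0 < y \<Longrightarrow> y < T/2 \<Longrightarrow> 0 < g y"
  shows "0 < prim g T"
proof -
  have d: "(prim g has_real_derivative g y) (at y)" for y
    using prim_has_vector_derivative[OF assms(1)] by (simp add: has_real_derivative_iff_has_vector_derivative)
  have "prim g 0 < prim g (T/2)"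
    by (rule DERIV_pos_imp_increasing_open) (use d assms(3) Tpos in \<open>auto intro!: continuous_at_imp_continuous_on DERIV_isCont[OF d]\<close>)
  also have "\<dots> \<le> prim g T"
    by (rule DERIV_nonneg_imp_nondecreasing) (use d assms(2) Tpos in auto)
  finally show ?thesis by simp
qed

lemma Qpos: "0 < prim (\<lambda>y. (dA y)\<^sup>2) T"
proof (rule prim_pos)
  show "0 < (dA y)\<^sup>2" if y: "0 < y" "y < T/2" for y
    using half_period(2)[OF pW, of y] y by simp
qed (auto intro!: continuous_intros DE.cDa)

lemma Mpos: "0 < Mmom w p"
  unfolding moments(1)[OF pW] by (rule prim_pos[OF cont(9)]) (use Anz in auto)

text \<open>By the Cauchy--Schwarz inequality for \<open>A\<close> and \<open>\<kappa> / A\<close>.\<close>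

lemma det_mat0: "sigma w p \<noteq> 0 \<Longrightarrow> det (mat0 w p) \<noteq> 0"
proof -
  assume s0: "sigma w p \<noteq> 0"
  let ?M = "Mmom w p" let ?Q = "prim (\<lambda>y. (dA y)\<^sup>2) T" let ?I = "prim (\<lambda>y. (\<kappa> / A y)\<^sup>2) T"
  have cI: "continuous_on UNIV (\<lambda>y. (\<kappa> / A y)\<^sup>2)" by (intro continuous_intros cont(8))
  have cQ: "continuous_on UNIV (\<lambda>y. (dA y)\<^sup>2)" by (intro continuous_intros DE.cDa)
  \<comment> \<open>The minimizer of the integral of (kappa / A - t A)^2, which yields the
    Cauchy--Schwarz inequality. Strictness of the final inequality comes from the integral of
    A_y^2.\<close>
  define t where "t = \<kappa> * T / ?M"
  have sq: "(\<kappa> / A y - t * A y)\<^sup>2 = 1 * (\<kappa> / A y)\<^sup>2 + (- 2 * t * \<kappa>) * 1 + t\<^sup>2 * (A y)\<^sup>2" for y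
    using Anz[of y] by (simp add: power2_eq_square algebra_simps)
  have "0 \<le> prim (\<lambda>y. (\<kappa> / A y - t * A y)\<^sup>2) T"
    using Tpos by (simp add: prim_nonneg) (rule integral_nonneg, rule integrable_continuous_interval, use Anz in \<open>auto intro!: continuous_intros DE.cDa\<close>)
  also have "\<dots> = 1 * ?I + (- 2 * t * \<kappa>) * prim (\<lambda>y. 1) T + t\<^sup>2 * ?M"
    unfolding sq moments(1)[OF pW] by (rule prim_linear3[OF cI _ cont(9)]) (rule continuous_on_const)
  also have "\<dots> = ?I - (\<kappa> * T)\<^sup>2 / ?M" using Mpos by (simp add: prim_const t_def field_simps power2_eq_square)
  finally have CS: "(\<kappa> * T)\<^sup>2 \<le> ?M * ?I" using Mpos by (simp add: field_simps)
  have QI: "prim (\<lambda>y. (dA y)\<^sup>2 + (\<kappa> / A y)\<^sup>2) T = ?Q + ?I"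
    using prim_linear[OF cQ cI, of 1 1 T] by simp
  have "det (mat0 w p) = (sigma w p)^4 * (?M * (?Q + ?I) - (\<kappa> * T)\<^sup>2)"
    unfolding det_2 mat0_eq pair_v1_L2u0 pair_v1_L2u2 pair_v3_L2u0 pair_v3_L2u2_raw QI
    by (simp add: power2_eq_square eval_nat_numeral algebra_simps)
  moreover have "0 < ?M * ?Q" using Mpos Qpos by simp
  hence "0 < ?M * (?Q + ?I) - (\<kappa> * T)\<^sup>2" using CS by (simp add: distrib_left)
  ultimately show ?thesis using s0 by simp
qed

end

section \<open>Reduction of the eigenvalue problem\<close>

lemma prim_of_real:
  assumes "continuous_on UNIV f"
  shows "prim (\<lambda>y. complex_of_real (f y)) y = of_real (prim f y)"
proof -
  have "((\<lambda>y. complex_of_real (prim f y)) has_vector_derivative of_real (f y)) (at y)" for y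
    by (intro has_vector_derivative_of_real)
       (simp add: has_real_derivative_iff_has_vector_derivative prim_has_vector_derivative[OF assms])
  moreover have "continuous_on UNIV (\<lambda>y. complex_of_real (f y))" by (intro continuous_intros assms)
  ultimately show ?thesis using eq_prim[of "\<lambda>y. complex_of_real (f y)" "\<lambda>y. of_real (prim f y)" y] by simp
qed

lemma (in linearized_system) csol_real:
  assumes "\<And>b y. (u b has_real_derivative u' b y) (at y)"
    "\<And>y. (u' True has_real_derivative qp y * u True y + s1 y * u False y + 2 * s y * u' False y - g False y) (at y)"
    "\<And>y. (u' False has_real_derivative qm y * u False y - s1 y * u True y - 2 * s y * u' True y + g True y) (at y)"
  shows "csol (\<lambda>b y. of_real (u b y)) (\<lambda>b y. of_real (u' b y)) (\<lambda>b y. of_real (g b y))"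
  unfolding csol_def
  by (intro conjI allI; (rule has_vector_derivative_eq_rhs, rule has_vector_derivative_of_real, rule assms, simp))

context wave_point
begin

definition Ef :: "nat \<Rightarrow> bool \<Rightarrow> real \<Rightarrow> real" where
  "Ef i b = (if i = 0 then (if b then (\<lambda>_. 0) else A) else if i = 1 then (if b then dA else (\<lambda>y. \<kappa> / A y))
     else if i = 2 then (if b then DE.Da else DE.PI) else (if b then DK.Da else DK.PI))"

definition Ef1 :: "nat \<Rightarrow> bool \<Rightarrow> real \<Rightarrow> real" where
  "Ef1 i b = (if i = 0 then (if b then (\<lambda>_. 0) else dA) else if i = 1 then (if b then (\<lambda>y. Nf w p (A y)) else (\<lambda>y. - \<kappa> * dA y / (A y)\<^sup>2))
     else if i = 2 then (if b then DE.Da1 else DE.PI1) else (if b then DK.Da1 else DK.PI1))"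

lemma Ef_simps [simp]:
  "Ef 0 True = (\<lambda>_. 0)" "Ef 0 False = A" "Ef 1 True = dA" "Ef 1 False = (\<lambda>y. \<kappa> / A y)"
  "Ef (Suc 0) True = dA" "Ef (Suc 0) False = (\<lambda>y. \<kappa> / A y)"
  "Ef 2 True = DE.Da" "Ef 2 False = DE.PI" "Ef 3 True = DK.Da" "Ef 3 False = DK.PI"
  "Ef1 0 True = (\<lambda>_. 0)" "Ef1 0 False = dA" "Ef1 1 True = (\<lambda>y. Nf w p (A y))" "Ef1 1 False = (\<lambda>y. - \<kappa> * dA y / (A y)\<^sup>2)"
  "Ef1 (Suc 0) True = (\<lambda>y. Nf w p (A y))" "Ef1 (Suc 0) False = (\<lambda>y. - \<kappa> * dA y / (A y)\<^sup>2)"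
  "Ef1 2 True = DE.Da1" "Ef1 2 False = DE.PI1" "Ef1 3 True = DK.Da1" "Ef1 3 False = DK.PI1"
  by (simp_all add: Ef_def Ef1_def)

lemma nat_lt_4: "(i::nat) < 4 \<Longrightarrow> (i = 0 \<Longrightarrow> P) \<Longrightarrow> (i = 1 \<Longrightarrow> P) \<Longrightarrow> (i = 2 \<Longrightarrow> P) \<Longrightarrow> (i = 3 \<Longrightarrow> P) \<Longrightarrow> P"
  by linarith

text \<open>A^2 S_y is constant. The identity is the second component of L (0, A) = 0.\<close>

lemma rotation: "DE.Syy y * A y + 2 * DE.Sy y * dA y = 0"
  using Anz[of y] by (simp add: DE.Syy_def DE.Sy_def field_simps eval_nat_numeral)

lemma kA_deriv: "((\<lambda>y. \<kappa> / A y) has_real_derivative - \<kappa> * dA y / (A y)\<^sup>2) (at y)"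
  using Anz[of y]
  apply -
  apply (rule DERIV_cong)
   apply (rule derivative_intros profile(1)[OF pW] | simp)+
  apply (simp add: power2_eq_square)
  done

lemma translation_R: "Nd w p (A y) * dA y = DE.Qp y * dA y + DE.Syy y * (\<kappa> / A y) + 2 * DE.Sy y * (- \<kappa> * dA y / (A y)\<^sup>2)"
  using Anz[of y] by (simp add: Nd_def DE.Qp_def DE.Qm_def DE.Sy_def DE.Syy_def field_simps eval_nat_numeral)

lemma translation_I: "((\<lambda>y. - \<kappa> * dA y / (A y)\<^sup>2) has_real_derivative
    DE.Qm y * (\<kappa> / A y) - DE.Syy y * dA y - 2 * DE.Sy y * Nf w p (A y)) (at y)"
proof (rule DERIV_cong)
  show "((\<lambda>y. - \<kappa> * dA y / (A y)\<^sup>2) has_real_derivative - \<kappa> * Nf w p (A y) / (A y)\<^sup>2 + 2 * \<kappa> * (dA y)\<^sup>2 / (A y)^3) (at y)"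
    using Anz[of y]
    apply -
    apply (rule DERIV_cong)
     apply (rule derivative_intros profile(1,2)[OF pW] | simp)+
    apply (simp add: field_simps eval_nat_numeral)
    done
  show "- \<kappa> * Nf w p (A y) / (A y)\<^sup>2 + 2 * \<kappa> * (dA y)\<^sup>2 / (A y)^3 = DE.Qm y * (\<kappa> / A y) - DE.Syy y * dA y - 2 * DE.Sy y * Nf w p (A y)"
    unfolding DE.NQ using Anz[of y] by (simp add: DE.Sy_def DE.Syy_def field_simps eval_nat_numeral)
qed

lemma Ef_deriv: "i < 4 \<Longrightarrow> (Ef i b has_real_derivative Ef1 i b y) (at y)"
  by (erule nat_lt_4; cases b)
     (simp_all add: profile(1,2)[OF pW] kA_deriv[simplified] DE.Da_deriv DK.Da_deriv DE.PI_deriv DK.PI_deriv)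

lemma Ef1_deriv:
  assumes "i < 4"
  shows "(Ef1 i True has_real_derivative DE.Qp y * Ef i True y + DE.Syy y * Ef i False y + 2 * DE.Sy y * Ef1 i False y) (at y)"
    "(Ef1 i False has_real_derivative DE.Qm y * Ef i False y - DE.Syy y * Ef i True y - 2 * DE.Sy y * Ef1 i True y) (at y)"
proof -
  have N: "((\<lambda>y. Nf w p (A y)) has_real_derivative Nd w p (A y) * dA y) (at y)"
    by (rule DERIV_chain2[OF Nf_deriv[OF profile(5)[OF pW]] profile(1)[OF pW]])
  show "(Ef1 i True has_real_derivative DE.Qp y * Ef i True y + DE.Syy y * Ef i False y + 2 * DE.Sy y * Ef1 i False y) (at y)"
    using assms
  proof (rule nat_lt_4)
    show ?thesis if i: "i = 0" using rotation[of y] unfolding i by (simp add: add.assoc)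
    show ?thesis if i: "i = 1" using N translation_R[of y] unfolding i by (simp only: Ef_simps)
    show ?thesis if i: "i = 2" using DE.Phi_R[of y] unfolding i by simp
    show ?thesis if i: "i = 3" using DK.Phi_R[of y] unfolding i by simp
  qed
  show "(Ef1 i False has_real_derivative DE.Qm y * Ef i False y - DE.Syy y * Ef i True y - 2 * DE.Sy y * Ef1 i True y) (at y)"
    using assms
  proof (rule nat_lt_4)
    show ?thesis if i: "i = 0" using profile(2)[OF pW, of y] unfolding i by (simp add: DE.NQ)
    show ?thesis if i: "i = 1" using translation_I[of y] unfolding i by (simp only: Ef_simps)
    show ?thesis if i: "i = 2" using DE.Phi_I[of y] unfolding i by simp
    show ?thesis if i: "i = 3" using DK.Phi_I[of y] unfolding i by simp
  qed
qed

text \<open>The pairings with rotation and translation are the variations of kappa and E by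
  Noether's principle. The pairing of the E- and kappa-derivatives starts at 0 and is conserved, as
  neither direction changes omega.\<close>

lemma Ef_symp:
  assumes "(i, j, c) \<in> {(0,3,1),(1,2,1),(0,1,0),(0,2,0),(1,3,0),(2,3,0)}"
  shows "Ef i True y * Ef1 j True y - Ef1 i True y * Ef j True y + Ef i False y * Ef1 j False y - Ef1 i False y * Ef j False y
    + 2 * DE.Sy y * (Ef i False y * Ef j True y - Ef i True y * Ef j False y) = c" (is "?B i j = c")
proof -
  have EK: "EK.BB y = 0" unfolding EK.BB_eq by (simp add: prim_def)
  have "?B 0 3 = 1" using DK.symp_w1[of y] by simp
  moreover have "?B 1 2 = 1" using DE.symp_w2[of y] by simp
  moreover have "?B 0 1 = 0" using Anz[of y] by (simp add: DE.Sy_def power2_eq_square)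
  moreover have "?B 0 2 = 0" using DE.symp_w1[of y] by simp
  moreover have "?B 1 3 = 0" using DK.symp_w2[of y] by simp
  moreover have "?B 2 3 = 0" using EK by (simp add: EK.BB_def)
  ultimately show ?thesis using assms by (elim insertE) (simp_all only: prod.inject, auto)
qed

definition Q :: real where "Q = prim (\<lambda>y. (dA y)\<^sup>2) T"

text \<open>The R-component normalizes the pairing with (0, A) to 1; the I-component cancels the
  pairing kappa T / M that it would have with the translation field.\<close>

definition h0f :: cfield where
  "h0f b y = of_real (if b then A y / Mmom w p else \<kappa> * T / (Mmom w p * Q) * dA y)"

definition h1f :: cfield where
  "h1f b y = of_real (if b then 0 else - dA y / Q)"

text \<open>All four duality integrands are combinations of A^2, 1 and A_y^2, whose integrals over a
  period are M, T and \<open>Q\<close>.\<close>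

lemma prim_quadratic:
  assumes "\<And>t. e t * f t - e' t * f' t = a * (A t)\<^sup>2 + b * 1 + c * (dA t)\<^sup>2" "v = a * Mmom w p + b * T + c * Q"
  shows "prim (\<lambda>t. of_real (e t) * complex_of_real (f t) - of_real (e' t) * of_real (f' t)) T = of_real v"
proof -
  have cQ: "continuous_on UNIV (\<lambda>y. (dA y)\<^sup>2)" and c1: "continuous_on UNIV (\<lambda>y::real. 1::real)" by (intro continuous_intros DE.cDa)+
  have "prim (\<lambda>t. complex_of_real (a * (A t)\<^sup>2 + b * 1 + c * (dA t)\<^sup>2)) T = of_real (prim (\<lambda>t. a * (A t)\<^sup>2 + b * 1 + c * (dA t)\<^sup>2) T)"
    by (rule prim_of_real) (intro continuous_intros DE.cDa)
  also have "prim (\<lambda>t. a * (A t)\<^sup>2 + b * 1 + c * (dA t)\<^sup>2) T = a * prim (\<lambda>y. (A y)\<^sup>2) T + b * prim (\<lambda>y. 1) T + c * prim (\<lambda>y. (dA y)\<^sup>2) T"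
    by (rule prim_linear3[OF cont(9) c1 cQ])
  also have "\<dots> = v" using assms(2) by (simp add: prim_const moments(1)[OF pW] Q_def)
  finally show ?thesis unfolding assms(1)[symmetric] by simp
qed

lemma h_pairings:
  "prim (\<lambda>t. of_real (Ef 0 False t) * h0f True t - of_real (Ef 0 True t) * h0f False t) T = 1"
  "prim (\<lambda>t. of_real (Ef 1 False t) * h0f True t - of_real (Ef 1 True t) * h0f False t) T = 0"
  "prim (\<lambda>t. of_real (Ef 0 False t) * h1f True t - of_real (Ef 0 True t) * h1f False t) T = 0"
  "prim (\<lambda>t. of_real (Ef 1 False t) * h1f True t - of_real (Ef 1 True t) * h1f False t) T = 1"
proof -
  let ?M = "Mmom w p"
  have M: "?M \<noteq> 0" and Q: "Q \<noteq> 0" using Mpos Qpos by (simp_all add: Q_def)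
  show "prim (\<lambda>t. of_real (Ef 0 False t) * h0f True t - of_real (Ef 0 True t) * h0f False t) T = 1"
    unfolding h0f_def by (subst prim_quadratic[where a="1/?M" and b=0 and c=0 and v=1]) (use M in \<open>simp_all add: power2_eq_square\<close>)
  show "prim (\<lambda>t. of_real (Ef 1 False t) * h0f True t - of_real (Ef 1 True t) * h0f False t) T = 0"
    unfolding h0f_def by (subst prim_quadratic[where a=0 and b="\<kappa> / ?M" and c="- (\<kappa> * T / (?M * Q))" and v=0]) (use M Q Anz in \<open>simp_all add: power2_eq_square\<close>)
  show "prim (\<lambda>t. of_real (Ef 0 False t) * h1f True t - of_real (Ef 0 True t) * h1f False t) T = 0"
    unfolding h1f_def by (subst prim_quadratic[where a=0 and b=0 and c=0 and v=0]) simp_all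
  show "prim (\<lambda>t. of_real (Ef 1 False t) * h1f True t - of_real (Ef 1 True t) * h1f False t) T = 1"
    unfolding h1f_def by (subst prim_quadratic[where a=0 and b=0 and c="1/Q" and v=1]) (use Q in \<open>simp_all add: power2_eq_square\<close>)
qed

lemma Ef_linearized_system:
  assumes "sigma w p \<noteq> 0"
  shows "linearized_system DE.Sy DE.Syy DE.Qm DE.Qp T Ef Ef1 DE.eta' DK.eta' DE.T' DK.T' (sigma w p) h0f h1f"
proof
  show "DE.Sy (y + T) = DE.Sy y" for y by (simp add: DE.Sy_def profile(7)[OF pW])
  show "Ef 0 b (y + T) = Ef 0 b y" "Ef 1 b (y + T) = Ef 1 b y" for b y
    by (cases b; simp add: profile(7)[OF pW] A1_shift[OF pW])+
  show "Ef 2 b (y + T) = Ef 2 b y + DE.eta' * Ef 0 b y - DE.T' * Ef 1 b y" for b y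
    by (cases b) (use DE.Phi_jump[of y] in simp_all)
  show "Ef 3 b (y + T) = Ef 3 b y + DK.eta' * Ef 0 b y - DK.T' * Ef 1 b y" for b y
    by (cases b) (use DK.Phi_jump[of y] in simp_all)
  show "sigma w p = DE.T' * DK.eta' - DK.T' * DE.eta'" by (rule coeffs)
  show "DK.T' = - DE.eta'" by (rule reciprocal)
  show "continuous_on UNIV (h0f b)" "continuous_on UNIV (h1f b)" for b
    unfolding h0f_def[abs_def] h1f_def[abs_def] by (cases b; simp only: if_True if_False; intro continuous_intros DE.cDa; use Mpos Qpos in \<open>simp add: Q_def\<close>)+
  show "h0f b (y + T) = h0f b y" "h1f b (y + T) = h1f b y" for b y
    by (simp_all add: h0f_def h1f_def profile(7)[OF pW] A1_shift[OF pW])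
qed (rule assms Tpos DE.Sy_deriv Ef_deriv Ef1_deriv h_pairings Ef_symp; assumption)+

end

locale nondegenerate_point = wave_point +
  assumes sg: "sigma w p \<noteq> 0"
begin

sublocale S: linearized_system DE.Sy DE.Syy DE.Qm DE.Qp T Ef Ef1 DE.eta' DK.eta' DE.T' DK.T' "sigma w p" h0f h1f
  by (rule Ef_linearized_system[OF sg])

text \<open>The fields \<open>u1\<close> (index 0) and \<open>u3\<close> (index 1), rewritten in the
  solution basis; they form Jordan chains over rotation and translation.\<close>

definition WV :: "nat \<Rightarrow> bool \<Rightarrow> real \<Rightarrow> real" where
  "WV i b y = (if i = 0
     then gam w p * Ef 2 b y + rho w p * Ef 3 b y + sigma w p * (if b then DO.Da y else DO.PI y)
     else tau w p * Ef 2 b y + nu w p * Ef 3 b y + sigma w p * (if b then 0 else y * A y / 2))"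

definition WV1 :: "nat \<Rightarrow> bool \<Rightarrow> real \<Rightarrow> real" where
  "WV1 i b y = (if i = 0
     then gam w p * Ef1 2 b y + rho w p * Ef1 3 b y + sigma w p * (if b then DO.Da1 y else DO.PI1 y)
     else tau w p * Ef1 2 b y + nu w p * Ef1 3 b y + sigma w p * (if b then 0 else A y / 2 + y * dA y / 2))"

lemma WV_simps [simp]:
  "WV 0 True = (\<lambda>y. gam w p * DE.Da y + rho w p * DK.Da y + sigma w p * DO.Da y)"
  "WV 0 False = (\<lambda>y. gam w p * DE.PI y + rho w p * DK.PI y + sigma w p * DO.PI y)"
  "WV 1 True = (\<lambda>y. tau w p * DE.Da y + nu w p * DK.Da y)"
  "WV 1 False = (\<lambda>y. tau w p * DE.PI y + nu w p * DK.PI y + sigma w p * (y * A y / 2))"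
  "WV1 0 True = (\<lambda>y. gam w p * DE.Da1 y + rho w p * DK.Da1 y + sigma w p * DO.Da1 y)"
  "WV1 0 False = (\<lambda>y. gam w p * DE.PI1 y + rho w p * DK.PI1 y + sigma w p * DO.PI1 y)"
  "WV1 1 True = (\<lambda>y. tau w p * DE.Da1 y + nu w p * DK.Da1 y)"
  "WV1 1 False = (\<lambda>y. tau w p * DE.PI1 y + nu w p * DK.PI1 y + sigma w p * (A y / 2 + y * dA y / 2))"
  by (simp_all add: WV_def WV1_def fun_eq_iff)

lemma lt_2: "(i::nat) < 2 \<Longrightarrow> (i = 0 \<Longrightarrow> P) \<Longrightarrow> (i = 1 \<Longrightarrow> P) \<Longrightarrow> P"
  by linarith

lemmas field_derivs = DE.Da_deriv DK.Da_deriv DO.Da_deriv DE.PI_deriv DK.PI_deriv DO.PI_deriv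
  DE.Phi_R DK.Phi_R DO.Phi_R DE.Phi_I DK.Phi_I DO.Phi_I

text \<open>The E- and kappa-derivatives are homogeneous solutions. The source comes from the
  omega-derivative for index 0, and for index 1 from the secular field (0, y A / 2), which L maps to
  (A_y, A S_y).\<close>

lemma WV_csol:
  assumes "i < 2"
  shows "S.csol (\<lambda>b y. of_real (WV i b y)) (\<lambda>b y. of_real (WV1 i b y)) (\<lambda>b y. of_real (sigma w p) * S.EE i b y)"
proof -
  have yA: "((\<lambda>y. y * A y / 2) has_real_derivative A y / 2 + y * dA y / 2) (at y)" for y
    by (rule DERIV_cong[OF DERIV_cdivide[OF DERIV_mult[OF DERIV_ident profile(1)[OF pW]]]]) (simp add: field_simps)
  have yA1: "((\<lambda>y. A y / 2 + y * dA y / 2) has_real_derivative dA y + y * (DE.Qm y * A y) / 2) (at y)" for y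
    by (rule DERIV_cong[OF DERIV_add[OF DERIV_cdivide[OF profile(1)[OF pW]] DERIV_cdivide[OF DERIV_mult[OF DERIV_ident profile(2)[OF pW]]]]])
       (simp add: DE.NQ field_simps)
  have r: "DE.Syy y = - (2 * (DE.Sy y * dA y) / A y)" "\<kappa> / A y = DE.Sy y * A y" for y
    using rotation[of y] Anz[of y] by (simp_all add: DE.Sy_def field_simps power2_eq_square)
  have "S.csol (\<lambda>b y. of_real (WV i b y)) (\<lambda>b y. of_real (WV1 i b y)) (\<lambda>b y. of_real (sigma w p * Ef i b y))"
    using assms
  proof (rule lt_2)
    assume i: "i = 0"
    show ?thesis unfolding i
    proof (rule S.csol_real)
      show "(WV 0 b has_real_derivative WV1 0 b y) (at y)" for b y
        by (cases b; simp only: WV_simps; rule DERIV_cong, (rule derivative_intros field_derivs)+, simp)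
      show "(WV1 0 True has_real_derivative DE.Qp y * WV 0 True y + DE.Syy y * WV 0 False y + 2 * DE.Sy y * WV1 0 False y - sigma w p * Ef 0 False y) (at y)" for y
        unfolding WV_simps Ef_simps by (rule DERIV_cong, (rule derivative_intros field_derivs)+) (simp add: algebra_simps)
      show "(WV1 0 False has_real_derivative DE.Qm y * WV 0 False y - DE.Syy y * WV 0 True y - 2 * DE.Sy y * WV1 0 True y + sigma w p * Ef 0 True y) (at y)" for y
        unfolding WV_simps Ef_simps by (rule DERIV_cong, (rule derivative_intros field_derivs)+) (simp add: algebra_simps)
    qed
  next
    assume i: "i = 1"
    show ?thesis unfolding i
    proof (rule S.csol_real)
      show "(WV 1 b has_real_derivative WV1 1 b y) (at y)" for b y
        by (cases b; simp only: WV_simps; rule DERIV_cong, (rule derivative_intros field_derivs yA yA1)+, simp)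
      show "(WV1 1 True has_real_derivative DE.Qp y * WV 1 True y + DE.Syy y * WV 1 False y + 2 * DE.Sy y * WV1 1 False y - sigma w p * Ef 1 False y) (at y)" for y
        unfolding WV_simps Ef_simps by (rule DERIV_cong, (rule derivative_intros field_derivs)+) (simp add: r Anz field_simps)
      show "(WV1 1 False has_real_derivative DE.Qm y * WV 1 False y - DE.Syy y * WV 1 True y - 2 * DE.Sy y * WV1 1 True y + sigma w p * Ef 1 True y) (at y)" for y
        unfolding WV_simps Ef_simps by (rule DERIV_cong, (rule derivative_intros field_derivs yA yA1)+) (simp add: algebra_simps)
    qed
  qed
  thus ?thesis by (simp add: S.EE_def)
qed

text \<open>Index 0 is periodic because (gam, rho, sigma) is orthogonal to the gradients of T and
  eta. For index 1 the combination kills the jump of T, and its jump of eta is offset by the growth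
  of y A / 2.\<close>

lemma WV_jump: "i < 2 \<Longrightarrow> WV i b (y + T) = WV i b y"
proof (erule lt_2)
  have id: "gam w p * DE.T' + rho w p * DK.T' + sigma w p * DO.T' = 0" "gam w p * DE.eta' + rho w p * DK.eta' + sigma w p * DO.eta' = 0"
    "tau w p * DE.T' + nu w p * DK.T' = 0" "tau w p * DE.eta' + nu w p * DK.eta' + sigma w p * T / 2 = 0"
    unfolding coeffs by (simp_all add: field_simps)
  have e: "gam w p * (a + DE.eta' * x - DE.T' * z) + rho w p * (b + DK.eta' * x - DK.T' * z) + sigma w p * (c + DO.eta' * x - DO.T' * z)
      = gam w p * a + rho w p * b + sigma w p * c
        + (gam w p * DE.eta' + rho w p * DK.eta' + sigma w p * DO.eta') * x - (gam w p * DE.T' + rho w p * DK.T' + sigma w p * DO.T') * z" for a b c x z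
    by (simp add: algebra_simps)
  have f: "tau w p * (a + DE.eta' * x - DE.T' * z) + nu w p * (b + DK.eta' * x - DK.T' * z) + sigma w p * ((y + T) * x / 2)
      = tau w p * a + nu w p * b + sigma w p * (y * x / 2)
        + (tau w p * DE.eta' + nu w p * DK.eta' + sigma w p * T / 2) * x - (tau w p * DE.T' + nu w p * DK.T') * z" for a b x z
    by (simp add: field_simps)
  have f0: "tau w p * (a + DE.eta' * 0 - DE.T' * z) + nu w p * (b + DK.eta' * 0 - DK.T' * z)
      = tau w p * a + nu w p * b - (tau w p * DE.T' + nu w p * DK.T') * z" for a b z
    by (simp add: algebra_simps)
  have j: "WV 0 True (y + T) = WV 0 True y" "WV 0 False (y + T) = WV 0 False y"
    unfolding WV_simps DE.Phi_jump DK.Phi_jump DO.Phi_jump e id by simp_all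
  have k: "WV 1 True (y + T) = WV 1 True y" "WV 1 False (y + T) = WV 1 False y"
    unfolding WV_simps DE.Phi_jump DK.Phi_jump profile(7)[OF pW] f f0 id by simp_all
  show "WV i b (y + T) = WV i b y" if "i = 0" unfolding that using j by (cases b) simp_all
  show "WV i b (y + T) = WV i b y" if "i = 1" unfolding that using k by (cases b) simp_all
qed

lemma WV_cper: "i < 2 \<Longrightarrow> S.cper (\<lambda>b y. of_real (WV i b y))"
  using S.csol_cont[OF WV_csol] by (simp add: S.cper_def WV_jump)

text \<open>Multiplication by J turns \<open>u0\<close> and \<open>u2\<close> into the densities of
  the solvability conditions, up to the factor - sigma.\<close>

lemma F_pairing:
  assumes "i < 2" "\<And>b. continuous_on UNIV (g b)" "\<And>y. vec_nth (u y) 1 = g True y" "\<And>y. vec_nth (u y) 2 = g False y"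
    and v: "v = (if i = 0 then v1 w p else v3 w p)"
  shows "of_real (pairing w p v u) = - of_real (sigma w p) * S.F i (\<lambda>b y. of_real (g b y))"
proof -
  let ?d = "\<lambda>y. Ef i False y * g True y - Ef i True y * g False y"
  have cE: "continuous_on UNIV (Ef i b)" for b
    using assms(1) by (intro S.contE) simp
  have c: "continuous_on UNIV ?d" by (intro continuous_intros assms(2) cE)
  have "S.F i (\<lambda>b y. of_real (g b y)) = prim (\<lambda>y. complex_of_real (?d y)) T"
    by (simp add: S.F_def S.Pg_def S.dens_def[abs_def])
  also have "\<dots> = of_real (prim ?d T)" by (rule prim_of_real[OF c])
  finally have F: "S.F i (\<lambda>b y. of_real (g b y)) = of_real (prim ?d T)" .
  have "pairing w p v u = prim (\<lambda>y. (- sigma w p) * ?d y + 0 * ?d y) T"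
    unfolding pairing_prim assms(3,4) using assms(1)
    by (elim lt_2; unfold v; intro arg_cong[of _ _ "\<lambda>f. prim f T"])
       (simp_all add: comps fun_eq_iff algebra_simps)
  thus ?thesis unfolding F prim_linear[OF c c] by simp
qed

lemma F_mat2:
  "of_real (vec_nth (vec_nth (mat2 w p) 1) 1) = - of_real (sigma w p) * S.F 0 (\<lambda>b y. of_real (WV 0 b y))"
  "of_real (vec_nth (vec_nth (mat2 w p) 1) 2) = - of_real (sigma w p) * S.F 0 (\<lambda>b y. of_real (WV 1 b y))"
  "of_real (vec_nth (vec_nth (mat2 w p) 2) 1) = - of_real (sigma w p) * S.F 1 (\<lambda>b y. of_real (WV 0 b y))"
  "of_real (vec_nth (vec_nth (mat2 w p) 2) 2) = - of_real (sigma w p) * S.F 1 (\<lambda>b y. of_real (WV 1 b y))"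
proof -
  have c: "continuous_on UNIV (WV i b)" if "i < 2" for i b
  proof -
    have "continuous_on UNIV (\<lambda>y. Re (complex_of_real (WV i b y)))" by (intro continuous_intros S.csol_cont[OF WV_csol[OF that]])
    thus ?thesis by simp
  qed
  show "of_real (vec_nth (vec_nth (mat2 w p) 1) 1) = - of_real (sigma w p) * S.F 0 (\<lambda>b y. of_real (WV 0 b y))"
    unfolding mat2_eq by (rule F_pairing) (use c in \<open>simp_all add: comps\<close>)
  show "of_real (vec_nth (vec_nth (mat2 w p) 1) 2) = - of_real (sigma w p) * S.F 0 (\<lambda>b y. of_real (WV 1 b y))"
    unfolding mat2_eq by (rule F_pairing) (use c in \<open>simp_all add: comps\<close>)
  show "of_real (vec_nth (vec_nth (mat2 w p) 2) 1) = - of_real (sigma w p) * S.F 1 (\<lambda>b y. of_real (WV 0 b y))"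
    unfolding mat2_eq by (rule F_pairing) (use c in \<open>simp_all add: comps\<close>)
  show "of_real (vec_nth (vec_nth (mat2 w p) 2) 2) = - of_real (sigma w p) * S.F 1 (\<lambda>b y. of_real (WV 1 b y))"
    unfolding mat2_eq by (rule F_pairing) (use c in \<open>simp_all add: comps\<close>)
qed

lemma F_mat0:
  assumes ij: "i < 2" "j < 2"
  shows "of_real (vec_nth (vec_nth (mat0 w p) (if i = 0 then 1 else 2)) (if j = 0 then 1 else 2))
    = of_real (sigma w p) * S.F i (S.Jf (\<lambda>b y. of_real (sigma w p) * S.EE j b y))"
proof -
  define g where "g b y = (if b then - (sigma w p * Ef j False y) else sigma w p * Ef j True y)" for b y
  define v where "v = (if i = 0 then v1 w p else v3 w p)"
  define u where "u = L2op (if j = 0 then u0 w p else u2 w p)"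
  have "continuous_on UNIV (Ef j b)" for b
    using ij by (intro S.contE) simp
  hence c: "continuous_on UNIV (g b)" for b
    unfolding g_def by (cases b) (auto intro!: continuous_intros)
  have u: "vec_nth (u y) 1 = g True y" "vec_nth (u y) 2 = g False y" for y
    using ij(2) by (elim lt_2; simp add: u_def g_def comps)+
  have "of_real (pairing w p v u) = - of_real (sigma w p) * S.F i (\<lambda>b y. of_real (g b y))"
    by (rule F_pairing[OF ij(1) c u v_def])
  moreover have "(\<lambda>b y. complex_of_real (g b y)) = S.Jf (\<lambda>b y. of_real (sigma w p) * S.EE j b y)"
    by (simp add: fun_eq_iff S.Jf_def g_def S.EE_def)
  moreover have "vec_nth (vec_nth (mat0 w p) (if i = 0 then 1 else 2)) (if j = 0 then 1 else 2) = - pairing w p v u"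
    by (simp add: mat0_eq v_def u_def)
  ultimately show ?thesis by simp
qed

lemma normal_form_expand:
  "normal_form w p s \<mu> k = (\<mu>\<^sup>2 * of_real (vec_nth (vec_nth (mat2 w p) 1) 1) + of_real s * k\<^sup>2 * of_real (vec_nth (vec_nth (mat0 w p) 1) 1))
     * (\<mu>\<^sup>2 * of_real (vec_nth (vec_nth (mat2 w p) 2) 2) + of_real s * k\<^sup>2 * of_real (vec_nth (vec_nth (mat0 w p) 2) 2))
   - (\<mu>\<^sup>2 * of_real (vec_nth (vec_nth (mat2 w p) 1) 2) + of_real s * k\<^sup>2 * of_real (vec_nth (vec_nth (mat0 w p) 1) 2))
     * (\<mu>\<^sup>2 * of_real (vec_nth (vec_nth (mat2 w p) 2) 1) + of_real s * k\<^sup>2 * of_real (vec_nth (vec_nth (mat0 w p) 2) 1))"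
  by (simp add: normal_form_def det_2)

theorem eig_near_0:
  assumes "\<bar>s\<bar> \<le> 1"
  shows "\<exists>Rem r. double_series 5 Rem \<and> 0 < r \<and> (\<forall>\<mu> k. cmod \<mu> < r \<and> \<bar>k\<bar> < r \<longrightarrow>
     (S.eig (of_real s) \<mu> k \<longleftrightarrow> normal_form w p s \<mu> (of_real k) + Rem \<mu> k = 0))"
proof -
  have s1: "cmod (of_real s) \<le> 1" and sc: "complex_of_real (sigma w p) \<noteq> 0" using assms sg by simp_all
  let ?wv = "\<lambda>i b y. complex_of_real (WV i b y)"
  let ?Q = "S.Qx (of_real s) (of_real (sigma w p)) ?wv"
  obtain R r where R: "double_series 5 R" "0 < r"
    "\<And>\<mu> k. cmod \<mu> < r \<Longrightarrow> \<bar>k\<bar> < r \<Longrightarrow> S.eig (of_real s) \<mu> k \<longleftrightarrow> ?Q 0 0 \<mu> k * ?Q 1 1 \<mu> k - ?Q 0 1 \<mu> k * ?Q 1 0 \<mu> k + R \<mu> k = 0"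
    using S.eig_normal_form[OF sc s1, of ?wv "\<lambda>i b y. of_real (WV1 i b y)", OF WV_csol WV_cper] by blast
  \<comment> \<open>Each entry of the normal form is - sigma times the corresponding quadratic part,
    hence the factor sigma^2 in the determinant.\<close>
  have nf: "normal_form w p s \<mu> (of_real k) = (of_real (sigma w p))\<^sup>2 * (?Q 0 0 \<mu> k * ?Q 1 1 \<mu> k - ?Q 0 1 \<mu> k * ?Q 1 0 \<mu> k)" for \<mu> k
  proof -
    have Qd: "?Q i j \<mu> k = \<mu>^2 * S.F i (?wv j) - of_real s * of_real (k^2) * S.F i (S.Jf (\<lambda>b y. of_real (sigma w p) * S.EE j b y))" for i j
      by (rule S.Qx_def[OF sc s1 WV_csol WV_cper])
    show ?thesis
      unfolding normal_form_expand Qd F_mat2 F_mat0[of 0 0, simplified] F_mat0[of 0 1, simplified] F_mat0[of 1 0, simplified] F_mat0[of 1 1, simplified]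
      by (simp add: power2_eq_square algebra_simps)
  qed
  have "double_series 5 (\<lambda>\<mu> k. (of_real (sigma w p))\<^sup>2 * R \<mu> k)" by (rule double_series_cmult[OF R(1)])
  moreover have "S.eig (of_real s) \<mu> k \<longleftrightarrow> normal_form w p s \<mu> (of_real k) + (of_real (sigma w p))\<^sup>2 * R \<mu> k = 0"
    if "cmod \<mu> < r" "\<bar>k\<bar> < r" for \<mu> k
    unfolding R(3)[OF that] nf using sc by (simp flip: distrib_left)
  ultimately show ?thesis using R(2) by blast
qed

end

section \<open>Equivalence with the vector-valued eigenvalue problem\<close>

lemma vec_nth_has_vector_derivative:
  "(u has_vector_derivative u') (at y) \<Longrightarrow> ((\<lambda>y. vec_nth (u y) i) has_vector_derivative vec_nth u' i) (at (y::real))"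
  by (rule bounded_linear.has_vector_derivative[OF bounded_linear_vec_nth])

lemma vector_2_has_vector_derivative:
  fixes f g :: "real \<Rightarrow> complex"
  assumes "(f has_vector_derivative f') (at y)" "(g has_vector_derivative g') (at y)"
  shows "((\<lambda>y. vector [f y, g y] :: complex^2) has_vector_derivative vector [f', g']) (at y)"
proof -
  have l: "linear (\<lambda>z::complex. vector [z, 0] :: complex^2)" "linear (\<lambda>z::complex. vector [0, z] :: complex^2)"
    by (auto intro!: linearI simp: vec_eq_iff forall_2)
  have b: "bounded_linear (\<lambda>z::complex. vector [z, 0] :: complex^2)" "bounded_linear (\<lambda>z::complex. vector [0, z] :: complex^2)"
    using l by (simp_all add: linear_conv_bounded_linear)
  have s: "vector [a, c] = (vector [a, 0] + vector [0, c] :: complex^2)" for a c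
    by (simp add: vec_eq_iff forall_2)
  show ?thesis
    unfolding s[of "f y" "g y" for y] s[of f' g']
    by (intro has_vector_derivative_add bounded_linear.has_vector_derivative[OF b(1) assms(1)] bounded_linear.has_vector_derivative[OF b(2) assms(2)])
qed

lemma C1_differentiable_derivative:
  "u C1_differentiable_on UNIV \<Longrightarrow> (u has_vector_derivative vector_derivative u (at y)) (at y)"
  by (simp add: C1_differentiable_on_eq vector_derivative_works)

context nondegenerate_point
begin

lemma phs_derivs: "deriv (phs w p) = DE.Sy" "deriv DE.Sy = DE.Syy"
  using dphs DERIV_imp_deriv[OF DE.Sy_deriv] by (simp_all add: fun_eq_iff DE.Sy_def)

lemma coeff_cont: "continuous_on S DE.Sy" "continuous_on S DE.Syy" "continuous_on S DE.Qm" "continuous_on S DE.Qp"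
proof -
  have l: "0 < lo w p" by (rule ends(1)[OF pW])
  have n: "continuous_on S (\<lambda>y. nlf w ((A y)\<^sup>2))" "continuous_on S (\<lambda>y. deriv (nlf w) ((A y)\<^sup>2))"
    by (rule continuous_on_compose2[OF nlf_cont(1)[OF l, of "hi w p"] amp_cont[OF pW]], use profile(4)[OF pW] in auto)
       (rule continuous_on_compose2[OF nlf_cont(2)[OF l, of "hi w p"] amp_cont[OF pW]], use profile(4)[OF pW] in auto)
  show s: "continuous_on S DE.Sy" "continuous_on S DE.Syy"
    unfolding DE.Sy_def[abs_def] DE.Syy_def[abs_def] by (intro continuous_intros DE.cDa; simp add: Anz)+
  show q: "continuous_on S DE.Qm" unfolding DE.Qm_def[abs_def] by (intro continuous_intros s n)
  show "continuous_on S DE.Qp" unfolding DE.Qp_def[abs_def] by (intro continuous_intros q n DE.cDa)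
qed

lemma Lk_components:
  assumes "\<And>y. ((\<lambda>y. vec_nth (u y) 1) has_vector_derivative q1 True y) (at y)" "\<And>y. ((\<lambda>y. vec_nth (u y) 2) has_vector_derivative q1 False y) (at y)"
    "\<And>b y. (q1 b has_vector_derivative q2 b y) (at y)"
  shows "vec_nth (Lk w p s k u y) 1 = of_real (DE.Syy y) * vec_nth (u y) 1 + 2 * of_real (DE.Sy y) * q1 True y
      - of_real (DE.Qm y) * vec_nth (u y) 2 + q2 False y - of_real (s * k\<^sup>2) * vec_nth (u y) 2"
    "vec_nth (Lk w p s k u y) 2 = of_real (DE.Qp y) * vec_nth (u y) 1 - q2 True y
      + of_real (DE.Syy y) * vec_nth (u y) 2 + 2 * of_real (DE.Sy y) * q1 False y + of_real (s * k\<^sup>2) * vec_nth (u y) 1"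
proof -
  have vd: "vector_derivative (\<lambda>y. vec_nth (u y) 1) (at x) = q1 True x" "vector_derivative (\<lambda>y. vec_nth (u y) 2) (at x) = q1 False x"
    "vector_derivative (q1 b) (at x) = q2 b x" for x b
    by (intro vector_derivative_at assms)+
  have e: "vector_derivative (\<lambda>x. q1 b x) (at y) = q2 b y" for b by (rule vd(3))
  show "vec_nth (Lk w p s k u y) 1 = of_real (DE.Syy y) * vec_nth (u y) 1 + 2 * of_real (DE.Sy y) * q1 True y
      - of_real (DE.Qm y) * vec_nth (u y) 2 + q2 False y - of_real (s * k\<^sup>2) * vec_nth (u y) 2"
    by (simp add: Lk_def Lop_def Kop_def Lminus_def Let_def phs_derivs vd e Jmat_mult vector_smult_component DE.Qm_def)
  show "vec_nth (Lk w p s k u y) 2 = of_real (DE.Qp y) * vec_nth (u y) 1 - q2 True y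
      + of_real (DE.Syy y) * vec_nth (u y) 2 + 2 * of_real (DE.Sy y) * q1 False y + of_real (s * k\<^sup>2) * vec_nth (u y) 1"
    by (simp add: Lk_def Lop_def Kop_def Lplus_def Lminus_def Let_def phs_derivs vd e Jmat_mult vector_smult_component DE.Qm_def DE.Qp_def algebra_simps)
qed

lemma eigenvalue_imp_eig:
  assumes "is_eigenvalue w p s k \<mu>" shows "S.eig (of_real s) \<mu> k"
proof -
  obtain u where u: "u C1_differentiable_on UNIV" "(\<lambda>y. vector_derivative u (at y)) C1_differentiable_on UNIV"
    "\<forall>y. u (y + T) = u y" "\<exists>y. u y \<noteq> 0" "\<forall>y. Lk w p s k u y = \<mu> *s u y"
    using assms unfolding is_eigenvalue_def by - (erule exE, (erule conjE)+, rule that; assumption)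
  let ?i = "\<lambda>b::bool. if b then 1 else 2 :: 2"
  define U where "U b y = vec_nth (u y) (?i b)" for b y
  define U1 where "U1 b y = vec_nth (vector_derivative u (at y)) (?i b)" for b y
  define U2 where "U2 b y = vec_nth (vector_derivative (\<lambda>y. vector_derivative u (at y)) (at y)) (?i b)" for b y
  have d: "(U b has_vector_derivative U1 b y) (at y)" "(U1 b has_vector_derivative U2 b y) (at y)" for b y
    unfolding U_def U1_def U2_def by (intro vec_nth_has_vector_derivative C1_differentiable_derivative u(1,2))+
  have d1: "((\<lambda>y. vec_nth (u y) 1) has_vector_derivative U1 True y) (at y)" "((\<lambda>y. vec_nth (u y) 2) has_vector_derivative U1 False y) (at y)" for y
    using d(1)[of True y] d(1)[of False y] by (simp_all add: U_def[abs_def])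
  have U: "vec_nth (u y) 1 = U True y" "vec_nth (u y) 2 = U False y" for y by (simp_all add: U_def)
  have eq: "of_real (DE.Syy y) * U True y + 2 * of_real (DE.Sy y) * U1 True y
      - of_real (DE.Qm y) * U False y + U2 False y - of_real (s * k\<^sup>2) * U False y = \<mu> * U True y"
    "of_real (DE.Qp y) * U True y - U2 True y
      + of_real (DE.Syy y) * U False y + 2 * of_real (DE.Sy y) * U1 False y + of_real (s * k\<^sup>2) * U True y = \<mu> * U False y" for y
    using Lk_components[of u U1 U2 s k y, OF d1 d(2)] u(5) by (simp_all add: U vector_smult_component)
  have nz: "\<exists>b y. U b y \<noteq> 0"
  proof (rule ccontr)
    assume "\<nexists>b y. U b y \<noteq> 0"
    hence "u y = 0" for y using U[of y] by (simp add: vec_eq_iff forall_2)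
    thus False using u(4) by simp
  qed
  have "continuous_on UNIV (U b)" for b
    by (intro continuous_at_imp_continuous_on ballI has_vector_derivative_continuous[OF d(1)])
  hence cp: "S.cper U" using u(3) by (simp add: S.cper_def U_def)
  have "S.csol U U1 (S.Th (of_real s) \<mu> k U)"
    unfolding S.csol_def
  proof (intro conjI allI)
    fix y
    have "U2 True y = of_real (DE.Qp y) * U True y + of_real (DE.Syy y) * U False y + 2 * of_real (DE.Sy y) * U1 False y
      - S.Th (of_real s) \<mu> k U False y"
      using eq(2)[of y] by (simp add: S.Th_def S.Jf_def algebra_simps)
    thus "(U1 True has_vector_derivative of_real (DE.Qp y) * U True y + of_real (DE.Syy y) * U False y + 2 * of_real (DE.Sy y) * U1 False y
      - S.Th (of_real s) \<mu> k U False y) (at y)" using d(2)[of True y] by simp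
    have "U2 False y = of_real (DE.Qm y) * U False y - of_real (DE.Syy y) * U True y - 2 * of_real (DE.Sy y) * U1 True y
      + S.Th (of_real s) \<mu> k U True y"
      using eq(1)[of y] by (simp add: S.Th_def S.Jf_def algebra_simps)
    thus "(U1 False has_vector_derivative of_real (DE.Qm y) * U False y - of_real (DE.Syy y) * U True y - 2 * of_real (DE.Sy y) * U1 True y
      + S.Th (of_real s) \<mu> k U True y) (at y)" using d(2)[of False y] by simp
  qed (rule d)
  thus ?thesis unfolding S.eig_def using nz cp by blast
qed

lemma eig_imp_eigenvalue:
  assumes "S.eig (of_real s) \<mu> k" shows "is_eigenvalue w p s k \<mu>"
proof -
  obtain U U1 where nz: "\<exists>b y. U b y \<noteq> 0" and cp: "S.cper U" and sol: "S.csol U U1 (S.Th (of_real s) \<mu> k U)"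
    using assms unfolding S.eig_def by - (erule exE, erule exE, (erule conjE)+, rule that; assumption)
  \<comment> \<open>The second derivative is read off from the equation; its continuity gives the C1
    property of the first derivative.\<close>
  define U2 where "U2 b y = (if b
    then of_real (DE.Qp y) * U True y + of_real (DE.Syy y) * U False y + 2 * of_real (DE.Sy y) * U1 False y - S.Th (of_real s) \<mu> k U False y
    else of_real (DE.Qm y) * U False y - of_real (DE.Syy y) * U True y - 2 * of_real (DE.Sy y) * U1 True y + S.Th (of_real s) \<mu> k U True y)" for b y
  have d: "(U b has_vector_derivative U1 b y) (at y)" "(U1 b has_vector_derivative U2 b y) (at y)" for b y
    using sol by (cases b; simp add: S.csol_def U2_def)+
  define u :: "real \<Rightarrow> complex^2" where "u y = vector [U True y, U False y]" for y
  define u' :: "real \<Rightarrow> complex^2" where "u' y = vector [U1 True y, U1 False y]" for y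
  define u'' :: "real \<Rightarrow> complex^2" where "u'' y = vector [U2 True y, U2 False y]" for y
  have D: "(u has_vector_derivative u' y) (at y)" "(u' has_vector_derivative u'' y) (at y)" for y
    unfolding u_def u'_def u''_def by (intro vector_2_has_vector_derivative d)+
  have c: "continuous_on UNIV (U b)" "continuous_on UNIV (U1 b)" for b
    by (intro continuous_at_imp_continuous_on ballI has_vector_derivative_continuous[OF d(1)] has_vector_derivative_continuous[OF d(2)])+
  have U2: "continuous_on UNIV (U2 b)" for b
    unfolding U2_def S.Th_def S.Jf_def by (cases b; simp; intro continuous_intros c coeff_cont)
  have "u'' = (\<lambda>y. \<chi> i. (if i = 1 then U2 True else U2 False) y)"
    by (simp add: u''_def fun_eq_iff vec_eq_iff forall_2)
  moreover have "continuous_on UNIV (if i = 1 then U2 True else U2 False)" for i :: 2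
    using U2 by simp
  ultimately have c2: "continuous_on UNIV u''"
    by (simp only:) (intro continuous_on_vec_lambda)
  have c1: "continuous_on UNIV u'"
    by (intro continuous_at_imp_continuous_on ballI has_vector_derivative_continuous[OF D(2)])
  have vd: "vector_derivative u (at y) = u' y" for y by (rule vector_derivative_at[OF D(1)])
  have C1: "u C1_differentiable_on UNIV" "u' C1_differentiable_on UNIV"
    unfolding C1_differentiable_on_def using D c1 c2 by blast+
  have comp: "vec_nth (u y) 1 = U True y" "vec_nth (u y) 2 = U False y" for y by (simp_all add: u_def)
  have "Lk w p s k u y = \<mu> *s u y" for y
  proof -
    have d1: "((\<lambda>y. vec_nth (u y) 1) has_vector_derivative U1 True y) (at y)" "((\<lambda>y. vec_nth (u y) 2) has_vector_derivative U1 False y) (at y)" for y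
      unfolding comp by (rule d)+
    show ?thesis
      using Lk_components[of u U1 U2 s k y, OF d1 d(2)]
      by (simp add: vec_eq_iff forall_2 comp vector_smult_component U2_def S.Th_def S.Jf_def algebra_simps)
  qed
  moreover have "\<exists>y. u y \<noteq> 0"
  proof -
    obtain b y where "U b y \<noteq> 0" using nz by blast
    hence "u y \<noteq> 0" using comp[of y] by (cases b) auto
    thus ?thesis by blast
  qed
  moreover have "\<forall>y. u (y + T) = u y" using cp by (simp add: u_def S.cper_def)
  ultimately show ?thesis unfolding is_eigenvalue_def using C1 by (intro exI[of _ u]) (simp add: vd[abs_def])
qed

lemma is_eigenvalue_iff: "is_eigenvalue w p s k \<mu> \<longleftrightarrow> S.eig (of_real s) \<mu> k"
  using eigenvalue_imp_eig eig_imp_eigenvalue by blast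

end

section \<open>Roots of the normal form and the four bands\<close>

lemma double_series_expansion:
  assumes "double_series n f"
  obtains c r where "0 < r" "\<And>\<mu> k. cmod \<mu> < r \<Longrightarrow> \<bar>k\<bar> < r \<Longrightarrow>
    (\<lambda>(j, l). c j l * \<mu> ^ j * of_real k ^ l) summable_on {(j, l). n \<le> j + l} \<and>
    (\<Sum>\<^sub>\<infinity>(j, l)\<in>{(j, l). n \<le> j + l}. c j l * \<mu> ^ j * of_real k ^ l) = f \<mu> k"
proof -
  obtain c r where c: "0 < r" "\<forall>j l. j + l < n \<longrightarrow> c j l = 0"
    "\<forall>\<mu> k. cmod \<mu> < r \<and> \<bar>k\<bar> < r \<longrightarrow> ((\<lambda>(j,l). c j l * \<mu>^j * of_real k^l) has_sum f \<mu> k) UNIV"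
    using assms unfolding double_series_def by blast
  show ?thesis
  proof (rule that[OF c(1)])
    fix \<mu> k assume "cmod \<mu> < r" "\<bar>k\<bar> < r"
    hence "((\<lambda>(j,l). c j l * \<mu>^j * of_real k^l) has_sum f \<mu> k) UNIV" using c(3) by blast
    moreover have "((\<lambda>(j,l). c j l * \<mu>^j * of_real k^l) has_sum f \<mu> k) UNIV
        \<longleftrightarrow> ((\<lambda>(j,l). c j l * \<mu>^j * of_real k^l) has_sum f \<mu> k) {(j, l). n \<le> j + l}"
      by (rule has_sum_cong_neutral) (use c(2) in auto)
    ultimately have "((\<lambda>(j,l). c j l * \<mu>^j * of_real k^l) has_sum f \<mu> k) {(j, l). n \<le> j + l}" by blast
    thus "(\<lambda>(j, l). c j l * \<mu> ^ j * of_real k ^ l) summable_on {(j, l). n \<le> j + l} \<and>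
      (\<Sum>\<^sub>\<infinity>(j, l)\<in>{(j, l). n \<le> j + l}. c j l * \<mu> ^ j * of_real k ^ l) = f \<mu> k"
      by (auto intro: has_sum_imp_summable infsumI)
  qed
qed

text \<open>The quadratic formula gives the squares of the roots, and \<open>csqrt\<close> the roots
  themselves. Coinciding roots are allowed.\<close>

lemma biquadratic_roots:
  fixes m0 m1 m2 :: complex
  assumes "m2 \<noteq> 0"
  obtains x y where "m1 = - (m2 * (x\<^sup>2 + y\<^sup>2))" "m0 = m2 * (x\<^sup>2 * y\<^sup>2)"
proof -
  define d where "d = csqrt (m1\<^sup>2 - 4 * m2 * m0)"
  have d: "d * d = m1 * m1 - 4 * m2 * m0" using power2_csqrt[of "m1\<^sup>2 - 4 * m2 * m0"] by (simp add: d_def power2_eq_square)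
  define s where "s = (- m1 + d) / (2 * m2)"
  define t where "t = (- m1 - d) / (2 * m2)"
  have "m1 = - (m2 * (s + t))" using assms by (simp add: s_def t_def field_simps)
  moreover have "m0 = m2 * (s * t)"
  proof -
    have "4 * m2 * (m2 * (s * t)) = (2 * m2 * s) * (2 * m2 * t)" by simp
    also have "\<dots> = (- m1 + d) * (- m1 - d)" using assms by (simp add: s_def t_def)
    also have "\<dots> = m1 * m1 - d * d" by (simp add: algebra_simps)
    also have "\<dots> = 4 * m2 * m0" unfolding d by simp
    finally show ?thesis using assms by simp
  qed
  ultimately show ?thesis by (intro that[of "csqrt s" "csqrt t"]) (simp_all add: power2_csqrt)
qed

lemma prod_lessThan_4: "(\<Prod>j<4::nat. f j) = f 0 * f 1 * f 2 * (f 3 :: complex)"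
  by (simp add: eval_nat_numeral lessThan_Suc mult_ac)

context nondegenerate_point
begin

lemma normal_form_quartic:
  obtains m1 where "\<And>s \<mu> k. normal_form w p s \<mu> k
    = of_real (det (mat2 w p)) * \<mu>^4 + of_real s * m1 * \<mu>\<^sup>2 * k\<^sup>2 + (of_real s)\<^sup>2 * of_real (det (mat0 w p)) * k^4"
proof -
  let ?m = "\<lambda>i j. complex_of_real (vec_nth (vec_nth (mat2 w p) i) j)"
  let ?n = "\<lambda>i j. complex_of_real (vec_nth (vec_nth (mat0 w p) i) j)"
  show ?thesis
    by (rule that[of "?m 1 1 * ?n 2 2 + ?n 1 1 * ?m 2 2 - ?m 1 2 * ?n 2 1 - ?n 1 2 * ?m 2 1"])
       (simp add: normal_form_expand det_2 algebra_simps power2_eq_square power4_eq_xxxx)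
qed

text \<open>The normal form depends on the sign s and on k only through s k^2. Passing to s = - 1
  therefore replaces k by i k, and with it the leading-order eigenvalues k c_j by i k c_j. The
  labelling is applied to both cases with one common radius.\<close>

theorem bands:
  assumes "det (mat2 w p) \<noteq> 0"
  shows "\<exists>(\<alpha> :: nat \<Rightarrow> real \<Rightarrow> complex) (\<beta> :: nat \<Rightarrow> real \<Rightarrow> complex) (c :: nat \<Rightarrow> complex). \<exists>r>0. \<exists>\<delta>>0.
        (\<forall>k. \<bar>k\<bar> < \<delta> \<longrightarrow>
           {\<mu>. cmod \<mu> < r \<and> is_eigenvalue w p 1 k \<mu>} = (\<lambda>j. \<alpha> j k) ` {..<4} \<and>
           {\<mu>. cmod \<mu> < r \<and> is_eigenvalue w p (- 1) k \<mu>} = (\<lambda>j. \<beta> j k) ` {..<4}) \<and>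
        (\<forall>z. normal_form w p 1 z 1 = of_real (det (mat2 w p)) * (\<Prod>j<4. z - c j)) \<and>
        (\<forall>j<4. c j \<noteq> 0 \<and>
           ((\<lambda>k. \<alpha> j k / of_real k) \<longlongrightarrow> c j) (at 0) \<and>
           ((\<lambda>k. \<beta> j k / of_real k) \<longlongrightarrow> \<i> * c j) (at 0))"
proof -
  let ?m2 = "complex_of_real (det (mat2 w p))" let ?m0 = "complex_of_real (det (mat0 w p))"
  have m2: "?m2 \<noteq> 0" and m0: "?m0 \<noteq> 0" using assms det_mat0[OF sg] by simp_all
  obtain m1 where m1: "\<And>s \<mu> k. normal_form w p s \<mu> k = ?m2 * \<mu>^4 + of_real s * m1 * \<mu>\<^sup>2 * k\<^sup>2 + (of_real s)\<^sup>2 * ?m0 * k^4"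
    using normal_form_quartic by blast
  obtain x y where xy: "m1 = - (?m2 * (x\<^sup>2 + y\<^sup>2))" "?m0 = ?m2 * (x\<^sup>2 * y\<^sup>2)"
    using biquadratic_roots[OF m2] by blast
  \<comment> \<open>The quartic is even in its variable, so its roots come in pairs of opposite
    sign.\<close>
  define c :: "nat \<Rightarrow> complex" where "c j = [x, - x, y, - y] ! j" for j
  have c: "c 0 = x" "c 1 = - x" "c 2 = y" "c 3 = - y" by (simp_all add: c_def nth_Cons')
  \<comment> \<open>\<open>e\<close> is a square root of the sign: 1 in the elliptic and i in the
    hyperbolic case.\<close>
  have nf: "normal_form w p s \<mu> K = ?m2 * (\<Prod>j<4. \<mu> - K * (e * c j))" if e: "e\<^sup>2 = of_real s" for s e \<mu> K
  proof -
    have sq: "(\<mu> - K * (e * z)) * (\<mu> - K * (e * - z)) = \<mu>\<^sup>2 - of_real s * K\<^sup>2 * z\<^sup>2" for z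
      unfolding e[symmetric] by (simp add: power2_eq_square algebra_simps)
    have "(\<Prod>j<4. \<mu> - K * (e * c j)) = (\<mu>\<^sup>2 - of_real s * K\<^sup>2 * x\<^sup>2) * (\<mu>\<^sup>2 - of_real s * K\<^sup>2 * y\<^sup>2)"
      unfolding prod_lessThan_4 c sq[symmetric] by (simp only: mult.assoc)
    moreover have "?m2 * ((a - t * k * u) * (a - t * k * v)) = ?m2 * a\<^sup>2 + t * (- (?m2 * (u + v))) * a * k + t\<^sup>2 * (?m2 * (u * v)) * k\<^sup>2" for a t k u v
      by (simp add: power2_eq_square algebra_simps)
    ultimately show ?thesis unfolding m1 xy by (simp flip: power_mult)
  qed
  have nf1: "normal_form w p 1 \<mu> K = ?m2 * (\<Prod>j<4. \<mu> - K * c j)" for \<mu> K using nf[of 1 1 \<mu> K] by simp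
  have nf2: "normal_form w p (- 1) \<mu> K = ?m2 * (\<Prod>j<4. \<mu> - K * (\<i> * c j))" for \<mu> K using nf[of \<i> "- 1" \<mu> K] by simp
  \<comment> \<open>The product of the squared roots is the quotient of the determinants of
    \<open>mat0\<close> and \<open>mat2\<close>; definiteness of the former keeps the roots away
    from 0.\<close>
  have x0: "x \<noteq> 0" "y \<noteq> 0" using m0 xy by auto
  have c0: "c j \<noteq> 0" if "j < 4" for j
    using that
  proof (rule nat_lt_4)
    show ?thesis if "j = 0" unfolding that c using x0 by simp
    show ?thesis if "j = 1" unfolding that c using x0 by simp
    show ?thesis if "j = 2" unfolding that c using x0 by simp
    show ?thesis if "j = 3" unfolding that c using x0 by simp
  qed
  obtain R1 r1 where R1: "double_series 5 R1" "0 < r1"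
    "\<And>\<mu> k. cmod \<mu> < r1 \<Longrightarrow> \<bar>k\<bar> < r1 \<Longrightarrow> is_eigenvalue w p 1 k \<mu> \<longleftrightarrow> ?m2 * (\<Prod>j<4. \<mu> - of_real k * c j) + R1 \<mu> k = 0"
    using eig_near_0[of 1] unfolding is_eigenvalue_iff nf1 by auto
  obtain R2 r2 where R2: "double_series 5 R2" "0 < r2"
    "\<And>\<mu> k. cmod \<mu> < r2 \<Longrightarrow> \<bar>k\<bar> < r2 \<Longrightarrow> is_eigenvalue w p (- 1) k \<mu> \<longleftrightarrow> ?m2 * (\<Prod>j<4. \<mu> - of_real k * (\<i> * c j)) + R2 \<mu> k = 0"
    using eig_near_0[of "- 1"] unfolding is_eigenvalue_iff nf2 by auto
  obtain q1 where q1: "0 < q1" "\<And>r. 0 < r \<Longrightarrow> r \<le> q1 \<Longrightarrow> \<exists>\<delta>>0. \<exists>\<alpha> :: nat \<Rightarrow> real \<Rightarrow> complex.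
     (\<forall>k. \<bar>k\<bar> < \<delta> \<longrightarrow> {\<mu>. cmod \<mu> < r \<and> ?m2 * (\<Prod>j<4. \<mu> - of_real k * c j) + R1 \<mu> k = 0} = (\<lambda>j. \<alpha> j k) ` {..<4}) \<and>
     (\<forall>j<4. ((\<lambda>k. \<alpha> j k / of_real k) \<longlongrightarrow> c j) (at 0))"
    using root_labelling[OF R1(1) m2, of c] by blast
  obtain q2 where q2: "0 < q2" "\<And>r. 0 < r \<Longrightarrow> r \<le> q2 \<Longrightarrow> \<exists>\<delta>>0. \<exists>\<alpha> :: nat \<Rightarrow> real \<Rightarrow> complex.
     (\<forall>k. \<bar>k\<bar> < \<delta> \<longrightarrow> {\<mu>. cmod \<mu> < r \<and> ?m2 * (\<Prod>j<4. \<mu> - of_real k * (\<i> * c j)) + R2 \<mu> k = 0} = (\<lambda>j. \<alpha> j k) ` {..<4}) \<and>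
     (\<forall>j<4. ((\<lambda>k. \<alpha> j k / of_real k) \<longlongrightarrow> \<i> * c j) (at 0))"
    using root_labelling[OF R2(1) m2, of "\<lambda>j. \<i> * c j"] by blast
  define r where "r = Min {r1, r2, q1, q2}"
  have r: "0 < r" "r \<le> r1" "r \<le> r2" "r \<le> q1" "r \<le> q2" using R1(2) R2(2) q1(1) q2(1) by (simp_all add: r_def)
  obtain \<delta>1 \<alpha> where \<alpha>: "0 < \<delta>1"
    "\<And>k. \<bar>k\<bar> < \<delta>1 \<Longrightarrow> {\<mu>. cmod \<mu> < r \<and> ?m2 * (\<Prod>j<4. \<mu> - of_real k * c j) + R1 \<mu> k = 0} = (\<lambda>j. \<alpha> j k) ` {..<4::nat}"
    "\<And>j. j < 4 \<Longrightarrow> ((\<lambda>k. \<alpha> j k / of_real k) \<longlongrightarrow> c j) (at 0)"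
    using q1(2)[OF r(1,4)] by auto
  obtain \<delta>2 \<beta> where \<beta>: "0 < \<delta>2"
    "\<And>k. \<bar>k\<bar> < \<delta>2 \<Longrightarrow> {\<mu>. cmod \<mu> < r \<and> ?m2 * (\<Prod>j<4. \<mu> - of_real k * (\<i> * c j)) + R2 \<mu> k = 0} = (\<lambda>j. \<beta> j k) ` {..<4::nat}"
    "\<And>j. j < 4 \<Longrightarrow> ((\<lambda>k. \<beta> j k / of_real k) \<longlongrightarrow> \<i> * c j) (at 0)"
    using q2(2)[OF r(1,5)] by auto
  define \<delta> where "\<delta> = Min {\<delta>1, \<delta>2, r}"
  have \<delta>: "0 < \<delta>" "\<delta> \<le> \<delta>1" "\<delta> \<le> \<delta>2" "\<delta> \<le> r" using \<alpha>(1) \<beta>(1) r(1) by (simp_all add: \<delta>_def)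
  have eqs: "{\<mu>. cmod \<mu> < r \<and> is_eigenvalue w p 1 k \<mu>} = (\<lambda>j. \<alpha> j k) ` {..<4}"
    "{\<mu>. cmod \<mu> < r \<and> is_eigenvalue w p (- 1) k \<mu>} = (\<lambda>j. \<beta> j k) ` {..<4}" if k: "\<bar>k\<bar> < \<delta>" for k
  proof -
    have "{\<mu>. cmod \<mu> < r \<and> is_eigenvalue w p 1 k \<mu>} = {\<mu>. cmod \<mu> < r \<and> ?m2 * (\<Prod>j<4. \<mu> - of_real k * c j) + R1 \<mu> k = 0}"
      using R1(3)[of _ k] k r \<delta> by (intro Collect_cong conj_cong refl) auto
    thus "{\<mu>. cmod \<mu> < r \<and> is_eigenvalue w p 1 k \<mu>} = (\<lambda>j. \<alpha> j k) ` {..<4}" using \<alpha>(2)[of k] k \<delta> by simp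
    have "{\<mu>. cmod \<mu> < r \<and> is_eigenvalue w p (- 1) k \<mu>} = {\<mu>. cmod \<mu> < r \<and> ?m2 * (\<Prod>j<4. \<mu> - of_real k * (\<i> * c j)) + R2 \<mu> k = 0}"
      using R2(3)[of _ k] k r \<delta> by (intro Collect_cong conj_cong refl) auto
    thus "{\<mu>. cmod \<mu> < r \<and> is_eigenvalue w p (- 1) k \<mu>} = (\<lambda>j. \<beta> j k) ` {..<4}" using \<beta>(2)[of k] k \<delta> by simp
  qed
  show ?thesis
    apply (rule exI[of _ \<alpha>], rule exI[of _ \<beta>], rule exI[of _ c], rule exI[of _ r], rule conjI[OF r(1)], rule exI[of _ \<delta>], rule conjI[OF \<delta>(1)])
    using eqs c0 \<alpha>(3) \<beta>(3) nf1[where K=1] by simp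
qed

theorem expansion:
  assumes "\<bar>s\<bar> \<le> 1"
  shows "\<exists>c :: nat \<Rightarrow> nat \<Rightarrow> complex. \<exists>r>0. \<forall>\<mu> k. cmod \<mu> < r \<and> \<bar>k\<bar> < r \<longrightarrow>
        (\<lambda>(j, l). c j l * \<mu> ^ j * of_real k ^ l) summable_on {(j, l). 5 \<le> j + l} \<and>
        (is_eigenvalue w p s k \<mu> \<longleftrightarrow>
           normal_form w p s \<mu> (of_real k)
           + (\<Sum>\<^sub>\<infinity>(j, l)\<in>{(j, l). 5 \<le> j + l}. c j l * \<mu> ^ j * of_real k ^ l) = 0)"
proof -
  obtain R r1 where R: "double_series 5 R" "0 < r1"
    "\<And>\<mu> k. cmod \<mu> < r1 \<Longrightarrow> \<bar>k\<bar> < r1 \<Longrightarrow> is_eigenvalue w p s k \<mu> \<longleftrightarrow> normal_form w p s \<mu> (of_real k) + R \<mu> k = 0"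
    using eig_near_0[OF assms] unfolding is_eigenvalue_iff by auto
  obtain c r2 where c: "0 < r2" "\<And>\<mu> k. cmod \<mu> < r2 \<Longrightarrow> \<bar>k\<bar> < r2 \<Longrightarrow>
    (\<lambda>(j, l). c j l * \<mu> ^ j * of_real k ^ l) summable_on {(j, l). 5 \<le> j + l} \<and>
    (\<Sum>\<^sub>\<infinity>(j, l)\<in>{(j, l). 5 \<le> j + l}. c j l * \<mu> ^ j * of_real k ^ l) = R \<mu> k"
    by (rule double_series_expansion[OF R(1)], rule that; assumption)
  show ?thesis
    by (rule exI[of _ c], rule exI[of _ "min r1 r2"]) (use R(2,3) c in simp)
qed

end

theorem corollary2:
  fixes w :: wave and W :: "params set" and p :: params and E \<kappa> \<omega> \<zeta> :: real
  assumes params: "p = (E, \<kappa>, \<omega>, \<zeta>)"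
    and family: "wave_family w W" "p \<in> W"
    and nonconstant: "\<not> amp w p constant_on UNIV"
    and generic: "generic w p"
  shows
    "(\<forall>s\<in>{1, - 1}. \<exists>c :: nat \<Rightarrow> nat \<Rightarrow> complex. \<exists>r>0. \<forall>\<mu> k. cmod \<mu> < r \<and> \<bar>k\<bar> < r \<longrightarrow>
        (\<lambda>(j, l). c j l * \<mu> ^ j * of_real k ^ l) summable_on {(j, l). 5 \<le> j + l} \<and>
        (is_eigenvalue w p s k \<mu> \<longleftrightarrow>
           normal_form w p s \<mu> (of_real k)
           + (\<Sum>\<^sub>\<infinity>(j, l)\<in>{(j, l). 5 \<le> j + l}. c j l * \<mu> ^ j * of_real k ^ l) = 0)) \<and>
     (let T = period w p; M = Mmom w p; U = Umom w p;
          \<sigma> = sigma w p; \<gamma> = gam w p; \<rho> = rho w p; \<tau> = tau w p; \<nu> = nu w p;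
          M\<^sub>E = dE (Mmom w) p; M\<^sub>\<kappa> = dkappa (Mmom w) p; M\<^sub>\<omega> = domega (Mmom w) p
      in
        pairing w p (v1 w p) (u1 w p) = - (\<sigma> / 2) * (\<gamma> * M\<^sub>E + \<rho> * M\<^sub>\<kappa> + \<sigma> * M\<^sub>\<omega>) \<and>
        pairing w p (v1 w p) (u3 w p) = pairing w p (v3 w p) (u1 w p) \<and>
        pairing w p (v1 w p) (u3 w p) = - (\<sigma> * \<rho> * T / 2) \<and>
        pairing w p (v1 w p) (u3 w p) = - (\<sigma> / 2) * (\<tau> * M\<^sub>E + \<nu> * M\<^sub>\<kappa>) \<and>
        pairing w p (v3 w p) (u3 w p) = - (\<sigma> / 2) * (\<nu> * T + \<sigma> * M / 2) \<and>
        - pairing w p (v1 w p) (L2op (u0 w p)) = - (\<sigma>\<^sup>2 * M) \<and>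
        - pairing w p (v1 w p) (L2op (u2 w p)) = - (\<sigma>\<^sup>2 * \<kappa> * T) \<and>
        - pairing w p (v3 w p) (L2op (u2 w p)) = - (\<sigma>\<^sup>2 * (2 * E * T - \<omega> * M - \<zeta> * U))) \<and>
     \<comment> \<open>elliptic (\<open>\<alpha>\<close>) and hyperbolic (\<open>\<beta>\<close>) eigenvalues to leading order\<close>
     (\<exists>(\<alpha> :: nat \<Rightarrow> real \<Rightarrow> complex) (\<beta> :: nat \<Rightarrow> real \<Rightarrow> complex) (c :: nat \<Rightarrow> complex). \<exists>r>0. \<exists>\<delta>>0.
        (\<forall>k. \<bar>k\<bar> < \<delta> \<longrightarrow>
           {\<mu>. cmod \<mu> < r \<and> is_eigenvalue w p 1 k \<mu>} = (\<lambda>j. \<alpha> j k) ` {..<4} \<and>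
           {\<mu>. cmod \<mu> < r \<and> is_eigenvalue w p (- 1) k \<mu>} = (\<lambda>j. \<beta> j k) ` {..<4}) \<and>
        (\<forall>z. normal_form w p 1 z 1 = of_real (det (mat2 w p)) * (\<Prod>j<4. z - c j)) \<and>
        (\<forall>j<4. c j \<noteq> 0 \<and>
           ((\<lambda>k. \<alpha> j k / of_real k) \<longlongrightarrow> c j) (at 0) \<and>
           ((\<lambda>k. \<beta> j k / of_real k) \<longlongrightarrow> \<i> * c j) (at 0)))"
proof -
  interpret P: wave_point w W E \<kappa> \<omega> \<zeta>
    by unfold_locales (use family params in simp_all)
  interpret SP: nondegenerate_point w W E \<kappa> \<omega> \<zeta>
    by unfold_locales (use P.det_mat2(2) generic params in simp)
  have det: "det (mat2 w (E, \<kappa>, \<omega>, \<zeta>)) \<noteq> 0" by (rule P.det_mat2(1)[OF generic[unfolded params]])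
  have exp: "\<forall>s\<in>{1, - 1}. \<exists>c :: nat \<Rightarrow> nat \<Rightarrow> complex. \<exists>r>0. \<forall>\<mu> k. cmod \<mu> < r \<and> \<bar>k\<bar> < r \<longrightarrow>
        (\<lambda>(j, l). c j l * \<mu> ^ j * of_real k ^ l) summable_on {(j, l). 5 \<le> j + l} \<and>
        (is_eigenvalue w (E, \<kappa>, \<omega>, \<zeta>) s k \<mu> \<longleftrightarrow>
           normal_form w (E, \<kappa>, \<omega>, \<zeta>) s \<mu> (of_real k)
           + (\<Sum>\<^sub>\<infinity>(j, l)\<in>{(j, l). 5 \<le> j + l}. c j l * \<mu> ^ j * of_real k ^ l) = 0)"
    by (rule ballI, rule SP.expansion) auto
  show ?thesis
    unfolding params
    apply (rule conjI[OF exp conjI[OF _ SP.bands[OF det]]])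
    unfolding Let_def P.derivs P.pair_v1u1 P.pair_v1u3 P.pair_v3u1 P.pair_v3u3 P.pair_v1_L2u0 P.pair_v1_L2u2 P.pair_v3_L2u2 P.b2_eq
    by (intro conjI refl)
qed

end
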